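(* Let $\Bbbk$ be a field of characteristic zero and let $\mathsf M$ be a finite-type symmetric bimodule such that $\mathsf M(0,0)$ is concentrated in strictly positive degrees. Then the character of its saturation is $$\mathrm{ch}(\mathcal S(\mathsf M))=\mathcal S(\mathrm{ch}(\mathsf M)),$$ where $\mathcal S$ on the left is the saturation of symmetric bimodules and $\mathcal S$ on the right is the saturation of bisymmetric functions.
   Context: All modules are non-negatively graded $\Bbbk$-vector spaces, with the Koszul sign rule for permuting tensor factors. A symmetric bimodule is a family $\mathsf M=(\mathsf M(m,n))_{m,n\ge0}$ with a left $\mathfrak S_m$-action and a commuting right $\mathfrak S_n$-action on $\mathsf M(m,n)$; it is of finite type if each $\mathsf M(m,n)$ is finite-dimensional. Turning left actions into right actions by inversion, the tensor product (horizontal concatenation, i.e. Day convolution) is $(\mathsf M\otimes\mathsf N)(m,n)=\bigoplus_{k+l=m,\,k'+l'=n}\mathrm{Ind}_{\mathfrak S_k\times\mathfrak S_l\times\mathfrak S_{k'}\times\mathfrak S_{l'}}^{\mathfrak S_m\times\mathfrak S_n}\mathsf M(k,k')\otimes\mathsf N(l,l')$. The saturation of $\mathsf M$ is $\mathcal S(\mathsf M)=\bigoplus_{n\ge1}(\mathsf M^{\otimes n})_{\mathfrak S_n}$ (coinvariants). Let $\Lambda_x,\Lambda_y$ be the rings of symmetric functions in $x_1,x_2,\dots$ and $y_1,y_2,\dots$, $\Lambda_{x,y}=\Lambda_x\otimes\Lambda_y$, with hats denoting completion with respect to polynomial degree. For a symmetric bimodule with finite-dimensional graded pieces in each biarity,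 $\mathrm{ch}(\mathsf M)$ is the series in $\hbar$ with coefficients in $\hat\Lambda_{x,y}$ whose projection to polynomials in $x_1,\dots,x_r,y_1,\dots,y_s$, for all $r,s\ge 1$, is the graded trace $\sum_d(-\hbar)^d\mathrm{tr}(\cdot)_d$ (computed separately in each biarity) of the endomorphism of $\bigoplus_{m,n}(\mathsf M(m,n)\otimes(\Bbbk^r)^{\otimes m}\otimes(\Bbbk^s)^{\otimes n})_{\mathfrak S_m\times\mathfrak S_n}$ induced by $\mathrm{diag}(x_1,\dots,x_r)$ and $\mathrm{diag}(y_1,\dots,y_s)$, with $\Bbbk^r,\Bbbk^s$ in degree 0. For $f\in\hat\Lambda_x$ and $\bar g$ a bisymmetric function (possibly completed and a series in $\hbar$) whose constant term in $x,y$ is concentrated in strictly positive $\hbar$-degree, the relative plethysm $f(x)\,\bar\circ\,(\bar g,0)$ is characterized by being a continuous ring homomorphism in $f$ with $p_n(x)\,\bar\circ\,(\bar g,0)=\bar g(x_1^n,x_2^n,\dots;y_1^n,y_2^n,\dots;\hbar^n)$ for $n\ge1$, where $p_n$ is the $n$-th power sum. The saturation of such a $\bar g$ is $\mathcal S(\bar g)=\sum_{n\ge1}h_n(x)\,\bar\circ\,(\bar g,0)$, with $h_n$ the $n$-th complete symmetric function. *)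

theory Defs
  imports
    "Jordan_Normal_Form.VS_Connect"
    "HOL-Algebra.AbelCoset"
    "HOL-Library.Poly_Mapping"
    "HOL-Library.FuncSet"
    "HOL-Combinatorics.Permutations"
begin

section \<open>Linear algebra over a field \<open>'k\<close>\<close>

text \<open>Vector spaces are \<open>vectorspace class_ring V\<close> for module records \<open>V\<close> with explicit carrier.
  The ring multiplication and unit that a module record also carries play no role.\<close>

definition free_space :: "'g set \<Rightarrow> ('k::field, 'g \<Rightarrow>\<^sub>0 'k) module" where
  "free_space X = \<lparr>carrier = {p. Poly_Mapping.keys p \<subseteq> X}, mult = undefined, one = undefined,
     zero = 0, add = (+), smult = (\<lambda>c. Poly_Mapping.map ((*) c))\<rparr>"

definition lin_ext :: "('g \<Rightarrow> ('h \<Rightarrow>\<^sub>0 'k::field)) \<Rightarrow> ('g \<Rightarrow>\<^sub>0 'k) \<Rightarrow> ('h \<Rightarrow>\<^sub>0 'k)" where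
  "lin_ext \<phi> p = (\<Sum>g\<in>Poly_Mapping.keys p. Poly_Mapping.map ((*) (Poly_Mapping.lookup p g)) (\<phi> g))"

definition quot_space :: "('k::field, 'v) module \<Rightarrow> 'v set \<Rightarrow> ('k, 'v set) module" where
  "quot_space V W = \<lparr>carrier = a_rcosets\<^bsub>V\<^esub> W, mult = undefined, one = undefined,
     zero = W, add = (<+>\<^bsub>V\<^esub>), smult = (\<lambda>c X. \<Union>x\<in>X. W +>\<^bsub>V\<^esub> (c \<odot>\<^bsub>V\<^esub> x))\<rparr>"

text \<open>The endomorphism of \<open>V/W\<close> induced by an endomorphism \<open>f\<close> of \<open>V\<close> with \<open>f W \<subseteq> W\<close>.\<close>

definition quot_map :: "('k::field, 'v) module \<Rightarrow> 'v set \<Rightarrow> ('v \<Rightarrow> 'v) \<Rightarrow> 'v set \<Rightarrow> 'v set" where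
  "quot_map V W f X = (\<Union>x\<in>X. W +>\<^bsub>V\<^esub> f x)"

definition direct_sum_space :: "'i set \<Rightarrow> ('i \<Rightarrow> ('k::field, 'v) module) \<Rightarrow> ('k, 'i \<Rightarrow> 'v) module" where
  "direct_sum_space I V = \<lparr>carrier = {t \<in> (\<Pi>\<^sub>E i\<in>I. carrier (V i)). finite {i\<in>I. t i \<noteq> \<zero>\<^bsub>V i\<^esub>}},
     mult = undefined, one = undefined,
     zero = (\<lambda>i\<in>I. \<zero>\<^bsub>V i\<^esub>), add = (\<lambda>t u. \<lambda>i\<in>I. t i \<oplus>\<^bsub>V i\<^esub> u i),
     smult = (\<lambda>c t. \<lambda>i\<in>I. c \<odot>\<^bsub>V i\<^esub> t i)\<rparr>"

definition coinv_rels :: "('k::field, 'v) module \<Rightarrow> 'g set \<Rightarrow> ('g \<Rightarrow> 'v \<Rightarrow> 'v) \<Rightarrow> 'v set" where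
  "coinv_rels V G act = LinearCombinations.module.span class_ring V {act g v \<ominus>\<^bsub>V\<^esub> v | g v. g \<in> G \<and> v \<in> carrier V}"

definition coinvariants :: "('k::field, 'v) module \<Rightarrow> 'g set \<Rightarrow> ('g \<Rightarrow> 'v \<Rightarrow> 'v) \<Rightarrow> ('k, 'v set) module" where
  "coinvariants V G act = quot_space V (coinv_rels V G act)"

text \<open>The trace of an endomorphism of a finite-dimensional space, read off from its matrix in an
  arbitrary basis.\<close>

definition lin_trace :: "('k::field, 'v) module \<Rightarrow> ('v \<Rightarrow> 'v) \<Rightarrow> 'k" where
  "lin_trace V f = (THE t. \<exists>B A. finite B \<and> vectorspace.basis class_ring V B \<and>
     (\<forall>c\<in>B. f c = LinearCombinations.module.lincomb V (\<lambda>b. A b c) B) \<and> t = (\<Sum>b\<in>B. A b b))"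

text \<open>Tensor products are presented by generators and relations: generators are tuples of vectors, and
  \<open>\<iota> v\<close> below is the tuple with \<open>v\<close> inserted in one particular slot, the others being fixed.\<close>

definition linear_rels :: "('k::field, 'v) module \<Rightarrow> ('v \<Rightarrow> 'g) \<Rightarrow> ('g \<Rightarrow>\<^sub>0 'k) set" where
  "linear_rels V \<iota> =
     {Poly_Mapping.single (\<iota> (u \<oplus>\<^bsub>V\<^esub> v)) 1 - Poly_Mapping.single (\<iota> u) 1 - Poly_Mapping.single (\<iota> v) 1
       | u v. u \<in> carrier V \<and> v \<in> carrier V} \<union>
     {Poly_Mapping.single (\<iota> (c \<odot>\<^bsub>V\<^esub> v)) 1 - Poly_Mapping.single (\<iota> v) c | c v. v \<in> carrier V}"


section \<open>Symmetric bimodules\<close>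

text \<open>\<open>bcomp M m n d\<close> is the degree \<open>d\<close> part of \<open>M(m,n)\<close>. The symmetric group on \<open>m\<close> letters is
  the set of all \<open>\<sigma>\<close> with \<open>\<sigma> permutes {..<m}\<close>, with product \<open>\<circ>\<close>.\<close>

record ('k, 'v) bimodule =
  bcomp :: "nat \<Rightarrow> nat \<Rightarrow> nat \<Rightarrow> ('k, 'v) module"
  lact :: "nat \<Rightarrow> nat \<Rightarrow> nat \<Rightarrow> (nat \<Rightarrow> nat) \<Rightarrow> 'v \<Rightarrow> 'v"
  ract :: "nat \<Rightarrow> nat \<Rightarrow> nat \<Rightarrow> (nat \<Rightarrow> nat) \<Rightarrow> 'v \<Rightarrow> 'v"

definition symmetric_bimodule :: "('k::field, 'v) bimodule \<Rightarrow> bool" where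
  "symmetric_bimodule M \<longleftrightarrow> (\<forall>m n d.
     vectorspace class_ring (bcomp M m n d) \<and>
     (\<forall>\<sigma>. \<sigma> permutes {..<m} \<longrightarrow>
        linear_map class_ring (bcomp M m n d) (bcomp M m n d) (lact M m n d \<sigma>)) \<and>
     (\<forall>\<tau>. \<tau> permutes {..<n} \<longrightarrow>
        linear_map class_ring (bcomp M m n d) (bcomp M m n d) (ract M m n d \<tau>)) \<and>
     (\<forall>v\<in>carrier (bcomp M m n d).
        lact M m n d id v = v \<and> ract M m n d id v = v \<and>
        (\<forall>\<sigma> \<sigma>'. \<sigma> permutes {..<m} \<and> \<sigma>' permutes {..<m} \<longrightarrow>
           lact M m n d (\<sigma> \<circ> \<sigma>') v = lact M m n d \<sigma> (lact M m n d \<sigma>' v)) \<and>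
        (\<forall>\<tau> \<tau>'. \<tau> permutes {..<n} \<and> \<tau>' permutes {..<n} \<longrightarrow>
           ract M m n d (\<tau> \<circ> \<tau>') v = ract M m n d \<tau>' (ract M m n d \<tau> v)) \<and>
        (\<forall>\<sigma> \<tau>. \<sigma> permutes {..<m} \<and> \<tau> permutes {..<n} \<longrightarrow>
           lact M m n d \<sigma> (ract M m n d \<tau> v) = ract M m n d \<tau> (lact M m n d \<sigma> v))))"

definition finite_type :: "('k::field, 'v) bimodule \<Rightarrow> bool" where
  "finite_type M \<longleftrightarrow> (\<forall>m n.
     (\<forall>d. vectorspace.fin_dim class_ring (bcomp M m n d)) \<and>
     finite {d. carrier (bcomp M m n d) \<noteq> {\<zero>\<^bsub>bcomp M m n d\<^esub>}})"

text \<open>The right action of the product of the two symmetric groups, the left action being turned into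
  a right one by inversion.\<close>

definition biact :: "('k, 'v) bimodule \<Rightarrow> nat \<Rightarrow> nat \<Rightarrow> nat \<Rightarrow> (nat \<Rightarrow> nat) \<Rightarrow> (nat \<Rightarrow> nat) \<Rightarrow> 'v \<Rightarrow> 'v" where
  "biact M m n d \<sigma> \<tau> v = lact M m n d (inv_into UNIV \<sigma>) (ract M m n d \<tau> v)"


section \<open>Tensor powers and saturation\<close>

text \<open>\<open>block_of ks p\<close> is the pair (block, position inside the block) of \<open>p < sum_list ks\<close> when
  \<open>{..<sum_list ks}\<close> is cut into consecutive blocks of sizes \<open>ks\<close>.\<close>

fun block_of :: "nat list \<Rightarrow> nat \<Rightarrow> nat \<times> nat" where
  "block_of [] p = (0, p)"
| "block_of (k # ks) p =
     (if p < k then (0, p) else case block_of ks (p - k) of (i, q) \<Rightarrow> (Suc i, q))"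

definition block_offset :: "nat list \<Rightarrow> nat \<Rightarrow> nat" where
  "block_offset ks i = sum_list (take i ks)"

text \<open>The element \<open>(h 0, \<dots>, h (n-1))\<close> of the Young subgroup given by \<open>ks\<close>.\<close>

definition block_sum :: "nat list \<Rightarrow> (nat \<Rightarrow> nat \<Rightarrow> nat) \<Rightarrow> nat \<Rightarrow> nat" where
  "block_sum ks h p = (if p < sum_list ks
     then case block_of ks p of (i, q) \<Rightarrow> block_offset ks i + h i q else p)"

text \<open>The block permutation that goes with \<open>permute_list f\<close>: since \<open>permute_list f ks ! i = ks ! f i\<close>,
  block \<open>j\<close> for the sizes \<open>ks\<close> moves to block \<open>inv_into UNIV f j\<close> for the sizes \<open>permute_list f ks\<close>.\<close>

definition block_perm :: "nat list \<Rightarrow> (nat \<Rightarrow> nat) \<Rightarrow> nat \<Rightarrow> nat" where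
  "block_perm ks f p = (if p < sum_list ks
     then case block_of ks p of (j, q) \<Rightarrow> block_offset (permute_list f ks) (inv_into UNIV f j) + q else p)"

text \<open>The sign for rearranging factors of degrees \<open>ds\<close> into the order given by \<open>permute_list f\<close>.\<close>

definition koszul_sign :: "nat list \<Rightarrow> (nat \<Rightarrow> nat) \<Rightarrow> 'k::field" where
  "koszul_sign ds f = (\<Prod>(i, j) \<in> {(i, j). i < j \<and> j < length ds \<and> f j < f i}.
     (-1) ^ (ds ! f i * ds ! f j))"

datatype 'v homog = Homog (lar: nat) (rar: nat) (hdeg: nat) (hvec: 'v)

text \<open>A generator \<open>(xs, \<sigma>, \<tau>)\<close> stands for \<open>(xs ! 0 \<otimes> \<dots> \<otimes> xs ! (n-1)) \<otimes> (\<sigma>, \<tau>)\<close> in the summand of the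
  \<open>n\<close>-fold tensor power given by the biarities of the \<open>xs ! i\<close>, the induction of a right module \<open>V\<close>
  from \<open>H\<close> to \<open>G\<close> being \<open>V \<otimes>\<^bsub>k[H]\<^esub> k[G]\<close>. The \<open>n\<close>-fold product is presented at once because an
  iterated binary product would live in a type depending on \<open>n\<close>.\<close>

type_synonym 'v tgen = "'v homog list \<times> (nat \<Rightarrow> nat) \<times> (nat \<Rightarrow> nat)"

definition tensor_gens :: "('k::field, 'v) bimodule \<Rightarrow> nat \<Rightarrow> nat \<Rightarrow> nat \<Rightarrow> nat \<Rightarrow> 'v tgen set" where
  "tensor_gens M n a b d = {(xs, \<sigma>, \<tau>). length xs = n \<and>
     (\<forall>x\<in>set xs. hvec x \<in> carrier (bcomp M (lar x) (rar x) (hdeg x))) \<and>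
     sum_list (map lar xs) = a \<and> sum_list (map rar xs) = b \<and> sum_list (map hdeg xs) = d \<and>
     \<sigma> permutes {..<a} \<and> \<tau> permutes {..<b}}"

definition tensor_act :: "('k::field, 'v) bimodule \<Rightarrow> (nat \<Rightarrow> nat \<Rightarrow> nat) \<Rightarrow> (nat \<Rightarrow> nat \<Rightarrow> nat)
    \<Rightarrow> 'v homog list \<Rightarrow> 'v homog list" where
  "tensor_act M h h' xs = map (\<lambda>i. case xs ! i of
     Homog k l e v \<Rightarrow> Homog k l e (biact M k l e (h i) (h' i) v)) [0..<length xs]"

definition tensor_rels :: "('k::field, 'v) bimodule \<Rightarrow> nat \<Rightarrow> nat \<Rightarrow> nat \<Rightarrow> nat \<Rightarrow> ('v tgen \<Rightarrow>\<^sub>0 'k) set" where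
  "tensor_rels M n a b d = LinearCombinations.module.span class_ring (free_space (tensor_gens M n a b d))
     ((\<Union>(xs, \<sigma>, \<tau>)\<in>tensor_gens M n a b d. \<Union>i<n.
         case xs ! i of Homog k l e _ \<Rightarrow>
           linear_rels (bcomp M k l e) (\<lambda>v. (xs[i := Homog k l e v], \<sigma>, \<tau>))) \<union>
      {Poly_Mapping.single (tensor_act M h h' xs, \<sigma>, \<tau>) 1 -
       Poly_Mapping.single (xs, block_sum (map lar xs) h \<circ> \<sigma>, block_sum (map rar xs) h' \<circ> \<tau>) 1
       | xs \<sigma> \<tau> h h'. (xs, \<sigma>, \<tau>) \<in> tensor_gens M n a b d \<and>
           (\<forall>i<n. h i permutes {..<lar (xs ! i)} \<and> h' i permutes {..<rar (xs ! i)})})"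

definition tensor_map :: "('k::field, 'v) bimodule \<Rightarrow> nat \<Rightarrow> nat \<Rightarrow> nat \<Rightarrow> nat
    \<Rightarrow> ('v tgen \<Rightarrow> ('v tgen \<Rightarrow>\<^sub>0 'k)) \<Rightarrow> ('v tgen \<Rightarrow>\<^sub>0 'k) set \<Rightarrow> ('v tgen \<Rightarrow>\<^sub>0 'k) set" where
  "tensor_map M n a b d \<phi> =
     quot_map (free_space (tensor_gens M n a b d)) (tensor_rels M n a b d) (lin_ext \<phi>)"

definition tensor_power :: "('k::field, 'v) bimodule \<Rightarrow> nat \<Rightarrow> ('k, ('v tgen \<Rightarrow>\<^sub>0 'k) set) bimodule" where
  "tensor_power M n = \<lparr>
     bcomp = (\<lambda>a b d. quot_space (free_space (tensor_gens M n a b d)) (tensor_rels M n a b d)),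
     lact = (\<lambda>a b d \<sigma>'. tensor_map M n a b d
        (\<lambda>(xs, \<sigma>, \<tau>). Poly_Mapping.single (xs, \<sigma> \<circ> inv_into UNIV \<sigma>', \<tau>) 1)),
     ract = (\<lambda>a b d \<tau>'. tensor_map M n a b d
        (\<lambda>(xs, \<sigma>, \<tau>). Poly_Mapping.single (xs, \<sigma>, \<tau> \<circ> \<tau>') 1))\<rparr>"

text \<open>The action of the symmetric group on \<open>n\<close> letters on the \<open>n\<close>-fold tensor power.\<close>

definition tensor_sym :: "('k::field, 'v) bimodule \<Rightarrow> nat \<Rightarrow> nat \<Rightarrow> nat \<Rightarrow> nat \<Rightarrow> (nat \<Rightarrow> nat)
    \<Rightarrow> ('v tgen \<Rightarrow>\<^sub>0 'k) set \<Rightarrow> ('v tgen \<Rightarrow>\<^sub>0 'k) set" where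
  "tensor_sym M n a b d f = tensor_map M n a b d
     (\<lambda>(xs, \<sigma>, \<tau>). Poly_Mapping.single
        (permute_list f xs, block_perm (map lar xs) f \<circ> \<sigma>, block_perm (map rar xs) f \<circ> \<tau>)
        (koszul_sign (map hdeg xs) f))"

definition saturation :: "('k::field, 'v) bimodule \<Rightarrow> ('k, nat \<Rightarrow> ('v tgen \<Rightarrow>\<^sub>0 'k) set set) bimodule" where
  "saturation M = (
     let S = (\<lambda>n. {f. f permutes {..<n}});
         induced = (\<lambda>n a b d. quot_map (bcomp (tensor_power M n) a b d)
           (coinv_rels (bcomp (tensor_power M n) a b d) (S n) (tensor_sym M n a b d)))
     in \<lparr>bcomp = (\<lambda>a b d. direct_sum_space {1..}
           (\<lambda>n. coinvariants (bcomp (tensor_power M n) a b d) (S n) (tensor_sym M n a b d))),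
         lact = (\<lambda>a b d \<sigma> t. \<lambda>n\<in>{1..}. induced n a b d (lact (tensor_power M n) a b d \<sigma>) (t n)),
         ract = (\<lambda>a b d \<tau> t. \<lambda>n\<in>{1..}. induced n a b d (ract (tensor_power M n) a b d \<tau>) (t n))\<rparr>)"


section \<open>Formal power series in arbitrarily many variables\<close>

typedef ('i, 'a) series = "UNIV :: (('i \<Rightarrow>\<^sub>0 nat) \<Rightarrow> 'a) set"
  morphisms scoeff Series ..

setup_lifting type_definition_series

lemma series_eqI: "(\<And>\<gamma>. scoeff f \<gamma> = scoeff g \<gamma>) \<Longrightarrow> f = g"
  by (metis scoeff_inject ext)

lemma finite_splittings: "finite {(\<alpha>, \<beta>). \<alpha> + \<beta> = (\<gamma> :: 'i \<Rightarrow>\<^sub>0 nat)}"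
proof -
  define K where "K = Poly_Mapping.keys \<gamma>"
  define N where "N = (\<Sum>j\<in>K. Poly_Mapping.lookup \<gamma> j)"
  define F where "F = {f :: 'i \<Rightarrow> nat. \<forall>i. (i \<in> K \<longrightarrow> f i \<in> {..N}) \<and> (i \<notin> K \<longrightarrow> f i = 0)}"
  define A where "A = {\<alpha> :: 'i \<Rightarrow>\<^sub>0 nat. \<forall>i. Poly_Mapping.lookup \<alpha> i \<le> Poly_Mapping.lookup \<gamma> i}"
  have "finite F"
    unfolding F_def by (rule finite_set_of_finite_funs) (simp_all add: K_def)
  moreover have "Poly_Mapping.lookup ` A \<subseteq> F"
  proof (rule image_subsetI)
    fix \<alpha> assume "\<alpha> \<in> A"
    then have le: "Poly_Mapping.lookup \<alpha> i \<le> Poly_Mapping.lookup \<gamma> i" for i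
      by (simp add: A_def)
    have "Poly_Mapping.lookup \<gamma> i \<le> N" if "i \<in> K" for i
      unfolding N_def by (rule member_le_sum) (use that in \<open>simp_all add: K_def\<close>)
    then have "Poly_Mapping.lookup \<alpha> i \<le> N" if "i \<in> K" for i
      using le order_trans that by blast
    moreover have "Poly_Mapping.lookup \<alpha> i = 0" if "i \<notin> K" for i
      using le[of i] that by (simp add: K_def in_keys_iff)
    ultimately show "Poly_Mapping.lookup \<alpha> \<in> F"
      by (simp add: F_def)
  qed
  ultimately have "finite (Poly_Mapping.lookup ` A)"
    by (rule finite_subset[rotated])
  then have "finite A"
    by (rule finite_imageD) (simp add: inj_on_def)
  then have "finite (A \<times> A)" by simp
  moreover have "{(\<alpha>, \<beta>). \<alpha> + \<beta> = \<gamma>} \<subseteq> A \<times> A"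
    by (auto simp: A_def lookup_add)
  ultimately show ?thesis
    by (rule finite_subset[rotated])
qed

instantiation series :: (type, comm_ring_1) comm_ring_1
begin

lift_definition zero_series :: "('a, 'b) series" is "\<lambda>_. 0" .

lift_definition one_series :: "('a, 'b) series" is "\<lambda>\<gamma>. if \<gamma> = 0 then 1 else 0" .

lift_definition plus_series :: "('a, 'b) series \<Rightarrow> ('a, 'b) series \<Rightarrow> ('a, 'b) series"
  is "\<lambda>f g \<gamma>. f \<gamma> + g \<gamma>" .

lift_definition uminus_series :: "('a, 'b) series \<Rightarrow> ('a, 'b) series" is "\<lambda>f \<gamma>. - f \<gamma>" .

lift_definition minus_series :: "('a, 'b) series \<Rightarrow> ('a, 'b) series \<Rightarrow> ('a, 'b) series"
  is "\<lambda>f g \<gamma>. f \<gamma> - g \<gamma>" .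

lift_definition times_series :: "('a, 'b) series \<Rightarrow> ('a, 'b) series \<Rightarrow> ('a, 'b) series"
  is "\<lambda>f g \<gamma>. \<Sum>(\<alpha>, \<beta>) | \<alpha> + \<beta> = \<gamma>. f \<alpha> * g \<beta>" .

instance
proof
  fix f g h :: "('a, 'b) series"
  show "f * g * h = f * (g * h)"
  proof (rule series_eqI)
    fix \<gamma> :: "'a \<Rightarrow>\<^sub>0 nat"
    have "scoeff (f * g * h) \<gamma> =
        (\<Sum>z\<in>{(\<delta>, \<beta>). \<delta> + \<beta> = \<gamma>}. \<Sum>w\<in>{(\<alpha>, \<epsilon>). \<alpha> + \<epsilon> = fst z}.
           scoeff f (fst w) * scoeff g (snd w) * scoeff h (snd z))"
      by (simp add: times_series.rep_eq case_prod_beta sum_distrib_right)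
    also have "\<dots> = (\<Sum>(z, w)\<in>(SIGMA z:{(\<delta>, \<beta>). \<delta> + \<beta> = \<gamma>}. {(\<alpha>, \<epsilon>). \<alpha> + \<epsilon> = fst z}).
           scoeff f (fst w) * scoeff g (snd w) * scoeff h (snd z))"
      by (rule sum.Sigma) (use finite_splittings in auto)
    also have "\<dots> = (\<Sum>(z, w)\<in>(SIGMA z:{(\<alpha>, \<delta>). \<alpha> + \<delta> = \<gamma>}. {(\<epsilon>, \<beta>). \<epsilon> + \<beta> = snd z}).
           scoeff f (fst z) * (scoeff g (fst w) * scoeff h (snd w)))"
      by (rule sum.reindex_bij_witness
            [where i = "\<lambda>((\<alpha>, _), (\<epsilon>, \<beta>)). ((\<alpha> + \<epsilon>, \<beta>), (\<alpha>, \<epsilon>))"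
               and j = "\<lambda>((_, \<beta>), (\<alpha>, \<epsilon>)). ((\<alpha>, \<epsilon> + \<beta>), (\<epsilon>, \<beta>))"])
         (auto simp: mult.assoc add.assoc)
    also have "\<dots> = (\<Sum>z\<in>{(\<alpha>, \<delta>). \<alpha> + \<delta> = \<gamma>}. \<Sum>w\<in>{(\<epsilon>, \<beta>). \<epsilon> + \<beta> = snd z}.
           scoeff f (fst z) * (scoeff g (fst w) * scoeff h (snd w)))"
      by (rule sum.Sigma[symmetric]) (use finite_splittings in auto)
    also have "\<dots> = scoeff (f * (g * h)) \<gamma>"
      by (simp add: times_series.rep_eq case_prod_beta sum_distrib_left)
    finally show "scoeff (f * g * h) \<gamma> = scoeff (f * (g * h)) \<gamma>" .
  qed
  show "f * g = g * f"
  proof (rule series_eqI)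
    fix \<gamma> :: "'a \<Rightarrow>\<^sub>0 nat"
    show "scoeff (f * g) \<gamma> = scoeff (g * f) \<gamma>"
      unfolding times_series.rep_eq
      by (rule sum.reindex_bij_witness[where i = prod.swap and j = prod.swap])
         (auto simp: add.commute mult.commute)
  qed
  show "1 * f = f"
  proof (rule series_eqI)
    fix \<gamma> :: "'a \<Rightarrow>\<^sub>0 nat"
    have "scoeff (1 * f) \<gamma> = (\<Sum>(\<alpha>, \<beta>)\<in>{(0 :: 'a \<Rightarrow>\<^sub>0 nat, \<gamma>)}. (if \<alpha> = 0 then 1 else 0) * scoeff f \<beta>)"
      unfolding times_series.rep_eq one_series.rep_eq
      by (rule sum.mono_neutral_right[OF finite_splittings]) (auto split: if_splits)
    then show "scoeff (1 * f) \<gamma> = scoeff f \<gamma>" by simp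
  qed
  show "(f + g) * h = f * h + g * h"
    by (rule series_eqI)
      (simp add: times_series.rep_eq plus_series.rep_eq case_prod_beta distrib_right sum.distrib)
  show "f + g + h = f + (g + h)" "f + g = g + f" "0 + f = f" "- f + f = 0" "f - g = f + - g"
    by (rule series_eqI, simp add: plus_series.rep_eq zero_series.rep_eq uminus_series.rep_eq
        minus_series.rep_eq ac_simps)+
  have "scoeff (0 :: ('a, 'b) series) 0 \<noteq> scoeff 1 0"
    by (simp add: zero_series.rep_eq one_series.rep_eq)
  then show "(0 :: ('a, 'b) series) \<noteq> 1" by metis
qed

end

definition scalar :: "'a \<Rightarrow> ('i, 'a::zero) series" where
  "scalar c = Series (\<lambda>\<gamma>. if \<gamma> = 0 then c else 0)"

definition mon_degree :: "('i \<Rightarrow>\<^sub>0 nat) \<Rightarrow> nat" where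
  "mon_degree \<gamma> = (\<Sum>i\<in>Poly_Mapping.keys \<gamma>. Poly_Mapping.lookup \<gamma> i)"


section \<open>Symmetric and bisymmetric functions, plethysm\<close>

text \<open>All symmetric functions have coefficients in \<open>'k\<close>. A series in variables indexed by \<open>nat\<close> that is
  invariant under permutations of the variables is an element of the degree completion of \<open>\<Lambda>\<^sub>x\<close>.\<close>

definition symmetric_functions :: "(nat, 'k) series set" where
  "symmetric_functions = {f. \<forall>\<pi> \<alpha>. bij \<pi> \<longrightarrow> scoeff f (Poly_Mapping.map_key \<pi> \<alpha>) = scoeff f \<alpha>}"

definition power_sum :: "nat \<Rightarrow> (nat, 'k::zero_neq_one) series" where
  "power_sum n = Series (\<lambda>\<alpha>. if \<exists>i. \<alpha> = Poly_Mapping.single i n then 1 else 0)"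

definition complete_sym :: "nat \<Rightarrow> (nat, 'k::zero_neq_one) series" where
  "complete_sym n = Series (\<lambda>\<alpha>. if mon_degree \<alpha> = n then 1 else 0)"

datatype var = X nat | Y nat | Hbar

fun rename_vars :: "(nat \<Rightarrow> nat) \<Rightarrow> (nat \<Rightarrow> nat) \<Rightarrow> var \<Rightarrow> var" where
  "rename_vars \<pi> \<rho> (X i) = X (\<pi> i)"
| "rename_vars \<pi> \<rho> (Y j) = Y (\<rho> j)"
| "rename_vars \<pi> \<rho> Hbar = Hbar"

text \<open>Series in \<open>\<hbar>\<close> with coefficients in the degree completion of \<open>\<Lambda>\<^sub>x \<otimes> \<Lambda>\<^sub>y\<close>.\<close>

definition bisymmetric_functions :: "(var, 'k) series set" where
  "bisymmetric_functions = {g. \<forall>\<pi> \<rho> \<gamma>. bij \<pi> \<and> bij \<rho> \<longrightarrow>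
     scoeff g (Poly_Mapping.map_key (rename_vars \<pi> \<rho>) \<gamma>) = scoeff g \<gamma>}"

text \<open>Substitution of \<open>v\<^sup>n\<close> for every variable \<open>v\<close>, for \<open>n \<ge> 1\<close>.\<close>

definition power_subst :: "nat \<Rightarrow> ('i, 'k::zero) series \<Rightarrow> ('i, 'k) series" where
  "power_subst n g = Series (\<lambda>\<gamma>. if \<forall>v. n dvd Poly_Mapping.lookup \<gamma> v
     then scoeff g (Poly_Mapping.map (\<lambda>e. e div n) \<gamma>) else 0)"

text \<open>Ring homomorphisms are taken to be linear over the coefficient field; without this,
  the values on power sums would not determine them. Continuity refers to the degree filtration on
  the source and to coefficientwise convergence on the target.\<close>

definition is_plethysm :: "(var, 'k::field_char_0) series \<Rightarrow> ((nat, 'k) series \<Rightarrow> (var, 'k) series) \<Rightarrow> bool" where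
  "is_plethysm g \<phi> \<longleftrightarrow>
     (\<forall>f\<in>symmetric_functions. \<phi> f \<in> bisymmetric_functions) \<and>
     (\<forall>c. \<phi> (scalar c) = scalar c) \<and>
     (\<forall>f\<in>symmetric_functions. \<forall>f'\<in>symmetric_functions.
        \<phi> (f + f') = \<phi> f + \<phi> f' \<and> \<phi> (f * f') = \<phi> f * \<phi> f') \<and>
     (\<forall>\<gamma>. \<exists>N. \<forall>f\<in>symmetric_functions.
        (\<forall>\<alpha>. mon_degree \<alpha> < N \<longrightarrow> scoeff f \<alpha> = 0) \<longrightarrow> scoeff (\<phi> f) \<gamma> = 0) \<and>
     (\<forall>n\<ge>1. \<phi> (power_sum n) = power_subst n g)"

definition rel_plethysm :: "(nat, 'k::field_char_0) series \<Rightarrow> (var, 'k) series \<Rightarrow> (var, 'k) series" where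
  "rel_plethysm f g = (THE r. \<exists>\<phi>. is_plethysm g \<phi> \<and> \<phi> f = r)"

text \<open>The sum over \<open>n\<close> is coefficientwise finite when \<open>g\<close> has no constant term.\<close>

definition series_saturation :: "(var, 'k::field_char_0) series \<Rightarrow> (var, 'k) series" where
  "series_saturation g = Series (\<lambda>\<gamma>.
     \<Sum>n | n \<ge> 1 \<and> scoeff (rel_plethysm (complete_sym n) g) \<gamma> \<noteq> 0.
       scoeff (rel_plethysm (complete_sym n) g) \<gamma>)"


section \<open>Characters\<close>

text \<open>\<open>(M(m,n)\<^sub>d \<otimes> (k\<^sup>r)\<^sup>\<otimes>\<^sup>m \<otimes> (k\<^sup>s)\<^sup>\<otimes>\<^sup>n)\<close> and its coinvariants, \<open>k\<^sup>r\<close> being the space of vectors of dimension \<open>r\<close>.\<close>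

type_synonym ('k, 'v) sgen = "'v \<times> 'k vec list \<times> 'k vec list"

definition schur_gens :: "('k::field, 'v) bimodule \<Rightarrow> nat \<Rightarrow> nat \<Rightarrow> nat \<Rightarrow> nat \<Rightarrow> nat \<Rightarrow> ('k, 'v) sgen set" where
  "schur_gens M r s m n d = {(v, us, ws). v \<in> carrier (bcomp M m n d) \<and>
     length us = m \<and> set us \<subseteq> carrier_vec r \<and> length ws = n \<and> set ws \<subseteq> carrier_vec s}"

definition schur_rels :: "('k::field, 'v) bimodule \<Rightarrow> nat \<Rightarrow> nat \<Rightarrow> nat \<Rightarrow> nat \<Rightarrow> nat
    \<Rightarrow> (('k, 'v) sgen \<Rightarrow>\<^sub>0 'k) set" where
  "schur_rels M r s m n d = LinearCombinations.module.span class_ring (free_space (schur_gens M r s m n d))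
     (\<Union>(v, us, ws)\<in>schur_gens M r s m n d.
        linear_rels (bcomp M m n d) (\<lambda>v'. (v', us, ws)) \<union>
        (\<Union>i<m. linear_rels (module_vec TYPE('k) r) (\<lambda>u. (v, us[i := u], ws))) \<union>
        (\<Union>j<n. linear_rels (module_vec TYPE('k) s) (\<lambda>w. (v, us, ws[j := w]))))"

definition schur_tensor :: "('k::field, 'v) bimodule \<Rightarrow> nat \<Rightarrow> nat \<Rightarrow> nat \<Rightarrow> nat \<Rightarrow> nat
    \<Rightarrow> ('k, (('k, 'v) sgen \<Rightarrow>\<^sub>0 'k) set) module" where
  "schur_tensor M r s m n d =
     quot_space (free_space (schur_gens M r s m n d)) (schur_rels M r s m n d)"

definition schur_map :: "('k::field, 'v) bimodule \<Rightarrow> nat \<Rightarrow> nat \<Rightarrow> nat \<Rightarrow> nat \<Rightarrow> nat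
    \<Rightarrow> (('k, 'v) sgen \<Rightarrow> ('k, 'v) sgen) \<Rightarrow> (('k, 'v) sgen \<Rightarrow>\<^sub>0 'k) set \<Rightarrow> (('k, 'v) sgen \<Rightarrow>\<^sub>0 'k) set" where
  "schur_map M r s m n d \<psi> = quot_map (free_space (schur_gens M r s m n d)) (schur_rels M r s m n d)
     (lin_ext (\<lambda>g. Poly_Mapping.single (\<psi> g) 1))"

text \<open>The diagonal right action; \<open>permute_list \<sigma>\<close> is the right action by place permutations.\<close>

definition schur_act :: "('k::field, 'v) bimodule \<Rightarrow> nat \<Rightarrow> nat \<Rightarrow> nat \<Rightarrow> nat \<Rightarrow> nat
    \<Rightarrow> (nat \<Rightarrow> nat) \<times> (nat \<Rightarrow> nat) \<Rightarrow> (('k, 'v) sgen \<Rightarrow>\<^sub>0 'k) set \<Rightarrow> (('k, 'v) sgen \<Rightarrow>\<^sub>0 'k) set" where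
  "schur_act M r s m n d = (\<lambda>(\<sigma>, \<tau>). schur_map M r s m n d
     (\<lambda>(v, us, ws). (biact M m n d \<sigma> \<tau> v, permute_list \<sigma> us, permute_list \<tau> ws)))"

definition schur_coinv_rels :: "('k::field, 'v) bimodule \<Rightarrow> nat \<Rightarrow> nat \<Rightarrow> nat \<Rightarrow> nat \<Rightarrow> nat
    \<Rightarrow> (('k, 'v) sgen \<Rightarrow>\<^sub>0 'k) set set" where
  "schur_coinv_rels M r s m n d = coinv_rels (schur_tensor M r s m n d)
     ({\<sigma>. \<sigma> permutes {..<m}} \<times> {\<tau>. \<tau> permutes {..<n}}) (schur_act M r s m n d)"

definition schur_space :: "('k::field, 'v) bimodule \<Rightarrow> nat \<Rightarrow> nat \<Rightarrow> nat \<Rightarrow> nat \<Rightarrow> nat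
    \<Rightarrow> ('k, (('k, 'v) sgen \<Rightarrow>\<^sub>0 'k) set set) module" where
  "schur_space M r s m n d = coinvariants (schur_tensor M r s m n d)
     ({\<sigma>. \<sigma> permutes {..<m}} \<times> {\<tau>. \<tau> permutes {..<n}}) (schur_act M r s m n d)"

definition schur_diag :: "('k::field, 'v) bimodule \<Rightarrow> nat \<Rightarrow> nat \<Rightarrow> nat \<Rightarrow> nat \<Rightarrow> nat
    \<Rightarrow> (nat \<Rightarrow> 'k) \<Rightarrow> (nat \<Rightarrow> 'k)
    \<Rightarrow> (('k, 'v) sgen \<Rightarrow>\<^sub>0 'k) set set \<Rightarrow> (('k, 'v) sgen \<Rightarrow>\<^sub>0 'k) set set" where
  "schur_diag M r s m n d x y =
     quot_map (schur_tensor M r s m n d) (schur_coinv_rels M r s m n d)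
       (schur_map M r s m n d (\<lambda>(v, us, ws).
          (v, map (\<lambda>u. mat_diag r x *\<^sub>v u) us, map (\<lambda>w. mat_diag s y *\<^sub>v w) ws)))"

text \<open>The part of \<open>g(x\<^sub>0,\<dots>,x\<^bsub>r-1\<^esub>,0,\<dots>; y\<^sub>0,\<dots>,y\<^bsub>s-1\<^esub>,0,\<dots>; \<hbar>)\<close> of degree \<open>m\<close> in the \<open>x\<close>'s, \<open>n\<close> in the
  \<open>y\<close>'s and \<open>d\<close> in \<open>\<hbar>\<close>, a polynomial evaluated at points of \<open>'k\<close>.\<close>

definition eval_part :: "(var, 'k::field) series \<Rightarrow> nat \<Rightarrow> nat \<Rightarrow> nat \<Rightarrow> nat \<Rightarrow> nat
    \<Rightarrow> (nat \<Rightarrow> 'k) \<Rightarrow> (nat \<Rightarrow> 'k) \<Rightarrow> 'k" where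
  "eval_part g r s m n d x y =
     (\<Sum>\<gamma> | Poly_Mapping.keys \<gamma> \<subseteq> X ` {..<r} \<union> Y ` {..<s} \<union> {Hbar} \<and>
           (\<Sum>i<r. Poly_Mapping.lookup \<gamma> (X i)) = m \<and>
           (\<Sum>j<s. Poly_Mapping.lookup \<gamma> (Y j)) = n \<and>
           Poly_Mapping.lookup \<gamma> Hbar = d.
        scoeff g \<gamma> * (\<Prod>i<r. x i ^ Poly_Mapping.lookup \<gamma> (X i))
                  * (\<Prod>j<s. y j ^ Poly_Mapping.lookup \<gamma> (Y j)))"

text \<open>The trace in biarity \<open>(m,n)\<close> is homogeneous of bidegree \<open>(m,n)\<close> in \<open>x, y\<close>, so that comparing series
  with values in each biarity amounts to comparing bihomogeneous parts. As \<open>'k\<close> is infinite, polynomials may be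
  compared through their values.\<close>

definition is_character :: "('k::field_char_0, 'v) bimodule \<Rightarrow> (var, 'k) series \<Rightarrow> bool" where
  "is_character M g \<longleftrightarrow> g \<in> bisymmetric_functions \<and>
     (\<forall>r\<ge>1. \<forall>s\<ge>1. \<forall>m n d x y.
        eval_part g r s m n d x y =
          (-1) ^ d * lin_trace (schur_space M r s m n d) (schur_diag M r s m n d x y))"

definition character :: "('k::field_char_0, 'v) bimodule \<Rightarrow> (var, 'k) series" where
  "character M = (THE g. is_character M g)"

end

theory Submission
  imports Defs
begin

text \<open>
  The theorem holds because both sides count multisets of the same letters.

  A monomial \<open>\<gamma>\<close> in the variables \<open>x\<close>, \<open>y\<close>, \<open>\<hbar>\<close> is a pair of multisets of indices together with a degree \<open>d\<close>;
  let \<open>I\<close> and \<open>J\<close> be words that list the two multisets, of lengths \<open>m\<close> and \<open>n\<close>. The part of the coinvariants of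
  \<open>(M(m,n)\<^sub>d \<otimes> (k\<^sup>r)\<^sup>\<otimes>\<^sup>m \<otimes> (k\<^sup>s)\<^sup>\<otimes>\<^sup>n)\<close> on which the diagonal matrices act through \<open>\<gamma>\<close> is the quotient of
  \<open>M(m,n)\<^sub>d\<close> by the differences \<open>v \<sigma> - v\<close>, where \<open>\<sigma>\<close> runs over the permutations that fix \<open>I\<close> and \<open>J\<close>. If
  \<open>c \<gamma>\<close> is its dimension, then \<open>ch(M) = \<Sum>\<gamma>. (-1)\<^sup>d c(\<gamma>) \<gamma>\<close> (lemmas \<open>schur_trace\<close> and
  \<open>is_character_from_dual_systems\<close>). Call the pairs \<open>(\<gamma>, t)\<close> with \<open>t < c \<gamma>\<close> letters, and a letter odd if \<open>d\<close> is.

  On the side of modules, the same quotient for the coinvariants of the \<open>n\<close>-th tensor power has a basis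
  indexed by the multisets of \<open>n\<close> letters of total weight \<open>\<gamma>\<close> in which no odd letter is repeated: a tensor whose
  factors are basis vectors can be reordered at the price of a Koszul sign, and a repeated odd factor
  makes it equal to its own negative. Spanning is \<open>class_span_gens\<close>; independence comes from explicit
  linear forms that sum over all ways to match the factors with the letters (\<open>tensor_dual_system\<close>,
  \<open>saturation_dual_system\<close>). All dimensions are certified by vectors and
  linear forms in duality.

  On the side of symmetric functions, a plethysm exists because power sums are free topological
  generators of the symmetric functions (\<open>plethysm_exists\<close>), and Newton's identity
  \<open>n h\<^sub>n = \<Sum>i. p\<^sub>i h\<^bsub>n-i\<^esub>\<close> determines its values on the complete symmetric functions. The signed generating
  series of the letter multisets of size \<open>n\<close> obeys the recursion that results from substituting \<open>ch(M)\<close>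
  (\<open>mset_series_newton\<close>): for an even letter one counts its copies one after the other, for an odd letter
  the alternating sum telescopes. So \<open>h\<^sub>n\<close> evaluated at \<open>ch(M)\<close> is that generating series, and summing over
  \<open>n\<close> gives the character of the saturation. Characters are unique because a polynomial over an
  infinite field is determined by its values (\<open>character_unique\<close>).
\<close>

section \<open>Vectors and forms in duality\<close>

abbreviation "lookup \<equiv> Poly_Mapping.lookup"
abbreviation "single \<equiv> Poly_Mapping.single"
abbreviation "keys \<equiv> Poly_Mapping.keys"
abbreviation "map_key \<equiv> Poly_Mapping.map_key"
abbreviation "smul c \<equiv> Poly_Mapping.map ((*) c)"
abbreviation "pinv \<equiv> inv_into UNIV"

abbreviation vspace :: "('k::field, 'v) module \<Rightarrow> bool" where
  "vspace V \<equiv> vectorspace class_ring V"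

abbreviation vspan :: "('k::field, 'v) module \<Rightarrow> 'v set \<Rightarrow> 'v set" where
  "vspan V S \<equiv> LinearCombinations.module.span class_ring V S"

definition lin_on :: "('k::field, 'v) module \<Rightarrow> ('k, 'w) module \<Rightarrow> ('v \<Rightarrow> 'w) \<Rightarrow> bool" where
  "lin_on V W f \<longleftrightarrow> (\<forall>v\<in>carrier V. f v \<in> carrier W) \<and>
     (\<forall>u\<in>carrier V. \<forall>v\<in>carrier V. f (u \<oplus>\<^bsub>V\<^esub> v) = f u \<oplus>\<^bsub>W\<^esub> f v) \<and>
     (\<forall>c. \<forall>v\<in>carrier V. f (c \<odot>\<^bsub>V\<^esub> v) = c \<odot>\<^bsub>W\<^esub> f v)"

definition linear_form :: "('k::field, 'v) module \<Rightarrow> ('v \<Rightarrow> 'k) \<Rightarrow> bool" where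
  "linear_form V \<psi> \<longleftrightarrow>
     (\<forall>u\<in>carrier V. \<forall>v\<in>carrier V. \<psi> (u \<oplus>\<^bsub>V\<^esub> v) = \<psi> u + \<psi> v) \<and>
     (\<forall>c. \<forall>v\<in>carrier V. \<psi> (c \<odot>\<^bsub>V\<^esub> v) = c * \<psi> v)"

lemma vspace_simps:
  assumes "vspace V"
  shows "\<zero>\<^bsub>V\<^esub> \<in> carrier V"
    and "\<And>u v. u \<in> carrier V \<Longrightarrow> v \<in> carrier V \<Longrightarrow> u \<oplus>\<^bsub>V\<^esub> v \<in> carrier V"
    and "\<And>u v. u \<in> carrier V \<Longrightarrow> v \<in> carrier V \<Longrightarrow> u \<ominus>\<^bsub>V\<^esub> v \<in> carrier V"
    and "\<And>c v. v \<in> carrier V \<Longrightarrow> c \<odot>\<^bsub>V\<^esub> v \<in> carrier V"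
    and "\<And>v. v \<in> carrier V \<Longrightarrow> \<zero>\<^bsub>V\<^esub> \<oplus>\<^bsub>V\<^esub> v = v"
    and "\<And>v. v \<in> carrier V \<Longrightarrow> v \<oplus>\<^bsub>V\<^esub> \<zero>\<^bsub>V\<^esub> = v"
    and "\<And>v. v \<in> carrier V \<Longrightarrow> v \<ominus>\<^bsub>V\<^esub> v = \<zero>\<^bsub>V\<^esub>"
    and "\<And>v. v \<in> carrier V \<Longrightarrow> 0 \<odot>\<^bsub>V\<^esub> v = \<zero>\<^bsub>V\<^esub>"
    and "\<And>v. v \<in> carrier V \<Longrightarrow> 1 \<odot>\<^bsub>V\<^esub> v = v"
    and "\<And>c. c \<odot>\<^bsub>V\<^esub> \<zero>\<^bsub>V\<^esub> = \<zero>\<^bsub>V\<^esub>"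
    and "\<And>u v. u \<in> carrier V \<Longrightarrow> v \<in> carrier V \<Longrightarrow> u \<ominus>\<^bsub>V\<^esub> v = u \<oplus>\<^bsub>V\<^esub> ((- 1) \<odot>\<^bsub>V\<^esub> v)"
    and "\<And>u v. u \<in> carrier V \<Longrightarrow> v \<in> carrier V \<Longrightarrow> u \<ominus>\<^bsub>V\<^esub> v = \<zero>\<^bsub>V\<^esub> \<longleftrightarrow> u = v"
    and "\<And>u v. u \<in> carrier V \<Longrightarrow> v \<in> carrier V \<Longrightarrow> u = (u \<ominus>\<^bsub>V\<^esub> v) \<oplus>\<^bsub>V\<^esub> v"
proof -
  interpret V: vectorspace class_ring V by fact
  show "\<zero>\<^bsub>V\<^esub> \<in> carrier V"
    "\<And>u v. u \<in> carrier V \<Longrightarrow> v \<in> carrier V \<Longrightarrow> u \<oplus>\<^bsub>V\<^esub> v \<in> carrier V"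
    "\<And>u v. u \<in> carrier V \<Longrightarrow> v \<in> carrier V \<Longrightarrow> u \<ominus>\<^bsub>V\<^esub> v \<in> carrier V"
    "\<And>v. v \<in> carrier V \<Longrightarrow> \<zero>\<^bsub>V\<^esub> \<oplus>\<^bsub>V\<^esub> v = v"
    "\<And>v. v \<in> carrier V \<Longrightarrow> v \<oplus>\<^bsub>V\<^esub> \<zero>\<^bsub>V\<^esub> = v" by auto
  show "\<And>c v. v \<in> carrier V \<Longrightarrow> c \<odot>\<^bsub>V\<^esub> v \<in> carrier V" using V.smult_closed by simp
  show "\<And>v. v \<in> carrier V \<Longrightarrow> v \<ominus>\<^bsub>V\<^esub> v = \<zero>\<^bsub>V\<^esub>" by (simp add: V.M.minus_eq V.M.r_neg)
  show "\<And>v. v \<in> carrier V \<Longrightarrow> 0 \<odot>\<^bsub>V\<^esub> v = \<zero>\<^bsub>V\<^esub>" using V.lmult_0 by simp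
  show "\<And>v. v \<in> carrier V \<Longrightarrow> 1 \<odot>\<^bsub>V\<^esub> v = v" using V.smult_one by simp
  show "\<And>c. c \<odot>\<^bsub>V\<^esub> \<zero>\<^bsub>V\<^esub> = \<zero>\<^bsub>V\<^esub>" using V.rmult_0 by simp
  have neg: "\<ominus>\<^bsub>V\<^esub> v = (- 1) \<odot>\<^bsub>V\<^esub> v" if "v \<in> carrier V" for v
    using V.smult_minus_1[OF that] by (simp add: class_ring_simps)
  show "\<And>u v. u \<in> carrier V \<Longrightarrow> v \<in> carrier V \<Longrightarrow> u \<ominus>\<^bsub>V\<^esub> v = u \<oplus>\<^bsub>V\<^esub> ((- 1) \<odot>\<^bsub>V\<^esub> v)"
    by (simp add: V.M.minus_eq neg)
  show "\<And>u v. u \<in> carrier V \<Longrightarrow> v \<in> carrier V \<Longrightarrow> u \<ominus>\<^bsub>V\<^esub> v = \<zero>\<^bsub>V\<^esub> \<longleftrightarrow> u = v"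
    using V.M.r_neg V.M.minus_equality V.M.minus_minus by (auto simp: V.M.minus_eq) (metis V.M.a_inv_closed V.M.minus_equality V.M.minus_minus)
  show "\<And>u v. u \<in> carrier V \<Longrightarrow> v \<in> carrier V \<Longrightarrow> u = (u \<ominus>\<^bsub>V\<^esub> v) \<oplus>\<^bsub>V\<^esub> v"
    by (simp add: V.M.minus_eq V.M.a_assoc V.M.l_neg)
qed

lemma vspan_induct [consumes 3, case_names zero base add smult]:
  assumes "vspace V" "S \<subseteq> carrier V" "x \<in> vspan V S"
    and "P \<zero>\<^bsub>V\<^esub>" "\<And>x. x \<in> S \<Longrightarrow> P x"
    and "\<And>x y. x \<in> carrier V \<Longrightarrow> y \<in> carrier V \<Longrightarrow> P x \<Longrightarrow> P y \<Longrightarrow> P (x \<oplus>\<^bsub>V\<^esub> y)"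
    and "\<And>c x. x \<in> carrier V \<Longrightarrow> P x \<Longrightarrow> P (c \<odot>\<^bsub>V\<^esub> x)"
  shows "P x"
proof -
  interpret V: vectorspace class_ring V by fact
  have "submodule class_ring {x \<in> carrier V. P x} V"
    by (rule submodule.intro) (use V.module_axioms assms(4,6,7) V.smult_closed in auto)
  then have "vspan V S \<subseteq> {x \<in> carrier V. P x}"
    by (rule V.span_is_subset[rotated]) (use assms(2,5) in auto)
  then show ?thesis using assms(3) by auto
qed

lemma vspan_sub:
  assumes "vspace V" "S \<subseteq> carrier V"
  shows "vspan V S \<subseteq> carrier V" "S \<subseteq> vspan V S" "\<zero>\<^bsub>V\<^esub> \<in> vspan V S"
    "\<And>x y. x \<in> vspan V S \<Longrightarrow> y \<in> vspan V S \<Longrightarrow> x \<oplus>\<^bsub>V\<^esub> y \<in> vspan V S"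
    "\<And>x y. x \<in> vspan V S \<Longrightarrow> y \<in> vspan V S \<Longrightarrow> x \<ominus>\<^bsub>V\<^esub> y \<in> vspan V S"
    "\<And>c x. x \<in> vspan V S \<Longrightarrow> c \<odot>\<^bsub>V\<^esub> x \<in> vspan V S"
    "submodule class_ring (vspan V S) V"
proof -
  interpret V: vectorspace class_ring V by fact
  show sub: "vspan V S \<subseteq> carrier V" "S \<subseteq> vspan V S"
    using V.span_is_subset2 V.in_own_span assms by auto
  show s: "submodule class_ring (vspan V S) V" using V.span_is_submodule assms by auto
  show "\<zero>\<^bsub>V\<^esub> \<in> vspan V S" using submodule.zero_closed[OF s] .
  show a: "\<And>x y. x \<in> vspan V S \<Longrightarrow> y \<in> vspan V S \<Longrightarrow> x \<oplus>\<^bsub>V\<^esub> y \<in> vspan V S"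
    using submodule.m_closed[OF s] .
  show m: "\<And>c x. x \<in> vspan V S \<Longrightarrow> c \<odot>\<^bsub>V\<^esub> x \<in> vspan V S"
    using submodule.smult_closed[OF s] by simp
  show "\<And>x y. x \<in> vspan V S \<Longrightarrow> y \<in> vspan V S \<Longrightarrow> x \<ominus>\<^bsub>V\<^esub> y \<in> vspan V S"
  proof -
    fix x y assume xy: "x \<in> vspan V S" "y \<in> vspan V S"
    then have "x \<in> carrier V" "y \<in> carrier V" using sub by auto
    then show "x \<ominus>\<^bsub>V\<^esub> y \<in> vspan V S" using a m xy vspace_simps(11)[OF assms(1)] by simp
  qed
qed

lemma vspan_mono: "vspace V \<Longrightarrow> S \<subseteq> T \<Longrightarrow> vspan V S \<subseteq> vspan V T"
  using module.span_is_monotone vectorspace_def by blast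

lemma vspan_least:
  assumes "vspace V" "T \<subseteq> carrier V" "S \<subseteq> vspan V T"
  shows "vspan V S \<subseteq> vspan V T"
proof -
  interpret V: vectorspace class_ring V by fact
  show ?thesis using V.span_is_subset V.span_is_submodule assms by auto
qed

lemma linear_form_simps:
  assumes "linear_form V \<psi>"
  shows "u \<in> carrier V \<Longrightarrow> v \<in> carrier V \<Longrightarrow> \<psi> (u \<oplus>\<^bsub>V\<^esub> v) = \<psi> u + \<psi> v"
    and "v \<in> carrier V \<Longrightarrow> \<psi> (c \<odot>\<^bsub>V\<^esub> v) = c * \<psi> v"
    and "vspace V \<Longrightarrow> \<psi> \<zero>\<^bsub>V\<^esub> = 0"
    and "vspace V \<Longrightarrow> u \<in> carrier V \<Longrightarrow> v \<in> carrier V \<Longrightarrow> \<psi> (u \<ominus>\<^bsub>V\<^esub> v) = \<psi> u - \<psi> v"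
proof -
  show a: "u \<in> carrier V \<Longrightarrow> v \<in> carrier V \<Longrightarrow> \<psi> (u \<oplus>\<^bsub>V\<^esub> v) = \<psi> u + \<psi> v" for u v
    using assms by (auto simp: linear_form_def)
  show s: "v \<in> carrier V \<Longrightarrow> \<psi> (c \<odot>\<^bsub>V\<^esub> v) = c * \<psi> v" for c v
    using assms by (auto simp: linear_form_def)
  show "vspace V \<Longrightarrow> \<psi> \<zero>\<^bsub>V\<^esub> = 0"
    using s[of "\<zero>\<^bsub>V\<^esub>" 0] vspace_simps(1,10)[of V] by simp
  show "vspace V \<Longrightarrow> u \<in> carrier V \<Longrightarrow> v \<in> carrier V \<Longrightarrow> \<psi> (u \<ominus>\<^bsub>V\<^esub> v) = \<psi> u - \<psi> v"
    by (simp add: vspace_simps a s)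
qed

lemma lin_on_simps:
  assumes "lin_on V W f"
  shows "v \<in> carrier V \<Longrightarrow> f v \<in> carrier W"
    and "u \<in> carrier V \<Longrightarrow> v \<in> carrier V \<Longrightarrow> f (u \<oplus>\<^bsub>V\<^esub> v) = f u \<oplus>\<^bsub>W\<^esub> f v"
    and "v \<in> carrier V \<Longrightarrow> f (c \<odot>\<^bsub>V\<^esub> v) = c \<odot>\<^bsub>W\<^esub> f v"
    and "vspace V \<Longrightarrow> vspace W \<Longrightarrow> f \<zero>\<^bsub>V\<^esub> = \<zero>\<^bsub>W\<^esub>"
    and "vspace V \<Longrightarrow> vspace W \<Longrightarrow> u \<in> carrier V \<Longrightarrow> v \<in> carrier V \<Longrightarrow> f (u \<ominus>\<^bsub>V\<^esub> v) = f u \<ominus>\<^bsub>W\<^esub> f v"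
proof -
  show c: "v \<in> carrier V \<Longrightarrow> f v \<in> carrier W" for v
    using assms by (auto simp: lin_on_def)
  show a: "u \<in> carrier V \<Longrightarrow> v \<in> carrier V \<Longrightarrow> f (u \<oplus>\<^bsub>V\<^esub> v) = f u \<oplus>\<^bsub>W\<^esub> f v" for u v
    using assms by (auto simp: lin_on_def)
  show s: "v \<in> carrier V \<Longrightarrow> f (c \<odot>\<^bsub>V\<^esub> v) = c \<odot>\<^bsub>W\<^esub> f v" for c v
    using assms by (auto simp: lin_on_def)
  show "vspace V \<Longrightarrow> vspace W \<Longrightarrow> f \<zero>\<^bsub>V\<^esub> = \<zero>\<^bsub>W\<^esub>"
    using s[of "\<zero>\<^bsub>V\<^esub>" 0] c[of "\<zero>\<^bsub>V\<^esub>"] vspace_simps(1,8,10)[of V] vspace_simps(8)[of W] by simp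
  show "vspace V \<Longrightarrow> vspace W \<Longrightarrow> u \<in> carrier V \<Longrightarrow> v \<in> carrier V \<Longrightarrow> f (u \<ominus>\<^bsub>V\<^esub> v) = f u \<ominus>\<^bsub>W\<^esub> f v"
    by (simp add: vspace_simps a s c)
qed

lemma lin_on_comp: "lin_on U V f \<Longrightarrow> lin_on V W g \<Longrightarrow> lin_on U W (\<lambda>x. g (f x))"
  by (simp add: lin_on_def)

lemma linear_form_comp: "lin_on U V f \<Longrightarrow> linear_form V \<psi> \<Longrightarrow> linear_form U (\<lambda>x. \<psi> (f x))"
  by (simp add: lin_on_def linear_form_def)

lemma linear_form_sum:
  "(\<And>i. i \<in> I \<Longrightarrow> linear_form V (\<psi> i)) \<Longrightarrow> linear_form V (\<lambda>v. \<Sum>i\<in>I. c i * \<psi> i v)"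
  by (simp add: linear_form_def sum.distrib sum_distrib_left algebra_simps cong: sum.cong)

lemma linear_form_scale: "linear_form V \<psi> \<Longrightarrow> linear_form V (\<lambda>v. c * \<psi> v)"
  by (simp add: linear_form_def algebra_simps)

lemma lin_on_eq:
  assumes "vspace V" "vspace W" "lin_on V W f" "lin_on V W g" "S \<subseteq> carrier V" "x \<in> vspan V S"
    and "\<And>s. s \<in> S \<Longrightarrow> f s = g s"
  shows "f x = g x"
  using assms(1,5,6)
  by (induction rule: vspan_induct)
    (use assms(1,2,7) in \<open>simp_all add: lin_on_simps[OF assms(3)] lin_on_simps[OF assms(4)]\<close>)

lemma linear_form_vanish:
  assumes "vspace V" "linear_form V \<psi>" "S \<subseteq> carrier V" "x \<in> vspan V S" "\<And>s. s \<in> S \<Longrightarrow> \<psi> s = 0"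
  shows "\<psi> x = 0"
  using assms(1,3,4)
  by (induction rule: vspan_induct) (use assms(1,5) in \<open>simp_all add: linear_form_simps[OF assms(2)]\<close>)

lemma lin_on_span_image:
  assumes "vspace V" "vspace W" "lin_on V W f" "S \<subseteq> carrier V" "T \<subseteq> carrier W" "x \<in> vspan V S"
    and "\<And>s. s \<in> S \<Longrightarrow> f s \<in> vspan W T"
  shows "f x \<in> vspan W T"
  using assms(1,4,6)
  by (induction rule: vspan_induct)
    (use assms vspan_sub[OF assms(2,5)] in \<open>auto simp: lin_on_simps[OF assms(3)]\<close>)

lemma linear_map_lin_on: "linear_map class_ring V W f \<Longrightarrow> lin_on V W f"
proof -
  assume "linear_map class_ring V W f"
  then interpret linear_map class_ring V W f .
  show ?thesis unfolding lin_on_def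
    using T_im T_add T_smult by (simp del: f_add f_smult)
qed

text \<open>Vectors \<open>e t\<close> and linear forms \<open>\<psi> t\<close> in duality modulo \<open>W\<close>. Such data certify that the quotient of \<open>V\<close> by the span of
  \<open>W\<close> has dimension \<open>card T\<close> without forming the quotient, which keeps iterated quotients out of the argument.\<close>

definition dual_system ::
  "('k::field, 'v) module \<Rightarrow> 'v set \<Rightarrow> 't set \<Rightarrow> ('t \<Rightarrow> 'v) \<Rightarrow> ('t \<Rightarrow> 'v \<Rightarrow> 'k) \<Rightarrow> bool" where
  "dual_system V W T e \<psi> \<longleftrightarrow> finite T \<and> W \<subseteq> carrier V \<and> e ` T \<subseteq> carrier V \<and>
     (\<forall>t\<in>T. linear_form V (\<psi> t) \<and> (\<forall>w\<in>W. \<psi> t w = 0)) \<and>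
     (\<forall>s\<in>T. \<forall>t\<in>T. \<psi> t (e s) = (if s = t then 1 else 0)) \<and>
     carrier V \<subseteq> vspan V (e ` T \<union> W)"

text \<open>Both sides are linear in \<open>v\<close> and agree on the spanning set.\<close>

lemma dual_system_expand:
  assumes "vspace V" "dual_system V W T e \<psi>" "linear_form V \<chi>" "\<And>w. w \<in> W \<Longrightarrow> \<chi> w = 0"
    and "v \<in> carrier V"
  shows "\<chi> v = (\<Sum>t\<in>T. \<psi> t v * \<chi> (e t))"
proof -
  note D = assms(2)[unfolded dual_system_def]
  have lf: "linear_form V (\<lambda>v. \<Sum>t\<in>T. \<chi> (e t) * \<psi> t v)"
    by (rule linear_form_sum) (use D in auto)
  have sub: "e ` T \<union> W \<subseteq> carrier V" and mem: "v \<in> vspan V (e ` T \<union> W)" using D assms(5) by auto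
  from assms(1) sub mem have "\<chi> v = (\<Sum>t\<in>T. \<chi> (e t) * \<psi> t v)"
  proof (induction rule: vspan_induct)
    case (base x)
    then consider s where "s \<in> T" "x = e s" | "x \<in> W" by auto
    then show ?case
    proof cases
      case 1
      have "(\<Sum>t\<in>T. \<chi> (e t) * \<psi> t x) = (\<Sum>t\<in>T. if s = t then \<chi> (e t) else 0)"
        by (rule sum.cong) (use D 1 in auto)
      then show ?thesis using D 1 by simp
    qed (use D assms(4) in simp)
  next
    case zero
    then show ?case using linear_form_simps(3)[OF lf assms(1)] linear_form_simps(3)[OF assms(3,1)] by simp
  next
    case (add x y)
    then show ?case using linear_form_simps(1)[OF lf] linear_form_simps(1)[OF assms(3)] by simp
  next
    case (smult c x)
    then show ?case using linear_form_simps(2)[OF lf] linear_form_simps(2)[OF assms(3)] by simp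
  qed
  then show ?thesis by (simp add: mult.commute)
qed

text \<open>Expanding each system in the other one computes the trace of the identity in two ways; in
  characteristic zero this compares the cardinalities.\<close>

lemma dual_system_card:
  fixes V :: "('k::field_char_0, 'v) module"
  assumes "vspace V" "dual_system V W T e \<psi>" "dual_system V W T' e' \<psi>'"
  shows "card T = card T'"
proof -
  note D = assms(2)[unfolded dual_system_def] and D' = assms(3)[unfolded dual_system_def]
  have "(of_nat (card T) :: 'k) = (\<Sum>t\<in>T. \<psi> t (e t))" using D by simp
  also have "\<dots> = (\<Sum>t\<in>T. \<Sum>t'\<in>T'. \<psi>' t' (e t) * \<psi> t (e' t'))"
    by (rule sum.cong[OF refl], rule dual_system_expand[OF assms(1,3)]) (use D in auto)
  also have "\<dots> = (\<Sum>t'\<in>T'. \<Sum>t\<in>T. \<psi> t (e' t') * \<psi>' t' (e t))"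
    by (subst sum.swap) (simp add: mult.commute)
  also have "\<dots> = (\<Sum>t'\<in>T'. \<psi>' t' (e' t'))"
    by (rule sum.cong[OF refl], rule dual_system_expand[OF assms(1,2), symmetric]) (use D' in auto)
  also have "\<dots> = of_nat (card T')" using D' by simp
  finally show ?thesis by simp
qed

lemma linear_form_lincomb:
  assumes "vspace V" "linear_form V \<psi>" "finite A" "A \<subseteq> carrier V"
  shows "\<psi> (LinearCombinations.module.lincomb V a A) = (\<Sum>v\<in>A. a v * \<psi> v)"
proof -
  interpret V: vectorspace class_ring V by fact
  from assms(3,4) show ?thesis
  proof (induction A rule: finite_induct)
    case empty
    then show ?case using linear_form_simps(3)[OF assms(2,1)] by (simp add: V.lincomb_def)
  next
    case (insert x A)
    have "V.lincomb a (insert x A) = a x \<odot>\<^bsub>V\<^esub> x \<oplus>\<^bsub>V\<^esub> V.lincomb a A"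
      using V.lincomb_insert[of A a x] insert by simp
    moreover have "V.lincomb a A \<in> carrier V"
      using insert V.lincomb_closed by simp
    ultimately show ?case
      using insert assms(2) by (simp add: linear_form_simps vspace_simps(4)[OF assms(1)])
  qed
qed

lemma basis_dual_system:
  assumes "vspace V" "finite B" "vectorspace.basis class_ring V B"
  shows "\<exists>\<beta>. dual_system V {} B (\<lambda>b. b) \<beta> \<and>
    (\<forall>v\<in>carrier V. v = LinearCombinations.module.lincomb V (\<lambda>b. \<beta> b v) B)"
proof -
  interpret V: vectorspace class_ring V by fact
  have BV: "B \<subseteq> carrier V" and gen: "vspan V B = carrier V" and li: "\<not> V.lin_dep B"
    using assms(3) by (auto simp: V.basis_def)
  have ex1: "\<exists>!a. a \<in> B \<rightarrow>\<^sub>E carrier class_ring \<and> V.lincomb a B = v" if "v \<in> carrier V" for v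
    using assms(3) V.basis_criterion[OF assms(2) BV] that by blast
  define C where "C v = (THE a. a \<in> B \<rightarrow>\<^sub>E carrier (class_ring :: 'a ring) \<and> V.lincomb a B = v)" for v
  have C: "C v \<in> extensional B" "V.lincomb (C v) B = v" if "v \<in> carrier V" for v
    using theI'[OF ex1[OF that]] by (auto simp: C_def PiE_def)
  have Cuniq: "C v b = a b" if "V.lincomb a B = v" "b \<in> B" for a b v
  proof -
    have v: "v \<in> carrier V" using that V.lincomb_closed[OF BV] by auto
    have "V.lincomb (restrict a B) B = v" using that V.lincomb_cong[OF refl BV, of "restrict a B" a] by auto
    moreover have "restrict a B \<in> B \<rightarrow>\<^sub>E carrier class_ring" by simp
    ultimately have "C v = restrict a B" unfolding C_def by (intro the1_equality[OF ex1[OF v]] conjI)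
    then show ?thesis using that by simp
  qed
  have add: "C (u \<oplus>\<^bsub>V\<^esub> v) b = C u b + C v b" if "u \<in> carrier V" "v \<in> carrier V" "b \<in> B" for u v b
    by (rule Cuniq) (use V.lincomb_sum[OF assms(2) BV, of "C u" "C v"] C that in simp_all)
  have smult: "C (c \<odot>\<^bsub>V\<^esub> v) b = c * C v b" if "v \<in> carrier V" "b \<in> B" for c v b
    by (rule Cuniq) (use V.lincomb_smult[OF BV, of "C v" c] C that in simp_all)
  have delta: "C s t = (if s = t then 1 else 0)" if "s \<in> B" "t \<in> B" for s t
  proof (rule Cuniq[OF _ that(2)])
    have "V.lincomb (\<lambda>t. if s = t then 1 else 0) B
        = (1::'a) \<odot>\<^bsub>V\<^esub> s \<oplus>\<^bsub>V\<^esub> V.lincomb (\<lambda>t. if s = t then 1 else 0) (B - {s})"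
      using V.lincomb_del2[OF assms(2) BV, of "\<lambda>t. if s = t then 1 else 0" s] that by auto
    also have "V.lincomb (\<lambda>t. if s = t then (1::'a) else 0) (B - {s}) = \<zero>\<^bsub>V\<^esub>"
      unfolding V.lincomb_def
      by (rule V.M.add.finprod_one_eqI) (use BV vspace_simps(8)[OF assms(1)] in auto)
    finally show "V.lincomb (\<lambda>t. if s = t then 1 else 0) B = s"
      using BV that vspace_simps(6,9)[OF assms(1)] by auto
  qed
  have "dual_system V {} B (\<lambda>b. b) (\<lambda>b v. C v b)"
    unfolding dual_system_def linear_form_def using add smult delta BV gen assms(2) by auto
  then show ?thesis using C by auto
qed

lemma dual_system_basis:
  assumes "vspace V" "dual_system V {} T e \<psi>"
  shows "vectorspace.basis class_ring V (e ` T)" "inj_on e T"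
proof -
  interpret V: vectorspace class_ring V by fact
  note D = assms(2)[unfolded dual_system_def]
  show inj: "inj_on e T"
  proof (rule inj_onI, rule ccontr)
    fix s t assume "s \<in> T" "t \<in> T" "e s = e t" "s \<noteq> t"
    then show False using D by (metis (no_types, lifting) zero_neq_one)
  qed
  have "\<not> V.lin_dep (e ` T)"
  proof (rule V.finite_lin_indpt2)
    fix a :: "'b \<Rightarrow> 'a" assume a: "V.lincomb a (e ` T) = \<zero>\<^bsub>V\<^esub>"
    show "\<forall>v\<in>e ` T. a v = \<zero>\<^bsub>class_ring\<^esub>"
    proof clarsimp
      fix t assume t: "t \<in> T"
      have "0 = \<psi> t (V.lincomb a (e ` T))"
        using a D t linear_form_simps(3)[OF _ assms(1)] by metis
      also have "\<dots> = (\<Sum>v\<in>e ` T. a v * \<psi> t v)"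
        by (rule linear_form_lincomb[OF assms(1)]) (use D t in auto)
      also have "\<dots> = (\<Sum>s\<in>T. a (e s) * \<psi> t (e s))"
        by (simp add: sum.reindex[OF inj])
      also have "\<dots> = (\<Sum>s\<in>T. if s = t then a (e s) else 0)"
        by (rule sum.cong) (use D t in auto)
      also have "\<dots> = a (e t)" using D t by simp
      finally show "a (e t) = 0" by simp
    qed
  qed (use D in auto)
  moreover have "vspan V (e ` T) = carrier V" using D vspan_sub(1)[OF assms(1), of "e ` T"] by auto
  ultimately show "vectorspace.basis class_ring V (e ` T)" using D by (auto simp: V.basis_def)
qed

text \<open>A dual system of eigenvectors relative to no relations diagonalises the endomorphism. The sum of the
  eigenvalues agrees with the matrix trace in an arbitrary basis, again by expanding one system in the other.\<close>

lemma lin_trace_dual_system: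
  fixes V :: "('k::field, 'v) module"
  assumes V: "vspace V" and ds: "dual_system V {} T e \<psi>" and f: "lin_on V V f"
    and ev: "\<And>t. t \<in> T \<Longrightarrow> f (e t) = l t \<odot>\<^bsub>V\<^esub> e t"
  shows "lin_trace V f = (\<Sum>t\<in>T. l t)"
  unfolding lin_trace_def
proof (rule the_equality)
  interpret V: vectorspace class_ring V by fact
  note D = ds[unfolded dual_system_def]
  have inj: "inj_on e T" and basis: "V.basis (e ` T)" using dual_system_basis[OF V ds] by auto
  have fin: "finite (e ` T)" using D by simp
  obtain \<beta> where \<beta>: "\<And>v. v \<in> carrier V \<Longrightarrow> v = V.lincomb (\<lambda>b. \<beta> b v) (e ` T)"
    and b2: "dual_system V {} (e ` T) (\<lambda>b. b) \<beta>"
    using basis_dual_system[OF V fin basis] by auto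
  have "\<forall>c\<in>e ` T. f c = V.lincomb (\<lambda>b. \<beta> b (f c)) (e ` T)"
  proof
    fix c assume "c \<in> e ` T"
    then have "f c \<in> carrier V" using lin_on_simps(1)[OF f] D by auto
    then show "f c = V.lincomb (\<lambda>b. \<beta> b (f c)) (e ` T)" by (rule \<beta>)
  qed
  moreover have "(\<Sum>t\<in>T. l t) = (\<Sum>b\<in>e ` T. \<beta> b (f b))"
  proof -
    have "\<beta> (e t) (f (e t)) = l t" if "t \<in> T" for t
    proof -
      have lf: "linear_form V (\<beta> (e t))" and one: "\<beta> (e t) (e t) = 1"
        using b2 that by (auto simp: dual_system_def)
      have "e t \<in> carrier V" using D that by auto
      then show ?thesis using linear_form_simps(2)[OF lf] one ev[OF that] by simp
    qed
    then show ?thesis by (simp add: sum.reindex[OF inj])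
  qed
  ultimately show "\<exists>B A. finite B \<and> V.basis B \<and> (\<forall>c\<in>B. f c = V.lincomb (\<lambda>b. A b c) B) \<and> (\<Sum>t\<in>T. l t) = (\<Sum>b\<in>B. A b b)"
    using fin basis by (intro exI[of _ "e ` T"] exI[of _ "\<lambda>b c. \<beta> b (f c)"]) auto
next
  interpret V: vectorspace class_ring V by fact
  note D = ds[unfolded dual_system_def]
  fix x assume "\<exists>B A. finite B \<and> V.basis B \<and> (\<forall>c\<in>B. f c = V.lincomb (\<lambda>b. A b c) B) \<and> x = (\<Sum>b\<in>B. A b b)"
  then obtain B A where B: "finite B" "V.basis B" and A: "\<And>c. c \<in> B \<Longrightarrow> f c = V.lincomb (\<lambda>b. A b c) B"
    and x: "x = (\<Sum>b\<in>B. A b b)" by auto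
  obtain \<beta> where b: "dual_system V {} B (\<lambda>b. b) \<beta>"
    using basis_dual_system[OF V B] by auto
  note Db = b[unfolded dual_system_def]
  have Ab: "A b b = \<beta> b (f b)" if "b \<in> B" for b
  proof -
    have "\<beta> b (f b) = (\<Sum>v\<in>B. A v b * \<beta> b v)"
      unfolding A[OF that] by (rule linear_form_lincomb[OF V]) (use Db that in auto)
    also have "\<dots> = (\<Sum>v\<in>B. if v = b then A v b else 0)"
      by (rule sum.cong) (use Db that in auto)
    finally show ?thesis using that B by simp
  qed
  have "x = (\<Sum>b\<in>B. \<beta> b (f b))" using x Ab by simp
  also have "\<dots> = (\<Sum>b\<in>B. \<Sum>t\<in>T. \<psi> t b * \<beta> b (f (e t)))"
    by (rule sum.cong[OF refl], rule dual_system_expand[OF V ds])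
      (use Db linear_form_comp[OF f, of "\<beta> _"] in auto)
  also have "\<dots> = (\<Sum>t\<in>T. l t * (\<Sum>b\<in>B. \<beta> b (e t) * \<psi> t b))"
    unfolding sum_distrib_left
  proof (subst sum.swap, intro sum.cong refl)
    fix t b assume tb: "t \<in> T" "b \<in> B"
    then have lf: "linear_form V (\<beta> b)" and "e t \<in> carrier V" using Db D by auto
    then have "\<beta> b (f (e t)) = l t * \<beta> b (e t)" using linear_form_simps(2)[OF lf] ev[OF tb(1)] by simp
    then show "\<psi> t b * \<beta> b (f (e t)) = l t * (\<beta> b (e t) * \<psi> t b)" by simp
  qed
  also have "\<dots> = (\<Sum>t\<in>T. l t * \<psi> t (e t))"
  proof (rule sum.cong[OF refl])
    fix t assume "t \<in> T"
    then have "\<psi> t (e t) = (\<Sum>b\<in>B. \<beta> b (e t) * \<psi> t b)"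
      by (intro dual_system_expand[OF V b]) (use D in auto)
    then show "l t * (\<Sum>b\<in>B. \<beta> b (e t) * \<psi> t b) = l t * \<psi> t (e t)" by simp
  qed
  also have "\<dots> = (\<Sum>t\<in>T. l t)" using D by simp
  finally show "x = (\<Sum>t\<in>T. l t)" .
qed

lemma quot_space_facts:
  assumes V: "vspace V" and W: "submodule class_ring W V"
  shows quot_coset_eq: "\<And>x y. x \<in> carrier V \<Longrightarrow> y \<in> carrier V \<Longrightarrow>
      W +>\<^bsub>V\<^esub> x = W +>\<^bsub>V\<^esub> y \<longleftrightarrow> x \<ominus>\<^bsub>V\<^esub> y \<in> W"
    and quot_carrier: "carrier (quot_space V W) = (\<lambda>x. W +>\<^bsub>V\<^esub> x) ` carrier V"
    and quot_zero: "\<zero>\<^bsub>quot_space V W\<^esub> = W +>\<^bsub>V\<^esub> \<zero>\<^bsub>V\<^esub>"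
    and quot_vspace: "vspace (quot_space V W)"
    and quot_lin_on: "lin_on V (quot_space V W) (\<lambda>x. W +>\<^bsub>V\<^esub> x)"
    and quot_map_coset: "\<And>f x. lin_on V V f \<Longrightarrow> f ` W \<subseteq> W \<Longrightarrow> x \<in> carrier V \<Longrightarrow>
      quot_map V W f (W +>\<^bsub>V\<^esub> x) = W +>\<^bsub>V\<^esub> f x"
proof -
  interpret V: vectorspace class_ring V by fact
  interpret W: submodule class_ring W V by fact
  have sub: "W \<subseteq> carrier V" by (rule W.subset)
  have minus: "(- 1) \<odot>\<^bsub>V\<^esub> w \<in> W" if "w \<in> W" for w using that W.smult_closed by simp
  interpret A: abelian_subgroup W V
  proof (rule abelian_subgroupI3)
    show "additive_subgroup W V"
    proof (rule additive_subgroup.intro, rule subgroup.intro)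
      fix x assume "x \<in> W"
      then show "inv\<^bsub>add_monoid V\<^esub> x \<in> W"
      proof -
        have "\<ominus>\<^bsub>V\<^esub> x = (- 1) \<odot>\<^bsub>V\<^esub> x"
          using V.smult_minus_1[of x] \<open>x \<in> W\<close> sub by (auto simp: class_ring_simps)
        then show ?thesis using minus[OF \<open>x \<in> W\<close>] by (simp add: a_inv_def)
      qed
    qed (use sub in auto)
  qed (rule V.abelian_group_axioms)
  have rep: "W +>\<^bsub>V\<^esub> x = W +>\<^bsub>V\<^esub> y" if "y \<in> W +>\<^bsub>V\<^esub> x" "x \<in> carrier V" for x y
    using V.M.a_repr_independence[OF that A.is_additive_subgroup[THEN additive_subgroup.a_subgroup]] .
  show eq: "W +>\<^bsub>V\<^esub> x = W +>\<^bsub>V\<^esub> y \<longleftrightarrow> x \<ominus>\<^bsub>V\<^esub> y \<in> W" if "x \<in> carrier V" "y \<in> carrier V" for x y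
    using A.a_rcos_module[OF that(2,1)] A.a_rcos_self[OF that(1)] rep[OF _ that(2), of x]
    by (auto simp: V.M.minus_eq)
  show car: "carrier (quot_space V W) = (\<lambda>x. W +>\<^bsub>V\<^esub> x) ` carrier V"
    by (auto simp: quot_space_def A_RCOSETS_def' image_def)
  have zero0: "W +>\<^bsub>V\<^esub> \<zero>\<^bsub>V\<^esub> = W" using sub by (rule V.M.a_coset_add_zero)
  then show zero: "\<zero>\<^bsub>quot_space V W\<^esub> = W +>\<^bsub>V\<^esub> \<zero>\<^bsub>V\<^esub>" by (simp add: quot_space_def)
  have add: "(W +>\<^bsub>V\<^esub> x) \<oplus>\<^bsub>quot_space V W\<^esub> (W +>\<^bsub>V\<^esub> y) = W +>\<^bsub>V\<^esub> (x \<oplus>\<^bsub>V\<^esub> y)"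
    if "x \<in> carrier V" "y \<in> carrier V" for x y
    using A.a_rcos_sum[OF that] by (simp add: quot_space_def)
  have coset_mem: "y \<in> carrier V \<and> W +>\<^bsub>V\<^esub> y = W +>\<^bsub>V\<^esub> x" if "x \<in> carrier V" "y \<in> W +>\<^bsub>V\<^esub> x" for x y
    using A.a_elemrcos_carrier[OF that] rep[OF that(2,1)] by simp
  have const: "(\<Union>y\<in>W +>\<^bsub>V\<^esub> x. W +>\<^bsub>V\<^esub> f y) = W +>\<^bsub>V\<^esub> f x"
    if f: "lin_on V V f" "f ` W \<subseteq> W" and x: "x \<in> carrier V" for f x
  proof -
    have "W +>\<^bsub>V\<^esub> f y = W +>\<^bsub>V\<^esub> f x" if y: "y \<in> W +>\<^bsub>V\<^esub> x" for y
    proof -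
      have yc: "y \<in> carrier V" and "y \<ominus>\<^bsub>V\<^esub> x \<in> W" using coset_mem[OF x y] eq[of y x] x by auto
      then have "f (y \<ominus>\<^bsub>V\<^esub> x) \<in> W" using f(2) by auto
      then show ?thesis using eq lin_on_simps[OF f(1)] yc x V by simp
    qed
    then show ?thesis using A.a_rcos_self[OF x] by blast
  qed
  have smult: "c \<odot>\<^bsub>quot_space V W\<^esub> (W +>\<^bsub>V\<^esub> x) = W +>\<^bsub>V\<^esub> (c \<odot>\<^bsub>V\<^esub> x)" if "x \<in> carrier V" for c x
  proof -
    have "lin_on V V (\<lambda>x. c \<odot>\<^bsub>V\<^esub> x)"
      unfolding lin_on_def
      using V.smult_closed V.smult_r_distr V.smult_assoc1[symmetric] by (simp add: mult.commute)
    then show ?thesis using const[of "\<lambda>x. c \<odot>\<^bsub>V\<^esub> x" x] that W.smult_closed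
      by (simp add: quot_space_def image_subset_iff)
  qed
  show "lin_on V (quot_space V W) (\<lambda>x. W +>\<^bsub>V\<^esub> x)"
    unfolding lin_on_def using car add smult by auto
  show "quot_map V W f (W +>\<^bsub>V\<^esub> x) = W +>\<^bsub>V\<^esub> f x"
    if "lin_on V V f" "f ` W \<subseteq> W" "x \<in> carrier V" for f x
    using const[OF that] by (simp add: quot_map_def)
  have neg: "\<exists>n\<in>carrier (quot_space V W). v \<oplus>\<^bsub>quot_space V W\<^esub> n = \<zero>\<^bsub>quot_space V W\<^esub>"
    if v: "v \<in> carrier (quot_space V W)" for v
  proof -
    obtain x where "x \<in> carrier V" "v = W +>\<^bsub>V\<^esub> x" using v car by auto
    then show ?thesis using car add zero V.M.r_neg by (intro bexI[of _ "W +>\<^bsub>V\<^esub> (\<ominus>\<^bsub>V\<^esub> x)"]) auto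
  qed
  have l_distr: "(a + b) \<odot>\<^bsub>V\<^esub> v = a \<odot>\<^bsub>V\<^esub> v \<oplus>\<^bsub>V\<^esub> b \<odot>\<^bsub>V\<^esub> v" if "v \<in> carrier V" for a b v
    using V.smult_l_distr[of a b v] that by simp
  have r_distr: "a \<odot>\<^bsub>V\<^esub> (v \<oplus>\<^bsub>V\<^esub> w) = a \<odot>\<^bsub>V\<^esub> v \<oplus>\<^bsub>V\<^esub> a \<odot>\<^bsub>V\<^esub> w" if "v \<in> carrier V" "w \<in> carrier V" for a v w
    using V.smult_r_distr[of a v w] that by simp
  have assoc1: "(a * b) \<odot>\<^bsub>V\<^esub> v = a \<odot>\<^bsub>V\<^esub> (b \<odot>\<^bsub>V\<^esub> v)" if "v \<in> carrier V" for a b v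
    using V.smult_assoc1[of a b v] that by simp
  show "vspace (quot_space V W)"
    by (rule vs_criteria[OF class_field])
      (use neg V.smult_closed vspace_simps(9)[OF V] l_distr r_distr assoc1 in
        \<open>auto simp: car zero add smult V.M.a_ac\<close>)
qed

lemma quot_map_lin_on:
  assumes "vspace V" "submodule class_ring W V" "lin_on V V f" "f ` W \<subseteq> W"
  shows "lin_on (quot_space V W) (quot_space V W) (quot_map V W f)"
proof -
  note Q = quot_carrier[OF assms(1,2)] quot_map_coset[OF assms(1-4)]
    lin_on_simps(2,3)[OF quot_lin_on[OF assms(1,2)], symmetric]
  show ?thesis
    unfolding lin_on_def by (auto simp: Q lin_on_simps[OF assms(3)] vspace_simps[OF assms(1)])
qed

lemma quot_form_exists:
  assumes "vspace V" "submodule class_ring W V" "linear_form V \<psi>" "\<And>w. w \<in> W \<Longrightarrow> \<psi> w = 0"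
  obtains \<psi>' where "linear_form (quot_space V W) \<psi>'" "\<And>x. x \<in> carrier V \<Longrightarrow> \<psi>' (W +>\<^bsub>V\<^esub> x) = \<psi> x"
proof
  define \<psi>' where "\<psi>' C = \<psi> (SOME x. x \<in> carrier V \<and> W +>\<^bsub>V\<^esub> x = C)" for C
  show coset: "\<psi>' (W +>\<^bsub>V\<^esub> x) = \<psi> x" if "x \<in> carrier V" for x
  proof -
    define y where "y = (SOME y. y \<in> carrier V \<and> W +>\<^bsub>V\<^esub> y = W +>\<^bsub>V\<^esub> x)"
    have "y \<in> carrier V \<and> W +>\<^bsub>V\<^esub> y = W +>\<^bsub>V\<^esub> x"
      unfolding y_def by (rule someI[of _ x]) (use that in simp)
    then have y: "y \<in> carrier V" "y \<ominus>\<^bsub>V\<^esub> x \<in> W" using quot_coset_eq[OF assms(1,2), of y x] that by auto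
    then have "\<psi> y - \<psi> x = 0" using assms(4) linear_form_simps(4)[OF assms(3,1) y(1) that] by metis
    then show ?thesis by (simp add: \<psi>'_def y_def)
  qed
  show "linear_form (quot_space V W) \<psi>'"
    unfolding linear_form_def
    by (auto simp: quot_carrier[OF assms(1,2)] lin_on_simps(2,3)[OF quot_lin_on[OF assms(1,2)], symmetric] coset
        vspace_simps[OF assms(1)] linear_form_simps[OF assms(3)])
qed

text \<open>Lift a basis of the quotient space to \<open>V\<close> and pull its coordinate forms back.\<close>

lemma dual_system_exists:
  assumes V: "vspace V" and fd: "vectorspace.fin_dim class_ring V" and W: "W \<subseteq> carrier V"
  obtains n :: nat and e \<psi> where "dual_system V W {..<n} e \<psi>"
proof -
  interpret V: vectorspace class_ring V by fact
  let ?W = "vspan V W" and ?Q = "quot_space V (vspan V W)"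
  note sub = vspan_sub[OF V W]
  have Q: "vspace ?Q" by (rule quot_vspace[OF V sub(7)])
  interpret Q: vectorspace class_ring ?Q by fact
  note lin = quot_lin_on[OF V sub(7)] and car = quot_carrier[OF V sub(7)]
  have "linear_map class_ring V ?Q (\<lambda>x. ?W +>\<^bsub>V\<^esub> x)"
    unfolding linear_map_def mod_hom_def mod_hom_axioms_def module_hom_def
    using V Q V.module_axioms Q.module_axioms lin by (auto simp: lin_on_def LinearCombinations.module_hom_def)
  then have "Q.fin_dim" using linear_map.rank_nullity_main(2) fd car by metis
  then obtain B where B: "finite B" "Q.basis B" using Q.finite_basis_exists by auto
  obtain \<beta> where b: "dual_system ?Q {} B (\<lambda>b. b) \<beta>" using basis_dual_system[OF Q B] by auto
  note D = b[unfolded dual_system_def]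
  obtain n g where g: "bij_betw g {..<n::nat} B"
    using ex_bij_betw_nat_finite[OF B(1)] by (auto simp: atLeast0LessThan)
  have "\<exists>x. x \<in> carrier V \<and> ?W +>\<^bsub>V\<^esub> x = b" if "b \<in> B" for b using D car that by auto
  then obtain r where r: "\<And>b. b \<in> B \<Longrightarrow> r b \<in> carrier V" "\<And>b. b \<in> B \<Longrightarrow> ?W +>\<^bsub>V\<^esub> r b = b" by metis
  define e where "e i = r (g i)" for i
  define \<psi> where "\<psi> i v = \<beta> (g i) (?W +>\<^bsub>V\<^esub> v)" for i v
  have gB: "g i \<in> B" if "i < n" for i using g that by (auto simp: bij_betw_def)
  have gi: "g i = g j \<longleftrightarrow> i = j" if "i < n" "j < n" for i j using g that by (auto simp: bij_betw_def inj_on_def)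
  have lf: "linear_form V (\<psi> i)" if "i < n" for i
    unfolding \<psi>_def by (rule linear_form_comp[OF lin]) (use D gB that in auto)
  have kill: "\<psi> i w = 0" if "i < n" "w \<in> W" for i w
  proof -
    have "?W +>\<^bsub>V\<^esub> w = ?W +>\<^bsub>V\<^esub> \<zero>\<^bsub>V\<^esub>"
      using quot_coset_eq[OF V sub(7), of w "\<zero>\<^bsub>V\<^esub>"] that W sub vspace_simps[OF V] by (auto simp: subset_iff)
    then show ?thesis using quot_zero[OF V sub(7)] D gB[OF that(1)] linear_form_simps(3)[OF _ Q] by (metis \<psi>_def)
  qed
  let ?E = "e ` {..<n} \<union> W"
  have E: "?E \<subseteq> carrier V" using W r gB by (auto simp: e_def)
  note Esub = vspan_sub[OF V E]
  have span: "\<exists>x\<in>vspan V ?E. x \<in> carrier V \<and> C = ?W +>\<^bsub>V\<^esub> x" if "C \<in> vspan ?Q B" for C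
  proof -
    have "B \<subseteq> carrier ?Q" using D by auto
    from Q this that show ?thesis
    proof (induction rule: vspan_induct)
      case zero
      show ?case using quot_zero[OF V sub(7)] Esub(1,3) by blast
    next
      case (base b)
      then obtain i where i: "i < n" "b = g i" using g by (auto simp: bij_betw_def)
      then show ?case using r base Esub(2) by (intro bexI[of _ "e i"]) (auto simp: e_def)
    next
      case (add x y)
      then show ?case using lin_on_simps(2)[OF lin] Esub(4) vspace_simps(2)[OF V] by metis
    next
      case (smult c x)
      then show ?case using lin_on_simps(3)[OF lin] Esub(6) vspace_simps(4)[OF V] by metis
    qed
  qed
  have "carrier V \<subseteq> vspan V ?E"
  proof
    fix v assume v: "v \<in> carrier V"
    then have "?W +>\<^bsub>V\<^esub> v \<in> vspan ?Q B" using D car by auto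
    then obtain x where x: "x \<in> vspan V ?E" "x \<in> carrier V" "?W +>\<^bsub>V\<^esub> v = ?W +>\<^bsub>V\<^esub> x" using span by blast
    then have "v \<ominus>\<^bsub>V\<^esub> x \<in> ?W" using quot_coset_eq[OF V sub(7)] v by auto
    then have "v \<ominus>\<^bsub>V\<^esub> x \<in> vspan V ?E" using vspan_mono[OF V, of W ?E] by auto
    then have "(v \<ominus>\<^bsub>V\<^esub> x) \<oplus>\<^bsub>V\<^esub> x \<in> vspan V ?E" using Esub(4) x by auto
    then show "v \<in> vspan V ?E" using vspace_simps(13)[OF V v x(2)] by simp
  qed
  then have "dual_system V W {..<n} e \<psi>"
    unfolding dual_system_def using lf kill W E D gB gi r by (auto simp: \<psi>_def e_def)
  then show thesis by (rule that)
qed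

lemma dual_systemI:
  assumes "vspace V" "finite T" "W \<subseteq> carrier V" "\<And>t. t \<in> T \<Longrightarrow> e t \<in> carrier V"
    and "\<And>t. t \<in> T \<Longrightarrow> linear_form V (\<psi> t)" "\<And>t w. t \<in> T \<Longrightarrow> w \<in> W \<Longrightarrow> \<psi> t w = 0"
    and "\<And>s t. s \<in> T \<Longrightarrow> t \<in> T \<Longrightarrow> s \<noteq> t \<Longrightarrow> \<psi> t (e s) = 0" "\<And>t. t \<in> T \<Longrightarrow> \<psi> t (e t) \<noteq> 0"
    and "\<And>v. v \<in> carrier V \<Longrightarrow> v \<in> vspan V (e ` T \<union> W)"
  shows "dual_system V W T e (\<lambda>t v. inverse (\<psi> t (e t)) * \<psi> t v)"
  unfolding dual_system_def using assms by (auto intro: linear_form_scale)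

section \<open>Coinvariants presented by generators and relations\<close>

lemma lookup_map_times: "lookup (smul (c::'k::field) p) g = c * lookup p g"
  by (simp add: Poly_Mapping.map.rep_eq when_def)

text \<open>The linear form on finitely supported functions with prescribed values on the generators.\<close>

definition lin_fun :: "('g \<Rightarrow> 'k::field) \<Rightarrow> ('g \<Rightarrow>\<^sub>0 'k) \<Rightarrow> 'k" where
  "lin_fun F p = (\<Sum>g\<in>keys p. lookup p g * F g)"

lemma lookup_sum_keys:
  "lookup (sum f A) h = (\<Sum>a\<in>A. lookup (f a) h)"
  by (induction A rule: infinite_finite_induct) (simp_all add: lookup_add)

lemma lin_fun_superset:
  "finite A \<Longrightarrow> keys p \<subseteq> A \<Longrightarrow> lin_fun F p = (\<Sum>g\<in>A. lookup p g * F g)"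
  unfolding lin_fun_def by (rule sum.mono_neutral_left) (auto simp: in_keys_iff)

lemma lin_fun_add: "lin_fun F (p + q) = lin_fun F p + lin_fun F q"
proof -
  let ?A = "keys p \<union> keys q"
  have "keys (p + q) \<subseteq> ?A" by (rule keys_add)
  then show ?thesis
    by (simp add: lin_fun_superset[of ?A] lookup_add sum.distrib distrib_right)
qed

lemma lin_fun_smult: "lin_fun F (smul c p) = c * lin_fun F p"
proof -
  have "keys (smul c p) \<subseteq> keys p"
    by (auto simp: in_keys_iff lookup_map_times)
  then show ?thesis
    by (simp add: lin_fun_superset[of "keys p"] lookup_map_times sum_distrib_left mult.assoc)
qed

lemma lin_fun_single [simp]: "lin_fun F (single g c) = c * F g"
  by (simp add: lin_fun_def)

lemma lin_fun_minus: "lin_fun F (p - q) = lin_fun F p - lin_fun F q"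
  using lin_fun_add[of F "p - q" q] by simp

lemma lookup_lin_ext: "lookup (lin_ext \<phi> p) h = lin_fun (\<lambda>g. lookup (\<phi> g) h) p"
  by (simp add: lin_ext_def lin_fun_def lookup_sum_keys lookup_map_times)

lemma lin_ext_add: "lin_ext \<phi> (p + q) = lin_ext \<phi> p + lin_ext \<phi> q"
  by (rule poly_mapping_eqI) (simp add: lookup_lin_ext lin_fun_add lookup_add)

lemma lin_ext_minus: "lin_ext \<phi> (p - q) = lin_ext \<phi> p - lin_ext \<phi> q"
  by (rule poly_mapping_eqI) (simp add: lookup_lin_ext lin_fun_minus lookup_minus)

lemma lin_ext_smult: "lin_ext \<phi> (smul c p) = smul c (lin_ext \<phi> p)"
  by (rule poly_mapping_eqI) (simp add: lookup_lin_ext lin_fun_smult lookup_map_times)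

lemma map_times_single [simp]:
  "smul (c::'k::field) (single g d) = single g (c * d)"
  by (rule poly_mapping_eqI) (simp add: lookup_map_times lookup_single when_def)

lemma lin_ext_single: "lin_ext \<phi> (single g c) = smul c (\<phi> g)"
  by (rule poly_mapping_eqI) (simp add: lookup_lin_ext lookup_map_times)

lemma free_space_simps [simp]:
  "carrier (free_space Z) = {p. keys p \<subseteq> Z}"
  "\<zero>\<^bsub>free_space Z\<^esub> = 0"
  "p \<oplus>\<^bsub>free_space Z\<^esub> q = p + q"
  "c \<odot>\<^bsub>free_space Z\<^esub> p = smul c p"
  by (simp_all add: free_space_def)

lemma keys_map_times: "keys (smul (c::'k::field) p) \<subseteq> keys p"
  by (auto simp: in_keys_iff lookup_map_times)

lemma free_space_vspace: "vspace (free_space Z :: ('k::field, 'g \<Rightarrow>\<^sub>0 'k) module)"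
proof (rule vs_criteria[OF class_field])
  let ?V = "free_space Z :: ('k::field, 'g \<Rightarrow>\<^sub>0 'k) module"
  show "\<forall>v\<in>carrier ?V. \<exists>w\<in>carrier ?V. v \<oplus>\<^bsub>?V\<^esub> w = \<zero>\<^bsub>?V\<^esub>"
    by (intro ballI bexI[of _ "- _"]) auto
  show "\<forall>v w. v \<in> carrier ?V \<and> w \<in> carrier ?V \<longrightarrow> v \<oplus>\<^bsub>?V\<^esub> w \<in> carrier ?V"
    using keys_add by fastforce
  show "\<forall>c v. c \<in> carrier class_ring \<and> v \<in> carrier ?V \<longrightarrow> c \<odot>\<^bsub>?V\<^esub> v \<in> carrier ?V"
    using keys_map_times by fastforce
qed (auto simp: algebra_simps lookup_map_times lookup_add intro!: poly_mapping_eqI)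

lemma free_space_minus [simp]:
  assumes "p \<in> carrier (free_space Z)" "q \<in> carrier (free_space Z)"
  shows "p \<ominus>\<^bsub>free_space Z\<^esub> q = p - q"
  unfolding vspace_simps(11)[OF free_space_vspace assms]
  by (rule poly_mapping_eqI) (simp add: lookup_add lookup_map_times lookup_minus)

lemma free_space_span:
  assumes "p \<in> carrier (free_space Z)"
  shows "p \<in> vspan (free_space Z) ((\<lambda>g. single g 1) ` Z)"
proof -
  let ?V = "free_space Z" and ?S = "(\<lambda>g. single g 1) ` Z"
  have S: "?S \<subseteq> carrier ?V" by auto
  note sub = vspan_sub[OF free_space_vspace S]
  have single: "single g c \<in> vspan ?V ?S" if "g \<in> Z" for g c
  proof -
    have "single g 1 \<in> vspan ?V ?S" using sub(2) that by auto
    from sub(6)[OF this, of c] show ?thesis by simp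
  qed
  have "(\<Sum>g\<in>A. single g (lookup p g)) \<in> vspan ?V ?S"
    if "finite A" "A \<subseteq> Z" for A
    using that
  proof (induction rule: finite_induct)
    case empty
    then show ?case using sub(3) by simp
  next
    case (insert x F)
    then have "(\<Sum>g\<in>F. single g (lookup p g)) \<in> vspan ?V ?S" "x \<in> Z" by auto
    then show ?case
      using sub(4)[OF single[of x "lookup p x"]] by (simp only: free_space_simps sum.insert[OF insert.hyps])
  qed
  moreover have "p = (\<Sum>g\<in>keys p. single g (lookup p g))"
    by (rule poly_mapping_eqI)
      (simp add: lookup_sum_keys lookup_single when_def in_keys_iff)
  ultimately show ?thesis using assms by (metis (no_types, lifting) finite_keys free_space_simps(1) mem_Collect_eq)
qed

lemma lin_ext_lin_on:
  assumes "\<And>g. g \<in> Z \<Longrightarrow> \<phi> g \<in> carrier (free_space Z')"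
  shows "lin_on (free_space Z) (free_space Z') (lin_ext \<phi>)"
proof -
  have "keys (lin_ext \<phi> p) \<subseteq> Z'" if "keys p \<subseteq> Z" for p
  proof
    fix h assume h: "h \<in> keys (lin_ext \<phi> p)"
    show "h \<in> Z'"
    proof (rule ccontr)
      assume "h \<notin> Z'"
      then have "lookup (\<phi> g) h = 0" if "g \<in> Z" for g
        using assms[OF that] by (auto simp: in_keys_iff)
      then have "lookup (lin_ext \<phi> p) h = 0"
        using \<open>keys p \<subseteq> Z\<close> by (simp add: lookup_lin_ext lin_fun_def subset_iff)
      then show False using h by (simp add: in_keys_iff)
    qed
  qed
  then show ?thesis by (simp add: lin_on_def lin_ext_add lin_ext_smult)
qed

lemma lin_fun_linear_form: "linear_form (free_space Z) (lin_fun F)"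
  by (simp add: linear_form_def lin_fun_add lin_fun_smult)

text \<open>A space given by generators and relations, with a family of operators given on generators. The locale
  treats the coinvariants \<open>Q\<close> of these operators as a single quotient of the free space: \<open>proj\<close> is the projection
  and \<open>sym g\<close> the class of a generator. This is the shape of both the tensor powers and the Schur functors.\<close>

locale presentation =
  fixes Gens :: "'g set" and Rels :: "('g \<Rightarrow>\<^sub>0 'k::field) set"
    and G :: "'a set" and \<phi> :: "'a \<Rightarrow> 'g \<Rightarrow> ('g \<Rightarrow>\<^sub>0 'k)"
  assumes Rels_sub: "Rels \<subseteq> carrier (free_space Gens)"
    and act_gen: "\<And>a g. a \<in> G \<Longrightarrow> g \<in> Gens \<Longrightarrow> \<phi> a g \<in> carrier (free_space Gens)"
    and act_rels: "\<And>a r. a \<in> G \<Longrightarrow> r \<in> Rels \<Longrightarrow> lin_ext (\<phi> a) r \<in> vspan (free_space Gens) Rels"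
begin

abbreviation "FS \<equiv> free_space Gens :: ('k, 'g \<Rightarrow>\<^sub>0 'k) module"
abbreviation "RR \<equiv> vspan FS Rels"
abbreviation "U \<equiv> quot_space FS RR"
abbreviation "act \<equiv> \<lambda>a. quot_map FS RR (lin_ext (\<phi> a))"
abbreviation "CR \<equiv> coinv_rels U G act"
abbreviation "Q \<equiv> coinvariants U G act"

definition proj :: "('g \<Rightarrow>\<^sub>0 'k) \<Rightarrow> ('g \<Rightarrow>\<^sub>0 'k) set set" where
  "proj p = CR +>\<^bsub>U\<^esub> (RR +>\<^bsub>FS\<^esub> p)"

definition sym :: "'g \<Rightarrow> ('g \<Rightarrow>\<^sub>0 'k) set set" where
  "sym g = proj (single g 1)"

lemmas FS_vspace = free_space_vspace[where 'k = 'k and Z = Gens]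

lemmas RR_sub = vspan_sub[OF FS_vspace Rels_sub]

lemma U_vspace: "vspace U"
  by (rule quot_vspace[OF FS_vspace RR_sub(7)])

lemma stable_map:
  assumes "\<And>g. g \<in> Gens \<Longrightarrow> \<delta> g \<in> carrier FS" "\<And>r. r \<in> Rels \<Longrightarrow> lin_ext \<delta> r \<in> RR"
  shows "lin_on FS FS (lin_ext \<delta>)" "lin_ext \<delta> ` RR \<subseteq> RR"
    "lin_on U U (quot_map FS RR (lin_ext \<delta>))"
    "\<And>p. p \<in> carrier FS \<Longrightarrow> quot_map FS RR (lin_ext \<delta>) (RR +>\<^bsub>FS\<^esub> p) = RR +>\<^bsub>FS\<^esub> lin_ext \<delta> p"
proof -
  show l: "lin_on FS FS (lin_ext \<delta>)" by (rule lin_ext_lin_on) (use assms in auto)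
  show i: "lin_ext \<delta> ` RR \<subseteq> RR"
  proof
    fix x assume "x \<in> lin_ext \<delta> ` RR"
    then obtain p where "p \<in> RR" "x = lin_ext \<delta> p" by auto
    then show "x \<in> RR"
      using lin_on_span_image[OF FS_vspace FS_vspace l Rels_sub Rels_sub] assms(2) by blast
  qed
  show "lin_on U U (quot_map FS RR (lin_ext \<delta>))"
    by (rule quot_map_lin_on[OF FS_vspace RR_sub(7) l i])
  show "\<And>p. p \<in> carrier FS \<Longrightarrow> quot_map FS RR (lin_ext \<delta>) (RR +>\<^bsub>FS\<^esub> p) = RR +>\<^bsub>FS\<^esub> lin_ext \<delta> p"
    by (rule quot_map_coset[OF FS_vspace RR_sub(7) l i])
qed

lemma act_map:
  assumes "a \<in> G"
  shows "lin_on FS FS (lin_ext (\<phi> a))" "lin_on U U (act a)"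
    "\<And>p. p \<in> carrier FS \<Longrightarrow> act a (RR +>\<^bsub>FS\<^esub> p) = RR +>\<^bsub>FS\<^esub> lin_ext (\<phi> a) p"
  by (rule stable_map(1) stable_map(3) stable_map(4); use act_gen[OF assms] act_rels[OF assms] in blast)+

lemma U_carrier: "carrier U = (\<lambda>p. RR +>\<^bsub>FS\<^esub> p) ` carrier FS"
  by (rule quot_carrier[OF FS_vspace RR_sub(7)])

lemmas to_U = quot_lin_on[OF FS_vspace RR_sub(7)]

definition CG :: "('g \<Rightarrow>\<^sub>0 'k) set set" where
  "CG = {act a v \<ominus>\<^bsub>U\<^esub> v | a v. a \<in> G \<and> v \<in> carrier U}"

lemma CG_sub: "CG \<subseteq> carrier U"
proof
  fix w assume "w \<in> CG"
  then obtain a v where w: "w = act a v \<ominus>\<^bsub>U\<^esub> v" and a: "a \<in> G" and v: "v \<in> carrier U" by (auto simp: CG_def)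
  show "w \<in> carrier U"
    unfolding w by (rule vspace_simps(3)[OF U_vspace lin_on_simps(1)[OF act_map(2)[OF a] v] v])
qed

lemma CR_eq: "CR = vspan U CG"
  by (simp add: coinv_rels_def CG_def)

lemmas CR_sub = vspan_sub[OF U_vspace CG_sub, folded CR_eq]

lemma Q_eq: "Q = quot_space U CR"
  by (simp add: coinvariants_def)

lemma Q_vspace: "vspace Q"
  unfolding Q_eq by (rule quot_vspace[OF U_vspace CR_sub(7)])

lemmas to_Q = quot_lin_on[OF U_vspace CR_sub(7), folded Q_eq]

lemma proj_lin_on: "lin_on FS Q proj"
  unfolding proj_def by (rule lin_on_comp[OF to_U to_Q])

lemma Q_carrier: "carrier Q = proj ` carrier FS"
  unfolding Q_eq quot_carrier[OF U_vspace CR_sub(7)] U_carrier by (auto simp: proj_def image_image)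

lemma sym_carrier: "g \<in> Gens \<Longrightarrow> sym g \<in> carrier Q"
  unfolding sym_def Q_carrier by auto

lemma Q_span: "x \<in> carrier Q \<Longrightarrow> x \<in> vspan Q (sym ` Gens)"
proof -
  assume "x \<in> carrier Q"
  then obtain p where p: "p \<in> carrier FS" "x = proj p" by (auto simp: Q_carrier)
  have S: "(\<lambda>g. single g 1) ` Gens \<subseteq> carrier FS" by auto
  have T: "sym ` Gens \<subseteq> carrier Q" using sym_carrier by auto
  show ?thesis unfolding p(2)
    by (rule lin_on_span_image[OF FS_vspace Q_vspace proj_lin_on S T free_space_span[OF p(1)]])
      (use vspan_sub(2)[OF Q_vspace T] in \<open>auto simp: sym_def\<close>)
qed

lemma proj_rel:
  assumes "r \<in> Rels"
  shows "proj r = \<zero>\<^bsub>Q\<^esub>"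
proof -
  have r: "r \<in> RR" "r \<in> carrier FS" using assms RR_sub(2) Rels_sub by auto
  then have "RR +>\<^bsub>FS\<^esub> r = RR +>\<^bsub>FS\<^esub> \<zero>\<^bsub>FS\<^esub>"
    using quot_coset_eq[OF FS_vspace RR_sub(7) r(2) vspace_simps(1)[OF FS_vspace]]
    by (simp add: vspace_simps(3)[OF FS_vspace])
  then have "proj r = proj \<zero>\<^bsub>FS\<^esub>" by (simp add: proj_def)
  then show ?thesis using lin_on_simps(4)[OF proj_lin_on FS_vspace Q_vspace] by simp
qed

lemma proj_act:
  assumes "a \<in> G" "p \<in> carrier FS"
  shows "proj (lin_ext (\<phi> a) p) = proj p"
proof -
  let ?v = "RR +>\<^bsub>FS\<^esub> p"
  have v: "?v \<in> carrier U" "act a ?v \<in> carrier U"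
    using lin_on_simps(1)[OF to_U assms(2)] lin_on_simps(1)[OF act_map(2)[OF assms(1)]] by auto
  then have "act a ?v \<ominus>\<^bsub>U\<^esub> ?v \<in> CR" using CR_sub(2) assms by (auto simp: CG_def)
  then have "CR +>\<^bsub>U\<^esub> act a ?v = CR +>\<^bsub>U\<^esub> ?v"
    using quot_coset_eq[OF U_vspace CR_sub(7)] v by simp
  then show ?thesis using act_map(3)[OF assms] by (simp add: proj_def)
qed

text \<open>The universal property of the coinvariants: a function on generators that kills the relations and is
  constant along the operators extends to a linear form.\<close>

lemma form_exists:
  assumes "\<And>r. r \<in> Rels \<Longrightarrow> lin_fun F r = 0"
    and "\<And>a g. a \<in> G \<Longrightarrow> g \<in> Gens \<Longrightarrow> lin_fun F (\<phi> a g) = F g"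
  obtains \<psi> where "linear_form Q \<psi>" "\<And>g. g \<in> Gens \<Longrightarrow> \<psi> (sym g) = F g"
proof -
  have kill: "lin_fun F r = 0" if "r \<in> RR" for r
    by (rule linear_form_vanish[OF FS_vspace lin_fun_linear_form Rels_sub that assms(1)])
  obtain \<psi>1 where \<psi>1: "linear_form U \<psi>1" "\<And>p. p \<in> carrier FS \<Longrightarrow> \<psi>1 (RR +>\<^bsub>FS\<^esub> p) = lin_fun F p"
    using quot_form_exists[OF FS_vspace RR_sub(7) lin_fun_linear_form kill] by blast
  have inv: "lin_fun F (lin_ext (\<phi> a) p) = lin_fun F p" if a: "a \<in> G" and p: "p \<in> carrier FS" for a p
  proof -
    have lf: "linear_form FS (\<lambda>p. lin_fun F (lin_ext (\<phi> a) p))"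
      by (rule linear_form_comp[OF act_map(1)[OF a] lin_fun_linear_form])
    have "linear_form FS (\<lambda>p. lin_fun F (lin_ext (\<phi> a) p) - lin_fun F p)"
      using lf lin_fun_linear_form[of Gens F] by (simp add: linear_form_def algebra_simps)
    then have "lin_fun F (lin_ext (\<phi> a) p) - lin_fun F p = 0"
      by (rule linear_form_vanish[OF FS_vspace _ _ free_space_span[OF p]])
        (use assms(2)[OF a] in \<open>auto simp: lin_ext_single lin_fun_smult\<close>)
    then show ?thesis by simp
  qed
  have "\<psi>1 w = 0" if "w \<in> CR" for w
  proof (rule linear_form_vanish[OF U_vspace \<psi>1(1) CG_sub])
    show "w \<in> vspan U CG" using that CR_eq by simp
    fix w assume "w \<in> CG"
    then obtain a p where ap: "a \<in> G" "p \<in> carrier FS" "w = act a (RR +>\<^bsub>FS\<^esub> p) \<ominus>\<^bsub>U\<^esub> (RR +>\<^bsub>FS\<^esub> p)"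
      unfolding CG_def U_carrier by blast
    moreover have c: "lin_ext (\<phi> a) p \<in> carrier FS" using lin_on_simps(1)[OF act_map(1)[OF ap(1)] ap(2)] .
    moreover have "act a (RR +>\<^bsub>FS\<^esub> p) = RR +>\<^bsub>FS\<^esub> lin_ext (\<phi> a) p"
      using act_map(3)[OF ap(1,2)] .
    ultimately show "\<psi>1 w = 0"
      using linear_form_simps(4)[OF \<psi>1(1) U_vspace] inv[OF ap(1,2)] \<psi>1(2) lin_on_simps(1)[OF to_U] by simp
  qed
  then obtain \<psi> where "linear_form Q \<psi>" "\<And>x. x \<in> carrier U \<Longrightarrow> \<psi> (CR +>\<^bsub>U\<^esub> x) = \<psi>1 x"
    using quot_form_exists[OF U_vspace CR_sub(7) \<psi>1(1)] unfolding Q_eq by blast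
  then show thesis
    using \<psi>1(2) lin_on_simps(1)[OF to_U] by (intro that[of \<psi>]) (auto simp: sym_def proj_def)
qed

text \<open>Serves the diagonal matrices and right multiplication on induced modules. Commutation with the action is
  tested on generators, which span the free space.\<close>

lemma endo:
  assumes "\<And>g. g \<in> Gens \<Longrightarrow> \<delta> g \<in> carrier FS" "\<And>r. r \<in> Rels \<Longrightarrow> lin_ext \<delta> r \<in> RR"
    and "\<And>a g. a \<in> G \<Longrightarrow> g \<in> Gens \<Longrightarrow> lin_ext \<delta> (\<phi> a g) = lin_ext (\<phi> a) (\<delta> g)"
  shows "lin_on Q Q (quot_map U CR (quot_map FS RR (lin_ext \<delta>)))"
    and "\<And>p. p \<in> carrier FS \<Longrightarrow> quot_map U CR (quot_map FS RR (lin_ext \<delta>)) (proj p) = proj (lin_ext \<delta> p)"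
proof -
  let ?d = "quot_map FS RR (lin_ext \<delta>)"
  have d: "lin_on FS FS (lin_ext \<delta>)" "lin_ext \<delta> ` RR \<subseteq> RR" "lin_on U U ?d"
    "\<And>p. p \<in> carrier FS \<Longrightarrow> ?d (RR +>\<^bsub>FS\<^esub> p) = RR +>\<^bsub>FS\<^esub> lin_ext \<delta> p"
    by (rule stable_map[OF assms(1,2)]; assumption)+
  have comm: "lin_ext \<delta> (lin_ext (\<phi> a) p) = lin_ext (\<phi> a) (lin_ext \<delta> p)"
    if a: "a \<in> G" and p: "p \<in> carrier FS" for a p
    by (rule lin_on_eq[OF FS_vspace FS_vspace lin_on_comp[OF act_map(1)[OF a] d(1)]
          lin_on_comp[OF d(1) act_map(1)[OF a]] _ free_space_span[OF p]])
      (use a assms(1,3) in \<open>auto simp: lin_ext_single lin_ext_smult\<close>)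
  have img: "?d ` CR \<subseteq> CR"
  proof clarify
    fix w assume w: "w \<in> CR"
    have "?d w \<in> vspan U CG"
    proof (rule lin_on_span_image[OF U_vspace U_vspace d(3) CG_sub CG_sub])
      show "w \<in> vspan U CG" using w CR_eq by simp
      fix w assume "w \<in> CG"
      then obtain a p where ap: "a \<in> G" "p \<in> carrier FS" "w = act a (RR +>\<^bsub>FS\<^esub> p) \<ominus>\<^bsub>U\<^esub> (RR +>\<^bsub>FS\<^esub> p)"
        unfolding CG_def U_carrier by blast
      have c: "lin_ext (\<phi> a) p \<in> carrier FS" "lin_ext \<delta> p \<in> carrier FS"
        using lin_on_simps(1)[OF act_map(1)[OF ap(1)] ap(2)] lin_on_simps(1)[OF d(1) ap(2)] by auto
      have e: "act a (RR +>\<^bsub>FS\<^esub> q) = RR +>\<^bsub>FS\<^esub> lin_ext (\<phi> a) q" if "q \<in> carrier FS" for q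
        using act_map(3)[OF ap(1) that] .
      have "?d w = (RR +>\<^bsub>FS\<^esub> lin_ext \<delta> (lin_ext (\<phi> a) p)) \<ominus>\<^bsub>U\<^esub> (RR +>\<^bsub>FS\<^esub> lin_ext \<delta> p)"
        using lin_on_simps(5)[OF d(3) U_vspace U_vspace] ap c e d(4) lin_on_simps(1)[OF to_U] by simp
      also have "\<dots> = act a (RR +>\<^bsub>FS\<^esub> lin_ext \<delta> p) \<ominus>\<^bsub>U\<^esub> (RR +>\<^bsub>FS\<^esub> lin_ext \<delta> p)"
        using comm[OF ap(1,2)] e c by simp
      also have "\<dots> \<in> CG" unfolding CG_def using ap(1) c lin_on_simps(1)[OF to_U] by blast
      finally show "?d w \<in> vspan U CG" using CR_sub(2) CR_eq by auto
    qed
    then show "?d w \<in> CR" using CR_eq by simp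
  qed
  show "lin_on Q Q (quot_map U CR ?d)"
    unfolding Q_eq by (rule quot_map_lin_on[OF U_vspace CR_sub(7) d(3) img])
  show "quot_map U CR ?d (proj p) = proj (lin_ext \<delta> p)" if "p \<in> carrier FS" for p
    unfolding proj_def
    using quot_map_coset[OF U_vspace CR_sub(7) d(3) img] d(4)[OF that] lin_on_simps(1)[OF to_U that] by simp
qed

end

section \<open>Words, monomials and stabilizers\<close>

lemma linear_relsE:
  assumes "r \<in> linear_rels V \<iota>"
  obtains (add) u v where "u \<in> carrier V" "v \<in> carrier V"
      "r = single (\<iota> (u \<oplus>\<^bsub>V\<^esub> v)) 1 - single (\<iota> u) 1 - single (\<iota> v) 1"
    | (smult) c v where "v \<in> carrier V"
      "r = single (\<iota> (c \<odot>\<^bsub>V\<^esub> v)) 1 - single (\<iota> v) c"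
  using assms by (auto simp: linear_rels_def)

lemma linear_relsI:
  "u \<in> carrier V \<Longrightarrow> v \<in> carrier V \<Longrightarrow>
    single (\<iota> (u \<oplus>\<^bsub>V\<^esub> v)) 1 - single (\<iota> u) 1 - single (\<iota> v) 1 \<in> linear_rels V \<iota>"
  "v \<in> carrier V \<Longrightarrow>
    single (\<iota> (c \<odot>\<^bsub>V\<^esub> v)) 1 - single (\<iota> v) c \<in> linear_rels V \<iota>"
  by (auto simp: linear_rels_def)

lemma free_space_closed:
  assumes "p \<in> carrier (free_space Z)" "q \<in> carrier (free_space Z)"
  shows "p - q \<in> carrier (free_space Z)" "p + q \<in> carrier (free_space Z)"
  using assms vspace_simps(2,3)[OF free_space_vspace assms] by simp_all

lemma single_in_free_space: "g \<in> Z \<Longrightarrow> single g c \<in> carrier (free_space Z)"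
  by auto

lemma linear_rels_sub:
  assumes "vspace V" "\<And>v. v \<in> carrier V \<Longrightarrow> \<iota> v \<in> Z"
  shows "linear_rels V \<iota> \<subseteq> carrier (free_space Z)"
proof
  fix r assume "r \<in> linear_rels V \<iota>"
  then show "r \<in> carrier (free_space Z)"
    by (cases rule: linear_relsE)
      (simp_all only: free_space_closed single_in_free_space assms(2) vspace_simps(2,4)[OF assms(1)])
qed

lemma map_times_minus:
  "smul (c::'k::field) (p - q) = smul c p - smul c q"
  by (rule poly_mapping_eqI) (simp add: lookup_map_times lookup_minus right_diff_distrib)

lemma linear_rels_transport:
  assumes "r \<in> linear_rels V \<iota>" "lin_on V W f" "vspace V" "\<And>v. v \<in> carrier V \<Longrightarrow> \<phi> (\<iota> v) = single (\<iota>' (f v)) c"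
  shows "\<exists>r'\<in>linear_rels W \<iota>'. lin_ext \<phi> r = smul c r'"
  using assms(1)
proof (cases rule: linear_relsE)
  case (add u v)
  let ?r = "single (\<iota>' (f u \<oplus>\<^bsub>W\<^esub> f v)) 1 - single (\<iota>' (f u)) 1 - single (\<iota>' (f v)) 1"
  have "\<phi> (\<iota> (u \<oplus>\<^bsub>V\<^esub> v)) = single (\<iota>' (f u \<oplus>\<^bsub>W\<^esub> f v)) c"
    using assms(4)[OF vspace_simps(2)[OF assms(3) add(1,2)]] lin_on_simps(2)[OF assms(2) add(1,2)] by simp
  then have "lin_ext \<phi> r = smul c ?r"
    unfolding add(3) using assms(4)[OF add(1)] assms(4)[OF add(2)]
    by (simp add: lin_ext_minus lin_ext_single map_times_minus)
  moreover have "?r \<in> linear_rels W \<iota>'" 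
    by (rule linear_relsI(1)[OF lin_on_simps(1)[OF assms(2) add(1)] lin_on_simps(1)[OF assms(2) add(2)]])
  ultimately show ?thesis by blast
next
  case (smult a v)
  let ?r = "single (\<iota>' (a \<odot>\<^bsub>W\<^esub> f v)) 1 - single (\<iota>' (f v)) a"
  have "\<phi> (\<iota> (a \<odot>\<^bsub>V\<^esub> v)) = single (\<iota>' (a \<odot>\<^bsub>W\<^esub> f v)) c"
    using assms(4)[OF vspace_simps(4)[OF assms(3) smult(1)]] lin_on_simps(3)[OF assms(2) smult(1)] by simp
  then have "lin_ext \<phi> r = smul c ?r"
    unfolding smult(2) using assms(4)[OF smult(1)]
    by (simp add: lin_ext_minus lin_ext_single map_times_minus mult.commute)
  moreover have "?r \<in> linear_rels W \<iota>'" 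
    by (rule linear_relsI(2)[OF lin_on_simps(1)[OF assms(2) smult(1)]])
  ultimately show ?thesis by blast
qed

lemma linear_rels_vanish:
  assumes "r \<in> linear_rels V \<iota>" "linear_form V (\<lambda>v. F (\<iota> v))"
  shows "lin_fun F r = 0"
  using assms(1) by (cases rule: linear_relsE) (simp_all add: lin_fun_minus linear_form_simps[OF assms(2)])

context presentation
begin

lemma sym_lin_on:
  assumes V: "vspace V" and sub: "linear_rels V \<iota> \<subseteq> Rels" and mem: "\<And>v. v \<in> carrier V \<Longrightarrow> \<iota> v \<in> Gens"
  shows "lin_on V Q (\<lambda>v. sym (\<iota> v))"
  unfolding lin_on_def
proof (intro conjI ballI allI)
  show "sym (\<iota> v) \<in> carrier Q" if "v \<in> carrier V" for v using sym_carrier mem that by auto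
  have s: "single (\<iota> v) c \<in> carrier FS" if "v \<in> carrier V" for v c
    by (rule single_in_free_space[OF mem[OF that]])
  have minus: "proj (p - q) = proj p \<ominus>\<^bsub>Q\<^esub> proj q" if "p \<in> carrier FS" "q \<in> carrier FS" for p q
    using lin_on_simps(5)[OF proj_lin_on FS_vspace Q_vspace that] that by simp
  note pc = lin_on_simps(1)[OF proj_lin_on]
  fix u v assume uv: "u \<in> carrier V" "v \<in> carrier V"
  let ?s = "\<lambda>v. single (\<iota> v) (1::'k)"
  have uv': "u \<oplus>\<^bsub>V\<^esub> v \<in> carrier V" using vspace_simps(2)[OF V uv] .
  have "\<zero>\<^bsub>Q\<^esub> = proj (?s (u \<oplus>\<^bsub>V\<^esub> v) - ?s u - ?s v)"
    by (rule proj_rel[OF subsetD[OF sub linear_relsI(1)[OF uv]], symmetric])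
  also have "\<dots> = proj (?s (u \<oplus>\<^bsub>V\<^esub> v) - (?s u + ?s v))" by (simp add: diff_diff_add)
  also have "\<dots> = proj (?s (u \<oplus>\<^bsub>V\<^esub> v)) \<ominus>\<^bsub>Q\<^esub> proj (?s u + ?s v)"
    by (intro minus s free_space_closed uv uv')
  finally have "proj (?s (u \<oplus>\<^bsub>V\<^esub> v)) = proj (?s u + ?s v)"
    using vspace_simps(12)[OF Q_vspace pc[OF s[OF uv']] pc[OF free_space_closed(2)[OF s[OF uv(1)] s[OF uv(2)]]], of 1 1 1]
    by simp
  then show "sym (\<iota> (u \<oplus>\<^bsub>V\<^esub> v)) = sym (\<iota> u) \<oplus>\<^bsub>Q\<^esub> sym (\<iota> v)"
    using lin_on_simps(2)[OF proj_lin_on s[OF uv(1)] s[OF uv(2)]] by (simp add: sym_def)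
next
  have s: "single (\<iota> v) c \<in> carrier FS" if "v \<in> carrier V" for v c
    by (rule single_in_free_space[OF mem[OF that]])
  have minus: "proj (p - q) = proj p \<ominus>\<^bsub>Q\<^esub> proj q" if "p \<in> carrier FS" "q \<in> carrier FS" for p q
    using lin_on_simps(5)[OF proj_lin_on FS_vspace Q_vspace that] that by simp
  note pc = lin_on_simps(1)[OF proj_lin_on]
  fix c v assume v: "v \<in> carrier V"
  then have cv: "c \<odot>\<^bsub>V\<^esub> v \<in> carrier V" using vspace_simps(4)[OF V] by blast
  have "\<zero>\<^bsub>Q\<^esub> = proj (single (\<iota> (c \<odot>\<^bsub>V\<^esub> v)) 1 - single (\<iota> v) c)"
    by (rule proj_rel[OF subsetD[OF sub linear_relsI(2)[OF v]], symmetric])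
  also have "\<dots> = sym (\<iota> (c \<odot>\<^bsub>V\<^esub> v)) \<ominus>\<^bsub>Q\<^esub> proj (single (\<iota> v) c)"
    unfolding sym_def by (intro minus s v cv)
  finally have "sym (\<iota> (c \<odot>\<^bsub>V\<^esub> v)) = proj (single (\<iota> v) c)"
    using vspace_simps(12)[OF Q_vspace sym_carrier[OF mem[OF cv]] pc[OF s[OF v, of c]]] by simp
  then show "sym (\<iota> (c \<odot>\<^bsub>V\<^esub> v)) = c \<odot>\<^bsub>Q\<^esub> sym (\<iota> v)"
    using lin_on_simps(3)[OF proj_lin_on s[OF v, of 1], of c] by (simp add: sym_def)
qed

lemma sym_act: "a \<in> G \<Longrightarrow> g \<in> Gens \<Longrightarrow> proj (\<phi> a g) = sym g"
proof -
  assume a: "a \<in> G" "g \<in> Gens"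
  have "lin_ext (\<phi> a) (single g 1) = \<phi> a g"
    by (rule poly_mapping_eqI) (simp add: lin_ext_single lookup_map_times)
  then show ?thesis using proj_act[OF a(1) single_in_free_space[OF a(2), of 1]] by (simp add: sym_def)
qed

end

text \<open>Replace the entries one slot at a time by combinations of the spanning vectors.\<close>

lemma multilinear_span:
  fixes V :: "nat \<Rightarrow> ('k::field, 'v) module" and Q :: "('k, 'q) module"
  assumes Q: "vspace Q" "T \<subseteq> carrier Q"
    and V: "\<And>i. i < n \<Longrightarrow> vspace (V i)" "\<And>i. i < n \<Longrightarrow> S i \<subseteq> carrier (V i)"
      "\<And>i. i < n \<Longrightarrow> carrier (V i) \<subseteq> vspan (V i) (S i)"
    and lin: "\<And>i vs. i < n \<Longrightarrow> length vs = n \<Longrightarrow> (\<And>j. j < n \<Longrightarrow> vs ! j \<in> carrier (V j)) \<Longrightarrow>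
      lin_on (V i) Q (\<lambda>u. f (vs[i := u]))"
    and base: "\<And>vs. length vs = n \<Longrightarrow> (\<And>j. j < n \<Longrightarrow> vs ! j \<in> S j) \<Longrightarrow> f vs \<in> vspan Q T"
    and vs: "length vs = n" "\<And>j. j < n \<Longrightarrow> vs ! j \<in> carrier (V j)"
  shows "f vs \<in> vspan Q T"
proof -
  have "f vs \<in> vspan Q T" if "k \<le> n" "length vs = n" "\<And>j. j < n \<Longrightarrow> vs ! j \<in> carrier (V j)"
    "\<And>j. k \<le> j \<Longrightarrow> j < n \<Longrightarrow> vs ! j \<in> S j" for k vs
    using that
  proof (induction k arbitrary: vs)
    case 0
    then show ?case using base by simp
  next
    case (Suc k)
    then have k: "k < n" by simp
    have "f (vs[k := vs ! k]) \<in> vspan Q T"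
    proof (rule lin_on_span_image[OF V(1)[OF k] Q(1) lin[OF k Suc.prems(2,3)] V(2)[OF k] Q(2)])
      show "vs ! k \<in> vspan (V k) (S k)" using V(3)[OF k] Suc.prems(3)[OF k] by auto
      fix u assume u: "u \<in> S k"
      show "f (vs[k := u]) \<in> vspan Q T"
      proof (rule Suc.IH)
        show "vs[k := u] ! j \<in> carrier (V j)" if "j < n" for j
          using that Suc.prems V(2)[OF k] u by (cases "j = k") auto
        show "vs[k := u] ! j \<in> S j" if "k \<le> j" "j < n" for j
          using that Suc.prems u by (cases "j = k") auto
      qed (use Suc.prems in auto)
    qed
    then show ?case by simp
  qed
  from this[of n vs] show ?thesis using vs by auto
qed

lemma multilinear_scale:
  fixes V :: "('k::field, 'v) module" and Q :: "('k, 'q) module"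
  assumes Q: "vspace Q" and V: "vspace V"
    and lin: "\<And>i vs. i < n \<Longrightarrow> length vs = n \<Longrightarrow> set vs \<subseteq> carrier V \<Longrightarrow> lin_on V Q (\<lambda>u. f (vs[i := u]))"
    and car: "\<And>vs. length vs = n \<Longrightarrow> set vs \<subseteq> carrier V \<Longrightarrow> f vs \<in> carrier Q"
    and vs: "length vs = n" "set vs \<subseteq> carrier V"
  shows "f (map (\<lambda>i. c i \<odot>\<^bsub>V\<^esub> vs ! i) [0..<n]) = (\<Prod>i<n. c i) \<odot>\<^bsub>Q\<^esub> f vs"
proof -
  define g where "g k = map (\<lambda>i. if i < k then c i \<odot>\<^bsub>V\<^esub> vs ! i else vs ! i) [0..<n]" for k
  have g: "length (g k) = n" "set (g k) \<subseteq> carrier V" for k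
    using vs vspace_simps(4)[OF V] by (auto simp: g_def subset_iff)
  interpret Qv: vectorspace class_ring Q by fact
  have assoc: "(a * b) \<odot>\<^bsub>Q\<^esub> q = a \<odot>\<^bsub>Q\<^esub> (b \<odot>\<^bsub>Q\<^esub> q)" if "q \<in> carrier Q" for a b :: 'k and q
    using Qv.smult_assoc1[of a b q] that by simp
  have "f (g k) = (\<Prod>i<k. c i) \<odot>\<^bsub>Q\<^esub> f vs" if "k \<le> n" for k
    using that
  proof (induction k)
    case 0
    have "g 0 = vs" using vs by (intro nth_equalityI) (auto simp: g_def)
    then show ?case using vspace_simps(9)[OF Q car[OF vs]] by simp
  next
    case (Suc k)
    then have k: "k < n" by simp
    have v: "vs ! k \<in> carrier V" using vs k by auto
    have "g (Suc k) = (g k)[k := c k \<odot>\<^bsub>V\<^esub> vs ! k]" "g k = (g k)[k := vs ! k]"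
      using k by (auto intro!: nth_equalityI simp: g_def nth_list_update less_Suc_eq)
    then have "f (g (Suc k)) = c k \<odot>\<^bsub>Q\<^esub> f (g k)"
      using lin_on_simps(3)[OF lin[OF k g[of k]] v, of "c k"] by metis
    also have "\<dots> = (\<Prod>i<Suc k. c i) \<odot>\<^bsub>Q\<^esub> f vs"
      using Suc assoc car[OF vs] by (simp add: mult.commute)
    finally show ?case .
  qed
  moreover have "g n = map (\<lambda>i. c i \<odot>\<^bsub>V\<^esub> vs ! i) [0..<n]" by (simp add: g_def)
  ultimately show ?thesis by (metis order_refl)
qed

definition bi_action ::
  "('k::field, 'v) module \<Rightarrow> nat \<Rightarrow> nat \<Rightarrow> ((nat \<Rightarrow> nat) \<Rightarrow> (nat \<Rightarrow> nat) \<Rightarrow> 'v \<Rightarrow> 'v) \<Rightarrow> bool" where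
  "bi_action V m n B \<longleftrightarrow> vspace V \<and>
     (\<forall>\<sigma> \<tau>. \<sigma> permutes {..<m} \<and> \<tau> permutes {..<n} \<longrightarrow> lin_on V V (B \<sigma> \<tau>)) \<and>
     (\<forall>v\<in>carrier V. B id id v = v \<and>
        (\<forall>\<sigma> \<tau> \<sigma>' \<tau>'. \<sigma> permutes {..<m} \<and> \<tau> permutes {..<n} \<and> \<sigma>' permutes {..<m} \<and> \<tau>' permutes {..<n} \<longrightarrow>
           B (\<sigma> \<circ> \<sigma>') (\<tau> \<circ> \<tau>') v = B \<sigma>' \<tau>' (B \<sigma> \<tau> v)))"

definition word_stab :: "'a list \<Rightarrow> (nat \<Rightarrow> nat) set" where
  "word_stab I = {\<sigma>. \<sigma> permutes {..<length I} \<and> permute_list \<sigma> I = I}"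

lemma finite_word_stab: "finite (word_stab I)"
  unfolding word_stab_def by (rule finite_subset[OF _ finite_permutations[of "{..<length I}"]]) auto

text \<open>The relations defining the weight space of a pair of words: the coinvariants of \<open>V\<close> under the Young subgroup that
  fixes \<open>I\<close> and \<open>J\<close>.\<close>

definition stab_rels ::
  "('k::field, 'v) module \<Rightarrow> ((nat \<Rightarrow> nat) \<Rightarrow> (nat \<Rightarrow> nat) \<Rightarrow> 'v \<Rightarrow> 'v) \<Rightarrow> nat list \<Rightarrow> nat list \<Rightarrow> 'v set" where
  "stab_rels V B I J =
     {B \<sigma> \<tau> v \<ominus>\<^bsub>V\<^esub> v | \<sigma> \<tau> v. \<sigma> \<in> word_stab I \<and> \<tau> \<in> word_stab J \<and> v \<in> carrier V}"

text \<open>An arbitrary but fixed arrangement of the exponents of the \<open>x\<close>-variables as a word of indices.\<close>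

definition wordX :: "(var \<Rightarrow>\<^sub>0 nat) \<Rightarrow> nat list" where
  "wordX \<gamma> = (SOME I. \<forall>i. count (mset I) i = lookup \<gamma> (X i))"

definition wordY :: "(var \<Rightarrow>\<^sub>0 nat) \<Rightarrow> nat list" where
  "wordY \<gamma> = (SOME I. \<forall>i. count (mset I) i = lookup \<gamma> (Y i))"

text \<open>The monomial read off from two words; it is inverse to forming words up to rearrangement.\<close>

definition word_monomial :: "nat list \<Rightarrow> nat list \<Rightarrow> nat \<Rightarrow> (var \<Rightarrow>\<^sub>0 nat)" where
  "word_monomial I J d = (\<Sum>i\<in>#mset I. single (X i) 1) + (\<Sum>j\<in>#mset J. single (Y j) 1)
     + single Hbar d"

lemma ex_list_count:
  fixes f :: "'a \<Rightarrow> nat"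
  assumes "finite {i. f i \<noteq> 0}"
  shows "\<exists>I. \<forall>i. count (mset I) i = f i"
proof -
  obtain I where "mset I = Abs_multiset f" using ex_mset by blast
  moreover have "count (Abs_multiset f) i = f i" for i
    using assms by (subst Abs_multiset_inverse) auto
  ultimately show ?thesis by metis
qed

lemma count_wordX: "count (mset (wordX \<gamma>)) i = lookup \<gamma> (X i)"
proof -
  have "{i. lookup \<gamma> (X i) \<noteq> 0} = X -` keys \<gamma>" by (auto simp: in_keys_iff)
  moreover have "finite (X -` keys \<gamma>)" by (rule finite_vimageI) (auto simp: inj_def)
  ultimately show ?thesis
    unfolding wordX_def using someI_ex[OF ex_list_count[of "\<lambda>i. lookup \<gamma> (X i)"]] by auto
qed

lemma count_wordY: "count (mset (wordY \<gamma>)) i = lookup \<gamma> (Y i)"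
proof -
  have "{i. lookup \<gamma> (Y i) \<noteq> 0} = Y -` keys \<gamma>" by (auto simp: in_keys_iff)
  moreover have "finite (Y -` keys \<gamma>)" by (rule finite_vimageI) (auto simp: inj_def)
  ultimately show ?thesis
    unfolding wordY_def using someI_ex[OF ex_list_count[of "\<lambda>i. lookup \<gamma> (Y i)"]] by auto
qed

lemma lookup_sum_mset: "lookup (\<Sum>i\<in>#A. f i) v = (\<Sum>i\<in>#A. lookup (f i) v)"
  by (induction A) (simp_all add: lookup_add)

lemma lookup_word_monomial:
  "lookup (word_monomial I J d) (X i) = count (mset I) i"
  "lookup (word_monomial I J d) (Y i) = count (mset J) i"
  "lookup (word_monomial I J d) Hbar = d"
proof -
  have 1: "(\<Sum>j\<in>#A. lookup (single (X j) 1) (X i)) = count A i" for A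
    by (induction A) (auto simp: lookup_single when_def)
  have 2: "(\<Sum>j\<in>#A. lookup (single (Y j) 1) (Y i)) = count A i" for A
    by (induction A) (auto simp: lookup_single when_def)
  show "lookup (word_monomial I J d) (X i) = count (mset I) i"
    "lookup (word_monomial I J d) (Y i) = count (mset J) i"
    "lookup (word_monomial I J d) Hbar = d"
    unfolding word_monomial_def lookup_add lookup_sum_mset 1 2 by (simp_all add: lookup_single)
qed

lemma monomial_eqI:
  assumes "\<And>i. lookup \<gamma> (X i) = lookup \<gamma>' (X i)"
    "\<And>i. lookup \<gamma> (Y i) = lookup \<gamma>' (Y i)"
    "lookup \<gamma> Hbar = lookup \<gamma>' Hbar"
  shows "\<gamma> = \<gamma>'"
  by (rule poly_mapping_eqI) (use assms in \<open>case_tac k; simp\<close>)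

lemma word_monomial_words: "word_monomial (wordX \<gamma>) (wordY \<gamma>) (lookup \<gamma> Hbar) = \<gamma>"
  by (rule monomial_eqI) (simp_all add: lookup_word_monomial count_wordX count_wordY)

lemma mset_word_monomial: "mset (wordX (word_monomial I J d)) = mset I" "mset (wordY (word_monomial I J d)) = mset J"
  by (rule multiset_eqI, simp add: count_wordX count_wordY lookup_word_monomial)+

lemma word_monomial_cong: "mset I = mset I' \<Longrightarrow> mset J = mset J' \<Longrightarrow> word_monomial I J d = word_monomial I' J' d"
  by (simp add: word_monomial_def)

definition monomials :: "nat \<Rightarrow> nat \<Rightarrow> nat \<Rightarrow> nat \<Rightarrow> nat \<Rightarrow> (var \<Rightarrow>\<^sub>0 nat) set" where
  "monomials r s m n d = {\<gamma>. keys \<gamma> \<subseteq> X ` {..<r} \<union> Y ` {..<s} \<union> {Hbar} \<and>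
     (\<Sum>i<r. lookup \<gamma> (X i)) = m \<and> (\<Sum>j<s. lookup \<gamma> (Y j)) = n \<and>
     lookup \<gamma> Hbar = d}"

lemma monomials_words:
  assumes "\<gamma> \<in> monomials r s m n d"
  shows "length (wordX \<gamma>) = m" "set (wordX \<gamma>) \<subseteq> {..<r}"
    "length (wordY \<gamma>) = n" "set (wordY \<gamma>) \<subseteq> {..<s}"
    "lookup \<gamma> Hbar = d"
proof -
  note A = assms[unfolded monomials_def]
  have "i \<in> set (wordX \<gamma>) \<longleftrightarrow> X i \<in> keys \<gamma>" for i
    using count_wordX[of \<gamma> i] by (metis count_mset_0_iff in_keys_iff)
  then show sx: "set (wordX \<gamma>) \<subseteq> {..<r}" using A by auto
  have "i \<in> set (wordY \<gamma>) \<longleftrightarrow> Y i \<in> keys \<gamma>" for i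
    using count_wordY[of \<gamma> i] by (metis count_mset_0_iff in_keys_iff)
  then show sy: "set (wordY \<gamma>) \<subseteq> {..<s}" using A by auto
  have "length (wordX \<gamma>) = (\<Sum>i\<in>set (wordX \<gamma>). count (mset (wordX \<gamma>)) i)"
    using size_multiset_overloaded_eq[of "mset (wordX \<gamma>)"] by simp
  also have "\<dots> = (\<Sum>i<r. count (mset (wordX \<gamma>)) i)"
    by (rule sum.mono_neutral_left) (use sx in \<open>auto simp: count_mset_0_iff\<close>)
  finally show "length (wordX \<gamma>) = m" using A by (simp add: count_wordX)
  have "length (wordY \<gamma>) = (\<Sum>i\<in>set (wordY \<gamma>). count (mset (wordY \<gamma>)) i)"
    using size_multiset_overloaded_eq[of "mset (wordY \<gamma>)"] by simp
  also have "\<dots> = (\<Sum>i<s. count (mset (wordY \<gamma>)) i)"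
    by (rule sum.mono_neutral_left) (use sy in \<open>auto simp: count_mset_0_iff\<close>)
  finally show "length (wordY \<gamma>) = n" using A by (simp add: count_wordY)
  show "lookup \<gamma> Hbar = d" using A by simp
qed

lemma monomials_word_monomial:
  assumes "length I = m" "set I \<subseteq> {..<r}" "length J = n" "set J \<subseteq> {..<s}"
  shows "word_monomial I J d \<in> monomials r s m n d"
proof -
  have k: "keys (word_monomial I J d) \<subseteq> X ` {..<r} \<union> Y ` {..<s} \<union> {Hbar}"
  proof
    fix v assume "v \<in> keys (word_monomial I J d)"
    then have nz: "lookup (word_monomial I J d) v \<noteq> 0" by (simp add: in_keys_iff)
    show "v \<in> X ` {..<r} \<union> Y ` {..<s} \<union> {Hbar}"
    proof (cases v)
      case (X i)
      then have "i \<in> set I" using nz by (simp add: lookup_word_monomial count_mset_0_iff)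
      then show ?thesis using X assms by auto
    next
      case (Y i)
      then have "i \<in> set J" using nz by (simp add: lookup_word_monomial count_mset_0_iff)
      then show ?thesis using Y assms by auto
    qed simp
  qed
  have "(\<Sum>i<r. count (mset I) i) = (\<Sum>i\<in>set I. count (mset I) i)"
    by (rule sum.mono_neutral_right) (use assms in \<open>auto simp: count_mset_0_iff\<close>)
  moreover have "(\<Sum>i<s. count (mset J) i) = (\<Sum>i\<in>set J. count (mset J) i)"
    by (rule sum.mono_neutral_right) (use assms in \<open>auto simp: count_mset_0_iff\<close>)
  ultimately show ?thesis
    using k size_multiset_overloaded_eq[of "mset I"] size_multiset_overloaded_eq[of "mset J"] assms
    by (simp add: monomials_def lookup_word_monomial)
qed

lemma finite_monomials: "finite (monomials r s m n d)"
proof -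
  have "monomials r s m n d \<subseteq> (\<lambda>(I, J). word_monomial I J d) `
      ({I. set I \<subseteq> {..<r} \<and> length I = m} \<times> {J. set J \<subseteq> {..<s} \<and> length J = n})"
  proof
    fix \<gamma> assume g: "\<gamma> \<in> monomials r s m n d"
    have "\<gamma> = (\<lambda>(I, J). word_monomial I J d) (wordX \<gamma>, wordY \<gamma>)"
      using word_monomial_words[of \<gamma>] monomials_words(5)[OF g] by simp
    then show "\<gamma> \<in> (\<lambda>(I, J). word_monomial I J d) `
      ({I. set I \<subseteq> {..<r} \<and> length I = m} \<times> {J. set J \<subseteq> {..<s} \<and> length J = n})"
      using monomials_words[OF g] by (intro image_eqI) auto
  qed
  then show ?thesis by (rule finite_subset) (simp add: finite_lists_length_eq)
qed

lemma prod_word: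
  fixes x :: "nat \<Rightarrow> 'k::comm_monoid_mult"
  assumes "set I \<subseteq> {..<r}"
  shows "(\<Prod>i<length I. x (I ! i)) = (\<Prod>i<r. x i ^ count (mset I) i)"
proof -
  have "(\<Prod>i<length I. x (I ! i)) = prod_mset (image_mset x (mset I))"
    using prod.list_conv_set_nth[of "map x I"]
    by (simp add: prod_mset_prod_list flip: mset_map) (simp add: atLeast0LessThan)
  also have "\<dots> = (\<Prod>i\<in>set I. x i ^ count (mset I) i)"
    by (simp add: image_prod_mset_multiplicity)
  also have "\<dots> = (\<Prod>i<r. x i ^ count (mset I) i)"
    by (rule prod.mono_neutral_left) (use assms in \<open>auto simp: count_mset_0_iff[THEN iffD2]\<close>)
  finally show ?thesis .
qed

lemma permute_list_update:
  assumes "\<sigma> permutes {..<length us}" "i < length us"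
  shows "permute_list \<sigma> (us[i := u]) = (permute_list \<sigma> us)[pinv \<sigma> i := u]"
proof (rule nth_equalityI)
  fix j assume "j < length (permute_list \<sigma> (us[i := u]))"
  then have j: "j < length us" by simp
  have "pinv \<sigma> i < length us" using permutes_in_image[OF permutes_inv[OF assms(1)], of i] assms(2) by simp
  moreover have "\<sigma> j = i \<longleftrightarrow> j = pinv \<sigma> i" using permutes_inv_eq[OF assms(1)] by metis
  moreover have "\<sigma> j < length us" using permutes_in_image[OF assms(1), of j] j by simp
  ultimately show "permute_list \<sigma> (us[i := u]) ! j = (permute_list \<sigma> us)[pinv \<sigma> i := u] ! j"
    using assms j by (auto simp: permute_list_nth nth_list_update)
qed simp

lemma word_permutation:
  assumes "mset I' = mset I"
  obtains \<sigma> where "\<sigma> permutes {..<length I'}" "permute_list \<sigma> I' = I"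
  using mset_eq_permutation[of I I'] assms by metis

section \<open>Weight spaces of a Schur functor\<close>

lemma prod_update:
  fixes g :: "nat \<Rightarrow> 'u \<Rightarrow> 'k::comm_monoid_mult"
  assumes "\<sigma> permutes {..<m}" "i < m" "length us = m"
  shows "(\<Prod>a<m. g a (us[i := u] ! \<sigma> a)) =
    g (pinv \<sigma> i) u * (\<Prod>a\<in>{..<m} - {pinv \<sigma> i}. g a (us ! \<sigma> a))"
proof -
  let ?j = "pinv \<sigma> i"
  have j: "?j < m" using permutes_in_image[OF permutes_inv[OF assms(1)], of i] assms(2) by simp
  have sj: "\<sigma> ?j = i" using permutes_inverses(1)[OF assms(1)] by simp
  have ne: "\<sigma> a \<noteq> i" if "a \<noteq> ?j" for a
    using that permutes_inverses(2)[OF assms(1), of a] by auto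
  have "(\<Prod>a<m. g a (us[i := u] ! \<sigma> a)) =
      g ?j (us[i := u] ! \<sigma> ?j) * (\<Prod>a\<in>{..<m} - {?j}. g a (us[i := u] ! \<sigma> a))"
    by (rule prod.remove) (use j in auto)
  also have "us[i := u] ! \<sigma> ?j = u" using sj assms by simp
  also have "(\<Prod>a\<in>{..<m} - {?j}. g a (us[i := u] ! \<sigma> a)) = (\<Prod>a\<in>{..<m} - {?j}. g a (us ! \<sigma> a))"
  proof (rule prod.cong[OF refl])
    fix a assume "a \<in> {..<m} - {?j}"
    then have "i \<noteq> \<sigma> a" using ne by blast
    then show "g a (us[i := u] ! \<sigma> a) = g a (us ! \<sigma> a)" by simp
  qed
  finally show ?thesis .
qed

lemma vec_vspace: "vspace (module_vec TYPE('k::field) r)"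
  by (rule vec_vs)

lemma vec_component_form:
  "k < r \<Longrightarrow> linear_form (module_vec TYPE('k::field) r) (\<lambda>u. u $ k)"
  by (simp add: linear_form_def module_vec_simps)

lemma unit_vecs_span: "carrier (module_vec TYPE('k::field) r) \<subseteq> vspan (module_vec TYPE('k) r) (unit_vec r ` {..<r})"
proof -
  interpret vec_space "TYPE('k)" r .
  have "set (unit_vecs r) = (unit_vec r ` {..<r} :: 'k vec set)"
    by (auto simp: unit_vecs_def)
  then show ?thesis using span_unit_vecs_is_carrier by (simp add: module_vec_simps)
qed

lemma mat_diag_unit_vec:
  assumes "i < r"
  shows "mat_diag r x *\<^sub>v unit_vec r i = (x i :: 'k::field) \<cdot>\<^sub>v unit_vec r i"
  by (rule eq_vecI) (use assms in \<open>auto simp: mat_diag_def\<close>)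

lemma mat_diag_lin_on: "lin_on (module_vec TYPE('k::field) r) (module_vec TYPE('k) r) (\<lambda>u. mat_diag r x *\<^sub>v u)"
proof -
  have D: "mat_diag r x \<in> carrier_mat r r" by (simp add: mat_diag_def)
  show ?thesis
    unfolding lin_on_def
    using mult_mat_vec_carrier[OF D] mult_add_distrib_mat_vec[OF D] mult_mat_vec[OF D]
    by (simp add: module_vec_simps)
qed

text \<open>One component of a Schur functor as an instance of \<open>presentation\<close>. Everything rests on the action alone, so that the
  results apply to a bimodule and to its saturation alike.\<close>

locale schur_setup =
  fixes M :: "('k::field_char_0, 'v) bimodule" and r s m n d :: nat
  assumes act_V: "bi_action (bcomp M m n d) m n (biact M m n d)"
begin

abbreviation "V \<equiv> bcomp M m n d"
abbreviation "B \<equiv> biact M m n d"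
abbreviation "kr \<equiv> module_vec TYPE('k) r"
abbreviation "ks \<equiv> module_vec TYPE('k) s"
abbreviation "SGens \<equiv> schur_gens M r s m n d"

definition "SRels = (\<Union>(v, us, ws)\<in>SGens.
        linear_rels V (\<lambda>v'. (v', us, ws)) \<union>
        (\<Union>i<m. linear_rels kr (\<lambda>u. (v, us[i := u], ws))) \<union>
        (\<Union>j<n. linear_rels ks (\<lambda>w. (v, us, ws[j := w]))))"

definition "schur_group = {\<sigma>. \<sigma> permutes {..<m}} \<times> {\<tau>. \<tau> permutes {..<n}}"

definition "schur_perm_gen = (\<lambda>a g. single (case g of (v, us, ws) \<Rightarrow>
    (B (fst a) (snd a) v, permute_list (fst a) us, permute_list (snd a) ws)) (1::'k))"

lemma V_vspace: "vspace V" using act_V by (simp add: bi_action_def)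

lemma B_facts:
  "\<sigma> permutes {..<m} \<Longrightarrow> \<tau> permutes {..<n} \<Longrightarrow> lin_on V V (B \<sigma> \<tau>)"
  "\<sigma> permutes {..<m} \<Longrightarrow> \<tau> permutes {..<n} \<Longrightarrow> \<sigma>' permutes {..<m} \<Longrightarrow> \<tau>' permutes {..<n} \<Longrightarrow>
    v \<in> carrier V \<Longrightarrow> B (\<sigma> \<circ> \<sigma>') (\<tau> \<circ> \<tau>') v = B \<sigma>' \<tau>' (B \<sigma> \<tau> v)"
  using act_V by (simp_all add: bi_action_def)

lemma SGens_iff: "(v, us, ws) \<in> SGens \<longleftrightarrow> v \<in> carrier V \<and>
     length us = m \<and> set us \<subseteq> carrier kr \<and> length ws = n \<and> set ws \<subseteq> carrier ks"
  by (auto simp: schur_gens_def module_vec_simps)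

lemma SRelsE:
  assumes "p \<in> SRels"
  obtains (vec) v us ws where "(v, us, ws) \<in> SGens" "p \<in> linear_rels V (\<lambda>v'. (v', us, ws))"
    | (left) v us ws i where "(v, us, ws) \<in> SGens" "i < m" "p \<in> linear_rels kr (\<lambda>u. (v, us[i := u], ws))"
    | (right) v us ws j where "(v, us, ws) \<in> SGens" "j < n" "p \<in> linear_rels ks (\<lambda>w. (v, us, ws[j := w]))"
  using assms unfolding SRels_def by blast

lemma SRelsI:
  assumes "(v, us, ws) \<in> SGens"
  shows "linear_rels V (\<lambda>v'. (v', us, ws)) \<subseteq> SRels"
    "i < m \<Longrightarrow> linear_rels kr (\<lambda>u. (v, us[i := u], ws)) \<subseteq> SRels"
    "j < n \<Longrightarrow> linear_rels ks (\<lambda>w. (v, us, ws[j := w])) \<subseteq> SRels"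
  unfolding SRels_def using assms by blast+

lemma SGens_update:
  assumes "(v, us, ws) \<in> SGens"
  shows "v' \<in> carrier V \<Longrightarrow> (v', us, ws) \<in> SGens"
    "u \<in> carrier kr \<Longrightarrow> (v, us[i := u], ws) \<in> SGens"
    "w \<in> carrier ks \<Longrightarrow> (v, us, ws[j := w]) \<in> SGens"
  using assms set_update_subset_insert[of us i u] set_update_subset_insert[of ws j w]
  unfolding SGens_iff by auto

lemma SRels_sub: "SRels \<subseteq> carrier (free_space SGens)"
proof
  fix p assume "p \<in> SRels"
  then show "p \<in> carrier (free_space SGens)"
  proof (cases rule: SRelsE)
    case (vec v us ws)
    then show ?thesis using linear_rels_sub[OF V_vspace, of "\<lambda>v'. (v', us, ws)"] SGens_update(1) by blast
  next
    case (left v us ws i)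
    then show ?thesis using linear_rels_sub[OF vec_vspace, of r "\<lambda>u. (v, us[i := u], ws)"] SGens_update(2) by blast
  next
    case (right v us ws j)
    then show ?thesis using linear_rels_sub[OF vec_vspace, of s "\<lambda>w. (v, us, ws[j := w])"] SGens_update(3) by blast
  qed
qed

lemma permute_gen:
  assumes "(v, us, ws) \<in> SGens" "\<sigma> permutes {..<m}" "\<tau> permutes {..<n}"
  shows "(B \<sigma> \<tau> v, permute_list \<sigma> us, permute_list \<tau> ws) \<in> SGens"
  using assms lin_on_simps(1)[OF B_facts(1)[OF assms(2,3)]]
  unfolding SGens_iff by (auto simp: set_permute_list)

lemma map_times_1: "smul (1::'k) p = p"
  by (rule poly_mapping_eqI) (simp add: lookup_map_times)

lemma lin_on_id: "lin_on W W (\<lambda>x. x)"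
  by (simp add: lin_on_def)

sublocale P: presentation SGens SRels schur_group schur_perm_gen
proof
  show "SRels \<subseteq> carrier (free_space SGens)" by (rule SRels_sub)
  show "schur_perm_gen a g \<in> carrier (free_space SGens)" if "a \<in> schur_group" "g \<in> SGens" for a g
  proof -
    obtain v us ws where g: "g = (v, us, ws)" by (cases g)
    have "(B (fst a) (snd a) v, permute_list (fst a) us, permute_list (snd a) ws) \<in> SGens"
      by (rule permute_gen) (use that g in \<open>auto simp: schur_group_def\<close>)
    then show ?thesis unfolding schur_perm_gen_def g prod.case by (rule single_in_free_space)
  qed
  show "lin_ext (schur_perm_gen a) p \<in> vspan (free_space SGens) SRels" if a: "a \<in> schur_group" and p: "p \<in> SRels" for a p
  proof -
    obtain \<sigma> \<tau> where st: "a = (\<sigma>, \<tau>)" "\<sigma> permutes {..<m}" "\<tau> permutes {..<n}"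
      using a by (auto simp: schur_group_def)
    have \<phi>: "schur_perm_gen a (v, us, ws) = single (B \<sigma> \<tau> v, permute_list \<sigma> us, permute_list \<tau> ws) 1" for v us ws
      by (simp add: schur_perm_gen_def st)
    from p have "lin_ext (schur_perm_gen a) p \<in> SRels"
    proof (cases rule: SRelsE)
      case (vec v us ws)
      have "\<exists>p'\<in>linear_rels V (\<lambda>v'. (v', permute_list \<sigma> us, permute_list \<tau> ws)).
          lin_ext (schur_perm_gen a) p = smul 1 p'"
        by (rule linear_rels_transport[OF vec(2) B_facts(1)[OF st(2,3)] V_vspace]) (simp add: \<phi>)
      then show ?thesis using SRelsI(1)[OF permute_gen[OF vec(1) st(2,3)]] by (auto simp: map_times_1)
    next
      case (left v us ws i)
      then have i: "i < length us" "\<sigma> permutes {..<length us}" using st by (auto simp: SGens_iff)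
      have j: "pinv \<sigma> i < m" using permutes_in_image[OF permutes_inv[OF st(2)], of i] left(2) by simp
      have "\<exists>p'\<in>linear_rels kr (\<lambda>u. (B \<sigma> \<tau> v, (permute_list \<sigma> us)[pinv \<sigma> i := u], permute_list \<tau> ws)).
          lin_ext (schur_perm_gen a) p = smul 1 p'"
        by (rule linear_rels_transport[OF left(3) lin_on_id vec_vspace]) (simp add: \<phi> permute_list_update[OF i(2,1)])
      then show ?thesis using SRelsI(2)[OF permute_gen[OF left(1) st(2,3)] j] by (auto simp: map_times_1)
    next
      case (right v us ws i)
      then have i: "i < length ws" "\<tau> permutes {..<length ws}" using st by (auto simp: SGens_iff)
      have j: "pinv \<tau> i < n" using permutes_in_image[OF permutes_inv[OF st(3)], of i] right(2) by simp
      have "\<exists>p'\<in>linear_rels ks (\<lambda>w. (B \<sigma> \<tau> v, permute_list \<sigma> us, (permute_list \<tau> ws)[pinv \<tau> i := w])).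
          lin_ext (schur_perm_gen a) p = smul 1 p'"
        by (rule linear_rels_transport[OF right(3) lin_on_id vec_vspace]) (simp add: \<phi> permute_list_update[OF i(2,1)])
      then show ?thesis using SRelsI(3)[OF permute_gen[OF right(1) st(2,3)] j] by (auto simp: map_times_1)
    qed
    then show ?thesis using vspan_sub(2)[OF free_space_vspace SRels_sub] by auto
  qed
qed

lemma schur_tensor_eq: "schur_tensor M r s m n d = P.U"
  by (simp add: schur_tensor_def schur_rels_def SRels_def)

lemma schur_act_eq: "schur_act M r s m n d = P.act"
  unfolding schur_act_def schur_map_def schur_rels_def SRels_def schur_perm_gen_def
  by (rule ext) (simp add: case_prod_beta)

lemma schur_space_eq: "schur_space M r s m n d = P.Q"
  unfolding schur_space_def schur_tensor_eq schur_act_eq schur_group_def[symmetric] ..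

definition "schur_diag_gen x y = (\<lambda>g. single (case g of (v, us, ws) \<Rightarrow>
    (v, map (\<lambda>u. mat_diag r x *\<^sub>v u) us, map (\<lambda>w. mat_diag s y *\<^sub>v w) ws)) (1::'k))"

lemma schur_diag_eq: "schur_diag M r s m n d x y = quot_map P.U P.CR (quot_map P.FS P.RR (lin_ext (schur_diag_gen x y)))"
  unfolding schur_diag_def schur_tensor_eq schur_coinv_rels_def schur_act_eq schur_group_def[symmetric] schur_map_def
    schur_diag_gen_def schur_rels_def SRels_def
  by (simp add: case_prod_beta)

lemma diag_gen:
  assumes "(v, us, ws) \<in> SGens"
  shows "(v, map (\<lambda>u. mat_diag r x *\<^sub>v u) us, map (\<lambda>w. mat_diag s y *\<^sub>v w) ws) \<in> SGens"
  using assms lin_on_simps(1)[OF mat_diag_lin_on] unfolding SGens_iff by auto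

lemma diag_endo:
  shows "lin_on P.Q P.Q (schur_diag M r s m n d x y)"
    and "\<And>g. g \<in> SGens \<Longrightarrow> schur_diag M r s m n d x y (P.sym g) = P.proj (schur_diag_gen x y g)"
proof -
  have gen: "schur_diag_gen x y g \<in> carrier P.FS" if "g \<in> SGens" for g
  proof -
    obtain v us ws where g: "g = (v, us, ws)" by (cases g)
    show ?thesis unfolding schur_diag_gen_def g prod.case
      by (rule single_in_free_space, rule diag_gen) (use that g in simp)
  qed
  have rels: "lin_ext (schur_diag_gen x y) p \<in> P.RR" if "p \<in> SRels" for p
  proof -
    have \<phi>: "schur_diag_gen x y (v, us, ws) = single (v, map (\<lambda>u. mat_diag r x *\<^sub>v u) us, map (\<lambda>w. mat_diag s y *\<^sub>v w) ws) 1" for v us ws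
      by (simp add: schur_diag_gen_def)
    from that have "lin_ext (schur_diag_gen x y) p \<in> SRels"
    proof (cases rule: SRelsE)
      case (vec v us ws)
      have "\<exists>p'\<in>linear_rels V (\<lambda>v'. (v', map (\<lambda>u. mat_diag r x *\<^sub>v u) us, map (\<lambda>w. mat_diag s y *\<^sub>v w) ws)).
          lin_ext (schur_diag_gen x y) p = smul 1 p'"
        by (rule linear_rels_transport[OF vec(2) lin_on_id V_vspace]) (simp add: \<phi>)
      then show ?thesis using SRelsI(1)[OF diag_gen[OF vec(1)]] by (auto simp: map_times_1)
    next
      case (left v us ws i)
      have "\<exists>p'\<in>linear_rels kr (\<lambda>u. (v, (map (\<lambda>u. mat_diag r x *\<^sub>v u) us)[i := u], map (\<lambda>w. mat_diag s y *\<^sub>v w) ws)).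
          lin_ext (schur_diag_gen x y) p = smul 1 p'"
        by (rule linear_rels_transport[OF left(3) mat_diag_lin_on vec_vspace]) (simp add: \<phi> map_update)
      then show ?thesis using SRelsI(2)[OF diag_gen[OF left(1)] left(2)] by (auto simp: map_times_1)
    next
      case (right v us ws i)
      have "\<exists>p'\<in>linear_rels ks (\<lambda>w. (v, map (\<lambda>u. mat_diag r x *\<^sub>v u) us, (map (\<lambda>w. mat_diag s y *\<^sub>v w) ws)[i := w])).
          lin_ext (schur_diag_gen x y) p = smul 1 p'"
        by (rule linear_rels_transport[OF right(3) mat_diag_lin_on vec_vspace]) (simp add: \<phi> map_update)
      then show ?thesis using SRelsI(3)[OF diag_gen[OF right(1)] right(2)] by (auto simp: map_times_1)
    qed
    then show ?thesis using vspan_sub(2)[OF free_space_vspace SRels_sub] by auto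
  qed
  have comm: "lin_ext (schur_diag_gen x y) (schur_perm_gen a g) = lin_ext (schur_perm_gen a) (schur_diag_gen x y g)" if a: "a \<in> schur_group" and g: "g \<in> SGens" for a g
  proof -
    obtain v us ws where g': "g = (v, us, ws)" by (cases g)
    obtain \<sigma> \<tau> where st: "a = (\<sigma>, \<tau>)" "\<sigma> permutes {..<m}" "\<tau> permutes {..<n}"
      using a by (auto simp: schur_group_def)
    have "permute_list \<sigma> (map (\<lambda>u. mat_diag r x *\<^sub>v u) us) = map (\<lambda>u. mat_diag r x *\<^sub>v u) (permute_list \<sigma> us)"
      "permute_list \<tau> (map (\<lambda>u. mat_diag s y *\<^sub>v u) ws) = map (\<lambda>u. mat_diag s y *\<^sub>v u) (permute_list \<tau> ws)"
      using st g g' by (auto intro: permute_list_map simp: SGens_iff)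
    then show ?thesis
      by (simp add: schur_perm_gen_def schur_diag_gen_def g' st lin_ext_single map_times_1)
  qed
  have E: "quot_map P.U P.CR (quot_map P.FS P.RR (lin_ext (schur_diag_gen x y))) (P.proj p) = P.proj (lin_ext (schur_diag_gen x y) p)"
    if "p \<in> carrier P.FS" for p
    by (rule P.endo(2)[OF gen rels comm]) (use that in auto)
  show "lin_on P.Q P.Q (schur_diag M r s m n d x y)"
    unfolding schur_diag_eq by (rule P.endo(1)[OF gen rels comm])
  show "schur_diag M r s m n d x y (P.sym g) = P.proj (schur_diag_gen x y g)" if "g \<in> SGens" for g
    unfolding schur_diag_eq P.sym_def
    using E[OF single_in_free_space[OF that, of 1]]
    by (simp add: lin_ext_single map_times_1)
qed

text \<open>The sum over the group makes the product of the coordinates selected by the words \<open>I\<close>, \<open>J\<close> with \<open>\<psi>\<close> invariant, so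
  that it descends to coinvariants.\<close>

definition word_form :: "('v \<Rightarrow> 'k) \<Rightarrow> nat list \<Rightarrow> nat list \<Rightarrow> ('k, 'v) sgen \<Rightarrow> 'k" where
  "word_form \<psi> I J g = (case g of (v, us, ws) \<Rightarrow> \<Sum>a\<in>schur_group. (\<Prod>k<m. us ! fst a k $ (I ! k)) *
     (\<Prod>k<n. ws ! snd a k $ (J ! k)) * \<psi> (B (fst a) (snd a) v))"

lemma schur_groupD: "a \<in> schur_group \<Longrightarrow> fst a permutes {..<m}" "a \<in> schur_group \<Longrightarrow> snd a permutes {..<n}"
  by (auto simp: schur_group_def)

lemma word_form_form:
  assumes \<psi>: "linear_form V \<psi>" and I: "length I = m" "set I \<subseteq> {..<r}" and J: "length J = n" "set J \<subseteq> {..<s}"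
  obtains \<chi> where "linear_form P.Q \<chi>" "\<And>g. g \<in> SGens \<Longrightarrow> \<chi> (P.sym g) = word_form \<psi> I J g"
proof -
  have 1: "lin_fun (word_form \<psi> I J) p = 0" if "p \<in> SRels" for p
    using that
  proof (cases rule: SRelsE)
    case (vec v us ws)
    have "linear_form V (\<lambda>v. \<Sum>a\<in>schur_group. ((\<Prod>k<m. us ! fst a k $ (I ! k)) * (\<Prod>k<n. ws ! snd a k $ (J ! k))) * \<psi> (B (fst a) (snd a) v))"
      by (rule linear_form_sum, rule linear_form_comp[OF B_facts(1) \<psi>]) (use schur_groupD in auto)
    then show ?thesis by (intro linear_rels_vanish[OF vec(2)]) (simp add: word_form_def)
  next
    case (left v us ws i)
    let ?c = "\<lambda>a. (\<Prod>k\<in>{..<m} - {pinv (fst a) i}. us ! fst a k $ (I ! k)) * (\<Prod>k<n. ws ! snd a k $ (J ! k)) * \<psi> (B (fst a) (snd a) v)"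
    have "word_form \<psi> I J (v, us[i := u], ws) = (\<Sum>a\<in>schur_group. ?c a * u $ (I ! pinv (fst a) i))" for u
      unfolding word_form_def prod.case
    proof (rule sum.cong[OF refl])
      fix a assume a: "a \<in> schur_group"
      have "length us = m" using left by (simp add: SGens_iff)
      from prod_update[OF schur_groupD(1)[OF a] left(2) this, of "\<lambda>k u. u $ (I ! k)" u]
      show "(\<Prod>k<m. us[i := u] ! fst a k $ (I ! k)) * (\<Prod>k<n. ws ! snd a k $ (J ! k)) * \<psi> (B (fst a) (snd a) v)
         = ?c a * u $ (I ! pinv (fst a) i)" by (simp add: mult_ac)
    qed
    moreover have "linear_form kr (\<lambda>u. \<Sum>a\<in>schur_group. ?c a * u $ (I ! pinv (fst a) i))"
    proof (rule linear_form_sum, rule vec_component_form)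
      fix a assume a: "a \<in> schur_group"
      have "pinv (fst a) i < m"
        using permutes_in_image[OF permutes_inv[OF schur_groupD(1)[OF a]], of i] left(2) by simp
      then have "I ! pinv (fst a) i \<in> set I" using I by simp
      then show "I ! pinv (fst a) i < r" using I by auto
    qed
    ultimately show ?thesis by (intro linear_rels_vanish[OF left(3)]) simp
  next
    case (right v us ws i)
    let ?c = "\<lambda>a. (\<Prod>k\<in>{..<n} - {pinv (snd a) i}. ws ! snd a k $ (J ! k)) * (\<Prod>k<m. us ! fst a k $ (I ! k)) * \<psi> (B (fst a) (snd a) v)"
    have "word_form \<psi> I J (v, us, ws[i := w]) = (\<Sum>a\<in>schur_group. ?c a * w $ (J ! pinv (snd a) i))" for w
      unfolding word_form_def prod.case
    proof (rule sum.cong[OF refl])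
      fix a assume a: "a \<in> schur_group"
      have "length ws = n" using right by (simp add: SGens_iff)
      from prod_update[OF schur_groupD(2)[OF a] right(2) this, of "\<lambda>k u. u $ (J ! k)" w]
      show "(\<Prod>k<m. us ! fst a k $ (I ! k)) * (\<Prod>k<n. ws[i := w] ! snd a k $ (J ! k)) * \<psi> (B (fst a) (snd a) v)
         = ?c a * w $ (J ! pinv (snd a) i)" by (simp add: mult_ac)
    qed
    moreover have "linear_form ks (\<lambda>u. \<Sum>a\<in>schur_group. ?c a * u $ (J ! pinv (snd a) i))"
    proof (rule linear_form_sum, rule vec_component_form)
      fix a assume a: "a \<in> schur_group"
      have "pinv (snd a) i < n"
        using permutes_in_image[OF permutes_inv[OF schur_groupD(2)[OF a]], of i] right(2) by simp
      then have "J ! pinv (snd a) i \<in> set J" using J by simp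
      then show "J ! pinv (snd a) i < s" using J by auto
    qed
    ultimately show ?thesis by (intro linear_rels_vanish[OF right(3)]) simp
  qed
  have 2: "lin_fun (word_form \<psi> I J) (schur_perm_gen a g) = word_form \<psi> I J g" if a: "a \<in> schur_group" and g: "g \<in> SGens" for a g
  proof -
    obtain v us ws where g': "g = (v, us, ws)" by (cases g)
    note sa = schur_groupD(1)[OF a] and ta = schur_groupD(2)[OF a]
    have len: "length us = m" "length ws = n" "v \<in> carrier V" using g g' by (auto simp: SGens_iff)
    have "lin_fun (word_form \<psi> I J) (schur_perm_gen a g) = word_form \<psi> I J (B (fst a) (snd a) v, permute_list (fst a) us, permute_list (snd a) ws)"
      by (simp add: schur_perm_gen_def g')
    also have "\<dots> = word_form \<psi> I J (v, us, ws)"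
      unfolding word_form_def prod.case
    proof (rule sum.reindex_bij_witness[where i = "\<lambda>b. (pinv (fst a) \<circ> fst b, pinv (snd a) \<circ> snd b)"
          and j = "\<lambda>b. (fst a \<circ> fst b, snd a \<circ> snd b)"])
      fix b assume b: "b \<in> schur_group"
      note sb = schur_groupD(1)[OF b] and tb = schur_groupD(2)[OF b]
      show "(pinv (fst a) \<circ> fst (fst a \<circ> fst b, snd a \<circ> snd b), pinv (snd a) \<circ> snd (fst a \<circ> fst b, snd a \<circ> snd b)) = b"
        using permutes_inv_o(2)[OF sa] permutes_inv_o(2)[OF ta] by (simp flip: comp_assoc)
      show "(fst a \<circ> fst (pinv (fst a) \<circ> fst b, pinv (snd a) \<circ> snd b),
            snd a \<circ> snd (pinv (fst a) \<circ> fst b, pinv (snd a) \<circ> snd b)) = b"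
        using permutes_inv_o(1)[OF sa] permutes_inv_o(1)[OF ta] by (simp flip: comp_assoc)
      show "(fst a \<circ> fst b, snd a \<circ> snd b) \<in> schur_group"
        using permutes_compose[OF sb sa] permutes_compose[OF tb ta] by (simp add: schur_group_def)
      show "(pinv (fst a) \<circ> fst b, pinv (snd a) \<circ> snd b) \<in> schur_group"
        using permutes_compose[OF sb permutes_inv[OF sa]] permutes_compose[OF tb permutes_inv[OF ta]] by (simp add: schur_group_def)
      have "(\<Prod>k<m. permute_list (fst a) us ! fst b k $ (I ! k)) = (\<Prod>k<m. us ! (fst a \<circ> fst b) k $ (I ! k))"
        using permutes_in_image[OF sb] sa len by (intro prod.cong refl) (simp add: permute_list_nth)
      moreover have "(\<Prod>k<n. permute_list (snd a) ws ! snd b k $ (J ! k)) = (\<Prod>k<n. ws ! (snd a \<circ> snd b) k $ (J ! k))"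
        using permutes_in_image[OF tb] ta len by (intro prod.cong refl) (simp add: permute_list_nth)
      ultimately show "(\<Prod>k<m. us ! fst (fst a \<circ> fst b, snd a \<circ> snd b) k $ (I ! k)) *
         (\<Prod>k<n. ws ! snd (fst a \<circ> fst b, snd a \<circ> snd b) k $ (J ! k)) *
         \<psi> (B (fst (fst a \<circ> fst b, snd a \<circ> snd b)) (snd (fst a \<circ> fst b, snd a \<circ> snd b)) v) =
         (\<Prod>k<m. permute_list (fst a) us ! fst b k $ (I ! k)) *
         (\<Prod>k<n. permute_list (snd a) ws ! snd b k $ (J ! k)) * \<psi> (B (fst b) (snd b) (B (fst a) (snd a) v))"
        using B_facts(2)[OF sa ta sb tb len(3)] by simp
    qed
    finally show ?thesis by (simp add: g')
  qed
  show thesis by (rule P.form_exists[OF 1 2]) (use that in auto)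
qed

lemma prod_unit:
  assumes "\<sigma> permutes {..<m'}" "length I = m'" "length I' = m'" "set I \<subseteq> {..<r'}" "set I' \<subseteq> {..<r'}"
  shows "(\<Prod>k<m'. map (unit_vec r') I' ! \<sigma> k $ (I ! k)) = (if permute_list \<sigma> I' = I then 1 else (0::'k))"
proof -
  have e: "map (unit_vec r') I' ! \<sigma> k $ (I ! k) = (if permute_list \<sigma> I' ! k = I ! k then 1 else (0::'k))" if k: "k < m'" for k
  proof -
    have s: "\<sigma> k < m'" using permutes_in_image[OF assms(1), of k] k by simp
    have "I ! k \<in> set I" "I' ! \<sigma> k \<in> set I'" using s k assms(2,3) by auto
    then have "I ! k < r'" "I' ! \<sigma> k < r'" using assms by auto
    then show ?thesis using s k assms by (simp add: permute_list_nth)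
  qed
  show ?thesis
  proof (cases "permute_list \<sigma> I' = I")
    case False
    then obtain k where "k < m'" "permute_list \<sigma> I' ! k \<noteq> I ! k"
      using nth_equalityI[of "permute_list \<sigma> I'" I] assms by auto
    then have "(\<Prod>k<m'. map (unit_vec r') I' ! \<sigma> k $ (I ! k)) = (0::'k)"
      using e by (intro prod_zero) auto
    then show ?thesis using False by simp
  qed (simp add: e)
qed

text \<open>On unit vectors only the permutations that match the two pairs of words survive.\<close>

lemma word_form_unit:
  assumes I: "length I = m" "set I \<subseteq> {..<r}" and J: "length J = n" "set J \<subseteq> {..<s}"
    and I': "length I' = m" "set I' \<subseteq> {..<r}" and J': "length J' = n" "set J' \<subseteq> {..<s}"
  shows "word_form \<psi> I J (v, map (unit_vec r) I', map (unit_vec s) J') =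
    (\<Sum>a\<in>{a\<in>schur_group. permute_list (fst a) I' = I \<and> permute_list (snd a) J' = J}. \<psi> (B (fst a) (snd a) v))"
proof -
  have fin: "finite schur_group" unfolding schur_group_def by (simp add: finite_permutations)
  have "word_form \<psi> I J (v, map (unit_vec r) I', map (unit_vec s) J') =
    (\<Sum>a\<in>schur_group. if permute_list (fst a) I' = I \<and> permute_list (snd a) J' = J then \<psi> (B (fst a) (snd a) v) else 0)"
    unfolding word_form_def prod.case
    by (rule sum.cong[OF refl])
      (simp only: prod_unit[OF schur_groupD(1) I(1) I'(1) I(2) I'(2)] prod_unit[OF schur_groupD(2) J(1) J'(1) J(2) J'(2)], simp)
  then show ?thesis by (simp only: sum.inter_filter[OF fin])
qed

end

text \<open>The classes of \<open>e \<gamma> t\<close> tensored with the unit vectors named by the words of \<open>\<gamma>\<close> are eigenvectors of the diagonal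
  matrices with eigenvalue \<open>\<gamma>(x, y)\<close>. They form a basis of the coinvariants: distinct monomials are separated by
  their words, and within one monomial the forms \<open>\<psi> \<gamma> t\<close> separate them after division by the order of the
  stabilizer, which is invertible in characteristic zero.\<close>

theorem schur_trace:
  fixes M :: "('k::field_char_0, 'v) bimodule" and T :: "(var \<Rightarrow>\<^sub>0 nat) \<Rightarrow> 't set"
  assumes act: "bi_action (bcomp M m n d) m n (biact M m n d)"
    and sys: "\<And>\<gamma>. \<gamma> \<in> monomials r s m n d \<Longrightarrow>
      dual_system (bcomp M m n d) (stab_rels (bcomp M m n d) (biact M m n d) (wordX \<gamma>) (wordY \<gamma>)) (T \<gamma>) (e \<gamma>) (\<psi> \<gamma>)"
  shows "lin_trace (schur_space M r s m n d) (schur_diag M r s m n d x y) =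
    (\<Sum>\<gamma>\<in>monomials r s m n d. of_nat (card (T \<gamma>)) * (\<Prod>i<r. x i ^ lookup \<gamma> (X i))
       * (\<Prod>j<s. y j ^ lookup \<gamma> (Y j)))"
proof -
  interpret schur_setup M r s m n d by unfold_locales fact
  let ?Mo = "monomials r s m n d"
  let ?ux = "map (unit_vec r :: nat \<Rightarrow> 'k vec)" and ?uy = "map (unit_vec s :: nat \<Rightarrow> 'k vec)"
  define TT where "TT = Sigma ?Mo T"
  define E where "E = (\<lambda>(\<gamma>, t). P.sym (e \<gamma> t, ?ux (wordX \<gamma>), ?uy (wordY \<gamma>)))"
  note D = sys[unfolded dual_system_def]
  have unitg: "(v, ?ux I, ?uy J) \<in> SGens" if "v \<in> carrier V" "length I = m" "length J = n" for v I J
    using that by (auto simp: SGens_iff module_vec_simps)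
  have evec: "e \<gamma> t \<in> carrier V" if "\<gamma> \<in> ?Mo" "t \<in> T \<gamma>" for \<gamma> t using D that by blast
  have genE: "(e \<gamma> t, ?ux (wordX \<gamma>), ?uy (wordY \<gamma>)) \<in> SGens" if "\<gamma> \<in> ?Mo" "t \<in> T \<gamma>" for \<gamma> t
    by (rule unitg[OF evec[OF that] monomials_words(1,3)[OF that(1)]])
  have Ecar: "E p \<in> carrier P.Q" if "p \<in> TT" for p
    using that P.sym_carrier genE by (auto simp: E_def TT_def)
  have finTT: "finite TT" unfolding TT_def using finite_monomials D by blast
  \<comment> \<open>The symmetrised forms are dual to the classes \<open>E\<close> up to the order of a stabilizer.\<close>
  have "\<forall>p\<in>TT. \<exists>\<chi>. linear_form P.Q \<chi> \<and>
      (\<forall>g\<in>SGens. \<chi> (P.sym g) = word_form (\<psi> (fst p) (snd p)) (wordX (fst p)) (wordY (fst p)) g)"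
  proof
    fix p assume "p \<in> TT"
    then have p: "fst p \<in> ?Mo" "snd p \<in> T (fst p)" by (auto simp: TT_def)
    show "\<exists>\<chi>. linear_form P.Q \<chi> \<and>
        (\<forall>g\<in>SGens. \<chi> (P.sym g) = word_form (\<psi> (fst p) (snd p)) (wordX (fst p)) (wordY (fst p)) g)"
      by (rule word_form_form[of "\<psi> (fst p) (snd p)" "wordX (fst p)" "wordY (fst p)"])
        (use D p monomials_words[OF p(1)] in auto)
  qed
  from bchoice[OF this] obtain \<chi> where \<chi>0: "\<And>p. p \<in> TT \<Longrightarrow> linear_form P.Q (\<chi> p) \<and>
      (\<forall>g\<in>SGens. \<chi> p (P.sym g) = word_form (\<psi> (fst p) (snd p)) (wordX (fst p)) (wordY (fst p)) g)"
    by blast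
  have \<chi>: "\<And>\<gamma> t. \<gamma> \<in> ?Mo \<Longrightarrow> t \<in> T \<gamma> \<Longrightarrow> linear_form P.Q (\<chi> (\<gamma>, t))"
    "\<And>\<gamma> t g. \<gamma> \<in> ?Mo \<Longrightarrow> t \<in> T \<gamma> \<Longrightarrow> g \<in> SGens \<Longrightarrow> \<chi> (\<gamma>, t) (P.sym g) = word_form (\<psi> \<gamma> t) (wordX \<gamma>) (wordY \<gamma>) g"
    using \<chi>0 by (simp_all add: TT_def)
  have eval: "\<chi> (\<gamma>, t) (E (\<gamma>', t')) = (if \<gamma>' = \<gamma> then of_nat (card (word_stab (wordX \<gamma>) \<times> word_stab (wordY \<gamma>))) * \<psi> \<gamma> t (e \<gamma> t') else 0)"
    if g: "\<gamma> \<in> ?Mo" "t \<in> T \<gamma>" "\<gamma>' \<in> ?Mo" "t' \<in> T \<gamma>'" for \<gamma> t \<gamma>' t'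
  proof -
    note w = monomials_words[OF g(1)] and w' = monomials_words[OF g(3)]
    let ?A = "{a \<in> schur_group. permute_list (fst a) (wordX \<gamma>') = wordX \<gamma> \<and> permute_list (snd a) (wordY \<gamma>') = wordY \<gamma>}"
    have s: "\<chi> (\<gamma>, t) (E (\<gamma>', t')) = (\<Sum>a\<in>?A. \<psi> \<gamma> t (B (fst a) (snd a) (e \<gamma>' t')))"
      using \<chi>(2)[OF g(1,2) genE[OF g(3,4)]] word_form_unit[OF w(1-4) w'(1-4)] by (simp add: E_def)
    show ?thesis
    proof (cases "\<gamma>' = \<gamma>")
      case True
      have A: "?A = word_stab (wordX \<gamma>) \<times> word_stab (wordY \<gamma>)"
        using True w by (auto simp: schur_group_def word_stab_def)
      have "\<psi> \<gamma> t (B (fst a) (snd a) (e \<gamma> t')) = \<psi> \<gamma> t (e \<gamma> t')" if a: "a \<in> ?A" for a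
      proof -
        have ev: "e \<gamma> t' \<in> carrier V" using evec g True by auto
        have "B (fst a) (snd a) (e \<gamma> t') \<ominus>\<^bsub>V\<^esub> e \<gamma> t' \<in> stab_rels V B (wordX \<gamma>) (wordY \<gamma>)"
          using a A ev unfolding stab_rels_def by (cases a) auto
        then have "\<psi> \<gamma> t (B (fst a) (snd a) (e \<gamma> t') \<ominus>\<^bsub>V\<^esub> e \<gamma> t') = 0" using D g by blast
        moreover have "B (fst a) (snd a) (e \<gamma> t') \<in> carrier V"
          using lin_on_simps(1)[OF B_facts(1) ev] a schur_groupD by auto
        ultimately show ?thesis
          using linear_form_simps(4)[of V "\<psi> \<gamma> t", OF _ V_vspace _ ev] D g by simp
      qed
      then have "(\<Sum>a\<in>?A. \<psi> \<gamma> t (B (fst a) (snd a) (e \<gamma>' t'))) = (\<Sum>a\<in>?A. \<psi> \<gamma> t (e \<gamma> t'))"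
        using True by (intro sum.cong) auto
      then show ?thesis using s A True by simp
    next
      case False
      have "?A = {}"
      proof (rule ccontr)
        assume "?A \<noteq> {}"
        then obtain a where a: "a \<in> schur_group" "permute_list (fst a) (wordX \<gamma>') = wordX \<gamma>" "permute_list (snd a) (wordY \<gamma>') = wordY \<gamma>" by auto
        then have "mset (wordX \<gamma>) = mset (wordX \<gamma>')" "mset (wordY \<gamma>) = mset (wordY \<gamma>')"
          using mset_permute_list[of "fst a" "wordX \<gamma>'"] mset_permute_list[of "snd a" "wordY \<gamma>'"] schur_groupD[OF a(1)] w' by auto
        then have "\<gamma> = \<gamma>'" using word_monomial_words[of \<gamma>] word_monomial_words[of \<gamma>'] w(5) w'(5) word_monomial_cong by metis
        then show False using False by simp
      qed
      then show ?thesis unfolding s using False by (simp only: sum.empty if_False)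
    qed
  qed
  have stab0: "(of_nat (card (word_stab I \<times> word_stab J)) :: 'k) \<noteq> 0" for I J :: "nat list"
  proof -
    have "id \<in> word_stab I" for I :: "nat list" by (simp add: word_stab_def permutes_id)
    then show ?thesis by (auto simp: card_eq_0_iff finite_word_stab)
  qed
  \<comment> \<open>A generator made of unit vectors can be permuted until its index words are the standard words
    of their monomial; its first entry then only matters modulo the stabilizer relations.\<close>
  have ETT: "E ` TT \<subseteq> carrier P.Q" using Ecar by auto
  note sub = vspan_sub[OF P.Q_vspace ETT]
  have span1: "P.sym (v, ?ux I, ?uy J) \<in> vspan P.Q (E ` TT)"
    if v: "v \<in> carrier V" and I: "length I = m" "set I \<subseteq> {..<r}" and J: "length J = n" "set J \<subseteq> {..<s}" for v I J
  proof -
    define \<gamma> where "\<gamma> = word_monomial I J d"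
    have g: "\<gamma> \<in> ?Mo" unfolding \<gamma>_def by (rule monomials_word_monomial[OF I J])
    note w = monomials_words[OF g]
    obtain \<sigma> where \<sigma>: "\<sigma> permutes {..<length I}" "permute_list \<sigma> I = wordX \<gamma>"
      using word_permutation[of I "wordX \<gamma>"] mset_word_monomial[of I J d] unfolding \<gamma>_def by metis
    obtain \<tau> where \<tau>: "\<tau> permutes {..<length J}" "permute_list \<tau> J = wordY \<gamma>"
      using word_permutation[of J "wordY \<gamma>"] mset_word_monomial[of I J d] unfolding \<gamma>_def by metis
    have st: "(\<sigma>, \<tau>) \<in> schur_group" using \<sigma> \<tau> I J by (simp add: schur_group_def)
    have \<phi>: "schur_perm_gen (a, b) (v, us, ws) = single (B a b v, permute_list a us, permute_list b ws) 1" for a b v us ws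
      by (simp add: schur_perm_gen_def)
    have "P.sym (v, ?ux I, ?uy J) = P.proj (schur_perm_gen (\<sigma>, \<tau>) (v, ?ux I, ?uy J))"
      using P.sym_act[OF st unitg[OF v I(1) J(1)]] by simp
    also have "\<dots> = P.sym (B \<sigma> \<tau> v, ?ux (wordX \<gamma>), ?uy (wordY \<gamma>))"
      unfolding \<phi> P.sym_def by (simp only: permute_list_map[OF \<sigma>(1)] permute_list_map[OF \<tau>(1)] \<sigma>(2) \<tau>(2))
    also have "\<dots> \<in> vspan P.Q (E ` TT)"
    proof (rule lin_on_span_image[OF V_vspace P.Q_vspace _ _ ETT])
      have g0: "(v, ?ux (wordX \<gamma>), ?uy (wordY \<gamma>)) \<in> SGens" by (rule unitg[OF v w(1,3)])
      show lin: "lin_on V P.Q (\<lambda>v. P.sym (v, ?ux (wordX \<gamma>), ?uy (wordY \<gamma>)))"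
        by (rule P.sym_lin_on[OF V_vspace SRelsI(1)[OF g0] SGens_update(1)[OF g0]])
      show "e \<gamma> ` T \<gamma> \<union> stab_rels V B (wordX \<gamma>) (wordY \<gamma>) \<subseteq> carrier V" using D[OF g] by auto
      have "B \<sigma> \<tau> v \<in> carrier V" using lin_on_simps(1)[OF B_facts(1) v] st schur_groupD[OF st] by simp
      then show "B \<sigma> \<tau> v \<in> vspan V (e \<gamma> ` T \<gamma> \<union> stab_rels V B (wordX \<gamma>) (wordY \<gamma>))" using D[OF g] by auto
      fix z assume "z \<in> e \<gamma> ` T \<gamma> \<union> stab_rels V B (wordX \<gamma>) (wordY \<gamma>)"
      then consider t where "t \<in> T \<gamma>" "z = e \<gamma> t"
        | a b u where "a \<in> word_stab (wordX \<gamma>)" "b \<in> word_stab (wordY \<gamma>)" "u \<in> carrier V" "z = B a b u \<ominus>\<^bsub>V\<^esub> u"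
        by (auto simp: stab_rels_def)
      then show "P.sym (z, ?ux (wordX \<gamma>), ?uy (wordY \<gamma>)) \<in> vspan P.Q (E ` TT)"
      proof cases
        case 1
        then show ?thesis using sub(2) g by (auto simp: E_def TT_def)
      next
        case 2
        then have ab: "a permutes {..<m}" "b permutes {..<n}" "permute_list a (wordX \<gamma>) = wordX \<gamma>" "permute_list b (wordY \<gamma>) = wordY \<gamma>"
          using w by (auto simp: word_stab_def)
        have abG: "(a, b) \<in> schur_group" using ab by (simp add: schur_group_def)
        have bu: "B a b u \<in> carrier V" using lin_on_simps(1)[OF B_facts(1)[OF ab(1,2)] 2(3)] .
        have "P.sym (u, ?ux (wordX \<gamma>), ?uy (wordY \<gamma>)) = P.proj (schur_perm_gen (a, b) (u, ?ux (wordX \<gamma>), ?uy (wordY \<gamma>)))"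
          using P.sym_act[OF abG unitg[OF 2(3) w(1,3)]] by simp
        also have "\<dots> = P.sym (B a b u, ?ux (wordX \<gamma>), ?uy (wordY \<gamma>))"
          unfolding \<phi> P.sym_def using permute_list_map[of a "wordX \<gamma>" "unit_vec r :: nat \<Rightarrow> 'k vec"]
            permute_list_map[of b "wordY \<gamma>" "unit_vec s :: nat \<Rightarrow> 'k vec"] ab w by simp
        finally have "P.sym (z, ?ux (wordX \<gamma>), ?uy (wordY \<gamma>)) = \<zero>\<^bsub>P.Q\<^esub>"
          using lin_on_simps(5)[OF lin V_vspace P.Q_vspace bu 2(3)] 2(4)
            vspace_simps(7)[OF P.Q_vspace lin_on_simps(1)[OF lin bu]] by simp
        then show ?thesis using sub(3) by simp
      qed
    qed
    finally show ?thesis .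
  qed
  have span2: "P.sym (v, us, ?uy J) \<in> vspan P.Q (E ` TT)"
    if v: "v \<in> carrier V" and us: "length us = m" "set us \<subseteq> carrier kr" and J: "length J = n" "set J \<subseteq> {..<s}" for v us J
  proof (rule multilinear_span[OF P.Q_vspace ETT, where V = "\<lambda>_. kr" and S = "\<lambda>_. unit_vec r ` {..<r}" and n = m
        and f = "\<lambda>us. P.sym (v, us, ?uy J)"])
    show "lin_on kr P.Q (\<lambda>u. P.sym (v, vs[i := u], ?uy J))"
      if "i < m" "length vs = m" "\<And>j. j < m \<Longrightarrow> vs ! j \<in> carrier kr" for i vs
    proof -
      have "(v, vs, ?uy J) \<in> SGens" using that v J by (auto simp: SGens_iff module_vec_simps in_set_conv_nth)
      then show ?thesis by (intro P.sym_lin_on[OF vec_vspace SRelsI(2)] SGens_update(2) that)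
    qed
    show "P.sym (v, vs, ?uy J) \<in> vspan P.Q (E ` TT)"
      if vs: "length vs = m" "\<And>j. j < m \<Longrightarrow> vs ! j \<in> unit_vec r ` {..<r}" for vs
    proof -
      have "\<forall>j<m. \<exists>i. i < r \<and> vs ! j = unit_vec r i" using vs by fastforce
      then obtain g where g: "\<And>j. j < m \<Longrightarrow> g j < r \<and> vs ! j = unit_vec r (g j)" by metis
      have "vs = ?ux (map g [0..<m])" using vs g by (intro nth_equalityI) auto
      moreover have "P.sym (v, ?ux (map g [0..<m]), ?uy J) \<in> vspan P.Q (E ` TT)"
        by (rule span1[OF v _ _ J]) (use g in auto)
      ultimately show ?thesis by simp
    qed
  qed (use us vec_vspace unit_vecs_span in \<open>auto simp: module_vec_simps\<close>)
  have span3: "P.sym (v, us, ws) \<in> vspan P.Q (E ` TT)"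
    if v: "v \<in> carrier V" and us: "length us = m" "set us \<subseteq> carrier kr" and ws: "length ws = n" "set ws \<subseteq> carrier ks" for v us ws
  proof (rule multilinear_span[OF P.Q_vspace ETT, where V = "\<lambda>_. ks" and S = "\<lambda>_. unit_vec s ` {..<s}" and n = n
        and f = "\<lambda>ws. P.sym (v, us, ws)"])
    show "lin_on ks P.Q (\<lambda>u. P.sym (v, us, vs[i := u]))"
      if "i < n" "length vs = n" "\<And>j. j < n \<Longrightarrow> vs ! j \<in> carrier ks" for i vs
    proof -
      have "(v, us, vs) \<in> SGens" using that v us by (auto simp: SGens_iff module_vec_simps in_set_conv_nth)
      then show ?thesis by (intro P.sym_lin_on[OF vec_vspace SRelsI(3)] SGens_update(3) that)
    qed
    show "P.sym (v, us, vs) \<in> vspan P.Q (E ` TT)"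
      if vs: "length vs = n" "\<And>j. j < n \<Longrightarrow> vs ! j \<in> unit_vec s ` {..<s}" for vs
    proof -
      have "\<forall>j<n. \<exists>i. i < s \<and> vs ! j = unit_vec s i" using vs by fastforce
      then obtain g where g: "\<And>j. j < n \<Longrightarrow> g j < s \<and> vs ! j = unit_vec s (g j)" by metis
      have "vs = ?uy (map g [0..<n])" using vs g by (intro nth_equalityI) auto
      moreover have "P.sym (v, us, ?uy (map g [0..<n])) \<in> vspan P.Q (E ` TT)"
        by (rule span2[OF v us]) (use g in auto)
      ultimately show ?thesis by simp
    qed
  qed (use ws vec_vspace unit_vecs_span in \<open>auto simp: module_vec_simps\<close>)
  have span: "q \<in> vspan P.Q (E ` TT \<union> {})" if "q \<in> carrier P.Q" for q
  proof -
    have "P.sym ` SGens \<subseteq> vspan P.Q (E ` TT)" using span3 by (auto simp: SGens_iff)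
    then show ?thesis using P.Q_span[OF that] vspan_least[OF P.Q_vspace ETT] by auto
  qed
  have ds: "dual_system P.Q {} TT E (\<lambda>p q. inverse (\<chi> p (E p)) * \<chi> p q)"
  proof (rule dual_systemI[OF P.Q_vspace finTT])
    show "\<chi> p' (E p) = 0" if pt: "p \<in> TT" "p' \<in> TT" "p \<noteq> p'" for p p'
    proof -
      obtain \<gamma> t \<gamma>' t' where pp: "p = (\<gamma>, t)" "\<gamma> \<in> ?Mo" "t \<in> T \<gamma>" "p' = (\<gamma>', t')" "\<gamma>' \<in> ?Mo" "t' \<in> T \<gamma>'"
        using pt(1,2) by (auto simp: TT_def)
      have "\<psi> \<gamma>' t' (e \<gamma>' t) = 0" if "\<gamma> = \<gamma>'" using D[OF pp(5)] pp that \<open>p \<noteq> p'\<close> by auto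
      then show ?thesis unfolding pp(1,4) eval[OF pp(5,6,2,3)] by simp
    qed
    show "\<chi> p (E p) \<noteq> 0" if pt: "p \<in> TT" for p
    proof -
      obtain \<gamma> t where pp: "p = (\<gamma>, t)" "\<gamma> \<in> ?Mo" "t \<in> T \<gamma>" using pt by (auto simp: TT_def)
      have "\<psi> \<gamma> t (e \<gamma> t) = 1" using D[OF pp(2)] pp by auto
      then show ?thesis unfolding pp(1) eval[OF pp(2,3,2,3)] using stab0 by simp
    qed
  qed (use Ecar \<chi>(1) span in \<open>auto simp: TT_def\<close>)
  define ev where "ev = (\<lambda>p::(var \<Rightarrow>\<^sub>0 nat) \<times> 't. (\<Prod>i<r. x i ^ lookup (fst p) (X i)) * (\<Prod>j<s. y j ^ lookup (fst p) (Y j)))"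
  have eig: "schur_diag M r s m n d x y (E p) = ev p \<odot>\<^bsub>P.Q\<^esub> E p" if pt: "p \<in> TT" for p
  proof -
    obtain \<gamma> t where p: "p = (\<gamma>, t)" "\<gamma> \<in> ?Mo" "t \<in> T \<gamma>" using pt by (auto simp: TT_def)
    note w = monomials_words[OF p(2)] and v = evec[OF p(2,3)]
    let ?v = "e \<gamma> t" and ?I = "wordX \<gamma>" and ?J = "wordY \<gamma>"
    let ?us = "map (\<lambda>i. x (?I ! i) \<odot>\<^bsub>kr\<^esub> ?ux ?I ! i) [0..<m]" and ?ws = "map (\<lambda>i. y (?J ! i) \<odot>\<^bsub>ks\<^esub> ?uy ?J ! i) [0..<n]"
    have Ilt: "?I ! i < r" if "i < m" for i using subsetD[OF w(2) nth_mem[of i ?I]] that w(1) by simp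
    have Jlt: "?J ! i < s" if "i < n" for i using subsetD[OF w(4) nth_mem[of i ?J]] that w(3) by simp
    have "map (\<lambda>u. mat_diag r x *\<^sub>v u) (?ux ?I) = ?us"
      using w Ilt by (intro nth_equalityI) (auto simp: mat_diag_unit_vec module_vec_simps)
    moreover have "map (\<lambda>u. mat_diag s y *\<^sub>v u) (?uy ?J) = ?ws"
      using w Jlt by (intro nth_equalityI) (auto simp: mat_diag_unit_vec module_vec_simps)
    ultimately have "schur_diag M r s m n d x y (E p) = P.sym (?v, ?us, ?ws)"
      using diag_endo(2)[OF genE[OF p(2,3)], of x y] by (simp add: p(1) E_def schur_diag_gen_def P.sym_def)
    also have "\<dots> = (\<Prod>i<m. x (?I ! i)) \<odot>\<^bsub>P.Q\<^esub> P.sym (?v, ?ux ?I, ?ws)"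
    proof (rule multilinear_scale[OF P.Q_vspace vec_vspace, where f = "\<lambda>us. P.sym (?v, us, ?ws)"])
      have ws: "length ?ws = n" "set ?ws \<subseteq> carrier ks" using w by (auto simp: module_vec_simps)
      show "lin_on kr P.Q (\<lambda>u. P.sym (?v, vs[i := u], ?ws))" if "i < m" "length vs = m" "set vs \<subseteq> carrier kr" for i vs
      proof -
        have "(?v, vs, ?ws) \<in> SGens" using that v ws by (simp add: SGens_iff)
        then show ?thesis by (intro P.sym_lin_on[OF vec_vspace SRelsI(2)] SGens_update(2) that)
      qed
      show "P.sym (?v, vs, ?ws) \<in> carrier P.Q" if "length vs = m" "set vs \<subseteq> carrier kr" for vs
        by (rule P.sym_carrier) (use that v ws in \<open>simp add: SGens_iff\<close>)
    qed (use w in \<open>auto simp: module_vec_simps\<close>)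
    also have "P.sym (?v, ?ux ?I, ?ws) = (\<Prod>i<n. y (?J ! i)) \<odot>\<^bsub>P.Q\<^esub> P.sym (?v, ?ux ?I, ?uy ?J)"
    proof (rule multilinear_scale[OF P.Q_vspace vec_vspace, where f = "\<lambda>ws. P.sym (?v, ?ux ?I, ws)"])
      have us: "length (?ux ?I) = m" "set (?ux ?I) \<subseteq> carrier kr" using w by (auto simp: module_vec_simps)
      show "lin_on ks P.Q (\<lambda>u. P.sym (?v, ?ux ?I, vs[i := u]))" if "i < n" "length vs = n" "set vs \<subseteq> carrier ks" for i vs
      proof -
        have "(?v, ?ux ?I, vs) \<in> SGens" using that v us by (simp add: SGens_iff)
        then show ?thesis by (intro P.sym_lin_on[OF vec_vspace SRelsI(3)] SGens_update(3) that)
      qed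
      show "P.sym (?v, ?ux ?I, vs) \<in> carrier P.Q" if "length vs = n" "set vs \<subseteq> carrier ks" for vs
        by (rule P.sym_carrier) (use that v us in \<open>simp add: SGens_iff\<close>)
    qed (use w in \<open>auto simp: module_vec_simps\<close>)
    also have "P.sym (?v, ?ux ?I, ?uy ?J) = E p" by (simp add: p(1) E_def)
    finally have "schur_diag M r s m n d x y (E p) = (\<Prod>i<m. x (?I ! i)) \<odot>\<^bsub>P.Q\<^esub> ((\<Prod>i<n. y (?J ! i)) \<odot>\<^bsub>P.Q\<^esub> E p)" .
    moreover have "(\<Prod>i<m. x (?I ! i)) * (\<Prod>i<n. y (?J ! i)) = ev p"
      using prod_word[OF w(2), of x] prod_word[OF w(4), of y] w(1,3) by (simp add: ev_def p(1) count_wordX count_wordY)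
    moreover have "(a * b) \<odot>\<^bsub>P.Q\<^esub> E p = a \<odot>\<^bsub>P.Q\<^esub> (b \<odot>\<^bsub>P.Q\<^esub> E p)" for a b
    proof -
      interpret Qv: vectorspace class_ring P.Q by (rule P.Q_vspace)
      show ?thesis using Qv.smult_assoc1[of a b "E p"] Ecar[OF pt] by simp
    qed
    ultimately show ?thesis by metis
  qed
  have "lin_trace (schur_space M r s m n d) (schur_diag M r s m n d x y) = (\<Sum>p\<in>TT. ev p)"
    unfolding schur_space_eq by (rule lin_trace_dual_system[OF P.Q_vspace ds diag_endo(1) eig])
  also have "\<dots> = (\<Sum>\<gamma>\<in>?Mo. \<Sum>t\<in>T \<gamma>. ev (\<gamma>, t))"
    unfolding TT_def using finite_monomials D by (subst sum.Sigma) auto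
  finally show ?thesis by (simp add: ev_def mult.assoc)
qed

section \<open>Blocks and Koszul signs\<close>

lemma block_of_offset:
  "i < length ks \<Longrightarrow> q < ks ! i \<Longrightarrow> block_offset ks i + q < sum_list ks \<and> block_of ks (block_offset ks i + q) = (i, q)"
proof (induction ks arbitrary: i)
  case (Cons k ks)
  show ?case
  proof (cases i)
    case (Suc j)
    then have "block_offset ks j + q < sum_list ks \<and> block_of ks (block_offset ks j + q) = (j, q)"
      using Cons by simp
    then show ?thesis using Suc by (simp add: block_offset_def add.assoc)
  qed (use Cons in \<open>simp add: block_offset_def\<close>)
qed simp

lemma block_position:
  assumes "p < sum_list ks"
  obtains i q where "i < length ks" "q < ks ! i" "p = block_offset ks i + q"
proof -
  have "\<exists>i q. i < length ks \<and> q < ks ! i \<and> p = block_offset ks i + q"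
    using assms
  proof (induction ks arbitrary: p)
    case (Cons k ks)
    show ?case
    proof (cases "p < k")
      case True
      then show ?thesis by (rule_tac x = 0 in exI, rule_tac x = p in exI) (simp add: block_offset_def)
    next
      case False
      then have "p - k < sum_list ks" using Cons by simp
      then obtain i q where "i < length ks \<and> q < ks ! i \<and> p - k = block_offset ks i + q" using Cons.IH by blast
      then have "Suc i < length (k # ks) \<and> q < (k # ks) ! Suc i \<and> p = block_offset (k # ks) (Suc i) + q"
        using False by (simp add: block_offset_def) arith
      then show ?thesis by blast
    qed
  qed simp
  then show thesis using that by blast
qed

lemma block_sum_offset:
  "i < length ks \<Longrightarrow> q < ks ! i \<Longrightarrow> block_sum ks h (block_offset ks i + q) = block_offset ks i + h i q"
  using block_of_offset[of i ks q] by (simp add: block_sum_def)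

lemma block_perm_offset:
  "j < length ks \<Longrightarrow> q < ks ! j \<Longrightarrow>
    block_perm ks f (block_offset ks j + q) = block_offset (permute_list f ks) (pinv f j) + q"
  using block_of_offset[of j ks q] by (simp add: block_perm_def)

lemma permutes_less:
  fixes \<sigma> :: "nat \<Rightarrow> nat"
  assumes "\<sigma> permutes {..<n}" "i < n"
  shows "\<sigma> i < n" "pinv \<sigma> i < n"
  using permutes_in_image[OF assms(1), of i] permutes_in_image[OF permutes_inv[OF assms(1)], of i] assms(2) by simp_all

lemma block_sum_permutes:
  assumes "\<And>i. i < length ks \<Longrightarrow> h i permutes {..<ks ! i}"
  shows "block_sum ks h permutes {..<sum_list ks}"
proof (rule bij_imp_permutes)
  let ?g = "block_sum ks (\<lambda>i. pinv (h i))"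
  show "bij_betw (block_sum ks h) {..<sum_list ks} {..<sum_list ks}"
  proof (rule bij_betw_byWitness[where f' = ?g])
    show "\<forall>p\<in>{..<sum_list ks}. ?g (block_sum ks h p) = p"
    proof
      fix p assume "p \<in> {..<sum_list ks}"
      then have "p < sum_list ks" by simp
      then obtain i q where p: "i < length ks" "q < ks ! i" "p = block_offset ks i + q" by (rule block_position)
      then show "?g (block_sum ks h p) = p"
        using permutes_less[OF assms[OF p(1)] p(2)] permutes_inverses(2)[OF assms[OF p(1)]] by (simp add: block_sum_offset)
    qed
    show "\<forall>p\<in>{..<sum_list ks}. block_sum ks h (?g p) = p"
    proof
      fix p assume "p \<in> {..<sum_list ks}"
      then have "p < sum_list ks" by simp
      then obtain i q where p: "i < length ks" "q < ks ! i" "p = block_offset ks i + q" by (rule block_position)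
      then show "block_sum ks h (?g p) = p"
        using permutes_less[OF assms[OF p(1)] p(2)] permutes_inverses(1)[OF assms[OF p(1)]] by (simp add: block_sum_offset)
    qed
    show "block_sum ks h ` {..<sum_list ks} \<subseteq> {..<sum_list ks}"
    proof clarify
      fix p assume "p < sum_list ks"
      then obtain i q where p: "i < length ks" "q < ks ! i" "p = block_offset ks i + q" by (rule block_position)
      then show "block_sum ks h p < sum_list ks"
        using permutes_less[OF assms[OF p(1)] p(2)] block_of_offset[of i ks "h i q"] by (simp add: block_sum_offset)
    qed
    show "?g ` {..<sum_list ks} \<subseteq> {..<sum_list ks}"
    proof clarify
      fix p assume "p < sum_list ks"
      then obtain i q where p: "i < length ks" "q < ks ! i" "p = block_offset ks i + q" by (rule block_position)
      then show "?g p < sum_list ks"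
        using permutes_less[OF assms[OF p(1)] p(2)] block_of_offset[of i ks "pinv (h i) q"] by (simp add: block_sum_offset)
    qed
  qed
qed (simp add: block_sum_def)

lemma inv_block_sum_offset:
  assumes "\<And>i. i < length ks \<Longrightarrow> h i permutes {..<ks ! i}" "i < length ks" "q < ks ! i"
  shows "pinv (block_sum ks h) (block_offset ks i + q) = block_offset ks i + pinv (h i) q"
proof -
  have "block_sum ks h (block_offset ks i + pinv (h i) q) = block_offset ks i + q"
    using permutes_less[OF assms(1)[OF assms(2)] assms(3)] permutes_inverses(1)[OF assms(1)[OF assms(2)]] assms(2)
    by (simp add: block_sum_offset)
  then show ?thesis using permutes_inv_eq[OF block_sum_permutes[OF assms(1)]] by metis
qed

lemma permute_list_inv:
  assumes "f permutes {..<length xs}"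
  shows "permute_list (pinv f) (permute_list f xs) = xs"
  using permute_list_compose[of "pinv f" xs f] permutes_inv[OF assms] permutes_inv_o(1)[OF assms] by simp

lemma sum_list_permute:
  fixes ks :: "nat list"
  assumes "f permutes {..<length ks}"
  shows "sum_list (permute_list f ks) = sum_list ks"
  by (metis assms mset_permute_list sum_mset_sum_list)

lemma block_perm_inverse:
  assumes f: "f permutes {..<length ks}" and "p < sum_list ks"
  shows "block_perm ks f p < sum_list ks"
    "block_perm (permute_list f ks) (pinv f) (block_perm ks f p) = p"
proof -
  let ?ks = "permute_list f ks"
  obtain j q where p: "j < length ks" "q < ks ! j" "p = block_offset ks j + q"
    using assms(2) by (rule block_position)
  have j: "pinv f j < length ?ks" using permutes_less[OF f p(1)] by simp
  moreover have "?ks ! pinv f j = ks ! j"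
    using permutes_less[OF f p(1)] permutes_inverses(1)[OF f] by (simp add: permute_list_nth[OF f])
  ultimately have e: "block_offset ?ks (pinv f j) + q < sum_list ?ks"
    "block_perm ?ks (pinv f) (block_offset ?ks (pinv f j) + q) =
      block_offset (permute_list (pinv f) ?ks) (pinv (pinv f) (pinv f j)) + q"
    using block_of_offset[of "pinv f j" ?ks q] block_perm_offset[of "pinv f j" ?ks q "pinv f"] p by auto
  have b: "block_perm ks f p = block_offset ?ks (pinv f j) + q"
    using p block_perm_offset by simp
  show "block_perm ks f p < sum_list ks" using b e(1) sum_list_permute[OF f] by simp
  show "block_perm (permute_list f ks) (pinv f) (block_perm ks f p) = p"
    by (simp only: b e(2) permute_list_inv[OF f] permutes_inv_inv[OF f] permutes_inverses(1)[OF f] p(3)[symmetric])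
qed

lemma block_perm_permutes:
  assumes f: "f permutes {..<length ks}"
  shows "block_perm ks f permutes {..<sum_list ks}"
proof (rule bij_imp_permutes)
  let ?ks = "permute_list f ks" and ?fi = "pinv f"
  have fi: "?fi permutes {..<length ?ks}" using permutes_inv[OF f] by simp
  note bk = permute_list_inv[OF f] and inv2 = permutes_inv_inv[OF f] and s = sum_list_permute[OF f]
  show "bij_betw (block_perm ks f) {..<sum_list ks} {..<sum_list ks}"
  proof (rule bij_betw_byWitness[where f' = "block_perm ?ks ?fi"])
    show "\<forall>p\<in>{..<sum_list ks}. block_perm ?ks ?fi (block_perm ks f p) = p"
      using block_perm_inverse(2)[OF f] by simp
    show "\<forall>p\<in>{..<sum_list ks}. block_perm ks f (block_perm ?ks ?fi p) = p"
      using block_perm_inverse(2)[OF fi] by (simp add: bk inv2 s)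
    show "block_perm ks f ` {..<sum_list ks} \<subseteq> {..<sum_list ks}"
      using block_perm_inverse(1)[OF f] by auto
    show "block_perm ?ks ?fi ` {..<sum_list ks} \<subseteq> {..<sum_list ks}"
      using block_perm_inverse(1)[OF fi] by (auto simp: s)
  qed
qed (simp add: block_perm_def)

lemma inv_block_perm_offset:
  assumes f: "f permutes {..<length ks}" and i: "i < length ks" "q < ks ! f i"
  shows "pinv (block_perm ks f) (block_offset (permute_list f ks) i + q) = block_offset ks (f i) + q"
proof -
  have "block_perm ks f (block_offset ks (f i) + q) = block_offset (permute_list f ks) i + q"
    using permutes_less[OF f i(1)] i permutes_inverses(2)[OF f] by (simp add: block_perm_offset)
  then show ?thesis using permutes_inv_eq[OF block_perm_permutes[OF f]] by metis
qed

text \<open>Moving blocks past an element of the Young subgroup permutes its components; this makes the action on the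
  factors compatible with the induction relations.\<close>

lemma block_perm_block_sum:
  assumes f: "f permutes {..<length ks}" and h: "\<And>i. i < length ks \<Longrightarrow> h i permutes {..<ks ! i}"
  shows "block_perm ks f \<circ> block_sum ks h = block_sum (permute_list f ks) (\<lambda>i. h (f i)) \<circ> block_perm ks f"
proof
  fix p
  show "(block_perm ks f \<circ> block_sum ks h) p = (block_sum (permute_list f ks) (\<lambda>i. h (f i)) \<circ> block_perm ks f) p"
  proof (cases "p < sum_list ks")
    case True
    then obtain j q where p: "j < length ks" "q < ks ! j" "p = block_offset ks j + q" by (rule block_position)
    have "permute_list f ks ! pinv f j = ks ! j"
      using permutes_less[OF f p(1)] permutes_inverses(1)[OF f] by (simp add: permute_list_nth[OF f])
    then show ?thesis
      using p permutes_less[OF h[OF p(1)] p(2)] permutes_less[OF f p(1)] permutes_inverses(1)[OF f]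
      by (simp add: block_sum_offset block_perm_offset)
  next
    case False
    then show ?thesis by (simp add: block_sum_def block_perm_def sum_list_permute[OF f])
  qed
qed

definition block_word :: "nat list \<Rightarrow> (nat \<Rightarrow> 'a) \<Rightarrow> nat \<Rightarrow> 'a list" where
  "block_word ks w i = map (\<lambda>q. w (block_offset ks i + q)) [0..<ks ! i]"

lemma block_word_sum:
  assumes "\<And>i. i < length ks \<Longrightarrow> h i permutes {..<ks ! i}" "i < length ks"
  shows "block_word ks (\<lambda>p. w (pinv (block_sum ks h) p)) i = permute_list (pinv (h i)) (block_word ks w i)"
proof (rule nth_equalityI)
  fix q assume "q < length (block_word ks (\<lambda>p. w (pinv (block_sum ks h) p)) i)"
  then have q: "q < ks ! i" by (simp add: block_word_def)
  have hp: "pinv (h i) permutes {..<length (block_word ks w i)}"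
    using permutes_inv[OF assms(1)[OF assms(2)]] by (simp add: block_word_def)
  have "permute_list (pinv (h i)) (block_word ks w i) ! q = block_word ks w i ! pinv (h i) q"
    by (rule permute_list_nth[OF hp]) (use q in \<open>simp add: block_word_def\<close>)
  then show "block_word ks (\<lambda>p. w (pinv (block_sum ks h) p)) i ! q = permute_list (pinv (h i)) (block_word ks w i) ! q"
    using q permutes_less[OF assms(1)[OF assms(2)] q] inv_block_sum_offset[OF assms q] by (simp add: block_word_def)
qed (simp add: block_word_def)

lemma block_word_perm:
  assumes f: "f permutes {..<length ks}" and i: "i < length ks"
  shows "block_word (permute_list f ks) (\<lambda>p. w (pinv (block_perm ks f) p)) i = block_word ks w (f i)"
  by (rule nth_equalityI) (use i permutes_less[OF f i] inv_block_perm_offset[OF f i] in \<open>auto simp: block_word_def permute_list_nth[OF f]\<close>)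

lemma block_word_cong:
  assumes "\<And>p. p < sum_list ks \<Longrightarrow> w p = w' p" "i < length ks"
  shows "block_word ks w i = block_word ks w' i"
  unfolding block_word_def using assms(1) block_of_offset[OF assms(2)] by (intro map_cong) auto

lemma block_word_determines:
  assumes "\<And>i. i < length ks \<Longrightarrow> block_word ks w i = block_word ks w' i" "p < sum_list ks"
  shows "w p = w' p"
proof -
  obtain i q where p: "i < length ks" "q < ks ! i" "p = block_offset ks i + q" using assms(2) by (rule block_position)
  have "block_word ks w i ! q = block_word ks w' i ! q" using assms(1)[OF p(1)] by simp
  then show ?thesis using p by (simp add: block_word_def)
qed

lemma block_word_concat:
  "i < length ws \<Longrightarrow> block_word (map length ws) (\<lambda>p. concat ws ! p) i = ws ! i"
proof (induction ws arbitrary: i)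
  case (Cons w ws)
  show ?case
  proof (cases i)
    case 0
    then show ?thesis by (auto intro!: nth_equalityI simp: block_word_def block_offset_def nth_append)
  next
    case (Suc j)
    then have "block_word (map length ws) (\<lambda>p. concat ws ! p) j = ws ! j" using Cons by simp
    moreover have "block_word (map length (w # ws)) (\<lambda>p. concat (w # ws) ! p) i = block_word (map length ws) (\<lambda>p. concat ws ! p) j"
      using Suc by (simp add: block_word_def block_offset_def nth_append)
    ultimately show ?thesis using Suc by simp
  qed
qed simp

text \<open>The cocycle property. The inversions of \<open>g \<circ> f\<close> are compared with those of \<open>f\<close> and \<open>g\<close> pair by pair; a pair that is
  inverted by both contributes its sign twice.\<close>

lemma koszul_sign_compose:
  assumes f: "f permutes {..<length ds}" and g: "g permutes {..<length ds}"
  shows "(koszul_sign ds (g \<circ> f) :: 'k::field) = koszul_sign ds g * koszul_sign (permute_list g ds) f"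
proof -
  let ?n = "length ds"
  define P where "P = {(i, j). i < j \<and> j < ?n}"
  define s :: "(nat \<Rightarrow> nat) \<Rightarrow> nat \<Rightarrow> nat \<Rightarrow> 'k" where
    "s D p q = (if q < p then (-1) ^ (D p * D q) else 1)" for D p q
  have finP: "finite P" unfolding P_def by (rule finite_subset[of _ "{..<?n} \<times> {..<?n}"]) auto
  have K: "koszul_sign es f = (\<Prod>(i, j)\<in>P. s (\<lambda>p. es ! p) (f i) (f j))" if "length es = ?n" for es f
  proof -
    have "(\<Prod>(i, j)\<in>P. s (\<lambda>p. es ! p) (f i) (f j)) = (\<Prod>(i, j)\<in>{(i, j). i < j \<and> j < ?n \<and> f j < f i}. s (\<lambda>p. es ! p) (f i) (f j))"
      by (rule prod.mono_neutral_right[OF finP]) (auto simp: P_def s_def split: if_splits)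
    also have "\<dots> = koszul_sign es f"
      unfolding koszul_sign_def that by (rule prod.cong) (auto simp: s_def)
    finally show ?thesis by simp
  qed
  let ?D = "\<lambda>p. ds ! p"
  have fi: "f (pinv f i) = i" "pinv f (f i) = i" for i
    using permutes_inverses[OF f] by auto
  have finj: "f i = f j \<longleftrightarrow> i = j" for i j using fi(2) by metis
  have fiinj: "pinv f i = pinv f j \<longleftrightarrow> i = j" for i j using fi(1) by metis
  have ginj: "g i = g j \<longleftrightarrow> i = j" for i j using permutes_inverses(2)[OF g] by metis
  have re: "(\<Prod>(i, j)\<in>P. s ?D (g i) (g j)) = (\<Prod>(i, j)\<in>P. s ?D (g (min (f i) (f j))) (g (max (f i) (f j))))"
  proof (rule prod.reindex_bij_witness[where
        i = "\<lambda>(i, j). (min (f i) (f j), max (f i) (f j))" and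
        j = "\<lambda>(i, j). (min (pinv f i) (pinv f j), max (pinv f i) (pinv f j))"])
    fix a assume "a \<in> P"
    then obtain i j where a: "a = (i, j)" "i < j" "j < ?n" by (auto simp: P_def)
    have ne: "f i \<noteq> f j" "pinv f i \<noteq> pinv f j" using a finj fiinj by auto
    note lt = permutes_less[OF f, of i] permutes_less[OF f, of j]
    show "(case case a of (i, j) \<Rightarrow> (min (pinv f i) (pinv f j), max (pinv f i) (pinv f j)) of (i, j) \<Rightarrow> (min (f i) (f j), max (f i) (f j))) = a"
      using a ne fi by (cases "pinv f i < pinv f j") (auto simp: min_def max_def)
    show "(case a of (i, j) \<Rightarrow> (min (pinv f i) (pinv f j), max (pinv f i) (pinv f j))) \<in> P"
      using a ne lt by (auto simp: P_def min_def max_def)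
    show "(case case a of (i, j) \<Rightarrow> (min (f i) (f j), max (f i) (f j)) of (i, j) \<Rightarrow> (min (pinv f i) (pinv f j), max (pinv f i) (pinv f j))) = a"
      using a ne fi by (cases "f i < f j") (auto simp: min_def max_def)
    show "(case a of (i, j) \<Rightarrow> (min (f i) (f j), max (f i) (f j))) \<in> P"
      using a ne lt by (auto simp: P_def min_def max_def)
    show "(case case a of (i, j) \<Rightarrow> (min (pinv f i) (pinv f j), max (pinv f i) (pinv f j)) of
        (i, j) \<Rightarrow> s ?D (g (min (f i) (f j))) (g (max (f i) (f j)))) = (case a of (i, j) \<Rightarrow> s ?D (g i) (g j))"
      using a ne fi by (cases "pinv f i < pinv f j") (auto simp: min_def max_def)
  qed
  have pw: "s ?D (g p) (g q) = s ?D (g (min p q)) (g (max p q)) * s (\<lambda>i. ds ! g i) p q" if "p \<noteq> q" for p q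
    using that ginj[of p q]
    by (cases "p < q"; cases "g p < g q") (auto simp: s_def min_def max_def mult.commute simp flip: power_add mult_2)
  have e: "permute_list g ds ! p = ds ! g p" if "p < ?n" for p
    using that by (simp add: permute_list_nth[OF g])
  have "koszul_sign ds (g \<circ> f) = (\<Prod>(i, j)\<in>P. s ?D (g (f i)) (g (f j)))"
    by (simp add: K)
  also have "\<dots> = (\<Prod>(i, j)\<in>P. s ?D (g (min (f i) (f j))) (g (max (f i) (f j))) * s (\<lambda>i. ds ! g i) (f i) (f j))"
    by (rule prod.cong[OF refl]) (use finj in \<open>auto simp: P_def intro!: pw\<close>)
  also have "\<dots> = (\<Prod>(i, j)\<in>P. s ?D (g i) (g j)) * (\<Prod>(i, j)\<in>P. s (\<lambda>i. ds ! g i) (f i) (f j))"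
    unfolding re by (simp add: prod.distrib case_prod_beta)
  also have "(\<Prod>(i, j)\<in>P. s (\<lambda>i. ds ! g i) (f i) (f j)) = (\<Prod>(i, j)\<in>P. s (\<lambda>p. permute_list g ds ! p) (f i) (f j))"
    by (rule prod.cong[OF refl]) (auto simp: P_def s_def e permutes_less[OF f])
  finally show ?thesis by (simp add: K)
qed

lemma koszul_sign_swap:
  assumes "odd d"
  shows "(koszul_sign (d # d # ds) (Transposition.transpose 0 1) :: 'k::field) = -1"
proof -
  have "{(i, j). i < j \<and> j < length (d # d # ds) \<and> Transposition.transpose 0 1 j < Transposition.transpose 0 1 i} = {(0, 1)}"
    by (auto simp: Transposition.transpose_def split: if_splits)
  then show ?thesis using assms by (simp add: koszul_sign_def)
qed

lemma nth_count_unique: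
  assumes "count (mset xs) (xs ! p) \<le> 1" "p < length xs" "q < length xs" "xs ! p = xs ! q"
  shows "p = q"
proof (rule ccontr)
  assume ne: "p \<noteq> q"
  have "count (mset xs) (xs ! p) = card {i. i < length xs \<and> xs ! i = xs ! p}"
    unfolding count_mset count_list_eq_length_filter length_filter_conv_card by (rule arg_cong[where f = card]) auto
  moreover have "card {p, q} \<le> card {i. i < length xs \<and> xs ! i = xs ! p}"
    by (rule card_mono) (use assms in auto)
  ultimately show False using assms(1) ne by simp
qed

text \<open>If no odd letter is repeated, a permutation that fixes the list of letters fixes the positions of all odd
  letters, so it never exchanges two odd factors.\<close>

lemma koszul_sign_stab:
  assumes f: "f \<in> word_stab ls" and odd: "\<And>l. l \<in> set ls \<Longrightarrow> odd (dg l) \<Longrightarrow> count (mset ls) l \<le> 1"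
  shows "(koszul_sign (map dg ls) f :: 'k::field) = 1"
  unfolding koszul_sign_def
proof (rule prod.neutral, clarify)
  fix i j assume ij: "i < j" "j < length (map dg ls)" "f j < f i"
  have fp: "f permutes {..<length ls}" and st: "permute_list f ls = ls" using f by (auto simp: word_stab_def)
  have fx: "ls ! f p = ls ! p" if "p < length ls" for p
    using arg_cong[OF st, of "\<lambda>xs. xs ! p"] unfolding permute_list_nth[OF fp that] .
  have fixp: "f p = p" if "p < length ls" "odd (dg (ls ! p))" for p
    using nth_count_unique[OF odd[OF nth_mem[OF that(1)] that(2)] that(1) permutes_less(1)[OF fp that(1)] fx[OF that(1), symmetric]]
    by (rule sym)
  have "even (dg (ls ! i) * dg (ls ! j))"
  proof (rule ccontr)
    assume "\<not> ?thesis"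
    then have "f i = i" "f j = j" using fixp[of i] fixp[of j] ij by auto
    then show False using ij by linarith
  qed
  moreover have "f i < length ls" "f j < length ls" using permutes_less(1)[OF fp] ij by auto
  ultimately show "(- 1) ^ (map dg ls ! f i * map dg ls ! f j) = (1::'k)" using fx[of i] fx[of j] ij by simp
qed

section \<open>Tensor powers of a symmetric bimodule\<close>

lemma symmetric_bimodule_action:
  assumes "symmetric_bimodule M"
  shows "bi_action (bcomp M m n d) m n (biact M m n d)"
proof -
  note S = assms[unfolded symmetric_bimodule_def, rule_format, of m n d]
  have V: "vspace (bcomp M m n d)" using S by blast
  have L: "lin_on (bcomp M m n d) (bcomp M m n d) (lact M m n d \<sigma>)" if "\<sigma> permutes {..<m}" for \<sigma>
    using S that linear_map_lin_on by blast
  have R: "lin_on (bcomp M m n d) (bcomp M m n d) (ract M m n d \<tau>)" if "\<tau> permutes {..<n}" for \<tau>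
    using S that linear_map_lin_on by blast
  have lin: "lin_on (bcomp M m n d) (bcomp M m n d) (biact M m n d \<sigma> \<tau>)" if "\<sigma> permutes {..<m}" "\<tau> permutes {..<n}" for \<sigma> \<tau>
    using lin_on_comp[OF R[OF that(2)] L[OF permutes_inv[OF that(1)]]]
    unfolding biact_def[abs_def] .
  have id: "biact M m n d id id v = v" if "v \<in> carrier (bcomp M m n d)" for v
    using S that by (simp add: biact_def inv_id)
  have comp: "biact M m n d (\<sigma> \<circ> \<sigma>') (\<tau> \<circ> \<tau>') v = biact M m n d \<sigma>' \<tau>' (biact M m n d \<sigma> \<tau> v)"
    if p: "\<sigma> permutes {..<m}" "\<tau> permutes {..<n}" "\<sigma>' permutes {..<m}" "\<tau>' permutes {..<n}"
      and v: "v \<in> carrier (bcomp M m n d)" for \<sigma> \<tau> \<sigma>' \<tau>' v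
  proof -
    have i: "pinv (\<sigma> \<circ> \<sigma>') = pinv \<sigma>' \<circ> pinv \<sigma>"
      by (rule o_inv_distrib[OF permutes_bij[OF p(1)] permutes_bij[OF p(3)]])
    note p1 = permutes_inv[OF p(1)] and p3 = permutes_inv[OF p(3)]
    have v1: "ract M m n d \<tau> v \<in> carrier (bcomp M m n d)" using lin_on_simps(1)[OF R[OF p(2)] v] .
    have v2: "ract M m n d \<tau>' (ract M m n d \<tau> v) \<in> carrier (bcomp M m n d)" using lin_on_simps(1)[OF R[OF p(4)] v1] .
    have "biact M m n d (\<sigma> \<circ> \<sigma>') (\<tau> \<circ> \<tau>') v =
        lact M m n d (pinv \<sigma>' \<circ> pinv \<sigma>) (ract M m n d \<tau>' (ract M m n d \<tau> v))"
      unfolding biact_def i using S v p by simp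
    also have "\<dots> = lact M m n d (pinv \<sigma>') (lact M m n d (pinv \<sigma>) (ract M m n d \<tau>' (ract M m n d \<tau> v)))"
      using S v2 p1 p3 by blast
    also have "lact M m n d (pinv \<sigma>) (ract M m n d \<tau>' (ract M m n d \<tau> v)) =
        ract M m n d \<tau>' (lact M m n d (pinv \<sigma>) (ract M m n d \<tau> v))"
      using S v1 p1 p(4) by blast
    finally show ?thesis unfolding biact_def[of M m n d \<sigma>' \<tau>'] biact_def[of M m n d \<sigma> \<tau>] .
  qed
  show ?thesis unfolding bi_action_def using V lin id comp by blast
qed

definition homog_update :: "'v homog \<Rightarrow> 'v \<Rightarrow> 'v homog" where
  "homog_update x v = Homog (lar x) (rar x) (hdeg x) v"

lemma homog_update_simps [simp]:
  "lar (homog_update x v) = lar x" "rar (homog_update x v) = rar x"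
  "hdeg (homog_update x v) = hdeg x" "hvec (homog_update x v) = v"
  "homog_update (homog_update x v) w = homog_update x w" "homog_update x (hvec x) = x"
  by (simp_all add: homog_update_def)

lemma map_homog_update [simp]:
  assumes "i < length xs"
  shows "map lar (xs[i := homog_update (xs ! i) v]) = map lar xs"
    "map rar (xs[i := homog_update (xs ! i) v]) = map rar xs"
    "map hdeg (xs[i := homog_update (xs ! i) v]) = map hdeg xs"
  using assms by (simp_all add: map_update list_update_same_conv)

text \<open>The generators obtained by permuting the tensor factors, and by multiplying with an element of the Young
  subgroup on the left.\<close>

abbreviation "perm_factors f xs \<sigma> \<tau> \<equiv> (permute_list f xs, block_perm (map lar xs) f \<circ> \<sigma>, block_perm (map rar xs) f \<circ> \<tau>)"

abbreviation "young_left h h' xs \<sigma> \<tau> \<equiv> (xs, block_sum (map lar xs) h \<circ> \<sigma>, block_sum (map rar xs) h' \<circ> \<tau>)"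

abbreviation space_of :: "('k::field, 'v) bimodule \<Rightarrow> 'v homog \<Rightarrow> ('k, 'v) module" where
  "space_of M x \<equiv> bcomp M (lar x) (rar x) (hdeg x)"

lemma tensor_act_alt: "tensor_act M h h' xs =
  map (\<lambda>i. homog_update (xs ! i) (biact M (lar (xs ! i)) (rar (xs ! i)) (hdeg (xs ! i)) (h i) (h' i) (hvec (xs ! i)))) [0..<length xs]"
  unfolding tensor_act_def by (intro map_cong refl) (simp add: homog_update_def homog.case_eq_if)

lemma tensor_act_simps [simp]:
  "length (tensor_act M h h' xs) = length xs"
  "map lar (tensor_act M h h' xs) = map lar xs"
  "map rar (tensor_act M h h' xs) = map rar xs"
  "map hdeg (tensor_act M h h' xs) = map hdeg xs"
  by (auto simp: tensor_act_alt intro: nth_equalityI)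

text \<open>The \<open>n\<close>-th tensor power in one biarity and degree, with its coinvariants under permutation of the factors, as
  an instance of \<open>presentation\<close>.\<close>

locale tensor_setup =
  fixes M :: "('k::field_char_0, 'v) bimodule" and n a b d :: nat
  assumes M: "symmetric_bimodule M"
begin

abbreviation "TGens \<equiv> tensor_gens M n a b d"

definition "TRels = (\<Union>(xs, \<sigma>, \<tau>)\<in>TGens. \<Union>i<n.
         case xs ! i of Homog k l e _ \<Rightarrow>
           linear_rels (bcomp M k l e) (\<lambda>v. (xs[i := Homog k l e v], \<sigma>, \<tau>))) \<union>
      {single (tensor_act M h h' xs, \<sigma>, \<tau>) 1 -
       single (young_left h h' xs \<sigma> \<tau>) (1::'k)
       | xs \<sigma> \<tau> h h'. (xs, \<sigma>, \<tau>) \<in> TGens \<and>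
           (\<forall>i<n. h i permutes {..<lar (xs ! i)} \<and> h' i permutes {..<rar (xs ! i)})}"

definition "factor_perms = {f. f permutes {..<n}}"

definition "factor_perm_gen = (\<lambda>f g. case g of (xs, \<sigma>, \<tau>) \<Rightarrow> single
        (perm_factors f xs \<sigma> \<tau>)
        (koszul_sign (map hdeg xs) f :: 'k))"

lemma space_vspace: "vspace (bcomp M k l e)"
  using M unfolding symmetric_bimodule_def by blast

lemmas action = symmetric_bimodule_action[OF M, unfolded bi_action_def, THEN conjunct2]

lemma action_lin: "\<sigma> permutes {..<k} \<Longrightarrow> \<tau> permutes {..<l} \<Longrightarrow>
    lin_on (bcomp M k l e) (bcomp M k l e) (biact M k l e \<sigma> \<tau>)"
  using action by blast

lemma action_comp: "\<sigma> permutes {..<k} \<Longrightarrow> \<tau> permutes {..<l} \<Longrightarrow> \<sigma>' permutes {..<k} \<Longrightarrow> \<tau>' permutes {..<l} \<Longrightarrow>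
    v \<in> carrier (bcomp M k l e) \<Longrightarrow>
    biact M k l e (\<sigma> \<circ> \<sigma>') (\<tau> \<circ> \<tau>') v = biact M k l e \<sigma>' \<tau>' (biact M k l e \<sigma> \<tau> v)"
  using action by blast

lemma action_id: "v \<in> carrier (bcomp M k l e) \<Longrightarrow> biact M k l e id id v = v"
  using action by blast

lemma TGens_iff: "(xs, \<sigma>, \<tau>) \<in> TGens \<longleftrightarrow> length xs = n \<and>
     (\<forall>i<n. hvec (xs ! i) \<in> carrier (space_of M (xs ! i))) \<and>
     sum_list (map lar xs) = a \<and> sum_list (map rar xs) = b \<and> sum_list (map hdeg xs) = d \<and>
     \<sigma> permutes {..<a} \<and> \<tau> permutes {..<b}"
  by (auto simp: tensor_gens_def all_set_conv_all_nth)

lemma TRelsE: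
  assumes "p \<in> TRels"
  obtains (lin) xs \<sigma> \<tau> i where "(xs, \<sigma>, \<tau>) \<in> TGens" "i < n"
      "p \<in> linear_rels (space_of M (xs ! i)) (\<lambda>v. (xs[i := homog_update (xs ! i) v], \<sigma>, \<tau>))"
    | (young) xs \<sigma> \<tau> h h' where "(xs, \<sigma>, \<tau>) \<in> TGens"
      "\<And>i. i < n \<Longrightarrow> h i permutes {..<lar (xs ! i)}" "\<And>i. i < n \<Longrightarrow> h' i permutes {..<rar (xs ! i)}"
      "p = single (tensor_act M h h' xs, \<sigma>, \<tau>) 1 -
       single (young_left h h' xs \<sigma> \<tau>) 1"
  using assms unfolding TRels_def homog_update_def homog.case_eq_if by blast

lemma TRels_lin:
  assumes "(xs, \<sigma>, \<tau>) \<in> TGens" "i < n"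
  shows "linear_rels (space_of M (xs ! i)) (\<lambda>v. (xs[i := homog_update (xs ! i) v], \<sigma>, \<tau>)) \<subseteq> TRels"
  using assms unfolding TRels_def homog_update_def homog.case_eq_if by blast

lemma TRels_young:
  assumes "(xs, \<sigma>, \<tau>) \<in> TGens"
      "\<And>i. i < n \<Longrightarrow> h i permutes {..<lar (xs ! i)}" "\<And>i. i < n \<Longrightarrow> h' i permutes {..<rar (xs ! i)}"
  shows "single (tensor_act M h h' xs, \<sigma>, \<tau>) 1 -
       single (young_left h h' xs \<sigma> \<tau>) 1 \<in> TRels"
  using assms unfolding TRels_def by blast

lemma TGens_update:
  assumes "(xs, \<sigma>, \<tau>) \<in> TGens" "i < n" "v \<in> carrier (space_of M (xs ! i))"
  shows "(xs[i := homog_update (xs ! i) v], \<sigma>, \<tau>) \<in> TGens"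
  using assms unfolding TGens_iff by (auto simp: nth_list_update)

lemma TGens_act:
  assumes "(xs, \<sigma>, \<tau>) \<in> TGens"
      "\<And>i. i < n \<Longrightarrow> h i permutes {..<lar (xs ! i)}" "\<And>i. i < n \<Longrightarrow> h' i permutes {..<rar (xs ! i)}"
  shows "(tensor_act M h h' xs, \<sigma>, \<tau>) \<in> TGens"
    "(young_left h h' xs \<sigma> \<tau>) \<in> TGens"
proof -
  note A = assms(1)[unfolded TGens_iff]
  show "(tensor_act M h h' xs, \<sigma>, \<tau>) \<in> TGens"
  proof -
    have "tensor_act M h h' xs ! i = homog_update (xs ! i)
        (biact M (lar (xs ! i)) (rar (xs ! i)) (hdeg (xs ! i)) (h i) (h' i) (hvec (xs ! i)))" if "i < n" for i
      using that A by (simp add: tensor_act_alt)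
    then show ?thesis using A lin_on_simps(1)[OF action_lin[OF assms(2,3)]] unfolding TGens_iff by simp
  qed
  have "block_sum (map lar xs) h permutes {..<a}"
    using block_sum_permutes[of "map lar xs" h] assms(2) A by simp
  moreover have "block_sum (map rar xs) h' permutes {..<b}"
    using block_sum_permutes[of "map rar xs" h'] assms(3) A by simp
  ultimately show "(young_left h h' xs \<sigma> \<tau>) \<in> TGens"
    using A permutes_compose unfolding TGens_iff by blast
qed

lemma permute_map_sel:
  assumes "f permutes {..<n}" "length xs = n"
  shows "map g (permute_list f xs) = permute_list f (map g xs)"
  using permute_list_map[of f xs g] assms by simp

lemma TGens_permute:
  assumes "(xs, \<sigma>, \<tau>) \<in> TGens" "f permutes {..<n}"
  shows "(perm_factors f xs \<sigma> \<tau>) \<in> TGens"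
proof -
  note A = assms(1)[unfolded TGens_iff]
  have len: "length xs = n" using A by simp
  have nth: "permute_list f xs ! i = xs ! f i" "f i < n" if "i < n" for i
    using permute_list_nth[of f xs i] permutes_less(1)[OF assms(2)] that assms(2) len by auto
  have s: "sum_list (map g (permute_list f xs)) = sum_list (map g xs)" for g :: "'v homog \<Rightarrow> nat"
    unfolding permute_map_sel[OF assms(2) len] by (rule sum_list_permute) (use assms(2) len in simp)
  have "block_perm (map lar xs) f permutes {..<a}"
    using block_perm_permutes[of f "map lar xs"] assms(2) A by simp
  moreover have "block_perm (map rar xs) f permutes {..<b}"
    using block_perm_permutes[of f "map rar xs"] assms(2) A by simp
  ultimately have "block_perm (map lar xs) f \<circ> \<sigma> permutes {..<a}" "block_perm (map rar xs) f \<circ> \<tau> permutes {..<b}"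
    using A permutes_compose by blast+
  then show ?thesis using A nth s unfolding TGens_iff by simp
qed

lemma TRels_sub: "TRels \<subseteq> carrier (free_space TGens)"
proof
  fix p assume "p \<in> TRels"
  then show "p \<in> carrier (free_space TGens)"
  proof (cases rule: TRelsE)
    case (lin xs \<sigma> \<tau> i)
    show ?thesis
      by (rule subsetD[OF linear_rels_sub[OF space_vspace TGens_update[OF lin(1,2)]] lin(3)])
  next
    case (young xs \<sigma> \<tau> h h')
    have "(tensor_act M h h' xs, \<sigma>, \<tau>) \<in> TGens"
      "(young_left h h' xs \<sigma> \<tau>) \<in> TGens"
      by (rule TGens_act[OF young(1-3)]; assumption)+
    then show ?thesis unfolding young(4) by (intro free_space_closed(1) single_in_free_space)
  qed
qed

lemma tensor_act_permute:
  assumes "f permutes {..<n}" "length xs = n"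
  shows "permute_list f (tensor_act M h h' xs) = tensor_act M (\<lambda>i. h (f i)) (\<lambda>i. h' (f i)) (permute_list f xs)"
proof (rule nth_equalityI)
  fix i assume "i < length (permute_list f (tensor_act M h h' xs))"
  then have i: "i < n" "f i < n" using assms permutes_less(1)[OF assms(1)] by auto
  have f: "f permutes {..<length xs}" "f permutes {..<length (tensor_act M h h' xs)}" using assms by auto
  show "permute_list f (tensor_act M h h' xs) ! i = tensor_act M (\<lambda>i. h (f i)) (\<lambda>i. h' (f i)) (permute_list f xs) ! i"
    using i assms by (simp add: permute_list_nth[OF f(1)] permute_list_nth[OF f(2)]) (simp add: tensor_act_alt permute_list_nth[OF f(1)])
qed simp

sublocale P: presentation TGens TRels factor_perms factor_perm_gen
proof
  show "TRels \<subseteq> carrier (free_space TGens)" by (rule TRels_sub)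
  show "factor_perm_gen f g \<in> carrier (free_space TGens)" if "f \<in> factor_perms" "g \<in> TGens" for f g
  proof -
    obtain xs \<sigma> \<tau> where g: "g = (xs, \<sigma>, \<tau>)" by (cases g)
    show ?thesis unfolding factor_perm_gen_def g prod.case
      by (rule single_in_free_space, rule TGens_permute) (use that g in \<open>auto simp: factor_perms_def\<close>)
  qed
  note sub = vspan_sub[OF free_space_vspace TRels_sub]
  show "lin_ext (factor_perm_gen f) p \<in> vspan (free_space TGens) TRels" if f: "f \<in> factor_perms" and p: "p \<in> TRels" for f p
  proof -
    have fp: "f permutes {..<n}" using f by (simp add: factor_perms_def)
    from p have "\<exists>p'\<in>TRels. \<exists>c. lin_ext (factor_perm_gen f) p = smul c p'"
    proof (cases rule: TRelsE)
      case (lin xs \<sigma> \<tau> i)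
      have len: "length xs = n" using lin(1) by (simp add: TGens_iff)
      have fl: "f permutes {..<length xs}" and il: "i < length xs" using fp len lin(2) by auto
      let ?j = "pinv f i" and ?ys = "permute_list f xs"
      have j: "?j < n" using permutes_less(2)[OF fp lin(2)] .
      have yj: "?ys ! ?j = xs ! i" using permute_list_nth[OF fl, of ?j] j len permutes_inverses(1)[OF fp] by simp
      have e: "factor_perm_gen f (xs[i := homog_update (xs ! i) v], \<sigma>, \<tau>) = single
          (?ys[?j := homog_update (?ys ! ?j) v], block_perm (map lar xs) f \<circ> \<sigma>, block_perm (map rar xs) f \<circ> \<tau>)
          (koszul_sign (map hdeg xs) f)" for v
        unfolding factor_perm_gen_def prod.case yj by (simp only: map_homog_update[OF il] permute_list_update[OF fl il])
      have "\<exists>p'\<in>linear_rels (space_of M (?ys ! ?j)) (\<lambda>v. (?ys[?j := homog_update (?ys ! ?j) v], block_perm (map lar xs) f \<circ> \<sigma>, block_perm (map rar xs) f \<circ> \<tau>)).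
          lin_ext (factor_perm_gen f) p = Poly_Mapping.map ((*) (koszul_sign (map hdeg xs) f)) p'"
        unfolding yj by (rule linear_rels_transport[OF lin(3) _ space_vspace, where f = "\<lambda>v. v"]) (use e[unfolded yj] in \<open>auto simp: lin_on_def\<close>)
      then show ?thesis using TRels_lin[OF TGens_permute[OF lin(1) fp] j] by blast
    next
      case (young xs \<sigma> \<tau> h h')
      have len: "length xs = n" using young(1) by (simp add: TGens_iff)
      have fl: "f permutes {..<length xs}" using fp len by auto
      let ?ys = "permute_list f xs" and ?bl = "block_perm (map lar xs) f" and ?br = "block_perm (map rar xs) f"
      have yn: "?ys ! i = xs ! f i" "f i < n" if "i < n" for i
        using permute_list_nth[OF fl] permutes_less(1)[OF fp] that len by auto
      let ?p = "single (tensor_act M (\<lambda>i. h (f i)) (\<lambda>i. h' (f i)) ?ys, ?bl \<circ> \<sigma>, ?br \<circ> \<tau>) (1::'k) -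
        single (?ys, block_sum (map lar ?ys) (\<lambda>i. h (f i)) \<circ> (?bl \<circ> \<sigma>), block_sum (map rar ?ys) (\<lambda>i. h' (f i)) \<circ> (?br \<circ> \<tau>)) 1"
      have pr: "?p \<in> TRels" by (rule TRels_young[OF TGens_permute[OF young(1) fp]]) (use young(2,3) yn in auto)
      have bl: "?bl \<circ> (block_sum (map lar xs) h \<circ> \<sigma>) = block_sum (map lar ?ys) (\<lambda>i. h (f i)) \<circ> (?bl \<circ> \<sigma>)"
        using block_perm_block_sum[of f "map lar xs" h] fl young(2) len permute_map_sel[OF fp len, of lar] by (simp add: comp_assoc[symmetric])
      have br: "?br \<circ> (block_sum (map rar xs) h' \<circ> \<tau>) = block_sum (map rar ?ys) (\<lambda>i. h' (f i)) \<circ> (?br \<circ> \<tau>)"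
        using block_perm_block_sum[of f "map rar xs" h'] fl young(3) len permute_map_sel[OF fp len, of rar] by (simp add: comp_assoc[symmetric])
      have "lin_ext (factor_perm_gen f) p = Poly_Mapping.map ((*) (koszul_sign (map hdeg xs) f)) ?p"
        unfolding young(4) lin_ext_minus lin_ext_single factor_perm_gen_def prod.case map_times_minus
        by (simp add: tensor_act_permute[OF fp len] bl br)
      then show ?thesis using pr by blast
    qed
    then obtain p' c where "p' \<in> vspan (free_space TGens) TRels" "lin_ext (factor_perm_gen f) p = smul c p'"
      using sub(2) by blast
    then show ?thesis using sub(6)[of p' c] by simp
  qed
qed

lemma tensor_power_eq: "bcomp (tensor_power M n) a b d = P.U"
  by (simp add: tensor_power_def tensor_rels_def TRels_def)

lemma tensor_map_eq: "tensor_map M n a b d \<delta> = quot_map P.FS P.RR (lin_ext \<delta>)"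
  by (simp add: tensor_map_def tensor_rels_def TRels_def)

lemma tensor_sym_eq: "tensor_sym M n a b d = P.act"
  unfolding tensor_sym_def[abs_def] tensor_map_eq factor_perm_gen_def by (rule ext) (simp add: case_prod_beta)

definition right_shift :: "(nat \<Rightarrow> nat) \<Rightarrow> (nat \<Rightarrow> nat) \<Rightarrow> 'v tgen \<Rightarrow> ('v tgen \<Rightarrow>\<^sub>0 'k)" where
  "right_shift \<rho> \<rho>' g = (case g of (xs, \<sigma>, \<tau>) \<Rightarrow> single (xs, \<sigma> \<circ> \<rho>, \<tau> \<circ> \<rho>') 1)"

definition right_map :: "(nat \<Rightarrow> nat) \<Rightarrow> (nat \<Rightarrow> nat) \<Rightarrow> ('v tgen \<Rightarrow>\<^sub>0 'k) set set \<Rightarrow> ('v tgen \<Rightarrow>\<^sub>0 'k) set set" where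
  "right_map \<rho> \<rho>' = quot_map P.U P.CR (quot_map P.FS P.RR (lin_ext (right_shift \<rho> \<rho>')))"

text \<open>The right action on the coinvariants, first \<open>\<tau>\<close> and then \<open>\<sigma>\<close> as in \<open>biact\<close>. Both factors act on generators by right
  multiplication, so they commute with the permutation of the tensor factors.\<close>

definition right_biact :: "(nat \<Rightarrow> nat) \<Rightarrow> (nat \<Rightarrow> nat) \<Rightarrow> ('v tgen \<Rightarrow>\<^sub>0 'k) set set \<Rightarrow> ('v tgen \<Rightarrow>\<^sub>0 'k) set set" where
  "right_biact \<sigma> \<tau> q = right_map \<sigma> id (right_map id \<tau> q)"

lemma TGens_right:
  assumes "(xs, \<sigma>, \<tau>) \<in> TGens" "\<rho> permutes {..<a}" "\<rho>' permutes {..<b}"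
  shows "(xs, \<sigma> \<circ> \<rho>, \<tau> \<circ> \<rho>') \<in> TGens"
  using assms permutes_compose[OF assms(2), of \<sigma>] permutes_compose[OF assms(3), of \<tau>] unfolding TGens_iff by blast

lemma right_map_facts:
  assumes r: "\<rho> permutes {..<a}" "\<rho>' permutes {..<b}"
  shows "lin_on P.Q P.Q (right_map \<rho> \<rho>')"
    and "\<And>xs \<sigma> \<tau>. (xs, \<sigma>, \<tau>) \<in> TGens \<Longrightarrow> right_map \<rho> \<rho>' (P.sym (xs, \<sigma>, \<tau>)) = P.sym (xs, \<sigma> \<circ> \<rho>, \<tau> \<circ> \<rho>')"
proof -
  have m1: "smul (1::'k) p = p" for p :: "'v tgen \<Rightarrow>\<^sub>0 'k"
    by (rule poly_mapping_eqI) (simp add: lookup_map_times)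
  have gen: "right_shift \<rho> \<rho>' g \<in> carrier P.FS" if "g \<in> TGens" for g
  proof -
    obtain xs \<sigma> \<tau> where g: "g = (xs, \<sigma>, \<tau>)" by (cases g)
    show ?thesis unfolding right_shift_def g prod.case
      by (rule single_in_free_space, rule TGens_right) (use that g r in auto)
  qed
  have rels: "lin_ext (right_shift \<rho> \<rho>') p \<in> P.RR" if "p \<in> TRels" for p
  proof -
    from that have "lin_ext (right_shift \<rho> \<rho>') p \<in> TRels"
    proof (cases rule: TRelsE)
      case (lin xs \<sigma> \<tau> i)
      have "\<exists>p'\<in>linear_rels (space_of M (xs ! i)) (\<lambda>v. (xs[i := homog_update (xs ! i) v], \<sigma> \<circ> \<rho>, \<tau> \<circ> \<rho>')).
          lin_ext (right_shift \<rho> \<rho>') p = smul 1 p'"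
        by (rule linear_rels_transport[OF lin(3) _ space_vspace, where f = "\<lambda>v. v"]) (auto simp: lin_on_def right_shift_def)
      then show ?thesis using TRels_lin[OF TGens_right[OF lin(1) r] lin(2)] unfolding m1 by blast
    next
      case (young xs \<sigma> \<tau> h h')
      have "lin_ext (right_shift \<rho> \<rho>') p = single (tensor_act M h h' xs, \<sigma> \<circ> \<rho>, \<tau> \<circ> \<rho>') 1 -
         single (xs, block_sum (map lar xs) h \<circ> (\<sigma> \<circ> \<rho>), block_sum (map rar xs) h' \<circ> (\<tau> \<circ> \<rho>')) 1"
        unfolding young(4) lin_ext_minus lin_ext_single right_shift_def prod.case m1 comp_assoc ..
      then show ?thesis using TRels_young[OF TGens_right[OF young(1) r] young(2,3)] by simp
    qed
    then show ?thesis using vspan_sub(2)[OF free_space_vspace TRels_sub] by auto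
  qed
  have comm: "lin_ext (right_shift \<rho> \<rho>') (factor_perm_gen f g) = lin_ext (factor_perm_gen f) (right_shift \<rho> \<rho>' g)" if "f \<in> factor_perms" "g \<in> TGens" for f g
    by (cases g) (simp add: factor_perm_gen_def right_shift_def lin_ext_single m1 comp_assoc)
  show "lin_on P.Q P.Q (right_map \<rho> \<rho>')" unfolding right_map_def by (rule P.endo(1)[OF gen rels comm])
  have E: "right_map \<rho> \<rho>' (P.proj p) = P.proj (lin_ext (right_shift \<rho> \<rho>') p)" if "p \<in> carrier P.FS" for p
    unfolding right_map_def by (rule P.endo(2)[OF gen rels comm]) (use that in auto)
  fix xs \<sigma> \<tau> assume g: "(xs, \<sigma>, \<tau>) \<in> TGens"
  show "right_map \<rho> \<rho>' (P.sym (xs, \<sigma>, \<tau>)) = P.sym (xs, \<sigma> \<circ> \<rho>, \<tau> \<circ> \<rho>')"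
    unfolding P.sym_def E[OF single_in_free_space[OF g]] by (simp add: lin_ext_single m1 right_shift_def)
qed

lemma right_biact_sym:
  assumes "\<rho> permutes {..<a}" "\<rho>' permutes {..<b}" "(xs, \<sigma>, \<tau>) \<in> TGens"
  shows "right_biact \<rho> \<rho>' (P.sym (xs, \<sigma>, \<tau>)) = P.sym (xs, \<sigma> \<circ> \<rho>, \<tau> \<circ> \<rho>')"
  using right_map_facts(2)[OF permutes_id assms(2,3)]
    right_map_facts(2)[OF assms(1) permutes_id TGens_right[OF assms(3) permutes_id assms(2)]]
  by (simp add: right_biact_def)

lemma right_biact_lin: "\<rho> permutes {..<a} \<Longrightarrow> \<rho>' permutes {..<b} \<Longrightarrow> lin_on P.Q P.Q (right_biact \<rho> \<rho>')"
  unfolding right_biact_def[abs_def] by (rule lin_on_comp[OF right_map_facts(1)[OF permutes_id] right_map_facts(1)[OF _ permutes_id]])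

lemma right_biact_action: "bi_action P.Q a b right_biact"
proof -
  have S: "P.sym ` TGens \<subseteq> carrier P.Q" using P.sym_carrier by auto
  have id: "right_biact id id q = q" if "q \<in> carrier P.Q" for q
    by (rule lin_on_eq[OF P.Q_vspace P.Q_vspace right_biact_lin[OF permutes_id permutes_id] _ S P.Q_span[OF that]])
      (auto simp: lin_on_def right_biact_sym[OF permutes_id permutes_id])
  have comp: "right_biact (\<sigma> \<circ> \<sigma>') (\<tau> \<circ> \<tau>') q = right_biact \<sigma>' \<tau>' (right_biact \<sigma> \<tau> q)"
    if p: "\<sigma> permutes {..<a}" "\<tau> permutes {..<b}" "\<sigma>' permutes {..<a}" "\<tau>' permutes {..<b}" and q: "q \<in> carrier P.Q" for \<sigma> \<tau> \<sigma>' \<tau>' q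
  proof (rule lin_on_eq[OF P.Q_vspace P.Q_vspace right_biact_lin[OF permutes_compose[OF p(3,1)] permutes_compose[OF p(4,2)]]
          lin_on_comp[OF right_biact_lin[OF p(1,2)] right_biact_lin[OF p(3,4)]] S P.Q_span[OF q]])
    fix g assume "g \<in> P.sym ` TGens"
    then obtain xs s t where g: "g = P.sym (xs, s, t)" "(xs, s, t) \<in> TGens" by auto
    show "right_biact (\<sigma> \<circ> \<sigma>') (\<tau> \<circ> \<tau>') g = right_biact \<sigma>' \<tau>' (right_biact \<sigma> \<tau> g)"
      unfolding g(1) right_biact_sym[OF permutes_compose[OF p(3,1)] permutes_compose[OF p(4,2)] g(2)] right_biact_sym[OF p(1,2) g(2)]
        right_biact_sym[OF p(3,4) TGens_right[OF g(2) p(1,2)]] by (simp only: comp_assoc)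
  qed
  show ?thesis unfolding bi_action_def
    by (intro conjI allI impI ballI P.Q_vspace right_biact_lin id comp; (elim conjE, assumption)?)
qed

end

section \<open>Letters\<close>

lemma (in presentation) proj_single: "g \<in> Gens \<Longrightarrow> proj (single g c) = c \<odot>\<^bsub>Q\<^esub> sym g"
  using lin_on_simps(3)[OF proj_lin_on single_in_free_space[of g Gens 1], of c] by (simp add: sym_def)

lemma concat_block_words:
  "concat (map (block_word ks w) [0..<length ks]) = map w [0..<sum_list ks]"
proof (induction ks arbitrary: w)
  case (Cons k ks)
  have "map (block_word (k # ks) w) [0..<length (k # ks)] =
      map w [0..<k] # map (block_word ks (\<lambda>p. w (k + p))) [0..<length ks]"
    by (rule nth_equalityI)
      (auto simp: nth_Cons' block_word_def block_offset_def nth_append add.assoc split: nat.split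
        simp del: upt_Suc dest!: gr0_implies_Suc)
  moreover have "map w [0..<k] @ map (\<lambda>p. w (k + p)) [0..<sum_list ks] = map w [0..<k + sum_list ks]"
    by (rule nth_equalityI) (auto simp: nth_append)
  ultimately show ?case using Cons.IH by simp
qed simp

definition perm2 :: "nat \<Rightarrow> nat \<Rightarrow> ((nat \<Rightarrow> nat) \<times> (nat \<Rightarrow> nat)) set" where
  "perm2 k l = {\<sigma>. \<sigma> permutes {..<k}} \<times> {\<tau>. \<tau> permutes {..<l}}"

lemma perm2D: "g \<in> perm2 k l \<Longrightarrow> fst g permutes {..<k}" "g \<in> perm2 k l \<Longrightarrow> snd g permutes {..<l}"
  by (auto simp: perm2_def)

lemma finite_perm2: "finite (perm2 k l)"
  by (simp add: perm2_def finite_permutations)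

type_synonym letter = "(var \<Rightarrow>\<^sub>0 nat) \<times> nat"

text \<open>A dual system in every weight of \<open>M\<close>. The number \<open>c \<gamma>\<close> is the dimension of the weight space of \<open>\<gamma>\<close>, and \<open>(\<gamma>, t)\<close> with
  \<open>t < c \<gamma>\<close> names its \<open>t\<close>-th basis vector.\<close>

locale letter_system =
  fixes M :: "('k::field_char_0, 'v) bimodule"
    and c :: "(var \<Rightarrow>\<^sub>0 nat) \<Rightarrow> nat"
    and ev :: "(var \<Rightarrow>\<^sub>0 nat) \<Rightarrow> nat \<Rightarrow> 'v"
    and ps :: "(var \<Rightarrow>\<^sub>0 nat) \<Rightarrow> nat \<Rightarrow> 'v \<Rightarrow> 'k"
  assumes sym_M: "symmetric_bimodule M"
    and sys: "\<And>\<gamma>. dual_system (bcomp M (length (wordX \<gamma>)) (length (wordY \<gamma>)) (lookup \<gamma> Hbar))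
      (stab_rels (bcomp M (length (wordX \<gamma>)) (length (wordY \<gamma>)) (lookup \<gamma> Hbar))
        (biact M (length (wordX \<gamma>)) (length (wordY \<gamma>)) (lookup \<gamma> Hbar)) (wordX \<gamma>) (wordY \<gamma>))
      {..<c \<gamma>} (ev \<gamma>) (ps \<gamma>)"
begin

abbreviation "mx \<gamma> \<equiv> length (wordX \<gamma>)"
abbreviation "my \<gamma> \<equiv> length (wordY \<gamma>)"
abbreviation "hb \<gamma> \<equiv> lookup \<gamma> Hbar"

definition valid :: "letter \<Rightarrow> bool" where
  "valid l \<longleftrightarrow> snd l < c (fst l)"

text \<open>The coordinate of a homogeneous element, decorated with two words, along the letter \<open>l\<close>: it sums over all
  ways to carry the words to the standard words of \<open>l\<close>, and is zero unless the biarity and the degree match.\<close>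

definition letter_value :: "letter \<Rightarrow> 'v homog \<times> nat list \<times> nat list \<Rightarrow> 'k" where
  "letter_value l z = (case z of (x, w, w') \<Rightarrow>
     if lar x = mx (fst l) \<and> rar x = my (fst l) \<and> hdeg x = hb (fst l)
     then \<Sum>g\<in>perm2 (lar x) (rar x).
       of_bool (permute_list (fst g) w = wordX (fst l) \<and> permute_list (snd g) w' = wordY (fst l)) *
       ps (fst l) (snd l) (biact M (lar x) (rar x) (hdeg x) (fst g) (snd g) (hvec x))
     else 0)"

definition letter_elem :: "letter \<Rightarrow> 'v homog \<times> nat list \<times> nat list" where
  "letter_elem l = (Homog (mx (fst l)) (my (fst l)) (hb (fst l)) (ev (fst l) (snd l)), wordX (fst l), wordY (fst l))"

definition letter_norm :: "letter \<Rightarrow> 'k" where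
  "letter_norm l = of_nat (card (word_stab (wordX (fst l)) \<times> word_stab (wordY (fst l))))"

lemma sysD:
  assumes "valid l"
  shows "linear_form (bcomp M (mx (fst l)) (my (fst l)) (hb (fst l))) (ps (fst l) (snd l))"
    "ev (fst l) (snd l) \<in> carrier (bcomp M (mx (fst l)) (my (fst l)) (hb (fst l)))"
    "\<And>\<sigma> \<tau> v. \<sigma> \<in> word_stab (wordX (fst l)) \<Longrightarrow> \<tau> \<in> word_stab (wordY (fst l)) \<Longrightarrow>
      v \<in> carrier (bcomp M (mx (fst l)) (my (fst l)) (hb (fst l))) \<Longrightarrow>
      ps (fst l) (snd l) (biact M (mx (fst l)) (my (fst l)) (hb (fst l)) \<sigma> \<tau> v) = ps (fst l) (snd l) v"
proof -
  note D = sys[of "fst l", unfolded dual_system_def] and A = symmetric_bimodule_action[OF sym_M, unfolded bi_action_def, of "mx (fst l)" "my (fst l)" "hb (fst l)"]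
  let ?V = "bcomp M (mx (fst l)) (my (fst l)) (hb (fst l))"
  have V: "vspace ?V" using A by blast
  show lf: "linear_form ?V (ps (fst l) (snd l))" using D assms by (auto simp: valid_def)
  show "ev (fst l) (snd l) \<in> carrier ?V" using D assms by (auto simp: valid_def)
  fix \<sigma> \<tau> v assume st: "\<sigma> \<in> word_stab (wordX (fst l))" "\<tau> \<in> word_stab (wordY (fst l))" and v: "v \<in> carrier ?V"
  let ?B = "biact M (mx (fst l)) (my (fst l)) (hb (fst l))"
  have p: "\<sigma> permutes {..<mx (fst l)}" "\<tau> permutes {..<my (fst l)}" using st by (auto simp: word_stab_def)
  have linB: "lin_on ?V ?V (?B \<sigma> \<tau>)" using A p by blast
  note Bv = lin_on_simps(1)[OF linB v]
  have "?B \<sigma> \<tau> v \<ominus>\<^bsub>?V\<^esub> v \<in> stab_rels ?V ?B (wordX (fst l)) (wordY (fst l))"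
    unfolding stab_rels_def using st v by blast
  then have "ps (fst l) (snd l) (?B \<sigma> \<tau> v \<ominus>\<^bsub>?V\<^esub> v) = 0" using D assms by (simp add: valid_def)
  then show "ps (fst l) (snd l) (?B \<sigma> \<tau> v) = ps (fst l) (snd l) v"
    using linear_form_simps(4)[OF lf V Bv v] by simp
qed

lemma sysD_delta:
  assumes "valid l" "valid l'" "fst l' = fst l"
  shows "ps (fst l) (snd l) (ev (fst l) (snd l')) = of_bool (l = l')"
  using sys[of "fst l", unfolded dual_system_def] assms by (auto simp: valid_def prod_eq_iff)

lemma letter_value_linear:
  assumes "valid l"
  shows "linear_form (space_of M x) (\<lambda>v. letter_value l (homog_update x v, w, w'))"
proof (cases "lar x = mx (fst l) \<and> rar x = my (fst l) \<and> hdeg x = hb (fst l)")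
  case True
  have "linear_form (space_of M x) (\<lambda>v. \<Sum>g\<in>perm2 (lar x) (rar x).
       of_bool (permute_list (fst g) w = wordX (fst l) \<and> permute_list (snd g) w' = wordY (fst l)) *
       ps (fst l) (snd l) (biact M (lar x) (rar x) (hdeg x) (fst g) (snd g) v))"
  proof (rule linear_form_sum)
    fix g assume "g \<in> perm2 (lar x) (rar x)"
    then have lin: "lin_on (space_of M x) (space_of M x) (biact M (lar x) (rar x) (hdeg x) (fst g) (snd g))"
      using symmetric_bimodule_action[OF sym_M, unfolded bi_action_def] perm2D by blast
    have lf: "linear_form (space_of M x) (ps (fst l) (snd l))" using sysD(1)[OF assms] True by simp
    show "linear_form (space_of M x) (\<lambda>v. ps (fst l) (snd l) (biact M (lar x) (rar x) (hdeg x) (fst g) (snd g) v))"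
      by (rule linear_form_comp[OF lin lf])
  qed
  then show ?thesis using True by (simp add: letter_value_def)
next
  case False
  then have "(\<lambda>v. letter_value l (homog_update x v, w, w')) = (\<lambda>_. 0)" by (auto simp: letter_value_def)
  then show ?thesis by (simp add: linear_form_def)
qed

text \<open>Acting on the element or on its words amounts to a reindexing of the sum. This identity makes the forms below
  compatible with the induction from Young subgroups.\<close>

lemma letter_value_equivariant:
  assumes g: "g permutes {..<lar x}" "g' permutes {..<rar x}" and w: "length w = lar x" "length w' = rar x"
    and x: "hvec x \<in> carrier (space_of M x)"
  shows "letter_value l (homog_update x (biact M (lar x) (rar x) (hdeg x) g g' (hvec x)), w, w') =
    letter_value l (x, permute_list (pinv g) w, permute_list (pinv g') w')"
proof -
  let ?B = "biact M (lar x) (rar x) (hdeg x)" and ?ps = "ps (fst l) (snd l)"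
  have "(\<Sum>h\<in>perm2 (lar x) (rar x).
       of_bool (permute_list (fst h) w = wordX (fst l) \<and> permute_list (snd h) w' = wordY (fst l)) *
       ?ps (?B (fst h) (snd h) (?B g g' (hvec x)))) =
     (\<Sum>h\<in>perm2 (lar x) (rar x).
       of_bool (permute_list (fst h) (permute_list (pinv g) w) = wordX (fst l) \<and>
          permute_list (snd h) (permute_list (pinv g') w') = wordY (fst l)) *
       ?ps (?B (fst h) (snd h) (hvec x)))"
  proof (rule sum.reindex_bij_witness[where i = "\<lambda>h. (pinv g \<circ> fst h, pinv g' \<circ> snd h)"
        and j = "\<lambda>h. (g \<circ> fst h, g' \<circ> snd h)"])
    fix h assume h: "h \<in> perm2 (lar x) (rar x)"
    note hp = perm2D[OF h]
    note gi = permutes_inv[OF g(1)] permutes_inv[OF g(2)]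
    have c1: "pinv g \<circ> (g \<circ> \<rho>) = \<rho>" "g \<circ> (pinv g \<circ> \<rho>) = \<rho>" for \<rho> :: "nat \<Rightarrow> nat"
      using permutes_inv_o[OF g(1)] by (simp_all flip: comp_assoc)
    have c2: "pinv g' \<circ> (g' \<circ> \<rho>) = \<rho>" "g' \<circ> (pinv g' \<circ> \<rho>) = \<rho>" for \<rho> :: "nat \<Rightarrow> nat"
      using permutes_inv_o[OF g(2)] by (simp_all flip: comp_assoc)
    show "(pinv g \<circ> fst (g \<circ> fst h, g' \<circ> snd h), pinv g' \<circ> snd (g \<circ> fst h, g' \<circ> snd h)) = h"
      by (simp add: c1 c2)
    show "(g \<circ> fst (pinv g \<circ> fst h, pinv g' \<circ> snd h), g' \<circ> snd (pinv g \<circ> fst h, pinv g' \<circ> snd h)) = h"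
      by (simp add: c1 c2)
    show "(g \<circ> fst h, g' \<circ> snd h) \<in> perm2 (lar x) (rar x)"
      using permutes_compose[OF hp(1) g(1)] permutes_compose[OF hp(2) g(2)] by (simp add: perm2_def)
    show "(pinv g \<circ> fst h, pinv g' \<circ> snd h) \<in> perm2 (lar x) (rar x)"
      using permutes_compose[OF hp(1) gi(1)] permutes_compose[OF hp(2) gi(2)] by (simp add: perm2_def)
    have e1: "permute_list (g \<circ> fst h) (permute_list (pinv g) w) = permute_list (fst h) w"
      using permute_list_compose[of "g \<circ> fst h" w "pinv g"] permutes_compose[OF hp(1) g(1)] c1(1) w by simp
    have e2: "permute_list (g' \<circ> snd h) (permute_list (pinv g') w') = permute_list (snd h) w'"
      using permute_list_compose[of "g' \<circ> snd h" w' "pinv g'"] permutes_compose[OF hp(2) g(2)] c2(1) w by simp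
    have e3: "?B (g \<circ> fst h) (g' \<circ> snd h) (hvec x) = ?B (fst h) (snd h) (?B g g' (hvec x))"
      using symmetric_bimodule_action[OF sym_M, unfolded bi_action_def] g hp x by blast
    show "of_bool (permute_list (fst (g \<circ> fst h, g' \<circ> snd h)) (permute_list (pinv g) w) = wordX (fst l) \<and>
          permute_list (snd (g \<circ> fst h, g' \<circ> snd h)) (permute_list (pinv g') w') = wordY (fst l)) *
       ?ps (?B (fst (g \<circ> fst h, g' \<circ> snd h)) (snd (g \<circ> fst h, g' \<circ> snd h)) (hvec x)) =
       of_bool (permute_list (fst h) w = wordX (fst l) \<and> permute_list (snd h) w' = wordY (fst l)) *
       ?ps (?B (fst h) (snd h) (?B g g' (hvec x)))"
      by (simp add: e1 e2 e3)
  qed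
  then show ?thesis unfolding letter_value_def prod.case homog_update_simps by (simp only:)
qed

text \<open>Words of different monomials are never rearrangements of each other; for equal monomials the
  stabilizer acts trivially on the dual forms and each of its elements contributes the same value.\<close>

lemma letter_value_letter:
  assumes "valid l" "valid l'"
  shows "letter_value l (letter_elem l') = (if l = l' then letter_norm l else 0)"
proof (cases "fst l' = fst l")
  case True
  let ?G = "perm2 (mx (fst l)) (my (fst l))" and ?S = "word_stab (wordX (fst l)) \<times> word_stab (wordY (fst l))"
  let ?f = "\<lambda>g. of_bool (permute_list (fst g) (wordX (fst l)) = wordX (fst l) \<and> permute_list (snd g) (wordY (fst l)) = wordY (fst l)) *
       ps (fst l) (snd l) (biact M (mx (fst l)) (my (fst l)) (hb (fst l)) (fst g) (snd g) (ev (fst l) (snd l')))"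
  have "letter_value l (letter_elem l') = (\<Sum>g\<in>?G. ?f g)"
    using True by (simp add: letter_value_def letter_elem_def)
  also have "\<dots> = (\<Sum>g\<in>?S. ?f g)"
    by (rule sum.mono_neutral_right[OF finite_perm2]) (auto simp: perm2_def word_stab_def)
  also have "\<dots> = (\<Sum>g\<in>?S. ps (fst l) (snd l) (ev (fst l) (snd l')))"
  proof (rule sum.cong[OF refl])
    fix g assume g: "g \<in> ?S"
    then show "?f g = ps (fst l) (snd l) (ev (fst l) (snd l'))"
      using sysD(3)[OF assms(1), of "fst g" "snd g" "ev (fst l) (snd l')"] sysD(2)[OF assms(2)] True
      by (auto simp: word_stab_def)
  qed
  finally show ?thesis using sysD_delta[OF assms True] by (simp add: letter_norm_def)
next
  case False
  have "letter_value l (letter_elem l') = 0"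
  proof (cases "mx (fst l') = mx (fst l) \<and> my (fst l') = my (fst l) \<and> hb (fst l') = hb (fst l)")
    case True
    have "\<not> (permute_list (fst g) (wordX (fst l')) = wordX (fst l) \<and> permute_list (snd g) (wordY (fst l')) = wordY (fst l))"
      if g: "g \<in> perm2 (mx (fst l')) (my (fst l'))" for g
    proof
      assume e: "permute_list (fst g) (wordX (fst l')) = wordX (fst l) \<and> permute_list (snd g) (wordY (fst l')) = wordY (fst l)"
      have "mset (wordX (fst l)) = mset (wordX (fst l'))"
        using mset_permute_list[OF perm2D(1)[OF g]] e by simp
      moreover have "mset (wordY (fst l)) = mset (wordY (fst l'))"
        using mset_permute_list[OF perm2D(2)[OF g]] e by simp
      ultimately have "word_monomial (wordX (fst l)) (wordY (fst l)) (hb (fst l)) = word_monomial (wordX (fst l')) (wordY (fst l')) (hb (fst l))"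
        by (rule word_monomial_cong)
      then have "fst l = fst l'" using word_monomial_words[of "fst l"] word_monomial_words[of "fst l'"] True by simp
      then show False using False by simp
    qed
    then show ?thesis unfolding letter_value_def letter_elem_def by (auto intro!: sum.neutral)
  next
    case False
    then show ?thesis by (auto simp: letter_value_def letter_elem_def)
  qed
  then show ?thesis using False by auto
qed

lemma letter_norm_nonzero: "letter_norm l \<noteq> 0"
proof -
  have "id \<in> word_stab I" for I :: "nat list" by (simp add: word_stab_def permutes_id)
  then show ?thesis by (auto simp: letter_norm_def card_eq_0_iff finite_word_stab)
qed

text \<open>Odd letters anticommute with themselves, so they are allowed at most once.\<close>

definition letter_msets :: "nat \<Rightarrow> (var \<Rightarrow>\<^sub>0 nat) \<Rightarrow> letter multiset set" where
  "letter_msets n \<gamma> = {A. size A = n \<and> (\<forall>l\<in>#A. valid l) \<and> (\<forall>l\<in>#A. odd (hb (fst l)) \<longrightarrow> count A l \<le> 1) \<and>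
     (\<Sum>l\<in>#A. fst l) = \<gamma>}"

end

locale tensor_letters = letter_system M c ev ps + T: tensor_setup M n "length (wordX \<gamma>0)" "length (wordY \<gamma>0)" "lookup \<gamma>0 Hbar"
  for M :: "('k::field_char_0, 'v) bimodule" and c ev ps n \<gamma>0
begin

abbreviation "WI \<equiv> wordX \<gamma>0"
abbreviation "WJ \<equiv> wordY \<gamma>0"
abbreviation "Gens \<equiv> tensor_gens M n (length WI) (length WJ) (hb \<gamma>0)"
abbreviation "TQ \<equiv> T.P.Q"
abbreviation "WQ \<equiv> stab_rels T.P.Q T.right_biact WI WJ"

text \<open>A generator distributes the words of \<open>\<gamma>0\<close> over its tensor factors: the permutations \<open>\<sigma>\<close>, \<open>\<tau>\<close> say which positions belong to
  which factor. The list records each factor with the subwords that it receives.\<close>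

definition factor_words :: "'v tgen \<Rightarrow> ('v homog \<times> nat list \<times> nat list) list" where
  "factor_words g = (case g of (xs, \<sigma>, \<tau>) \<Rightarrow> map (\<lambda>i. (xs ! i,
     block_word (map lar xs) (\<lambda>p. WI ! pinv \<sigma> p) i,
     block_word (map rar xs) (\<lambda>p. WJ ! pinv \<tau> p) i)) [0..<length xs])"

text \<open>The sum runs over all matchings of the factors with the letters of the list, weighted by Koszul signs. It is
  the analogue of a determinant for odd letters and of a permanent for even ones.\<close>

definition list_value :: "letter list \<Rightarrow> 'v tgen \<Rightarrow> 'k" where
  "list_value ls g = (\<Sum>f\<in>T.factor_perms. koszul_sign (map (\<lambda>z. hdeg (fst z)) (factor_words g)) f * (\<Prod>k<n. letter_value (ls ! k) (factor_words g ! f k)))"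

lemma factor_words_length: "(xs, \<sigma>, \<tau>) \<in> Gens \<Longrightarrow> length (factor_words (xs, \<sigma>, \<tau>)) = n"
  by (simp add: factor_words_def T.TGens_iff)

lemma factor_words_nth: "(xs, \<sigma>, \<tau>) \<in> Gens \<Longrightarrow> i < n \<Longrightarrow> factor_words (xs, \<sigma>, \<tau>) ! i = (xs ! i,
     block_word (map lar xs) (\<lambda>p. WI ! pinv \<sigma> p) i,
     block_word (map rar xs) (\<lambda>p. WJ ! pinv \<tau> p) i)"
  by (simp add: factor_words_def T.TGens_iff)

lemma factor_words_lengths:
  assumes "(xs, \<sigma>, \<tau>) \<in> Gens" "i < n"
  shows "length (block_word (map lar xs) w i) = lar (xs ! i)" "length (block_word (map rar xs) w i) = rar (xs ! i)"
  using assms by (simp_all add: block_word_def T.TGens_iff)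

lemma map_hdeg_factor_words: "map (\<lambda>z. hdeg (fst z)) (factor_words (xs, \<sigma>, \<tau>)) = map hdeg xs"
  by (rule nth_equalityI) (simp_all add: factor_words_def)

lemma map_fst_factor_words: "map fst (factor_words (xs, \<sigma>, \<tau>)) = xs"
  by (rule nth_equalityI) (simp_all add: factor_words_def)

lemma factor_words_update:
  assumes g: "(xs, \<sigma>, \<tau>) \<in> Gens" and i: "i < n"
  shows "factor_words (xs[i := homog_update (xs ! i) v], \<sigma>, \<tau>) = (factor_words (xs, \<sigma>, \<tau>))[i := (homog_update (xs ! i) v, snd (factor_words (xs, \<sigma>, \<tau>) ! i))]"
proof -
  have len: "length xs = n" using g by (simp add: T.TGens_iff)
  then have il: "i < length xs" using i by simp
  show ?thesis
    by (rule nth_equalityI) (use len i in \<open>auto simp: factor_words_def map_homog_update[OF il] nth_list_update\<close>)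
qed

lemma factor_words_act:
  assumes g: "(xs, \<sigma>, \<tau>) \<in> Gens" and i: "i < n"
    and h: "\<And>i. i < n \<Longrightarrow> h i permutes {..<lar (xs ! i)}" "\<And>i. i < n \<Longrightarrow> h' i permutes {..<rar (xs ! i)}"
  shows "factor_words (tensor_act M h h' xs, \<sigma>, \<tau>) ! i = (homog_update (xs ! i) (biact M (lar (xs ! i)) (rar (xs ! i)) (hdeg (xs ! i)) (h i) (h' i) (hvec (xs ! i))),
       snd (factor_words (xs, \<sigma>, \<tau>) ! i))"
    and "factor_words (young_left h h' xs \<sigma> \<tau>) ! i = (xs ! i,
       permute_list (pinv (h i)) (fst (snd (factor_words (xs, \<sigma>, \<tau>) ! i))),
       permute_list (pinv (h' i)) (snd (snd (factor_words (xs, \<sigma>, \<tau>) ! i))))"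
proof -
  note A = g[unfolded T.TGens_iff]
  have len: "length xs = n" using A by simp
  show "factor_words (tensor_act M h h' xs, \<sigma>, \<tau>) ! i = (homog_update (xs ! i) (biact M (lar (xs ! i)) (rar (xs ! i)) (hdeg (xs ! i)) (h i) (h' i) (hvec (xs ! i))),
       snd (factor_words (xs, \<sigma>, \<tau>) ! i))"
    using i len by (simp add: factor_words_def) (simp add: tensor_act_alt)
  have hx: "\<And>i. i < length (map lar xs) \<Longrightarrow> h i permutes {..<map lar xs ! i}" using h len by simp
  have hy: "\<And>i. i < length (map rar xs) \<Longrightarrow> h' i permutes {..<map rar xs ! i}" using h len by simp
  have sx: "pinv (block_sum (map lar xs) h \<circ> \<sigma>) = pinv \<sigma> \<circ> pinv (block_sum (map lar xs) h)"
    by (rule o_inv_distrib[OF permutes_bij[OF block_sum_permutes[OF hx]] permutes_bij[of \<sigma>]]) (use A in auto)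
  have sy: "pinv (block_sum (map rar xs) h' \<circ> \<tau>) = pinv \<tau> \<circ> pinv (block_sum (map rar xs) h')"
    by (rule o_inv_distrib[OF permutes_bij[OF block_sum_permutes[OF hy]] permutes_bij[of \<tau>]]) (use A in auto)
  show "factor_words (young_left h h' xs \<sigma> \<tau>) ! i = (xs ! i,
       permute_list (pinv (h i)) (fst (snd (factor_words (xs, \<sigma>, \<tau>) ! i))),
       permute_list (pinv (h' i)) (snd (snd (factor_words (xs, \<sigma>, \<tau>) ! i))))"
    using i len block_word_sum[OF hx, of i "\<lambda>p. WI ! pinv \<sigma> p"] block_word_sum[OF hy, of i "\<lambda>p. WJ ! pinv \<tau> p"]
    by (simp add: factor_words_def sx sy)
qed

lemma factor_words_permute:
  assumes g: "(xs, \<sigma>, \<tau>) \<in> Gens" and f: "f permutes {..<n}"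
  shows "factor_words (perm_factors f xs \<sigma> \<tau>) = permute_list f (factor_words (xs, \<sigma>, \<tau>))"
proof (rule nth_equalityI)
  note A = g[unfolded T.TGens_iff]
  have len: "length xs = n" using A by simp
  show "length (factor_words (perm_factors f xs \<sigma> \<tau>)) = length (permute_list f (factor_words (xs, \<sigma>, \<tau>)))"
    by (simp add: factor_words_def)
  fix i assume "i < length (factor_words (perm_factors f xs \<sigma> \<tau>))"
  then have i: "i < n" "f i < n" using len permutes_less(1)[OF f] by (auto simp: factor_words_def)
  have fx: "f permutes {..<length (map lar xs)}" and fy: "f permutes {..<length (map rar xs)}" using f len by auto
  have fl: "f permutes {..<length xs}" "f permutes {..<length (factor_words (xs, \<sigma>, \<tau>))}" using f len by (auto simp: factor_words_def)
  have sx: "pinv (block_perm (map lar xs) f \<circ> \<sigma>) = pinv \<sigma> \<circ> pinv (block_perm (map lar xs) f)"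
    by (rule o_inv_distrib[OF permutes_bij[OF block_perm_permutes[OF fx]] permutes_bij[of \<sigma>]]) (use A in auto)
  have sy: "pinv (block_perm (map rar xs) f \<circ> \<tau>) = pinv \<tau> \<circ> pinv (block_perm (map rar xs) f)"
    by (rule o_inv_distrib[OF permutes_bij[OF block_perm_permutes[OF fy]] permutes_bij[of \<tau>]]) (use A in auto)
  have "factor_words (perm_factors f xs \<sigma> \<tau>) ! i = factor_words (xs, \<sigma>, \<tau>) ! f i"
    using i len block_word_perm[OF fx, of i "\<lambda>p. WI ! pinv \<sigma> p"] block_word_perm[OF fy, of i "\<lambda>p. WJ ! pinv \<tau> p"]
    by (simp add: factor_words_def permute_list_nth[OF fl(1)] sx sy T.permute_map_sel[OF f len])
  then show "factor_words (perm_factors f xs \<sigma> \<tau>) ! i = permute_list f (factor_words (xs, \<sigma>, \<tau>)) ! i"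
    using i len permute_list_nth[OF fl(2), of i] by (simp add: factor_words_def)
qed

lemma factor_perms_D: "f \<in> T.factor_perms \<Longrightarrow> f permutes {..<n}"
  by (simp add: T.factor_perms_def)

text \<open>Multilinearity is inherited factor by factor, the induction relations hold by \<open>letter_value_equivariant\<close>, and
  the invariance under permutation of the factors is the cocycle property of the Koszul sign.\<close>

lemma list_value_form:
  assumes valid: "\<And>k. k < n \<Longrightarrow> valid (ls ! k)"
  obtains \<chi> where "linear_form TQ \<chi>" "\<And>g. g \<in> Gens \<Longrightarrow> \<chi> (T.P.sym g) = list_value ls g"
proof -
  have 1: "lin_fun (list_value ls) p = 0" if "p \<in> T.TRels" for p
    using that
  proof (cases rule: T.TRelsE)
    case (lin xs \<sigma> \<tau> i)
    let ?z = "factor_words (xs, \<sigma>, \<tau>)"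
    have len: "length xs = n" using lin by (simp add: T.TGens_iff)
    let ?c = "\<lambda>f. koszul_sign (map hdeg xs) f * (\<Prod>k\<in>{..<n} - {pinv f i}. letter_value (ls ! k) (?z ! f k))"
    have "list_value ls (xs[i := homog_update (xs ! i) v], \<sigma>, \<tau>) =
        (\<Sum>f\<in>T.factor_perms. ?c f * letter_value (ls ! pinv f i) (homog_update (xs ! i) v, snd (?z ! i)))" for v
      unfolding list_value_def
    proof (rule sum.cong[OF refl])
      fix f assume f: "f \<in> T.factor_perms"
      have "length ?z = n" using factor_words_length[OF lin(1)] .
      from prod_update[OF factor_perms_D[OF f] lin(2) this, of "\<lambda>k. letter_value (ls ! k)" "(homog_update (xs ! i) v, snd (?z ! i))"]
      show "koszul_sign (map (\<lambda>z. hdeg (fst z)) (factor_words (xs[i := homog_update (xs ! i) v], \<sigma>, \<tau>))) f *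
          (\<Prod>k<n. letter_value (ls ! k) (factor_words (xs[i := homog_update (xs ! i) v], \<sigma>, \<tau>) ! f k)) =
          ?c f * letter_value (ls ! pinv f i) (homog_update (xs ! i) v, snd (?z ! i))"
        using map_homog_update(3)[of i xs v] len lin(2)
        unfolding map_hdeg_factor_words by (simp add: factor_words_update[OF lin(1,2)] mult_ac)
    qed
    moreover have "linear_form (space_of M (xs ! i)) (\<lambda>v. \<Sum>f\<in>T.factor_perms. ?c f * letter_value (ls ! pinv f i) (homog_update (xs ! i) v, snd (?z ! i)))"
    proof (rule linear_form_sum)
      fix f assume f: "f \<in> T.factor_perms"
      show "linear_form (space_of M (xs ! i)) (\<lambda>v. letter_value (ls ! pinv f i) (homog_update (xs ! i) v, snd (?z ! i)))"
        using letter_value_linear[OF valid[OF permutes_less(2)[OF factor_perms_D[OF f] lin(2)]], of "xs ! i" "fst (snd (?z ! i))" "snd (snd (?z ! i))"] by simp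
    qed
    ultimately show ?thesis by (intro linear_rels_vanish[OF lin(3)]) simp
  next
    case (young xs \<sigma> \<tau> h h')
    have "list_value ls (tensor_act M h h' xs, \<sigma>, \<tau>) = list_value ls (young_left h h' xs \<sigma> \<tau>)"
      unfolding list_value_def map_hdeg_factor_words tensor_act_simps
    proof (intro sum.cong refl arg_cong2[where f = "(*)"] prod.cong)
      fix f k assume f: "f \<in> T.factor_perms" and "k \<in> {..<n}"
      then have k: "f k < n" using permutes_less(1)[OF factor_perms_D[OF f]] by simp
      have x: "hvec (xs ! f k) \<in> carrier (space_of M (xs ! f k))" using young(1) k by (simp add: T.TGens_iff)
      show "letter_value (ls ! k) (factor_words (tensor_act M h h' xs, \<sigma>, \<tau>) ! f k) =
          letter_value (ls ! k) (factor_words (young_left h h' xs \<sigma> \<tau>) ! f k)"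
        using factor_words_act[of xs \<sigma> \<tau> "f k" h h', OF young(1) k young(2,3)] factor_words_nth[OF young(1) k]
          letter_value_equivariant[OF young(2)[OF k] young(3)[OF k] factor_words_lengths[OF young(1) k] x, of "ls ! k"] by simp
    qed
    then show ?thesis unfolding young(4) by (simp add: lin_fun_minus)
  qed
  have 2: "lin_fun (list_value ls) (T.factor_perm_gen f g) = list_value ls g" if f: "f \<in> T.factor_perms" and g: "g \<in> Gens" for f g
  proof -
    obtain xs \<sigma> \<tau> where g': "g = (xs, \<sigma>, \<tau>)" by (cases g)
    note fp = factor_perms_D[OF f]
    have len: "length xs = n" "length (factor_words g) = n" using g factor_words_length by (auto simp: T.TGens_iff g')
    let ?F = "\<lambda>f. koszul_sign (map hdeg xs) f * (\<Prod>k<n. letter_value (ls ! k) (factor_words g ! f k))"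
    have "list_value ls (perm_factors f xs \<sigma> \<tau>) * koszul_sign (map hdeg xs) f =
        (\<Sum>f'\<in>T.factor_perms. ?F (f \<circ> f'))"
      unfolding list_value_def map_hdeg_factor_words sum_distrib_right
    proof (rule sum.cong[OF refl])
      fix f' assume f': "f' \<in> T.factor_perms"
      have p: "permute_list f (factor_words g) ! f' k = factor_words g ! (f \<circ> f') k" if "k < n" for k
        using permute_list_nth[of f "factor_words g" "f' k"] fp len permutes_less(1)[OF factor_perms_D[OF f'] that] by simp
      have k: "koszul_sign (map hdeg xs) (f \<circ> f') = (koszul_sign (map hdeg xs) f * koszul_sign (map hdeg (permute_list f xs)) f' :: 'k)"
        using koszul_sign_compose[of f' "map hdeg xs" f] fp factor_perms_D[OF f'] len T.permute_map_sel[OF fp len(1), of hdeg] by simp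
      show "koszul_sign (map hdeg (permute_list f xs)) f' *
          (\<Prod>k<n. letter_value (ls ! k) (factor_words (perm_factors f xs \<sigma> \<tau>) ! f' k)) * koszul_sign (map hdeg xs) f = ?F (f \<circ> f')"
        unfolding factor_words_permute[OF g[unfolded g'] fp] k using p by (simp add: g' mult_ac)
    qed
    also have "\<dots> = (\<Sum>f'\<in>T.factor_perms. ?F f')"
    proof (rule sum.reindex_bij_witness[where i = "\<lambda>f'. pinv f \<circ> f'" and j = "\<lambda>f'. f \<circ> f'"])
      fix f' assume f': "f' \<in> T.factor_perms"
      show "pinv f \<circ> (f \<circ> f') = f'" "f \<circ> (pinv f \<circ> f') = f'"
        using permutes_inv_o[OF fp] by (simp_all flip: comp_assoc)
      show "f \<circ> f' \<in> T.factor_perms" "pinv f \<circ> f' \<in> T.factor_perms"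
        using permutes_compose[OF factor_perms_D[OF f'] fp] permutes_compose[OF factor_perms_D[OF f'] permutes_inv[OF fp]] by (simp_all add: T.factor_perms_def)
    qed simp
    also have "\<dots> = list_value ls g" unfolding list_value_def g' map_hdeg_factor_words ..
    finally show ?thesis by (simp add: T.factor_perm_gen_def g' mult.commute)
  qed
  show thesis by (rule T.P.form_exists[OF 1 2]) (use that in auto)
qed

text \<open>The stabilizer of the words of \<open>\<gamma>0\<close> does not change the letters found at any position.\<close>

lemma factor_words_right:
  assumes g: "(xs, \<sigma>, \<tau>) \<in> Gens" and "\<rho> \<in> word_stab WI" "\<rho>' \<in> word_stab WJ"
  shows "factor_words (xs, \<sigma> \<circ> \<rho>, \<tau> \<circ> \<rho>') = factor_words (xs, \<sigma>, \<tau>)"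
proof (rule nth_equalityI)
  note A = g[unfolded T.TGens_iff]
  have st: "WI ! pinv (\<sigma> \<circ> \<rho>) p = WI ! pinv \<sigma> p" if s: "\<sigma> permutes {..<length WI}" and r: "\<rho> \<in> word_stab WI" and p: "p < length WI"
    for WI :: "nat list" and \<sigma> \<rho> p
  proof -
    have rp: "\<rho> permutes {..<length WI}" "permute_list \<rho> WI = WI" using r by (auto simp: word_stab_def)
    let ?q = "pinv \<rho> (pinv \<sigma> p)"
    have q: "?q < length WI" using permutes_less(2)[OF rp(1) permutes_less(2)[OF s p]] .
    have "WI ! pinv (\<sigma> \<circ> \<rho>) p = WI ! ?q"
      using o_inv_distrib[OF permutes_bij[OF s] permutes_bij[OF rp(1)]] by simp
    also have "\<dots> = permute_list \<rho> WI ! ?q" using rp(2) by simp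
    also have "\<dots> = WI ! pinv \<sigma> p"
      using permute_list_nth[OF rp(1) q] permutes_inverses(1)[OF rp(1)] by simp
    finally show ?thesis .
  qed
  fix i assume "i < length (factor_words (xs, \<sigma> \<circ> \<rho>, \<tau> \<circ> \<rho>'))"
  then have i: "i < length xs" by (simp add: factor_words_def)
  have "block_word (map lar xs) (\<lambda>p. WI ! pinv (\<sigma> \<circ> \<rho>) p) i = block_word (map lar xs) (\<lambda>p. WI ! pinv \<sigma> p) i"
    by (rule block_word_cong) (use A i st[OF _ assms(2)] in auto)
  moreover have "block_word (map rar xs) (\<lambda>p. WJ ! pinv (\<tau> \<circ> \<rho>') p) i = block_word (map rar xs) (\<lambda>p. WJ ! pinv \<tau> p) i"
    by (rule block_word_cong) (use A i st[OF _ assms(3)] in auto)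
  ultimately show "factor_words (xs, \<sigma> \<circ> \<rho>, \<tau> \<circ> \<rho>') ! i = factor_words (xs, \<sigma>, \<tau>) ! i"
    using i by (simp add: factor_words_def)
qed (simp add: factor_words_def)

end

section \<open>Letter multisets and the weight spaces of a tensor power\<close>

lemma sum_mset_list: "(\<Sum>l\<in>#mset ls. F l) = sum_list (map F ls)"
  by (induction ls) auto

context tensor_letters
begin

text \<open>The generator is a pure tensor of basis vectors, named by the letters, with the standard words.\<close>

definition realizes :: "letter list \<Rightarrow> 'v tgen \<Rightarrow> bool" where
  "realizes ls g \<longleftrightarrow> g \<in> Gens \<and> factor_words g = map letter_elem ls"

lemma TQ_vspace: "vspace TQ" by (rule T.P.Q_vspace)

lemma WQ_sub: "WQ \<subseteq> carrier TQ"
proof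
  fix w assume "w \<in> WQ"
  then obtain \<sigma> \<tau> v where w: "w = T.right_biact \<sigma> \<tau> v \<ominus>\<^bsub>TQ\<^esub> v" and st: "\<sigma> \<in> word_stab WI" "\<tau> \<in> word_stab WJ" and v: "v \<in> carrier TQ"
    unfolding stab_rels_def by blast
  have "T.right_biact \<sigma> \<tau> v \<in> carrier TQ" using lin_on_simps(1)[OF T.right_biact_lin v] st by (auto simp: word_stab_def)
  then show "w \<in> carrier TQ" unfolding w using v by (rule vspace_simps(3)[OF TQ_vspace])
qed

text \<open>Two generators with the same factors and the same subwords differ by right multiplication with an element
  that fixes the words of \<open>\<gamma>0\<close>, so their classes agree modulo the stabilizer relations.\<close>

lemma same_words:
  assumes "g \<in> Gens" "g' \<in> Gens" "factor_words g = factor_words g'"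
  shows "T.P.sym g' \<ominus>\<^bsub>TQ\<^esub> T.P.sym g \<in> WQ"
proof -
  obtain xs \<sigma> \<tau> xs' \<sigma>' \<tau>' where g: "g = (xs, \<sigma>, \<tau>)" "g' = (xs', \<sigma>', \<tau>')" by (cases g, cases g') auto
  have xs: "xs' = xs" using arg_cong[OF assms(3), of "map fst"] unfolding g map_fst_factor_words by simp
  note A = assms(1)[unfolded g T.TGens_iff] and A' = assms(2)[unfolded g xs T.TGens_iff]
  have z: "factor_words (xs, \<sigma>, \<tau>) ! i = factor_words (xs, \<sigma>', \<tau>') ! i" for i using assms(3) by (simp add: g xs)
  have wx: "WI ! pinv \<sigma> p = WI ! pinv \<sigma>' p" if "p < length WI" for p
  proof (rule block_word_determines[where ks = "map lar xs" and w = "\<lambda>p. WI ! pinv \<sigma> p" and w' = "\<lambda>p. WI ! pinv \<sigma>' p"])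
    show "block_word (map lar xs) (\<lambda>p. WI ! pinv \<sigma> p) i = block_word (map lar xs) (\<lambda>p. WI ! pinv \<sigma>' p) i"
      if "i < length (map lar xs)" for i
      using z[of i] that by (simp add: factor_words_def)
  qed (use that A in simp)
  have wy: "WJ ! pinv \<tau> p = WJ ! pinv \<tau>' p" if "p < length WJ" for p
  proof (rule block_word_determines[where ks = "map rar xs" and w = "\<lambda>p. WJ ! pinv \<tau> p" and w' = "\<lambda>p. WJ ! pinv \<tau>' p"])
    show "block_word (map rar xs) (\<lambda>p. WJ ! pinv \<tau> p) i = block_word (map rar xs) (\<lambda>p. WJ ! pinv \<tau>' p) i"
      if "i < length (map rar xs)" for i
      using z[of i] that by (simp add: factor_words_def)
  qed (use that A in simp)
  have stab: "pinv \<sigma> \<circ> \<sigma>' \<in> word_stab W"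
    if s: "\<sigma> permutes {..<length W}" "\<sigma>' permutes {..<length W}" and w: "\<And>p. p < length W \<Longrightarrow> W ! pinv \<sigma> p = W ! pinv \<sigma>' p"
    for \<sigma> \<sigma>' and W :: "nat list"
  proof -
    have p: "pinv \<sigma> \<circ> \<sigma>' permutes {..<length W}" by (rule permutes_compose[OF s(2) permutes_inv[OF s(1)]])
    have "permute_list (pinv \<sigma> \<circ> \<sigma>') W = W"
    proof (rule nth_equalityI)
      fix q assume "q < length (permute_list (pinv \<sigma> \<circ> \<sigma>') W)"
      then have q: "q < length W" by simp
      show "permute_list (pinv \<sigma> \<circ> \<sigma>') W ! q = W ! q"
        using permute_list_nth[OF p q] w[OF permutes_less(1)[OF s(2) q]] permutes_inverses(2)[OF s(2)] by simp
    qed simp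
    then show ?thesis using p by (simp add: word_stab_def)
  qed
  let ?r = "pinv \<sigma> \<circ> \<sigma>'" and ?r' = "pinv \<tau> \<circ> \<tau>'"
  have r: "?r \<in> word_stab WI" "?r' \<in> word_stab WJ"
    using stab[of \<sigma> WI \<sigma>'] stab[of \<tau> WJ \<tau>'] A A' wx wy by auto
  have "\<sigma> permutes {..<length WI}" "\<tau> permutes {..<length WJ}" using A by auto
  then have "\<sigma> \<circ> ?r = \<sigma>'" "\<tau> \<circ> ?r' = \<tau>'" by (simp_all add: permutes_inv_o(1) flip: comp_assoc)
  then have e: "T.right_biact ?r ?r' (T.P.sym g) = T.P.sym g'"
    using T.right_biact_sym[of ?r ?r' xs \<sigma> \<tau>] r assms(1) by (simp add: g xs word_stab_def)
  have "T.right_biact ?r ?r' (T.P.sym g) \<ominus>\<^bsub>TQ\<^esub> T.P.sym g \<in> WQ"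
    unfolding stab_rels_def using r T.P.sym_carrier[OF assms(1)] by blast
  then show ?thesis unfolding e .
qed

lemma young_sym:
  assumes "(xs, \<sigma>, \<tau>) \<in> Gens"
      "\<And>i. i < n \<Longrightarrow> h i permutes {..<lar (xs ! i)}" "\<And>i. i < n \<Longrightarrow> h' i permutes {..<rar (xs ! i)}"
  shows "T.P.sym (tensor_act M h h' xs, \<sigma>, \<tau>) = T.P.sym (young_left h h' xs \<sigma> \<tau>)"
proof -
  let ?g1 = "(tensor_act M h h' xs, \<sigma>, \<tau>)" and ?g2 = "(young_left h h' xs \<sigma> \<tau>)"
  have g: "?g1 \<in> Gens" "?g2 \<in> Gens" by (rule T.TGens_act[OF assms]; assumption)+
  note s = single_in_free_space[OF g(1), of 1] single_in_free_space[OF g(2), of 1]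
  have "\<zero>\<^bsub>TQ\<^esub> = T.P.proj (single ?g1 1 - single ?g2 1)"
    by (rule T.P.proj_rel[OF T.TRels_young[OF assms], symmetric])
  also have "\<dots> = T.P.sym ?g1 \<ominus>\<^bsub>TQ\<^esub> T.P.sym ?g2"
    using lin_on_simps(5)[OF T.P.proj_lin_on T.P.FS_vspace TQ_vspace s] unfolding free_space_minus[OF s] T.P.sym_def .
  finally show ?thesis using vspace_simps(12)[OF TQ_vspace T.P.sym_carrier[OF g(1)] T.P.sym_carrier[OF g(2)]] by simp
qed

lemma realizes_permute:
  assumes r: "realizes ls (xs, \<sigma>, \<tau>)" and f: "f permutes {..<n}"
  shows "realizes (permute_list f ls) (perm_factors f xs \<sigma> \<tau>)"
    "T.P.sym (xs, \<sigma>, \<tau>) = koszul_sign (map hdeg xs) f \<odot>\<^bsub>TQ\<^esub> T.P.sym (perm_factors f xs \<sigma> \<tau>)"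
proof -
  have g: "(xs, \<sigma>, \<tau>) \<in> Gens" using r by (simp add: realizes_def)
  note g' = T.TGens_permute[OF g f]
  have len: "length ls = n" using r factor_words_length[OF g] by (simp add: realizes_def)
  show "realizes (permute_list f ls) (perm_factors f xs \<sigma> \<tau>)"
    using r g' factor_words_permute[OF g f] T.permute_map_sel[OF f, of "map letter_elem ls" id] permute_list_map[of f ls letter_elem] f len
    by (simp add: realizes_def)
  have "T.P.sym (xs, \<sigma>, \<tau>) = T.P.proj (T.factor_perm_gen f (xs, \<sigma>, \<tau>))"
    using T.P.sym_act[of f] f g by (simp add: T.factor_perms_def)
  also have "\<dots> = koszul_sign (map hdeg xs) f \<odot>\<^bsub>TQ\<^esub> T.P.sym (perm_factors f xs \<sigma> \<tau>)"
  proof -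
    have "T.factor_perm_gen f (xs, \<sigma>, \<tau>) = single (perm_factors f xs \<sigma> \<tau>)
        (koszul_sign (map hdeg xs) f)" by (simp add: T.factor_perm_gen_def)
    then show ?thesis by (simp only: T.P.proj_single[OF g'])
  qed
  finally show "T.P.sym (xs, \<sigma>, \<tau>) = koszul_sign (map hdeg xs) f \<odot>\<^bsub>TQ\<^esub> T.P.sym (perm_factors f xs \<sigma> \<tau>)" .
qed

lemma realizes_hdeg: "realizes ls (xs, \<sigma>, \<tau>) \<Longrightarrow> map hdeg xs = map (\<lambda>l. hb (fst l)) ls"
  using map_hdeg_factor_words[of xs \<sigma> \<tau>] by (simp add: realizes_def letter_elem_def o_def)

lemma realizes_length: "realizes ls g \<Longrightarrow> length ls = n"
  using factor_words_length by (cases g) (metis length_map realizes_def)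

lemma realizes_weight:
  assumes "realizes ls g"
  shows "(\<Sum>l\<in>#mset ls. fst l) = \<gamma>0"
proof -
  obtain xs \<sigma> \<tau> where g: "g = (xs, \<sigma>, \<tau>)" by (cases g)
  have gG: "(xs, \<sigma>, \<tau>) \<in> Gens" and z: "factor_words (xs, \<sigma>, \<tau>) = map letter_elem ls" using assms by (auto simp: realizes_def g)
  note A = gG[unfolded T.TGens_iff]
  have len: "length ls = n" "length xs = n" using realizes_length[OF assms] A by auto
  have zi: "factor_words (xs, \<sigma>, \<tau>) ! i = letter_elem (ls ! i)" if "i < n" for i using z len that by simp
  have key: "mset (concat (map (block_word ks (\<lambda>p. W ! pinv \<sigma> p)) [0..<length ks])) = mset W"
    if "\<sigma> permutes {..<length W}" "sum_list ks = length W" for ks \<sigma> and W :: "nat list"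
  proof -
    have "map (\<lambda>p. W ! pinv \<sigma> p) [0..<length W] = permute_list (pinv \<sigma>) W" by (simp add: permute_list_def)
    then show ?thesis unfolding concat_block_words that(2) using mset_permute_list[OF permutes_inv[OF that(1)]] by simp
  qed
  have bx: "map (block_word (map lar xs) (\<lambda>p. WI ! pinv \<sigma> p)) [0..<length (map lar xs)] = map (\<lambda>l. wordX (fst l)) ls"
    by (rule nth_equalityI) (use len zi factor_words_nth[OF gG] in \<open>auto simp: letter_elem_def\<close>)
  have by': "map (block_word (map rar xs) (\<lambda>p. WJ ! pinv \<tau> p)) [0..<length (map rar xs)] = map (\<lambda>l. wordY (fst l)) ls"
    by (rule nth_equalityI) (use len zi factor_words_nth[OF gG] in \<open>auto simp: letter_elem_def\<close>)
  have X: "mset (concat (map (\<lambda>l. wordX (fst l)) ls)) = mset WI" using key[of \<sigma> WI "map lar xs"] A unfolding bx by simp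
  have Y: "mset (concat (map (\<lambda>l. wordY (fst l)) ls)) = mset WJ" using key[of \<tau> WJ "map rar xs"] A unfolding by' by simp
  have H: "sum_list (map (\<lambda>l. hb (fst l)) ls) = hb \<gamma>0" using A realizes_hdeg[OF assms[unfolded g]] by simp
  have cc: "count (mset (concat (map (\<lambda>l. w (fst l)) ls))) i = (\<Sum>l\<in>#mset ls. count (mset (w (fst l))) i)" for w :: "(var \<Rightarrow>\<^sub>0 nat) \<Rightarrow> nat list" and i
    by (induction ls) auto
  show ?thesis
  proof (rule monomial_eqI)
    fix i
    show "lookup (\<Sum>l\<in>#mset ls. fst l) (X i) = lookup \<gamma>0 (X i)"
      using cc[of wordX i] X count_wordX by (simp add: lookup_sum_mset)
    show "lookup (\<Sum>l\<in>#mset ls. fst l) (Y i) = lookup \<gamma>0 (Y i)"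
      using cc[of wordY i] Y count_wordY by (simp add: lookup_sum_mset)
  next
    show "lookup (\<Sum>l\<in>#mset ls. fst l) Hbar = lookup \<gamma>0 Hbar"
      unfolding lookup_sum_mset by (rule trans[OF sum_mset_list H])
  qed
qed

text \<open>Since the weights add up to \<open>\<gamma>0\<close>, the concatenation of the words of the letters is a rearrangement of the
  words of \<open>\<gamma>0\<close>; the rearranging permutations supply the generator.\<close>

lemma realizes_exists:
  assumes v: "\<And>l. l \<in> set ls \<Longrightarrow> valid l" and n: "length ls = n" and w: "(\<Sum>l\<in>#mset ls. fst l) = \<gamma>0"
  shows "\<exists>g. realizes ls g"
proof -
  let ?xs = "map (\<lambda>l. fst (letter_elem l)) ls"
  have cc: "count (mset (concat (map (\<lambda>l. w (fst l)) ls))) i = (\<Sum>l\<in>#mset ls. count (mset (w (fst l))) i)" for w :: "(var \<Rightarrow>\<^sub>0 nat) \<Rightarrow> nat list" and i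
    by (induction ls) auto
  have "mset WI = mset (concat (map (\<lambda>l. wordX (fst l)) ls))"
    by (rule multiset_eqI) (simp add: cc count_wordX flip: w, simp add: lookup_sum_mset)
  then obtain \<rho> where r: "\<rho> permutes {..<length WI}" "permute_list \<rho> WI = concat (map (\<lambda>l. wordX (fst l)) ls)"
    by (rule word_permutation)
  have "mset WJ = mset (concat (map (\<lambda>l. wordY (fst l)) ls))"
    by (rule multiset_eqI) (simp add: cc count_wordY flip: w, simp add: lookup_sum_mset)
  then obtain \<rho>' where r': "\<rho>' permutes {..<length WJ}" "permute_list \<rho>' WJ = concat (map (\<lambda>l. wordY (fst l)) ls)"
    by (rule word_permutation)
  define \<sigma> where "\<sigma> = pinv \<rho>"
  define \<tau> where "\<tau> = pinv \<rho>'"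
  have inv_st: "pinv \<sigma> = \<rho>" "pinv \<tau> = \<rho>'" unfolding \<sigma>_def \<tau>_def using permutes_inv_inv r r' by auto
  have lx: "map lar ?xs = map length (map (\<lambda>l. wordX (fst l)) ls)" "map rar ?xs = map length (map (\<lambda>l. wordY (fst l)) ls)"
    by (auto simp: letter_elem_def)
  have sx: "sum_list (map lar ?xs) = length WI" "sum_list (map rar ?xs) = length WJ"
    unfolding lx using arg_cong[OF r(2), of length] arg_cong[OF r'(2), of length] by (simp_all add: length_concat)
  have sh: "sum_list (map hdeg ?xs) = hb \<gamma>0"
  proof -
    have "sum_list (map hdeg ?xs) = (\<Sum>l\<in>#mset ls. hb (fst l))" unfolding sum_mset_list by (simp add: letter_elem_def o_def)
    also have "\<dots> = hb (\<Sum>l\<in>#mset ls. fst l)" by (simp add: lookup_sum_mset)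
    finally show ?thesis using w by simp
  qed
  have G: "(?xs, \<sigma>, \<tau>) \<in> Gens"
    unfolding T.TGens_iff using sx sh n permutes_inv[OF r(1)] permutes_inv[OF r'(1)] sysD(2)[OF v]
    by (auto simp: \<sigma>_def \<tau>_def) (simp add: letter_elem_def)
  have "factor_words (?xs, \<sigma>, \<tau>) = map letter_elem ls"
  proof (rule nth_equalityI)
    fix i assume "i < length (factor_words (?xs, \<sigma>, \<tau>))"
    then have i: "i < length ls" "i < n" using factor_words_length[OF G] n by auto
    have nthr: "WI ! \<rho> p = concat (map (\<lambda>l. wordX (fst l)) ls) ! p" if "p < length WI" for p
      using permute_list_nth[OF r(1) that] r(2) by simp
    have nthr': "WJ ! \<rho>' p = concat (map (\<lambda>l. wordY (fst l)) ls) ! p" if "p < length WJ" for p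
      using permute_list_nth[OF r'(1) that] r'(2) by simp
    have "block_word (map lar ?xs) (\<lambda>p. WI ! \<rho> p) i = block_word (map lar ?xs) (\<lambda>p. concat (map (\<lambda>l. wordX (fst l)) ls) ! p) i"
      by (rule block_word_cong) (use nthr sx i in auto)
    also have "\<dots> = wordX (fst (ls ! i))" unfolding lx using block_word_concat[of i "map (\<lambda>l. wordX (fst l)) ls"] i by simp
    finally have 1: "block_word (map lar ?xs) (\<lambda>p. WI ! \<rho> p) i = wordX (fst (ls ! i))" .
    have "block_word (map rar ?xs) (\<lambda>p. WJ ! \<rho>' p) i = block_word (map rar ?xs) (\<lambda>p. concat (map (\<lambda>l. wordY (fst l)) ls) ! p) i"
      by (rule block_word_cong) (use nthr' sx i in auto)
    also have "\<dots> = wordY (fst (ls ! i))" unfolding lx using block_word_concat[of i "map (\<lambda>l. wordY (fst l)) ls"] i by simp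
    finally have 2: "block_word (map rar ?xs) (\<lambda>p. WJ ! \<rho>' p) i = wordY (fst (ls ! i))" .
    show "factor_words (?xs, \<sigma>, \<tau>) ! i = map letter_elem ls ! i"
      unfolding factor_words_nth[OF G i(2)] inv_st 1 2 using i by (simp add: letter_elem_def)
  qed (simp add: factor_words_def)
  then show ?thesis using G unfolding realizes_def by blast
qed

definition rep_list :: "letter multiset \<Rightarrow> letter list" where
  "rep_list A = (SOME ls. mset ls = A)"

definition rep_gen :: "letter multiset \<Rightarrow> 'v tgen" where
  "rep_gen A = (SOME g. realizes (rep_list A) g)"

abbreviation "TA \<equiv> letter_msets n \<gamma>0"

lemma mset_rep_list: "mset (rep_list A) = A"
  unfolding rep_list_def by (rule someI_ex[OF ex_mset])

lemma rep_facts: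
  assumes "A \<in> TA"
  shows "realizes (rep_list A) (rep_gen A)" "\<And>l. l \<in> set (rep_list A) \<Longrightarrow> valid l" "length (rep_list A) = n"
    "\<And>l. l \<in> set (rep_list A) \<Longrightarrow> odd (hb (fst l)) \<Longrightarrow> count (mset (rep_list A)) l \<le> 1"
proof -
  note m = mset_rep_list[of A] and A = assms[unfolded letter_msets_def]
  have sm: "l \<in># A" if "l \<in> set (rep_list A)" for l using that m set_mset_mset[of "rep_list A"] by simp
  show v: "valid l" if "l \<in> set (rep_list A)" for l using A sm[OF that] by simp
  show n: "length (rep_list A) = n" using A size_mset[of "rep_list A"] unfolding m by simp
  show "count (mset (rep_list A)) l \<le> 1" if "l \<in> set (rep_list A)" "odd (hb (fst l))" for l
    unfolding m using A sm[OF that(1)] that(2) by simp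
  have "(\<Sum>l\<in>#mset (rep_list A). fst l) = \<gamma>0" using A m by simp
  then show "realizes (rep_list A) (rep_gen A)"
    unfolding rep_gen_def by (intro someI_ex[OF realizes_exists[OF v n]])
qed

definition letter_class :: "letter multiset \<Rightarrow> ('v tgen \<Rightarrow>\<^sub>0 'k) set set" where
  "letter_class A = T.P.sym (rep_gen A)"

lemma letter_class_carrier: "A \<in> TA \<Longrightarrow> letter_class A \<in> carrier TQ"
  unfolding letter_class_def using rep_facts(1) T.P.sym_carrier by (auto simp: realizes_def)

abbreviation "class_span \<equiv> vspan TQ (letter_class ` TA \<union> WQ)"

lemma letter_class_WQ_sub: "letter_class ` TA \<union> WQ \<subseteq> carrier TQ"
  using letter_class_carrier WQ_sub by auto

lemmas class_span_sub = vspan_sub[OF TQ_vspace letter_class_WQ_sub]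

lemma class_span_cancel:
  assumes "v \<in> carrier TQ" "v \<ominus>\<^bsub>TQ\<^esub> u \<in> WQ" "u \<in> class_span"
  shows "v \<in> class_span"
proof -
  have "v \<ominus>\<^bsub>TQ\<^esub> u \<in> class_span" using class_span_sub(2) assms(2) by auto
  then have "(v \<ominus>\<^bsub>TQ\<^esub> u) \<oplus>\<^bsub>TQ\<^esub> u \<in> class_span" using class_span_sub(4) assms(3) by blast
  moreover have "u \<in> carrier TQ" using class_span_sub(1) assms(3) by blast
  ultimately show ?thesis using vspace_simps(13)[OF TQ_vspace assms(1)] by simp
qed

text \<open>Rearranging the factors only costs a sign, and afterwards \<open>same_words\<close> applies.\<close>

lemma class_span_rearrange:
  assumes r: "realizes ls g" and r2: "realizes ls2 g2" and m: "mset ls2 = mset ls" and s: "T.P.sym g2 \<in> class_span"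
  shows "T.P.sym g \<in> class_span"
proof -
  obtain xs \<sigma> \<tau> where g: "g = (xs, \<sigma>, \<tau>)" by (cases g)
  obtain f where f: "f permutes {..<length ls}" "permute_list f ls = ls2"
    using mset_eq_permutation[OF m] by blast
  have fn: "f permutes {..<n}" using f realizes_length[OF r] by simp
  let ?g' = "(perm_factors f xs \<sigma> \<tau>)"
  note R = realizes_permute[OF r[unfolded g] fn]
  have gs: "g2 \<in> Gens" "?g' \<in> Gens" "factor_words g2 = factor_words ?g'" using R(1) r2 f by (auto simp: realizes_def)
  have "T.P.sym ?g' \<in> class_span" by (rule class_span_cancel[OF T.P.sym_carrier[OF gs(2)] same_words[OF gs] s])
  then show ?thesis unfolding g R(2) by (rule class_span_sub(6))
qed

text \<open>Either the multiset of letters is admissible, or an odd letter is repeated and the class is its own negative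
  modulo the stabilizer relations.\<close>

lemma class_span_letters:
  assumes r: "realizes ls g" and v: "\<And>l. l \<in> set ls \<Longrightarrow> valid l"
  shows "T.P.sym g \<in> class_span"
proof (cases "\<forall>l\<in>set ls. odd (hb (fst l)) \<longrightarrow> count (mset ls) l \<le> 1")
  case True
  let ?A = "mset ls"
  have A: "?A \<in> TA" unfolding letter_msets_def using True v realizes_length[OF r] realizes_weight[OF r] by simp
  show ?thesis
    by (rule class_span_rearrange[OF r rep_facts(1)[OF A] mset_rep_list]) (use class_span_sub(2) A in \<open>auto simp: letter_class_def\<close>)
next
  case False
  then obtain l where l: "l \<in> set ls" "odd (hb (fst l))" "count (mset ls) l \<ge> 2" by force
  define B where "B = mset ls - {#l, l#}"
  have B: "mset ls = add_mset l (add_mset l B)"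
    unfolding B_def by (rule multiset_eqI) (use l(3) in auto)
  obtain bs where bs: "mset bs = B" using ex_mset by blast
  define ls2 where "ls2 = l # l # bs"
  have m2: "mset ls2 = mset ls" using B bs by (simp add: ls2_def)
  have n2: "length ls2 = n" using m2 realizes_length[OF r] by (metis size_mset)
  obtain g2 where r2: "realizes ls2 g2"
  proof -
    have "set ls2 = set ls" using m2 by (rule mset_eq_setD)
    then have "\<exists>g. realizes ls2 g" by (intro realizes_exists) (use v n2 m2 realizes_weight[OF r] in auto)
    then show ?thesis using that by blast
  qed
  \<comment> \<open>With two equal odd letters in front, the transposition fixes the letter list and has sign \<open>-1\<close>:
    twice the class is a stabilizer relation.\<close>
  obtain xs \<sigma> \<tau> where g: "g2 = (xs, \<sigma>, \<tau>)" by (cases g2)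
  let ?f = "Transposition.transpose 0 (1::nat)"
  have f: "?f permutes {..<n}" by (rule permutes_swap_id) (use n2 ls2_def in auto)
  let ?g' = "(permute_list ?f xs, block_perm (map lar xs) ?f \<circ> \<sigma>, block_perm (map rar xs) ?f \<circ> \<tau>)"
  note R = realizes_permute[OF r2[unfolded g] f]
  have fl: "permute_list ?f ls2 = ls2"
  proof (rule nth_equalityI)
    fix i assume "i < length (permute_list ?f ls2)"
    then show "permute_list ?f ls2 ! i = ls2 ! i"
      using permute_list_nth[of ?f ls2 i] f n2 by (auto simp: ls2_def Transposition.transpose_def)
  qed simp
  have sgn: "koszul_sign (map hdeg xs) ?f = (-1 :: 'k)"
    unfolding realizes_hdeg[OF r2[unfolded g]] ls2_def using koszul_sign_swap[OF l(2)] by simp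
  have gs: "g2 \<in> Gens" "?g' \<in> Gens" "factor_words g2 = factor_words ?g'" using R(1) r2 fl by (auto simp: realizes_def)
  note w = same_words[OF gs]
  let ?s = "T.P.sym ?g'"
  note sc = T.P.sym_carrier[OF gs(2)]
  interpret Qv: vectorspace class_ring TQ by (rule TQ_vspace)
  have "T.P.sym g2 = (-1) \<odot>\<^bsub>TQ\<^esub> ?s" using R(2) sgn by (simp add: g)
  then have "?s \<ominus>\<^bsub>TQ\<^esub> T.P.sym g2 = ?s \<oplus>\<^bsub>TQ\<^esub> ((-1) \<odot>\<^bsub>TQ\<^esub> ((-1) \<odot>\<^bsub>TQ\<^esub> ?s))"
    using vspace_simps(11)[OF TQ_vspace sc] T.P.sym_carrier[OF gs(1)] by simp
  also have "\<dots> = 2 \<odot>\<^bsub>TQ\<^esub> ?s"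
    using Qv.smult_assoc1[of "-1" "-1" ?s] Qv.smult_l_distr[of 1 1 ?s] sc vspace_simps(9)[OF TQ_vspace sc] by simp
  finally have two: "2 \<odot>\<^bsub>TQ\<^esub> ?s \<in> class_span" using w class_span_sub(2) by auto
  have "(- 1 / 2) \<odot>\<^bsub>TQ\<^esub> (2 \<odot>\<^bsub>TQ\<^esub> ?s) = (-1) \<odot>\<^bsub>TQ\<^esub> ?s"
    using Qv.smult_assoc1[of "-1/2" 2 ?s] sc by simp
  then have "T.P.sym g2 \<in> class_span" using class_span_sub(6)[OF two, of "-1/2"] \<open>T.P.sym g2 = (-1) \<odot>\<^bsub>TQ\<^esub> ?s\<close> by simp
  then show ?thesis by (rule class_span_rearrange[OF r r2 m2])
qed

text \<open>If all factors carry standard words, each factor can be expanded in the dual system of its weight. A stabilizer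
  relation in one factor becomes a stabilizer relation of the whole tensor by the induction relation.\<close>

lemma class_span_sorted:
  assumes g: "(xs, \<sigma>, \<tau>) \<in> Gens"
    and w: "\<And>i. i < n \<Longrightarrow> snd (factor_words (xs, \<sigma>, \<tau>) ! i) = (wordX (\<gamma> i), wordY (\<gamma> i))"
    and hd: "\<And>i. i < n \<Longrightarrow> hdeg (xs ! i) = hb (\<gamma> i)"
  shows "T.P.sym (xs, \<sigma>, \<tau>) \<in> class_span"
proof -
  note A = g[unfolded T.TGens_iff]
  have len: "length xs = n" using A by simp
  have lx: "lar (xs ! i) = mx (\<gamma> i)" "rar (xs ! i) = my (\<gamma> i)" if "i < n" for i
  proof -
    have e: "wordX (\<gamma> i) = block_word (map lar xs) (\<lambda>p. WI ! pinv \<sigma> p) i"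
      "wordY (\<gamma> i) = block_word (map rar xs) (\<lambda>p. WJ ! pinv \<tau> p) i"
      using w[OF that] factor_words_nth[OF g that] by auto
    show "lar (xs ! i) = mx (\<gamma> i)" "rar (xs ! i) = my (\<gamma> i)"
      unfolding e by (rule factor_words_lengths[OF g that, symmetric])+
  qed
  define upd where "upd vs = map (\<lambda>i. homog_update (xs ! i) (vs ! i)) [0..<n]" for vs
  define V where "V i = space_of M (xs ! i)" for i
  define R where "R i = stab_rels (V i) (biact M (lar (xs ! i)) (rar (xs ! i)) (hdeg (xs ! i))) (wordX (\<gamma> i)) (wordY (\<gamma> i))" for i
  define S where "S i = ev (\<gamma> i) ` {..<c (\<gamma> i)} \<union> R i" for i
  have D: "R i \<subseteq> carrier (V i)" "ev (\<gamma> i) ` {..<c (\<gamma> i)} \<subseteq> carrier (V i)" "carrier (V i) \<subseteq> vspan (V i) (S i)" if "i < n" for i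
    using sys[of "\<gamma> i", unfolded dual_system_def] lx[OF that] hd[OF that] by (auto simp: V_def R_def S_def)
  have upd_nth: "upd vs ! i = homog_update (xs ! i) (vs ! i)" if "i < n" for vs i using that by (simp add: upd_def)
  have upd_len: "length (upd vs) = n" for vs by (simp add: upd_def)
  have upd_map: "map lar (upd vs) = map lar xs" "map rar (upd vs) = map rar xs" "map hdeg (upd vs) = map hdeg xs" for vs
    using len by (auto simp: upd_def intro: nth_equalityI)
  have updG: "(upd vs, \<sigma>, \<tau>) \<in> Gens" if "\<And>j. j < n \<Longrightarrow> vs ! j \<in> carrier (V j)" for vs
    using A that unfolding T.TGens_iff upd_map by (simp add: upd_len upd_nth V_def)
  have upd_upd: "upd (vs[i := u]) = (upd vs)[i := homog_update (upd vs ! i) u]" if "length vs = n" "i < n" for vs i u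
    using that by (intro nth_equalityI) (auto simp: upd_len upd_nth nth_list_update)
  have upd_zs: "factor_words (upd vs, \<sigma>, \<tau>) ! i = (homog_update (xs ! i) (vs ! i), wordX (\<gamma> i), wordY (\<gamma> i))"
    if "i < n" for vs i
    using w[OF that] factor_words_nth[OF g that] that by (simp add: factor_words_def upd_map upd_len upd_nth)
  have f_lin: "lin_on (V i) TQ (\<lambda>u. T.P.sym (upd (vs[i := u]), \<sigma>, \<tau>))"
    if i: "i < n" and vs: "length vs = n" "\<And>j. j < n \<Longrightarrow> vs ! j \<in> carrier (V j)" for i vs
  proof -
    have e: "space_of M (upd vs ! i) = V i" using upd_nth[OF i] by (simp add: V_def)
    show ?thesis unfolding upd_upd[OF vs(1) i] e[symmetric]
      by (rule T.P.sym_lin_on[OF T.space_vspace T.TRels_lin[OF updG[OF vs(2)] i] T.TGens_update[OF updG[OF vs(2)] i]])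
  qed
  have "T.P.sym (upd (map hvec xs), \<sigma>, \<tau>) \<in> class_span"
  proof (rule multilinear_span[OF TQ_vspace letter_class_WQ_sub, where V = V and S = S and n = n and f = "\<lambda>vs. T.P.sym (upd vs, \<sigma>, \<tau>)"])
    show "vspace (V i)" for i unfolding V_def by (rule T.space_vspace)
    show "S i \<subseteq> carrier (V i)" if "i < n" for i using D(1,2)[OF that] by (simp add: S_def)
    show "carrier (V i) \<subseteq> vspan (V i) (S i)" if "i < n" for i using D(3)[OF that] .
    show "lin_on (V i) TQ (\<lambda>u. T.P.sym (upd (vs[i := u]), \<sigma>, \<tau>))"
      if "i < n" "length vs = n" "\<And>j. j < n \<Longrightarrow> vs ! j \<in> carrier (V j)" for i vs
      by (rule f_lin[OF that])
    show "length (map hvec xs) = n" using len by simp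
    show "map hvec xs ! j \<in> carrier (V j)" if "j < n" for j using A that by (simp add: V_def)
    fix vs assume vs: "length vs = n" "\<And>j. j < n \<Longrightarrow> vs ! j \<in> S j"
    have vc: "vs ! j \<in> carrier (V j)" if "j < n" for j using vs(2)[OF that] D(1,2)[OF that] by (auto simp: S_def)
    show "T.P.sym (upd vs, \<sigma>, \<tau>) \<in> class_span"
    proof (cases "\<forall>j<n. vs ! j \<in> ev (\<gamma> j) ` {..<c (\<gamma> j)}")
      case True
      then have "\<forall>j<n. \<exists>t. t < c (\<gamma> j) \<and> vs ! j = ev (\<gamma> j) t" by auto
      then obtain t where t: "\<And>j. j < n \<Longrightarrow> t j < c (\<gamma> j) \<and> vs ! j = ev (\<gamma> j) (t j)" by metis
      let ?ls = "map (\<lambda>j. (\<gamma> j, t j)) [0..<n]"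
      have "factor_words (upd vs, \<sigma>, \<tau>) = map letter_elem ?ls"
        by (rule nth_equalityI)
          (use upd_zs t lx hd factor_words_length[OF updG[OF vc]] in \<open>auto simp: letter_elem_def homog_update_def\<close>)
      then have "realizes ?ls (upd vs, \<sigma>, \<tau>)" using updG[OF vc] by (simp add: realizes_def)
      then show ?thesis by (rule class_span_letters) (use t in \<open>auto simp: valid_def\<close>)
    next
      case False
      then obtain j where j: "j < n" "vs ! j \<in> R j" using vs(2) by (auto simp: S_def)
      let ?B = "biact M (lar (xs ! j)) (rar (xs ! j)) (hdeg (xs ! j))"
      obtain s t u where u: "vs ! j = ?B s t u \<ominus>\<^bsub>V j\<^esub> u" "s \<in> word_stab (wordX (\<gamma> j))" "t \<in> word_stab (wordY (\<gamma> j))" "u \<in> carrier (V j)"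
        using j(2) unfolding R_def stab_rels_def by blast
      have st: "s permutes {..<lar (xs ! j)}" "t permutes {..<rar (xs ! j)}" "permute_list s (wordX (\<gamma> j)) = wordX (\<gamma> j)" "permute_list t (wordY (\<gamma> j)) = wordY (\<gamma> j)"
        using u lx[OF j(1)] by (auto simp: word_stab_def)
      have Bu: "?B s t u \<in> carrier (V j)" using lin_on_simps(1)[OF T.action_lin[OF st(1,2)]] u(4) by (simp add: V_def)
      note fl = f_lin[OF j(1) vs(1) vc]
      have Vj: "vspace (V j)" unfolding V_def by (rule T.space_vspace)
      have "T.P.sym (upd vs, \<sigma>, \<tau>) = T.P.sym (upd (vs[j := vs ! j]), \<sigma>, \<tau>)" by simp
      also have "\<dots> = T.P.sym (upd (vs[j := ?B s t u]), \<sigma>, \<tau>) \<ominus>\<^bsub>TQ\<^esub> T.P.sym (upd (vs[j := u]), \<sigma>, \<tau>)"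
        unfolding u(1) by (rule lin_on_simps(5)[OF fl Vj TQ_vspace Bu u(4)])
      also have "\<dots> \<in> WQ"
      proof -
        let ?vs = "vs[j := u]"
        have vc': "?vs ! i \<in> carrier (V i)" if "i < n" for i using vc[OF that] u(4) vs(1) that by (cases "i = j") auto
        define h where "h i = (if i = j then s else id)" for i
        define h' where "h' i = (if i = j then t else id)" for i
        have hp: "h i permutes {..<lar (upd ?vs ! i)}" "h' i permutes {..<rar (upd ?vs ! i)}" if "i < n" for i
          using st that by (auto simp: h_def h'_def upd_nth permutes_id)
        have act: "tensor_act M h h' (upd ?vs) = upd (vs[j := ?B s t u])"
        proof (rule nth_equalityI)
          fix i assume "i < length (tensor_act M h h' (upd ?vs))"
          then have i: "i < n" by (simp add: upd_len)
          have vi: "vs ! i \<in> carrier (space_of M (xs ! i))" using vc[OF i] by (simp add: V_def)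
          show "tensor_act M h h' (upd ?vs) ! i = upd (vs[j := ?B s t u]) ! i"
            using i j(1) vs(1) T.action_id[OF vi] by (auto simp: tensor_act_alt upd_len upd_nth h_def h'_def nth_list_update)
        qed (simp add: upd_len)
        let ?g1 = "(upd ?vs, \<sigma>, \<tau>)" and ?g2 = "(upd ?vs, block_sum (map lar (upd ?vs)) h \<circ> \<sigma>, block_sum (map rar (upd ?vs)) h' \<circ> \<tau>)"
        note G1 = updG[OF vc']
        have G2: "?g2 \<in> Gens" by (rule T.TGens_act(2)[OF G1 hp])
        have e: "T.P.sym (upd (vs[j := ?B s t u]), \<sigma>, \<tau>) = T.P.sym ?g2"
          unfolding act[symmetric] by (rule young_sym[OF G1 hp])
        have inv_stab: "permute_list (pinv \<rho>) W = W" if "\<rho> permutes {..<length W}" "permute_list \<rho> W = W" for \<rho> and W :: "nat list"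
          using permute_list_inv[OF that(1)] that(2) by simp
        have zz: "factor_words ?g1 = factor_words ?g2"
        proof (rule nth_equalityI)
          show "length (factor_words ?g1) = length (factor_words ?g2)" using factor_words_length[OF G1] factor_words_length[OF G2] by simp
          fix i assume "i < length (factor_words ?g1)"
          then have i: "i < n" using factor_words_length[OF G1] by simp
          have "permute_list (pinv (h i)) (wordX (\<gamma> i)) = wordX (\<gamma> i)" "permute_list (pinv (h' i)) (wordY (\<gamma> i)) = wordY (\<gamma> i)"
            using inv_stab[of s "wordX (\<gamma> j)"] inv_stab[of t "wordY (\<gamma> j)"] st lx[OF j(1)] by (auto simp: h_def h'_def inv_id)
          then show "factor_words ?g1 ! i = factor_words ?g2 ! i"
            using factor_words_act(2)[of "upd ?vs" \<sigma> \<tau> i h h', OF G1 i hp] upd_zs[OF i, of ?vs] upd_nth[OF i, of ?vs] by simp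
        qed
        have "T.P.sym ?g2 \<ominus>\<^bsub>TQ\<^esub> T.P.sym ?g1 \<in> WQ" by (rule same_words[OF _ G2 zz]) (rule G1)
        then show ?thesis using e by simp
      qed
      finally show ?thesis using class_span_sub(2) by auto
    qed
  qed
  moreover have "upd (map hvec xs) = xs"
    using len by (intro nth_equalityI) (auto simp: upd_len upd_nth)
  ultimately show ?thesis by simp
qed

text \<open>An arbitrary generator is brought to standard words by acting with a Young subgroup.\<close>

lemma class_span_gens:
  assumes g: "(xs, \<sigma>, \<tau>) \<in> Gens"
  shows "T.P.sym (xs, \<sigma>, \<tau>) \<in> class_span"
proof -
  note A = g[unfolded T.TGens_iff]
  have len: "length xs = n" using A by simp
  define w where "w i = fst (snd (factor_words (xs, \<sigma>, \<tau>) ! i))" for i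
  define w' where "w' i = snd (snd (factor_words (xs, \<sigma>, \<tau>) ! i))" for i
  define \<gamma> where "\<gamma> i = word_monomial (w i) (w' i) (hdeg (xs ! i))" for i
  have wl: "length (w i) = lar (xs ! i)" "length (w' i) = rar (xs ! i)" if "i < n" for i
    using factor_words_nth[OF g that] factor_words_lengths[OF g that] by (simp_all add: w_def w'_def)
  have "\<exists>h. h permutes {..<length (w i)} \<and> permute_list h (w i) = wordX (\<gamma> i)" for i
    using word_permutation[of "w i" "wordX (\<gamma> i)"] mset_word_monomial(1)[of "w i" "w' i" "hdeg (xs ! i)"] unfolding \<gamma>_def by metis
  then obtain h where h: "\<And>i. h i permutes {..<length (w i)}" "\<And>i. permute_list (h i) (w i) = wordX (\<gamma> i)" by metis
  have "\<exists>h. h permutes {..<length (w' i)} \<and> permute_list h (w' i) = wordY (\<gamma> i)" for i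
    using word_permutation[of "w' i" "wordY (\<gamma> i)"] mset_word_monomial(2)[of "w i" "w' i" "hdeg (xs ! i)"] unfolding \<gamma>_def by metis
  then obtain h' where h': "\<And>i. h' i permutes {..<length (w' i)}" "\<And>i. permute_list (h' i) (w' i) = wordY (\<gamma> i)" by metis
  have hp: "h i permutes {..<lar (xs ! i)}" "h' i permutes {..<rar (xs ! i)}" if "i < n" for i
    using h(1)[of i] h'(1)[of i] wl[OF that] by auto
  define xs' where "xs' = tensor_act M h h' xs"
  let ?k = "\<lambda>i. pinv (h i)" and ?k' = "\<lambda>i. pinv (h' i)"
  have xs'_nth: "xs' ! i = homog_update (xs ! i) (biact M (lar (xs ! i)) (rar (xs ! i)) (hdeg (xs ! i)) (h i) (h' i) (hvec (xs ! i)))" if "i < n" for i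
    using that len by (simp add: xs'_def tensor_act_alt)
  have G': "(xs', \<sigma>, \<tau>) \<in> Gens" unfolding xs'_def by (rule T.TGens_act(1)[OF g hp])
  have kp: "?k i permutes {..<lar (xs' ! i)}" "?k' i permutes {..<rar (xs' ! i)}" if "i < n" for i
    using permutes_inv[OF hp(1)[OF that]] permutes_inv[OF hp(2)[OF that]] xs'_nth[OF that] by simp_all
  have undo: "tensor_act M ?k ?k' xs' = xs"
  proof (rule nth_equalityI)
    show l: "length (tensor_act M ?k ?k' xs') = length xs" by (simp add: xs'_def)
    fix i assume "i < length (tensor_act M ?k ?k' xs')"
    then have i: "i < n" using l len by simp
    let ?B = "biact M (lar (xs ! i)) (rar (xs ! i)) (hdeg (xs ! i))"
    have v: "hvec (xs ! i) \<in> carrier (space_of M (xs ! i))" using A i by simp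
    have "?B (?k i) (?k' i) (?B (h i) (h' i) (hvec (xs ! i))) = ?B (h i \<circ> ?k i) (h' i \<circ> ?k' i) (hvec (xs ! i))"
      by (rule T.action_comp[symmetric, OF hp[OF i] permutes_inv[OF hp(1)[OF i]] permutes_inv[OF hp(2)[OF i]] v])
    also have "\<dots> = hvec (xs ! i)"
      unfolding permutes_inv_o(1)[OF hp(1)[OF i]] permutes_inv_o(1)[OF hp(2)[OF i]] by (rule T.action_id[OF v])
    finally show "tensor_act M ?k ?k' xs' ! i = xs ! i"
      using i len xs'_nth[OF i] by (simp add: tensor_act_alt xs'_def)
  qed
  let ?g2 = "(xs', block_sum (map lar xs') ?k \<circ> \<sigma>, block_sum (map rar xs') ?k' \<circ> \<tau>)"
  have e: "T.P.sym (xs, \<sigma>, \<tau>) = T.P.sym ?g2"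
    using young_sym[of xs' \<sigma> \<tau> ?k ?k', OF G' kp] unfolding undo .
  have G2: "?g2 \<in> Gens" by (rule T.TGens_act(2)[OF G' kp])
  have z: "snd (factor_words ?g2 ! i) = (wordX (\<gamma> i), wordY (\<gamma> i))" if i: "i < n" for i
  proof -
    have "snd (factor_words (xs', \<sigma>, \<tau>) ! i) = (w i, w' i)"
      using factor_words_act(1)[of xs \<sigma> \<tau> i h h', OF g i hp] by (simp add: xs'_def w_def w'_def)
    then show ?thesis
      using factor_words_act(2)[of xs' \<sigma> \<tau> i ?k ?k', OF G' i kp] h h' permutes_inv_inv[OF h(1)] permutes_inv_inv[OF h'(1)] by simp
  qed
  show ?thesis unfolding e
    by (rule class_span_sorted[OF G2 z]) (use xs'_nth in \<open>auto simp: \<gamma>_def lookup_word_monomial\<close>)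
qed

definition letter_form :: "letter multiset \<Rightarrow> ('v tgen \<Rightarrow>\<^sub>0 'k) set set \<Rightarrow> 'k" where
  "letter_form A = (SOME \<chi>. linear_form TQ \<chi> \<and> (\<forall>g\<in>Gens. \<chi> (T.P.sym g) = list_value (rep_list A) g))"

lemma letter_form:
  assumes "A \<in> TA"
  shows "linear_form TQ (letter_form A)" "\<And>g. g \<in> Gens \<Longrightarrow> letter_form A (T.P.sym g) = list_value (rep_list A) g"
proof -
  have "valid (rep_list A ! k)" if "k < n" for k
    using rep_facts(2)[OF assms] rep_facts(3)[OF assms] that by simp
  then have "\<exists>\<chi>. linear_form TQ \<chi> \<and> (\<forall>g\<in>Gens. \<chi> (T.P.sym g) = list_value (rep_list A) g)"
    using list_value_form[of "rep_list A"] by metis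
  then have "linear_form TQ (letter_form A) \<and> (\<forall>g\<in>Gens. letter_form A (T.P.sym g) = list_value (rep_list A) g)"
    unfolding letter_form_def by (rule someI_ex)
  then show "linear_form TQ (letter_form A)" "\<And>g. g \<in> Gens \<Longrightarrow> letter_form A (T.P.sym g) = list_value (rep_list A) g" by auto
qed

lemma list_value_realizes:
  assumes r: "realizes ls g" and ls: "\<And>l. l \<in> set ls \<Longrightarrow> valid l" and ls': "\<And>l. l \<in> set ls' \<Longrightarrow> valid l" "length ls' = n"
  shows "list_value ls' g = (\<Sum>f\<in>T.factor_perms. if permute_list f ls = ls' then koszul_sign (map (\<lambda>l. hb (fst l)) ls) f * (\<Prod>k<n. letter_norm (ls' ! k)) else 0)"
  unfolding list_value_def
proof (rule sum.cong[OF refl])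
  fix f assume "f \<in> T.factor_perms"
  then have f: "f permutes {..<n}" by (rule factor_perms_D)
  have len: "length ls = n" using realizes_length[OF r] .
  have z: "factor_words g = map letter_elem ls" using r by (simp add: realizes_def)
  have dg: "map (\<lambda>z. hdeg (fst z)) (factor_words g) = map (\<lambda>l. hb (fst l)) ls" unfolding z by (simp add: letter_elem_def o_def)
  have fl: "f permutes {..<length ls}" using f len by simp
  have LFk: "letter_value (ls' ! k) (factor_words g ! f k) = (if permute_list f ls ! k = ls' ! k then letter_norm (ls' ! k) else 0)" if k: "k < n" for k
  proof -
    have fk: "f k < n" using permutes_less(1)[OF f k] .
    have "letter_value (ls' ! k) (letter_elem (ls ! f k)) = (if ls' ! k = ls ! f k then letter_norm (ls' ! k) else 0)"
      by (rule letter_value_letter) (use ls ls' k fk len in auto)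
    then show ?thesis using fk k len permute_list_nth[OF fl, of k] by (auto simp: z)
  qed
  show "koszul_sign (map (\<lambda>z. hdeg (fst z)) (factor_words g)) f * (\<Prod>k<n. letter_value (ls' ! k) (factor_words g ! f k)) =
      (if permute_list f ls = ls' then koszul_sign (map (\<lambda>l. hb (fst l)) ls) f * (\<Prod>k<n. letter_norm (ls' ! k)) else 0)"
  proof (cases "permute_list f ls = ls'")
    case True
    then show ?thesis using LFk by (simp add: dg)
  next
    case False
    then obtain k where "k < n" "permute_list f ls ! k \<noteq> ls' ! k"
      using nth_equalityI[of "permute_list f ls" ls'] len ls' by auto
    then have "(\<Prod>k<n. letter_value (ls' ! k) (factor_words g ! f k)) = 0" using LFk by (intro prod_zero) auto
    then show ?thesis using False by simp
  qed
qed

text \<open>Only matchings that identify the two lists of letters contribute. For equal lists all signs are \<open>1\<close> by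
  \<open>koszul_sign_stab\<close>, so that nothing cancels.\<close>

lemma letter_form_eval:
  assumes A: "A \<in> TA" and A': "A' \<in> TA"
  shows "A \<noteq> A' \<Longrightarrow> letter_form A' (letter_class A) = 0" "letter_form A (letter_class A) \<noteq> 0"
proof -
  have G: "rep_gen A \<in> Gens" using rep_facts(1)[OF A] by (simp add: realizes_def)
  have e: "letter_form B (letter_class A) = (\<Sum>f\<in>T.factor_perms. if permute_list f (rep_list A) = rep_list B then
      koszul_sign (map (\<lambda>l. hb (fst l)) (rep_list A)) f * (\<Prod>k<n. letter_norm (rep_list B ! k)) else 0)" if B: "B \<in> TA" for B
    unfolding letter_class_def letter_form(2)[OF B G]
    by (rule list_value_realizes[OF rep_facts(1,2)[OF A] rep_facts(2,3)[OF B]])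
  show "letter_form A' (letter_class A) = 0" if "A \<noteq> A'"
  proof -
    have "permute_list f (rep_list A) \<noteq> rep_list A'" if f: "f \<in> T.factor_perms" for f
    proof
      assume "permute_list f (rep_list A) = rep_list A'"
      then have "mset (rep_list A') = mset (rep_list A)"
        using mset_permute_list[of f "rep_list A"] factor_perms_D[OF f] rep_facts(3)[OF A] by simp
      then show False using \<open>A \<noteq> A'\<close> by (simp add: mset_rep_list)
    qed
    then show ?thesis unfolding e[OF A'] by (intro sum.neutral) auto
  qed
  let ?ls = "rep_list A"
  have n: "length ?ls = n" by (rule rep_facts(3)[OF A])
  have fin: "finite T.factor_perms" unfolding T.factor_perms_def by (simp add: finite_permutations)
  have "letter_form A (letter_class A) = (\<Sum>f\<in>word_stab ?ls. koszul_sign (map (\<lambda>l. hb (fst l)) ?ls) f * (\<Prod>k<n. letter_norm (?ls ! k)))"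
  proof -
    have "word_stab ?ls = {f \<in> T.factor_perms. permute_list f ?ls = ?ls}" using n by (auto simp: word_stab_def T.factor_perms_def)
    then show ?thesis unfolding e[OF A] by (simp only: sum.inter_filter[OF fin])
  qed
  also have "\<dots> = (\<Sum>f\<in>word_stab ?ls. \<Prod>k<n. letter_norm (?ls ! k))"
    by (rule sum.cong[OF refl]) (use koszul_sign_stab[of _ ?ls "\<lambda>l. hb (fst l)"] rep_facts(4)[OF A] in auto)
  also have "\<dots> = of_nat (card (word_stab ?ls)) * (\<Prod>k<n. letter_norm (?ls ! k))" by simp
  also have "\<dots> \<noteq> 0"
  proof -
    have "id \<in> word_stab ?ls" by (simp add: word_stab_def permutes_id)
    then show ?thesis using letter_norm_nonzero finite_word_stab[of ?ls] by (auto simp: card_eq_0_iff)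
  qed
  finally show "letter_form A (letter_class A) \<noteq> 0" .
qed

lemma letter_form_stab_rels:
  assumes A: "A \<in> TA" and w: "w \<in> WQ"
  shows "letter_form A w = 0"
proof -
  obtain \<rho> \<rho>' v where v: "w = T.right_biact \<rho> \<rho>' v \<ominus>\<^bsub>TQ\<^esub> v" "\<rho> \<in> word_stab WI" "\<rho>' \<in> word_stab WJ" "v \<in> carrier TQ"
    using w unfolding stab_rels_def by blast
  have rp: "\<rho> permutes {..<length WI}" "\<rho>' permutes {..<length WJ}" using v by (auto simp: word_stab_def)
  note lf = letter_form(1)[OF A]
  have S: "T.P.sym ` Gens \<subseteq> carrier TQ" using T.P.sym_carrier by auto
  have "linear_form TQ (\<lambda>v. letter_form A (T.right_biact \<rho> \<rho>' v) - letter_form A v)"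
    using linear_form_comp[OF T.right_biact_lin[OF rp] lf] lf by (simp add: linear_form_def algebra_simps)
  then have "letter_form A (T.right_biact \<rho> \<rho>' v) - letter_form A v = 0"
  proof (rule linear_form_vanish[OF TQ_vspace _ S T.P.Q_span[OF v(4)]])
    fix s assume "s \<in> T.P.sym ` Gens"
    then obtain xs \<sigma> \<tau> where s: "s = T.P.sym (xs, \<sigma>, \<tau>)" "(xs, \<sigma>, \<tau>) \<in> Gens" by auto
    have "list_value (rep_list A) (xs, \<sigma> \<circ> \<rho>, \<tau> \<circ> \<rho>') = list_value (rep_list A) (xs, \<sigma>, \<tau>)"
      unfolding list_value_def factor_words_right[OF s(2) v(2,3)] ..
    then show "letter_form A (T.right_biact \<rho> \<rho>' s) - letter_form A s = 0"
      unfolding s(1) T.right_biact_sym[OF rp s(2)] letter_form(2)[OF A s(2)] letter_form(2)[OF A T.TGens_right[OF s(2) rp]] by simp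
  qed
  then show ?thesis unfolding v(1) using linear_form_simps(4)[OF lf TQ_vspace lin_on_simps(1)[OF T.right_biact_lin[OF rp] v(4)] v(4)] by simp
qed

text \<open>The forms have to be rescaled: the value of each at its own class is a nonzero integer, a product of
  orders of stabilizers, rather than one.\<close>

theorem tensor_dual_system:
  assumes "finite TA"
  shows "dual_system TQ WQ TA letter_class (\<lambda>A v. inverse (letter_form A (letter_class A)) * letter_form A v)"
proof (rule dual_systemI[OF TQ_vspace assms WQ_sub])
  show "v \<in> class_span" if "v \<in> carrier TQ" for v
  proof -
    have "T.P.sym ` Gens \<subseteq> class_span" using class_span_gens by auto
    then show ?thesis using T.P.Q_span[OF that] vspan_least[OF TQ_vspace letter_class_WQ_sub] by auto
  qed
qed (use letter_class_carrier letter_form(1) letter_form_stab_rels letter_form_eval in auto)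

end

section \<open>Weight spaces of the saturation\<close>

definition ds_inj :: "'i set \<Rightarrow> ('i \<Rightarrow> ('k::field, 'v) module) \<Rightarrow> 'i \<Rightarrow> 'v \<Rightarrow> 'i \<Rightarrow> 'v" where
  "ds_inj I V i v = (\<lambda>j\<in>I. if j = i then v else \<zero>\<^bsub>V j\<^esub>)"

lemma direct_sum_simps:
  "carrier (direct_sum_space I V) = {t \<in> (\<Pi>\<^sub>E i\<in>I. carrier (V i)). finite {i\<in>I. t i \<noteq> \<zero>\<^bsub>V i\<^esub>}}"
  "\<zero>\<^bsub>direct_sum_space I V\<^esub> = (\<lambda>i\<in>I. \<zero>\<^bsub>V i\<^esub>)"
  "t \<oplus>\<^bsub>direct_sum_space I V\<^esub> u = (\<lambda>i\<in>I. t i \<oplus>\<^bsub>V i\<^esub> u i)"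
  "c \<odot>\<^bsub>direct_sum_space I V\<^esub> t = (\<lambda>i\<in>I. c \<odot>\<^bsub>V i\<^esub> t i)"
  by (simp_all add: direct_sum_space_def)

locale direct_sum_family =
  fixes I :: "'i set" and V :: "'i \<Rightarrow> ('k::field, 'v) module"
  assumes V: "\<And>i. i \<in> I \<Longrightarrow> vspace (V i)"
begin

abbreviation "DS \<equiv> direct_sum_space I V"

lemma DS_mem: "t \<in> carrier DS \<Longrightarrow> i \<in> I \<Longrightarrow> t i \<in> carrier (V i)"
  by (auto simp: direct_sum_simps)

lemma DS_eqI: "t \<in> carrier DS \<Longrightarrow> u \<in> carrier DS \<Longrightarrow> (\<And>i. i \<in> I \<Longrightarrow> t i = u i) \<Longrightarrow> t = u"
  unfolding direct_sum_simps by (auto intro!: extensionalityI[of _ I] simp: PiE_def)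

lemma DS_add: "t \<in> carrier DS \<Longrightarrow> u \<in> carrier DS \<Longrightarrow> t \<oplus>\<^bsub>DS\<^esub> u \<in> carrier DS"
proof -
  assume tu: "t \<in> carrier DS" "u \<in> carrier DS"
  have "{i\<in>I. t i \<oplus>\<^bsub>V i\<^esub> u i \<noteq> \<zero>\<^bsub>V i\<^esub>} \<subseteq> {i\<in>I. t i \<noteq> \<zero>\<^bsub>V i\<^esub>} \<union> {i\<in>I. u i \<noteq> \<zero>\<^bsub>V i\<^esub>}"
    using vspace_simps(1,5)[OF V] by auto
  moreover have "finite ({i\<in>I. t i \<noteq> \<zero>\<^bsub>V i\<^esub>} \<union> {i\<in>I. u i \<noteq> \<zero>\<^bsub>V i\<^esub>})" using tu by (simp add: direct_sum_simps)
  ultimately have "finite {i\<in>I. t i \<oplus>\<^bsub>V i\<^esub> u i \<noteq> \<zero>\<^bsub>V i\<^esub>}" by (rule finite_subset)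
  moreover have "{i \<in> I. (t \<oplus>\<^bsub>DS\<^esub> u) i \<noteq> \<zero>\<^bsub>V i\<^esub>} = {i\<in>I. t i \<oplus>\<^bsub>V i\<^esub> u i \<noteq> \<zero>\<^bsub>V i\<^esub>}" by (auto simp: direct_sum_simps)
  ultimately show ?thesis
    using vspace_simps(2)[OF V DS_mem[OF tu(1)] DS_mem[OF tu(2)]] by (simp add: direct_sum_simps)
qed

lemma DS_smult: "t \<in> carrier DS \<Longrightarrow> c \<odot>\<^bsub>DS\<^esub> t \<in> carrier DS"
proof -
  assume t: "t \<in> carrier DS"
  have "{i\<in>I. (c \<odot>\<^bsub>DS\<^esub> t) i \<noteq> \<zero>\<^bsub>V i\<^esub>} \<subseteq> {i\<in>I. t i \<noteq> \<zero>\<^bsub>V i\<^esub>}"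
    using vspace_simps(10)[OF V] by (auto simp: direct_sum_simps)
  moreover have "finite {i\<in>I. t i \<noteq> \<zero>\<^bsub>V i\<^esub>}" using t by (simp add: direct_sum_simps)
  ultimately have "finite {i\<in>I. (c \<odot>\<^bsub>DS\<^esub> t) i \<noteq> \<zero>\<^bsub>V i\<^esub>}" by (rule finite_subset)
  then show ?thesis
    using vspace_simps(4)[OF V DS_mem[OF t]] by (simp add: direct_sum_simps)
qed

lemma DS_zero: "\<zero>\<^bsub>DS\<^esub> \<in> carrier DS"
proof -
  have "{i\<in>I. \<zero>\<^bsub>DS\<^esub> i \<noteq> \<zero>\<^bsub>V i\<^esub>} = {}" by (auto simp: direct_sum_simps)
  then have "finite {i\<in>I. \<zero>\<^bsub>DS\<^esub> i \<noteq> \<zero>\<^bsub>V i\<^esub>}" by (metis finite.emptyI)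
  then show ?thesis using vspace_simps(1)[OF V] by (simp add: direct_sum_simps)
qed

lemma DS_nth:
  "i \<in> I \<Longrightarrow> (t \<oplus>\<^bsub>DS\<^esub> u) i = t i \<oplus>\<^bsub>V i\<^esub> u i" "i \<in> I \<Longrightarrow> (c \<odot>\<^bsub>DS\<^esub> t) i = c \<odot>\<^bsub>V i\<^esub> t i"
  "i \<in> I \<Longrightarrow> \<zero>\<^bsub>DS\<^esub> i = \<zero>\<^bsub>V i\<^esub>"
  by (simp_all add: direct_sum_simps)

lemma vspace_laws:
  assumes "i \<in> I"
  shows "\<And>u v. u \<in> carrier (V i) \<Longrightarrow> v \<in> carrier (V i) \<Longrightarrow> u \<oplus>\<^bsub>V i\<^esub> v = v \<oplus>\<^bsub>V i\<^esub> u"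
    "\<And>u v w. u \<in> carrier (V i) \<Longrightarrow> v \<in> carrier (V i) \<Longrightarrow> w \<in> carrier (V i) \<Longrightarrow>
      (u \<oplus>\<^bsub>V i\<^esub> v) \<oplus>\<^bsub>V i\<^esub> w = u \<oplus>\<^bsub>V i\<^esub> (v \<oplus>\<^bsub>V i\<^esub> w)"
    "\<And>u a b. u \<in> carrier (V i) \<Longrightarrow> (a * b) \<odot>\<^bsub>V i\<^esub> u = a \<odot>\<^bsub>V i\<^esub> (b \<odot>\<^bsub>V i\<^esub> u)"
    "\<And>u a b. u \<in> carrier (V i) \<Longrightarrow> (a + b) \<odot>\<^bsub>V i\<^esub> u = a \<odot>\<^bsub>V i\<^esub> u \<oplus>\<^bsub>V i\<^esub> b \<odot>\<^bsub>V i\<^esub> u"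
    "\<And>u v a. u \<in> carrier (V i) \<Longrightarrow> v \<in> carrier (V i) \<Longrightarrow>
      a \<odot>\<^bsub>V i\<^esub> (u \<oplus>\<^bsub>V i\<^esub> v) = a \<odot>\<^bsub>V i\<^esub> u \<oplus>\<^bsub>V i\<^esub> a \<odot>\<^bsub>V i\<^esub> v"
    "\<And>u. u \<in> carrier (V i) \<Longrightarrow> u \<oplus>\<^bsub>V i\<^esub> ((- 1) \<odot>\<^bsub>V i\<^esub> u) = \<zero>\<^bsub>V i\<^esub>"
proof -
  interpret Vi: vectorspace class_ring "V i" by (rule V[OF assms(1)])
  fix u v w a b assume u: "u \<in> carrier (V i)"
  show "(a * b) \<odot>\<^bsub>V i\<^esub> u = a \<odot>\<^bsub>V i\<^esub> (b \<odot>\<^bsub>V i\<^esub> u)" using Vi.smult_assoc1[of a b u] u by simp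
  show "(a + b) \<odot>\<^bsub>V i\<^esub> u = a \<odot>\<^bsub>V i\<^esub> u \<oplus>\<^bsub>V i\<^esub> b \<odot>\<^bsub>V i\<^esub> u" using Vi.smult_l_distr[of a b u] u by simp
  show "u \<oplus>\<^bsub>V i\<^esub> ((- 1) \<odot>\<^bsub>V i\<^esub> u) = \<zero>\<^bsub>V i\<^esub>"
    using vspace_simps(7,11)[OF V[OF assms(1)] u] u by simp
  assume v: "v \<in> carrier (V i)"
  show "u \<oplus>\<^bsub>V i\<^esub> v = v \<oplus>\<^bsub>V i\<^esub> u" using u v Vi.M.a_ac by auto
  show "a \<odot>\<^bsub>V i\<^esub> (u \<oplus>\<^bsub>V i\<^esub> v) = a \<odot>\<^bsub>V i\<^esub> u \<oplus>\<^bsub>V i\<^esub> a \<odot>\<^bsub>V i\<^esub> v" using Vi.smult_r_distr[of a u v] u v by simp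
  assume "w \<in> carrier (V i)"
  then show "(u \<oplus>\<^bsub>V i\<^esub> v) \<oplus>\<^bsub>V i\<^esub> w = u \<oplus>\<^bsub>V i\<^esub> (v \<oplus>\<^bsub>V i\<^esub> w)" using u v Vi.M.a_ac by auto
qed

lemma DS_vspace: "vspace DS"
proof (rule vs_criteria[OF class_field DS_zero])
  note m = DS_mem and cl = DS_add DS_smult DS_zero
  show "\<forall>v w. v \<in> carrier DS \<and> w \<in> carrier DS \<longrightarrow> v \<oplus>\<^bsub>DS\<^esub> w \<in> carrier DS" using DS_add by blast
  show "\<forall>c v. c \<in> carrier class_ring \<and> v \<in> carrier DS \<longrightarrow> c \<odot>\<^bsub>DS\<^esub> v \<in> carrier DS" using DS_smult by blast
  show "\<forall>v w. v \<in> carrier DS \<and> w \<in> carrier DS \<longrightarrow> v \<oplus>\<^bsub>DS\<^esub> w = w \<oplus>\<^bsub>DS\<^esub> v"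
  proof (intro allI impI, elim conjE)
    fix v w assume vw: "v \<in> carrier DS" "w \<in> carrier DS"
    show "v \<oplus>\<^bsub>DS\<^esub> w = w \<oplus>\<^bsub>DS\<^esub> v"
      by (rule DS_eqI[OF DS_add[OF vw] DS_add[OF vw(2,1)]])
        (simp only: DS_nth, rule vspace_laws(1)[OF _ m[OF vw(1)] m[OF vw(2)]])
  qed
  show "\<forall>v w x. v \<in> carrier DS \<and> w \<in> carrier DS \<and> x \<in> carrier DS \<longrightarrow> v \<oplus>\<^bsub>DS\<^esub> w \<oplus>\<^bsub>DS\<^esub> x = v \<oplus>\<^bsub>DS\<^esub> (w \<oplus>\<^bsub>DS\<^esub> x)"
    by (auto intro!: DS_eqI cl simp: DS_nth vspace_laws(2) m)
  show "\<forall>v\<in>carrier DS. v \<oplus>\<^bsub>DS\<^esub> \<zero>\<^bsub>DS\<^esub> = v"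
    by (auto intro!: DS_eqI cl simp: DS_nth vspace_simps(6)[OF V] m)
  show "\<forall>a b v. a \<in> carrier class_ring \<and> b \<in> carrier class_ring \<and> v \<in> carrier DS \<longrightarrow>
      (a \<otimes>\<^bsub>class_ring\<^esub> b) \<odot>\<^bsub>DS\<^esub> v = a \<odot>\<^bsub>DS\<^esub> (b \<odot>\<^bsub>DS\<^esub> v)"
    by (auto intro!: DS_eqI cl simp: DS_nth vspace_laws(3) m)
  show "\<forall>a b v. a \<in> carrier class_ring \<and> b \<in> carrier class_ring \<and> v \<in> carrier DS \<longrightarrow>
      (a \<oplus>\<^bsub>class_ring\<^esub> b) \<odot>\<^bsub>DS\<^esub> v = a \<odot>\<^bsub>DS\<^esub> v \<oplus>\<^bsub>DS\<^esub> b \<odot>\<^bsub>DS\<^esub> v"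
    by (auto intro!: DS_eqI cl simp: DS_nth vspace_laws(4) m)
  show "\<forall>a v w. a \<in> carrier class_ring \<and> v \<in> carrier DS \<and> w \<in> carrier DS \<longrightarrow>
      a \<odot>\<^bsub>DS\<^esub> (v \<oplus>\<^bsub>DS\<^esub> w) = a \<odot>\<^bsub>DS\<^esub> v \<oplus>\<^bsub>DS\<^esub> a \<odot>\<^bsub>DS\<^esub> w"
    by (auto intro!: DS_eqI cl simp: DS_nth vspace_laws(5) m)
  show "\<forall>v\<in>carrier DS. \<one>\<^bsub>class_ring\<^esub> \<odot>\<^bsub>DS\<^esub> v = v"
    by (auto intro!: DS_eqI cl simp: DS_nth vspace_simps(9)[OF V] m)
  show "\<forall>v\<in>carrier DS. \<exists>w\<in>carrier DS. v \<oplus>\<^bsub>DS\<^esub> w = \<zero>\<^bsub>DS\<^esub>"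
  proof
    fix v assume v: "v \<in> carrier DS"
    have "v \<oplus>\<^bsub>DS\<^esub> ((-1) \<odot>\<^bsub>DS\<^esub> v) = \<zero>\<^bsub>DS\<^esub>"
      by (rule DS_eqI) (use v in \<open>auto intro!: cl simp: DS_nth vspace_laws(6) m\<close>)
    then show "\<exists>w\<in>carrier DS. v \<oplus>\<^bsub>DS\<^esub> w = \<zero>\<^bsub>DS\<^esub>" using DS_smult[OF v] by blast
  qed
qed

lemma DS_component: "i \<in> I \<Longrightarrow> lin_on DS (V i) (\<lambda>t. t i)"
  by (auto simp: lin_on_def DS_nth DS_mem)

lemma DS_inj_carrier: "i \<in> I \<Longrightarrow> v \<in> carrier (V i) \<Longrightarrow> ds_inj I V i v \<in> carrier DS"
proof -
  assume i: "i \<in> I" "v \<in> carrier (V i)"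
  have "{j\<in>I. ds_inj I V i v j \<noteq> \<zero>\<^bsub>V j\<^esub>} \<subseteq> {i}" by (auto simp: ds_inj_def split: if_splits)
  then have "finite {j\<in>I. ds_inj I V i v j \<noteq> \<zero>\<^bsub>V j\<^esub>}" by (rule finite_subset) simp
  then show ?thesis using i vspace_simps(1)[OF V] by (simp add: direct_sum_simps) (simp add: ds_inj_def)
qed

lemma DS_inj_lin: "i \<in> I \<Longrightarrow> lin_on (V i) DS (ds_inj I V i)"
  unfolding lin_on_def
proof (intro conjI ballI allI)
  assume i: "i \<in> I"
  fix v assume v: "v \<in> carrier (V i)"
  show "ds_inj I V i v \<in> carrier DS" by (rule DS_inj_carrier[OF i v])
  show "ds_inj I V i (c \<odot>\<^bsub>V i\<^esub> v) = c \<odot>\<^bsub>DS\<^esub> ds_inj I V i v" for c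
    by (rule DS_eqI) (use i v in \<open>auto intro!: DS_inj_carrier DS_smult simp: DS_nth vspace_simps[OF V], auto simp: ds_inj_def vspace_simps[OF V]\<close>)
next
  assume i: "i \<in> I"
  fix u v assume uv: "u \<in> carrier (V i)" "v \<in> carrier (V i)"
  show "ds_inj I V i (u \<oplus>\<^bsub>V i\<^esub> v) = ds_inj I V i u \<oplus>\<^bsub>DS\<^esub> ds_inj I V i v"
    by (rule DS_eqI) (use i uv in \<open>auto intro!: DS_inj_carrier DS_add simp: DS_nth vspace_simps[OF V], auto simp: ds_inj_def vspace_simps[OF V]\<close>)
qed

lemma DS_span:
  assumes S: "\<And>i. i \<in> I \<Longrightarrow> S i \<subseteq> carrier (V i)" "\<And>i. i \<in> I \<Longrightarrow> carrier (V i) \<subseteq> vspan (V i) (S i)"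
    and t: "t \<in> carrier DS"
  shows "t \<in> vspan DS (\<Union>i\<in>I. ds_inj I V i ` S i)"
proof -
  let ?S = "\<Union>i\<in>I. ds_inj I V i ` S i"
  have sub: "?S \<subseteq> carrier DS" using DS_inj_carrier S(1) by blast
  note SS = vspan_sub[OF DS_vspace sub]
  have inj: "ds_inj I V i v \<in> vspan DS ?S" if i: "i \<in> I" and v: "v \<in> carrier (V i)" for i v
  proof (rule lin_on_span_image[OF V[OF i] DS_vspace DS_inj_lin[OF i] S(1)[OF i] sub])
    show "v \<in> vspan (V i) (S i)" using S(2)[OF i] v by auto
    show "ds_inj I V i s \<in> vspan DS ?S" if "s \<in> S i" for s using SS(2) i that by blast
  qed
  have "t \<in> vspan DS ?S" if "finite F" "t \<in> carrier DS" "{i\<in>I. t i \<noteq> \<zero>\<^bsub>V i\<^esub>} \<subseteq> F" for F t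
    using that
  proof (induction F arbitrary: t rule: finite_induct)
    case empty
    have "t = \<zero>\<^bsub>DS\<^esub>" by (rule DS_eqI[OF empty(1) DS_zero]) (use empty in \<open>auto simp: DS_nth\<close>)
    then show ?case using SS(3) by simp
  next
    case (insert j F)
    show ?case
    proof (cases "j \<in> I")
      case False
      then show ?thesis using insert.IH[OF insert.prems(1)] insert.prems(2) by blast
    next
      case True
      let ?u = "t \<oplus>\<^bsub>DS\<^esub> ((-1) \<odot>\<^bsub>DS\<^esub> ds_inj I V j (t j))"
      have tj: "t j \<in> carrier (V j)" using DS_mem[OF insert.prems(1) True] .
      note ic = DS_inj_carrier[OF True tj]
      have uc: "?u \<in> carrier DS" by (rule DS_add[OF insert.prems(1) DS_smult[OF ic]])
      have "{i\<in>I. ?u i \<noteq> \<zero>\<^bsub>V i\<^esub>} \<subseteq> F"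
      proof clarify
        fix i assume i: "i \<in> I" "?u i \<noteq> \<zero>\<^bsub>V i\<^esub>"
        have ti: "t i \<in> carrier (V i)" using DS_mem[OF insert.prems(1) i(1)] .
        show "i \<in> F"
        proof (cases "i = j")
          case True
          then have "?u i = \<zero>\<^bsub>V i\<^esub>" using i(1) vspace_laws(6)[OF i(1) ti] by (simp add: DS_nth) (simp add: ds_inj_def)
          then show ?thesis using i(2) by simp
        next
          case False
          then have "?u i = t i" using i(1) vspace_simps(6,10)[OF V[OF i(1)]] ti by (simp add: DS_nth) (simp add: ds_inj_def)
          then have "i \<in> insert j F" using i insert.prems(2) by auto
          then show ?thesis using False by simp
        qed
      qed
      then have u: "?u \<in> vspan DS ?S" by (rule insert.IH[OF uc])
      have "t = ?u \<oplus>\<^bsub>DS\<^esub> ds_inj I V j (t j)"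
        using vspace_simps(13)[OF DS_vspace insert.prems(1) ic] vspace_simps(11)[OF DS_vspace insert.prems(1) ic] by simp
      then show ?thesis using SS(4)[OF u inj[OF True tj]] by simp
    qed
  qed
  then show ?thesis using t by (auto simp: direct_sum_simps)
qed

text \<open>Elements of the direct sum have finitely many nonzero components, so the spanning sets of the summands
  together span it; \<open>idx\<close> tells to which summand an index belongs.\<close>

lemma DS_dual_system:
  assumes ds: "\<And>i. i \<in> I \<Longrightarrow> dual_system (V i) (W i) (T i) (e i) (\<psi> i)"
    and TT: "finite TT" "\<And>i. i \<in> I \<Longrightarrow> T i = {t \<in> TT. idx t = i}" "idx ` TT \<subseteq> I"
    and W': "W' \<subseteq> carrier DS" "\<And>w i. w \<in> W' \<Longrightarrow> i \<in> I \<Longrightarrow> w i \<in> W i"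
      "\<And>w i. i \<in> I \<Longrightarrow> w \<in> W i \<Longrightarrow> ds_inj I V i w \<in> W'"
  shows "dual_system DS W' TT (\<lambda>t. ds_inj I V (idx t) (e (idx t) t)) (\<lambda>t v. \<psi> (idx t) t (v (idx t)))"
  unfolding dual_system_def
proof (intro conjI ballI)
  note D = ds[unfolded dual_system_def]
  have idx: "idx t \<in> I" "t \<in> T (idx t)" if "t \<in> TT" for t using TT that by auto
  show "finite TT" by fact
  show "W' \<subseteq> carrier DS" by fact
  have ec: "e (idx t) t \<in> carrier (V (idx t))" if "t \<in> TT" for t using D[OF idx(1)[OF that]] idx(2)[OF that] by auto
  show sub: "(\<lambda>t. ds_inj I V (idx t) (e (idx t) t)) ` TT \<subseteq> carrier DS"
    using DS_inj_carrier[OF idx(1) ec] by auto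
  fix t assume t: "t \<in> TT"
  show "linear_form DS (\<lambda>v. \<psi> (idx t) t (v (idx t)))"
    by (rule linear_form_comp[OF DS_component]) (use D[OF idx(1)[OF t]] idx[OF t] in auto)
  show "\<psi> (idx t) t (w (idx t)) = 0" if "w \<in> W'" for w
    using D[OF idx(1)[OF t]] idx[OF t] W'(2)[OF that idx(1)[OF t]] by auto
next
  note D = ds[unfolded dual_system_def]
  have idx: "idx t \<in> I" "t \<in> T (idx t)" if "t \<in> TT" for t using TT that by auto
  fix s t assume st: "s \<in> TT" "t \<in> TT"
  note Dt = D[OF idx(1)[OF st(2)]]
  have lf: "linear_form (V (idx t)) (\<psi> (idx t) t)" using Dt idx(2)[OF st(2)] by auto
  show "\<psi> (idx t) t (ds_inj I V (idx s) (e (idx s) s) (idx t)) = (if s = t then 1 else 0)"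
  proof (cases "idx s = idx t")
    case True
    then show ?thesis using Dt idx[OF st(1)] idx[OF st(2)] by (simp add: ds_inj_def)
  next
    case False
    then show ?thesis using linear_form_simps(3)[OF lf V[OF idx(1)[OF st(2)]]] idx[OF st(2)] by (auto simp: ds_inj_def)
  qed
next
  note D = ds[unfolded dual_system_def]
  let ?E = "(\<lambda>t. ds_inj I V (idx t) (e (idx t) t)) ` TT"
  have idx: "idx t \<in> I" "t \<in> T (idx t)" if "t \<in> TT" for t using TT that by auto
  have ec: "e (idx t) t \<in> carrier (V (idx t))" if "t \<in> TT" for t using D[OF idx(1)[OF that]] idx(2)[OF that] by auto
  have sub: "?E \<union> W' \<subseteq> carrier DS" using DS_inj_carrier[OF idx(1) ec] W'(1) by auto
  show "carrier DS \<subseteq> vspan DS (?E \<union> W')"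
  proof
    fix t assume t: "t \<in> carrier DS"
    have "t \<in> vspan DS (\<Union>i\<in>I. ds_inj I V i ` (e i ` T i \<union> W i))"
      by (rule DS_span[OF _ _ t]) (use D in auto)
    moreover have "(\<Union>i\<in>I. ds_inj I V i ` (e i ` T i \<union> W i)) \<subseteq> ?E \<union> W'"
      using TT(2) W'(3) by auto
    ultimately show "t \<in> vspan DS (?E \<union> W')" using vspan_mono[OF DS_vspace] by blast
  qed
qed

lemma DS_bi_action:
  assumes B: "\<And>i. i \<in> I \<Longrightarrow> bi_action (V i) m n (B i)"
  shows "bi_action DS m n (\<lambda>\<sigma> \<tau> t. \<lambda>i\<in>I. B i \<sigma> \<tau> (t i))"
proof -
  have lin: "lin_on (V i) (V i) (B i \<sigma> \<tau>)" if "i \<in> I" "\<sigma> permutes {..<m}" "\<tau> permutes {..<n}" for i \<sigma> \<tau>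
    using B[OF that(1)] that unfolding bi_action_def by blast
  have car: "(\<lambda>i\<in>I. B i \<sigma> \<tau> (t i)) \<in> carrier DS" if p: "\<sigma> permutes {..<m}" "\<tau> permutes {..<n}" and t: "t \<in> carrier DS" for \<sigma> \<tau> t
  proof -
    have "{i\<in>I. (\<lambda>i\<in>I. B i \<sigma> \<tau> (t i)) i \<noteq> \<zero>\<^bsub>V i\<^esub>} \<subseteq> {i\<in>I. t i \<noteq> \<zero>\<^bsub>V i\<^esub>}"
      using lin_on_simps(4)[OF lin[OF _ p] V V] by auto
    moreover have "finite {i\<in>I. t i \<noteq> \<zero>\<^bsub>V i\<^esub>}" using t by (simp add: direct_sum_simps)
    ultimately have "finite {i\<in>I. (\<lambda>i\<in>I. B i \<sigma> \<tau> (t i)) i \<noteq> \<zero>\<^bsub>V i\<^esub>}" by (rule finite_subset)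
    then show ?thesis using lin_on_simps(1)[OF lin[OF _ p] DS_mem[OF t]] by (simp add: direct_sum_simps)
  qed
  have l: "lin_on DS DS (\<lambda>t. \<lambda>i\<in>I. B i \<sigma> \<tau> (t i))" if p: "\<sigma> permutes {..<m}" "\<tau> permutes {..<n}" for \<sigma> \<tau>
    unfolding lin_on_def
  proof (intro conjI ballI allI)
    fix t assume t: "t \<in> carrier DS"
    show "(\<lambda>i\<in>I. B i \<sigma> \<tau> (t i)) \<in> carrier DS" by (rule car[OF p t])
    show "(\<lambda>i\<in>I. B i \<sigma> \<tau> ((c \<odot>\<^bsub>DS\<^esub> t) i)) = c \<odot>\<^bsub>DS\<^esub> (\<lambda>i\<in>I. B i \<sigma> \<tau> (t i))" for c
      by (rule DS_eqI[OF car[OF p DS_smult[OF t]] DS_smult[OF car[OF p t]]])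
        (simp add: DS_nth lin_on_simps(3)[OF lin[OF _ p] DS_mem[OF t]])
    fix u assume u: "u \<in> carrier DS"
    show "(\<lambda>i\<in>I. B i \<sigma> \<tau> ((t \<oplus>\<^bsub>DS\<^esub> u) i)) = (\<lambda>i\<in>I. B i \<sigma> \<tau> (t i)) \<oplus>\<^bsub>DS\<^esub> (\<lambda>i\<in>I. B i \<sigma> \<tau> (u i))"
      by (rule DS_eqI[OF car[OF p DS_add[OF t u]] DS_add[OF car[OF p t] car[OF p u]]])
        (simp add: DS_nth lin_on_simps(2)[OF lin[OF _ p] DS_mem[OF t] DS_mem[OF u]])
  qed
  have id: "(\<lambda>i\<in>I. B i id id (t i)) = t" if t: "t \<in> carrier DS" for t
    by (rule DS_eqI[OF car[OF permutes_id permutes_id t] t])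
      (use B DS_mem[OF t] in \<open>simp add: bi_action_def\<close>)
  have comp: "(\<lambda>i\<in>I. B i (\<sigma> \<circ> \<sigma>') (\<tau> \<circ> \<tau>') (t i)) = (\<lambda>i\<in>I. B i \<sigma>' \<tau>' ((\<lambda>i\<in>I. B i \<sigma> \<tau> (t i)) i))"
    if p: "\<sigma> permutes {..<m}" "\<tau> permutes {..<n}" "\<sigma>' permutes {..<m}" "\<tau>' permutes {..<n}" and t: "t \<in> carrier DS" for \<sigma> \<tau> \<sigma>' \<tau>' t
    by (rule restrict_ext) (use B DS_mem[OF t] p in \<open>simp add: bi_action_def\<close>)
  show ?thesis unfolding bi_action_def
    by (intro conjI allI impI ballI DS_vspace l id comp; (elim conjE, assumption)?)
qed

lemma DS_stab_rels:
  assumes B: "\<And>i. i \<in> I \<Longrightarrow> bi_action (V i) (length wI) (length wJ) (B i)"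
  shows "stab_rels DS (\<lambda>\<sigma> \<tau> t. \<lambda>i\<in>I. B i \<sigma> \<tau> (t i)) wI wJ \<subseteq> carrier DS"
    "\<And>w i. w \<in> stab_rels DS (\<lambda>\<sigma> \<tau> t. \<lambda>i\<in>I. B i \<sigma> \<tau> (t i)) wI wJ \<Longrightarrow> i \<in> I \<Longrightarrow> w i \<in> stab_rels (V i) (B i) wI wJ"
    "\<And>w i. i \<in> I \<Longrightarrow> w \<in> stab_rels (V i) (B i) wI wJ \<Longrightarrow> ds_inj I V i w \<in> stab_rels DS (\<lambda>\<sigma> \<tau> t. \<lambda>i\<in>I. B i \<sigma> \<tau> (t i)) wI wJ"
proof -
  let ?B = "\<lambda>\<sigma> \<tau> t. \<lambda>i\<in>I. B i \<sigma> \<tau> (t i)"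
  have lin: "lin_on DS DS (?B \<sigma> \<tau>)" if "\<sigma> \<in> word_stab wI" "\<tau> \<in> word_stab wJ" for \<sigma> \<tau>
    using DS_bi_action[of "length wI" "length wJ" B, OF B] that unfolding bi_action_def word_stab_def by blast
  show "stab_rels DS ?B wI wJ \<subseteq> carrier DS"
    using vspace_simps(3)[OF DS_vspace lin_on_simps(1)[OF lin]] unfolding stab_rels_def by auto
  show "w i \<in> stab_rels (V i) (B i) wI wJ" if w: "w \<in> stab_rels DS ?B wI wJ" and i: "i \<in> I" for w i
  proof -
    obtain \<sigma> \<tau> v where v: "w = ?B \<sigma> \<tau> v \<ominus>\<^bsub>DS\<^esub> v" "\<sigma> \<in> word_stab wI" "\<tau> \<in> word_stab wJ" "v \<in> carrier DS"
      using w unfolding stab_rels_def by blast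
    have "w i = B i \<sigma> \<tau> (v i) \<ominus>\<^bsub>V i\<^esub> v i"
      unfolding v(1) using lin_on_simps(5)[OF DS_component[OF i] DS_vspace V[OF i] lin_on_simps(1)[OF lin[OF v(2,3)] v(4)] v(4)] i by simp
    then show ?thesis unfolding stab_rels_def using v DS_mem[OF v(4) i] by blast
  qed
  show "ds_inj I V i w \<in> stab_rels DS ?B wI wJ" if i: "i \<in> I" and w: "w \<in> stab_rels (V i) (B i) wI wJ" for w i
  proof -
    obtain \<sigma> \<tau> v where v: "w = B i \<sigma> \<tau> v \<ominus>\<^bsub>V i\<^esub> v" "\<sigma> \<in> word_stab wI" "\<tau> \<in> word_stab wJ" "v \<in> carrier (V i)"
      using w unfolding stab_rels_def by blast
    have li: "lin_on (V j) (V j) (B j \<sigma> \<tau>)" if "j \<in> I" for j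
      using B[OF that] v unfolding bi_action_def word_stab_def by blast
    have Bv: "B i \<sigma> \<tau> v \<in> carrier (V i)" using lin_on_simps(1)[OF li[OF i] v(4)] .
    have e: "?B \<sigma> \<tau> (ds_inj I V i v) = ds_inj I V i (B i \<sigma> \<tau> v)"
      unfolding ds_inj_def by (rule restrict_ext) (use lin_on_simps(4)[OF li V V] in auto)
    have "ds_inj I V i w = ?B \<sigma> \<tau> (ds_inj I V i v) \<ominus>\<^bsub>DS\<^esub> ds_inj I V i v"
      unfolding v(1) e by (rule lin_on_simps(5)[OF DS_inj_lin[OF i] V[OF i] DS_vspace Bv v(4)])
    then show ?thesis unfolding stab_rels_def using v DS_inj_carrier[OF i v(4)] by blast
  qed
qed

end

lemma mon_degree_superset:
  "finite A \<Longrightarrow> keys \<gamma> \<subseteq> A \<Longrightarrow> mon_degree \<gamma> = (\<Sum>i\<in>A. lookup \<gamma> i)"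
  unfolding mon_degree_def by (rule sum.mono_neutral_left) (auto simp: in_keys_iff)

lemma mon_degree_add: "mon_degree (\<alpha> + \<beta>) = mon_degree \<alpha> + mon_degree \<beta>"
proof -
  let ?A = "keys \<alpha> \<union> keys \<beta>"
  have "keys (\<alpha> + \<beta>) \<subseteq> ?A" by (rule keys_add)
  then show ?thesis by (simp add: mon_degree_superset[of ?A] lookup_add sum.distrib)
qed

lemma mon_degree_eq_0_iff: "mon_degree \<alpha> = 0 \<longleftrightarrow> \<alpha> = 0"
  by (auto simp: mon_degree_def in_keys_iff intro!: poly_mapping_eqI)

lemma mon_degree_zero [simp]: "mon_degree 0 = 0"
  by (simp add: mon_degree_eq_0_iff)

context letter_system
begin

lemma mset_weight_split: "l \<in># A \<Longrightarrow> \<exists>\<beta>. fst l + \<beta> = (\<Sum>l\<in>#A. fst l)"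
  by (metis insert_DiffM image_mset_add_mset sum_mset.add_mset)

text \<open>If no letter has weight zero, each letter raises the degree by at least one and has a weight dividing \<open>\<gamma>\<close>.\<close>

lemma finite_letter_msets:
  assumes c0: "c 0 = 0"
  shows "finite (\<Union>n. letter_msets n \<gamma>)"
proof -
  define L where "L = Sigma {\<alpha>. \<exists>\<beta>. \<alpha> + \<beta> = \<gamma>} (\<lambda>\<alpha>. {..<c \<alpha>})"
  have "{\<alpha>. \<exists>\<beta>. \<alpha> + \<beta> = \<gamma>} = fst ` {(\<alpha>, \<beta>). \<alpha> + \<beta> = \<gamma>}" by force
  then have finL: "finite L" unfolding L_def using finite_splittings[of \<gamma>] by (intro finite_SigmaI) auto
  have "(\<Union>n. letter_msets n \<gamma>) \<subseteq> mset ` {ls. set ls \<subseteq> L \<and> length ls \<le> mon_degree \<gamma>}"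
  proof
    fix A assume "A \<in> (\<Union>n. letter_msets n \<gamma>)"
    then have v: "\<And>l. l \<in># A \<Longrightarrow> valid l" and w: "(\<Sum>l\<in>#A. fst l) = \<gamma>" by (auto simp: letter_msets_def)
    have inL: "l \<in> L" if "l \<in># A" for l
      using v[OF that] mset_weight_split[OF that] w by (cases l) (auto simp: L_def valid_def)
    have pos: "mon_degree (fst l) \<ge> 1" if "l \<in># A" for l
    proof -
      have "fst l \<noteq> 0" using v[OF that] c0 by (auto simp: valid_def)
      then show ?thesis using mon_degree_eq_0_iff[of "fst l"] by linarith
    qed
    have "size A \<le> mon_degree (\<Sum>l\<in>#A. fst l)"
      using pos by (induction A) (force simp: mon_degree_add)+
    then have size: "size A \<le> mon_degree \<gamma>" using w by simp
    obtain ls where "mset ls = A" using ex_mset by blast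
    then show "A \<in> mset ` {ls. set ls \<subseteq> L \<and> length ls \<le> mon_degree \<gamma>}"
      using inL size by (intro image_eqI[of _ _ ls]) auto
  qed
  then show ?thesis by (rule finite_subset) (simp add: finite_lists_length_le finL)
qed

theorem saturation_dual_system:
  assumes c0: "c 0 = 0" and a: "a = mx \<gamma>" and b: "b = my \<gamma>" and d: "d = hb \<gamma>"
  shows "bi_action (bcomp (saturation M) a b d) a b (biact (saturation M) a b d)"
    and "\<exists>e \<psi>. dual_system (bcomp (saturation M) a b d)
      (stab_rels (bcomp (saturation M) a b d) (biact (saturation M) a b d) (wordX \<gamma>) (wordY \<gamma>))
      (\<Union>n\<in>{1..}. letter_msets n \<gamma>) e \<psi>"
proof -
  let ?N = "{1::nat..}"
  define Q where "Q n = coinvariants (bcomp (tensor_power M n) a b d) {f. f permutes {..<n}} (tensor_sym M n a b d)" for n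
  define B where "B n = tensor_setup.right_biact M n a b d" for n
  have T: "tensor_letters M c ev ps"
    by (intro tensor_letters.intro tensor_setup.intro letter_system_axioms sym_M)
  have Q: "vspace (Q n)" "bi_action (Q n) a b (B n)"
    "\<exists>e \<psi>. dual_system (Q n) (stab_rels (Q n) (B n) (wordX \<gamma>) (wordY \<gamma>)) (letter_msets n \<gamma>) e \<psi>" for n
  proof -
    interpret TL: tensor_letters M c ev ps n \<gamma> by (rule T)
    have e: "Q n = TL.T.P.Q"
      unfolding Q_def a b d TL.T.tensor_power_eq TL.T.tensor_sym_eq TL.T.factor_perms_def ..
    have eB: "B n = TL.T.right_biact" unfolding B_def a b d ..
    show "vspace (Q n)" unfolding e by (rule TL.T.P.Q_vspace)
    show "bi_action (Q n) a b (B n)" unfolding e eB a b by (rule TL.T.right_biact_action)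
    have "finite (letter_msets n \<gamma>)" by (rule finite_subset[OF _ finite_letter_msets[OF c0, of \<gamma>]]) auto
    then show "\<exists>e \<psi>. dual_system (Q n) (stab_rels (Q n) (B n) (wordX \<gamma>) (wordY \<gamma>)) (letter_msets n \<gamma>) e \<psi>"
      unfolding e eB using TL.tensor_dual_system by blast
  qed
  interpret DF: direct_sum_family ?N Q by (rule direct_sum_family.intro) (rule Q(1))
  have X: "bcomp (saturation M) a b d = DF.DS"
    by (simp add: saturation_def Let_def Q_def[abs_def])
  have act: "biact (saturation M) a b d \<sigma> \<tau> t = (\<lambda>n\<in>?N. B n \<sigma> \<tau> (t n))"
    if p: "\<sigma> permutes {..<a}" "\<tau> permutes {..<b}" for \<sigma> \<tau> t
  proof -
    have ii: "pinv (pinv \<sigma>) = \<sigma>" by (rule permutes_inv_inv[OF p(1)])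
    have e: "quot_map (bcomp (tensor_power M n) a b d) (coinv_rels (bcomp (tensor_power M n) a b d) {f. f permutes {..<n}} (tensor_sym M n a b d))
          (lact (tensor_power M n) a b d (pinv \<sigma>))
        (quot_map (bcomp (tensor_power M n) a b d) (coinv_rels (bcomp (tensor_power M n) a b d) {f. f permutes {..<n}} (tensor_sym M n a b d))
          (ract (tensor_power M n) a b d \<tau>) q) = B n \<sigma> \<tau> q" for n q
    proof -
      interpret TL: tensor_letters M c ev ps n \<gamma> by (rule T)
      have l: "lact (tensor_power M n) a b d (pinv \<sigma>) = quot_map TL.T.P.FS TL.T.P.RR (lin_ext (TL.T.right_shift \<sigma> id))"
      proof -
        have "(\<lambda>(xs, \<sigma>', \<tau>). single (xs, \<sigma>' \<circ> pinv (pinv \<sigma>), \<tau>) 1) = TL.T.right_shift \<sigma> id"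
          by (rule ext) (auto simp: TL.T.right_shift_def ii)
        then show ?thesis unfolding tensor_power_def bimodule.simps a b d TL.T.tensor_map_eq by simp
      qed
      have r: "ract (tensor_power M n) a b d \<tau> = quot_map TL.T.P.FS TL.T.P.RR (lin_ext (TL.T.right_shift id \<tau>))"
      proof -
        have "(\<lambda>(xs, \<sigma>', \<tau>'). single (xs, \<sigma>', \<tau>' \<circ> \<tau>) 1) = TL.T.right_shift id \<tau>"
          by (rule ext) (auto simp: TL.T.right_shift_def)
        then show ?thesis unfolding tensor_power_def bimodule.simps a b d TL.T.tensor_map_eq by simp
      qed
      show ?thesis
        unfolding l r B_def unfolding a b d TL.T.tensor_power_eq TL.T.tensor_sym_eq TL.T.factor_perms_def[symmetric] TL.T.right_biact_def TL.T.right_map_def ..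
    qed
    show ?thesis unfolding biact_def saturation_def Let_def bimodule.simps
      by (rule restrict_ext) (simp add: e)
  qed
  have A1: "bi_action DF.DS a b (\<lambda>\<sigma> \<tau> t. \<lambda>n\<in>?N. B n \<sigma> \<tau> (t n))"
    by (rule DF.DS_bi_action) (rule Q(2))
  have l: "lin_on DF.DS DF.DS (biact (saturation M) a b d \<sigma> \<tau>)" if p: "\<sigma> permutes {..<a}" "\<tau> permutes {..<b}" for \<sigma> \<tau>
  proof -
    have "biact (saturation M) a b d \<sigma> \<tau> = (\<lambda>t. \<lambda>n\<in>?N. B n \<sigma> \<tau> (t n))" using act[OF p] by blast
    then show ?thesis using A1 p unfolding bi_action_def by simp
  qed
  show "bi_action (bcomp (saturation M) a b d) a b (biact (saturation M) a b d)"
    unfolding X bi_action_def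
  proof (intro conjI allI impI ballI)
    show "vspace DF.DS" by (rule DF.DS_vspace)
    show "lin_on DF.DS DF.DS (biact (saturation M) a b d \<sigma> \<tau>)" if "\<sigma> permutes {..<a} \<and> \<tau> permutes {..<b}" for \<sigma> \<tau>
      using l that by blast
    fix t assume t: "t \<in> carrier DF.DS"
    show "biact (saturation M) a b d id id t = t"
      unfolding act[OF permutes_id permutes_id] using A1 t unfolding bi_action_def by blast
    fix \<sigma> \<tau> \<sigma>' \<tau>'
    assume p: "\<sigma> permutes {..<a} \<and> \<tau> permutes {..<b} \<and> \<sigma>' permutes {..<a} \<and> \<tau>' permutes {..<b}"
    have q: "\<sigma> \<circ> \<sigma>' permutes {..<a}" "\<tau> \<circ> \<tau>' permutes {..<b}" using p permutes_compose by blast+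
    show "biact (saturation M) a b d (\<sigma> \<circ> \<sigma>') (\<tau> \<circ> \<tau>') t = biact (saturation M) a b d \<sigma>' \<tau>' (biact (saturation M) a b d \<sigma> \<tau> t)"
    proof -
      have "(\<lambda>n\<in>?N. B n (\<sigma> \<circ> \<sigma>') (\<tau> \<circ> \<tau>') (t n)) = (\<lambda>n\<in>?N. B n \<sigma>' \<tau>' ((\<lambda>n\<in>?N. B n \<sigma> \<tau> (t n)) n))"
        using A1 t p unfolding bi_action_def by blast
      moreover have "\<sigma> permutes {..<a}" "\<tau> permutes {..<b}" "\<sigma>' permutes {..<a}" "\<tau>' permutes {..<b}" using p by auto
      ultimately show ?thesis by (simp only: act[OF q] act)
    qed
  qed
  have stab: "stab_rels DF.DS (biact (saturation M) a b d) (wordX \<gamma>) (wordY \<gamma>) =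
      stab_rels DF.DS (\<lambda>\<sigma> \<tau> t. \<lambda>n\<in>?N. B n \<sigma> \<tau> (t n)) (wordX \<gamma>) (wordY \<gamma>)"
  proof -
    have e: "biact (saturation M) a b d \<sigma> \<tau> v = (\<lambda>n\<in>?N. B n \<sigma> \<tau> (v n))"
      if "\<sigma> \<in> word_stab (wordX \<gamma>)" "\<tau> \<in> word_stab (wordY \<gamma>)" for \<sigma> \<tau> v
      by (rule act) (use that in \<open>auto simp: word_stab_def a b\<close>)
    show ?thesis
    proof (rule subset_antisym; rule subsetI)
      fix w assume "w \<in> stab_rels DF.DS (biact (saturation M) a b d) (wordX \<gamma>) (wordY \<gamma>)"
      then obtain \<sigma> \<tau> v where w: "w = biact (saturation M) a b d \<sigma> \<tau> v \<ominus>\<^bsub>DF.DS\<^esub> v"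
        and st: "\<sigma> \<in> word_stab (wordX \<gamma>)" "\<tau> \<in> word_stab (wordY \<gamma>)" "v \<in> carrier DF.DS" unfolding stab_rels_def by blast
      show "w \<in> stab_rels DF.DS (\<lambda>\<sigma> \<tau> t. \<lambda>n\<in>?N. B n \<sigma> \<tau> (t n)) (wordX \<gamma>) (wordY \<gamma>)"
        unfolding w e[OF st(1,2)] stab_rels_def using st by blast
    next
      fix w assume "w \<in> stab_rels DF.DS (\<lambda>\<sigma> \<tau> t. \<lambda>n\<in>?N. B n \<sigma> \<tau> (t n)) (wordX \<gamma>) (wordY \<gamma>)"
      then obtain \<sigma> \<tau> v where w: "w = (\<lambda>n\<in>?N. B n \<sigma> \<tau> (v n)) \<ominus>\<^bsub>DF.DS\<^esub> v"
        and st: "\<sigma> \<in> word_stab (wordX \<gamma>)" "\<tau> \<in> word_stab (wordY \<gamma>)" "v \<in> carrier DF.DS" unfolding stab_rels_def by blast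
      show "w \<in> stab_rels DF.DS (biact (saturation M) a b d) (wordX \<gamma>) (wordY \<gamma>)"
        unfolding w e[OF st(1,2), symmetric] stab_rels_def using st by blast
    qed
  qed
  have "\<forall>n. \<exists>e \<psi>. dual_system (Q n) (stab_rels (Q n) (B n) (wordX \<gamma>) (wordY \<gamma>)) (letter_msets n \<gamma>) e \<psi>"
    using Q(3) by blast
  then obtain e \<psi> where e\<psi>: "\<And>n. dual_system (Q n) (stab_rels (Q n) (B n) (wordX \<gamma>) (wordY \<gamma>)) (letter_msets n \<gamma>) (e n) (\<psi> n)"
    by metis
  note Bw = Q(2)[unfolded a b]
  have "dual_system DF.DS (stab_rels DF.DS (\<lambda>\<sigma> \<tau> t. \<lambda>n\<in>?N. B n \<sigma> \<tau> (t n)) (wordX \<gamma>) (wordY \<gamma>))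
      (\<Union>n\<in>?N. letter_msets n \<gamma>) (\<lambda>t. ds_inj ?N Q (size t) (e (size t) t)) (\<lambda>t v. \<psi> (size t) t (v (size t)))"
  proof (rule DF.DS_dual_system[OF e\<psi>])
    show "finite (\<Union>n\<in>?N. letter_msets n \<gamma>)" by (rule finite_subset[OF _ finite_letter_msets[OF c0, of \<gamma>]]) auto
    show "letter_msets n \<gamma> = {t \<in> \<Union>n\<in>?N. letter_msets n \<gamma>. size t = n}" if "n \<in> ?N" for n
      using that by (auto simp: letter_msets_def)
    show "size ` (\<Union>n\<in>?N. letter_msets n \<gamma>) \<subseteq> ?N" by (auto simp: letter_msets_def)
  qed (use DF.DS_stab_rels[OF Bw] in auto)
  then show "\<exists>e \<psi>. dual_system (bcomp (saturation M) a b d)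
      (stab_rels (bcomp (saturation M) a b d) (biact (saturation M) a b d) (wordX \<gamma>) (wordY \<gamma>))
      (\<Union>n\<in>{1..}. letter_msets n \<gamma>) e \<psi>"
    unfolding X stab by blast
qed

end

section \<open>Substitution into power series\<close>

lemma scoeff_simps [simp]:
  "scoeff 0 \<gamma> = 0" "scoeff (f + g) \<gamma> = scoeff f \<gamma> + scoeff g \<gamma>"
  "scoeff 1 \<gamma> = (if \<gamma> = 0 then 1 else 0)" "scoeff (Series F) \<gamma> = F \<gamma>"
  "scoeff (scalar c) \<gamma> = (if \<gamma> = 0 then c else 0)"
  by (simp_all add: zero_series.rep_eq plus_series.rep_eq one_series.rep_eq scalar_def Series_inverse)

lemma scoeff_times: "scoeff (f * g) \<gamma> = (\<Sum>(\<alpha>, \<beta>) | \<alpha> + \<beta> = \<gamma>. scoeff f \<alpha> * scoeff g \<beta>)"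
  by (simp add: times_series.rep_eq)

lemma scoeff_sum [simp]: "scoeff (sum f A) \<gamma> = (\<Sum>a\<in>A. scoeff (f a) \<gamma>)"
  by (induction A rule: infinite_finite_induct) auto

lemma scalar_1: "scalar 1 = (1 :: ('i, 'k::comm_ring_1) series)"
  by (rule series_eqI) simp

lemma scoeff_scalar_times:
  fixes f :: "('i, 'k::comm_ring_1) series"
  shows "scoeff (scalar c * f) \<gamma> = c * scoeff f \<gamma>"
proof -
  have "scoeff (scalar c * f) \<gamma> = (\<Sum>(\<alpha>, \<beta>)\<in>{(0 :: 'i \<Rightarrow>\<^sub>0 nat, \<gamma>)}. scoeff (scalar c) \<alpha> * scoeff f \<beta>)"
    unfolding scoeff_times by (rule sum.mono_neutral_right) (use finite_splittings in \<open>auto split: if_splits\<close>)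
  then show ?thesis by simp
qed

lemma scoeff_times_nonzero:
  assumes "scoeff (f * g) \<gamma> \<noteq> 0"
  obtains \<alpha> \<beta> where "\<alpha> + \<beta> = \<gamma>" "scoeff f \<alpha> \<noteq> 0" "scoeff g \<beta> \<noteq> 0"
proof -
  have "\<exists>z\<in>{(\<alpha>, \<beta>). \<alpha> + \<beta> = \<gamma>}. scoeff f (fst z) * scoeff g (snd z) \<noteq> 0"
  proof (rule ccontr)
    assume "\<not> ?thesis"
    then have "scoeff (f * g) \<gamma> = 0" unfolding scoeff_times by (intro sum.neutral) auto
    then show False using assms by simp
  qed
  then obtain z where "fst z + snd z = \<gamma>" "scoeff f (fst z) * scoeff g (snd z) \<noteq> 0" by auto
  then show thesis using that[of "fst z" "snd z"] by (metis mult_zero_left mult_zero_right)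
qed

definition order_ge :: "nat \<Rightarrow> ('i, 'k::zero) series \<Rightarrow> bool" where
  "order_ge N f \<longleftrightarrow> (\<forall>\<alpha>. scoeff f \<alpha> \<noteq> 0 \<longrightarrow> N \<le> mon_degree \<alpha>)"

definition homogeneous :: "nat \<Rightarrow> ('i, 'k::zero) series \<Rightarrow> bool" where
  "homogeneous N f \<longleftrightarrow> (\<forall>\<alpha>. scoeff f \<alpha> \<noteq> 0 \<longrightarrow> mon_degree \<alpha> = N)"

lemma order_ge_times: "order_ge N f \<Longrightarrow> order_ge N' g \<Longrightarrow> order_ge (N + N') (f * g)"
  unfolding order_ge_def by (fastforce elim!: scoeff_times_nonzero simp: mon_degree_add intro: add_mono)

lemma homogeneous_times: "homogeneous N f \<Longrightarrow> homogeneous N' g \<Longrightarrow> homogeneous (N + N') (f * g)"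
  unfolding homogeneous_def by (auto elim!: scoeff_times_nonzero simp: mon_degree_add)

lemma order_ge_1: "order_ge 0 f" by (simp add: order_ge_def)

lemma homogeneous_1: "homogeneous 0 1" by (simp add: homogeneous_def)

text \<open>The index \<open>i\<close> stands for the power sum of degree \<open>i + 1\<close>, so \<open>l\<close> encodes a partition of \<open>weight l\<close> with \<open>mon_degree l\<close>
  parts, counted with multiplicity.\<close>

definition weight :: "(nat \<Rightarrow>\<^sub>0 nat) \<Rightarrow> nat" where
  "weight l = (\<Sum>i\<in>keys l. Suc i * lookup l i)"

lemma weight_superset:
  "finite A \<Longrightarrow> keys l \<subseteq> A \<Longrightarrow> weight l = (\<Sum>i\<in>A. Suc i * lookup l i)"
  unfolding weight_def by (rule sum.mono_neutral_left) (auto simp: in_keys_iff)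

lemma weight_add: "weight (a + b) = weight a + weight b"
proof -
  let ?A = "keys a \<union> keys b"
  have "keys (a + b) \<subseteq> ?A" by (rule keys_add)
  then show ?thesis by (simp add: weight_superset[of ?A] lookup_add sum.distrib add_mult_distrib2)
qed

lemma weight_single: "weight (single i n) = Suc i * n"
  by (simp add: weight_def)

lemma mon_degree_single [simp]: "mon_degree (single i n) = n"
  by (simp add: mon_degree_def)

lemma mon_degree_le_weight: "mon_degree l \<le> weight l"
  unfolding mon_degree_def weight_def by (rule sum_mono) simp

lemma finite_weight_le: "finite {l. weight l \<le> N}"
proof -
  define L where "L = (\<Sum>i<N. single i N)"
  have L: "lookup L i = (if i < N then N else 0)" for i
    by (simp add: L_def lookup_sum_keys lookup_single when_def)
  have "{l. weight l \<le> N} \<subseteq> fst ` {(a, b). a + b = L}"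
  proof
    fix l assume "l \<in> {l. weight l \<le> N}"
    then have w: "weight l \<le> N" by simp
    have le: "lookup l i \<le> lookup L i" for i
    proof (cases "i \<in> keys l")
      case True
      then have "Suc i * lookup l i \<le> weight l"
        unfolding weight_def by (intro member_le_sum) auto
      moreover have "lookup l i \<ge> 1" using True by (simp add: in_keys_iff Suc_le_eq)
      moreover have "lookup l i \<le> Suc i * lookup l i" by simp
      moreover have "Suc i * 1 \<le> Suc i * lookup l i"
        using \<open>lookup l i \<ge> 1\<close> by (rule mult_le_mono2)
      ultimately have "i < N" "lookup l i \<le> N"
        using w Suc_le_lessD le_trans mult_1_right by metis+
      then show ?thesis by (simp add: L)
    qed (simp add: in_keys_iff)
    have "l + (L - l) = L" by (rule poly_mapping_eqI) (simp add: lookup_add lookup_minus le)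
    then show "l \<in> fst ` {(a, b). a + b = L}" by force
  qed
  then show ?thesis by (rule finite_subset) (use finite_splittings in auto)
qed

definition mpow :: "(nat \<Rightarrow> 'a::comm_monoid_mult) \<Rightarrow> (nat \<Rightarrow>\<^sub>0 nat) \<Rightarrow> 'a" where
  "mpow s l = (\<Prod>i\<in>keys l. s i ^ lookup l i)"

lemma mpow_superset:
  "finite A \<Longrightarrow> keys l \<subseteq> A \<Longrightarrow> mpow s l = (\<Prod>i\<in>A. s i ^ lookup l i)"
  unfolding mpow_def by (rule prod.mono_neutral_left) (auto simp: in_keys_iff)

lemma mpow_add: "mpow s (a + b) = mpow s a * mpow s b"
proof -
  let ?A = "keys a \<union> keys b"
  have "keys (a + b) \<subseteq> ?A" by (rule keys_add)
  then show ?thesis by (simp add: mpow_superset[of ?A] lookup_add prod.distrib power_add)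
qed

lemma mpow_single [simp]: "mpow s (single i n) = s i ^ n"
  by (simp add: mpow_def)

lemma mpow_zero [simp]: "mpow s 0 = 1"
  by (simp add: mpow_def)

lemma multi_index_induct [case_names zero add]:
  assumes "P 0" "\<And>i l. P l \<Longrightarrow> P (single i (Suc 0) + l)"
  shows "P (l :: nat \<Rightarrow>\<^sub>0 nat)"
proof (induction "mon_degree l" arbitrary: l)
  case 0
  then show ?case using assms(1) mon_degree_eq_0_iff[of l] by simp
next
  case (Suc n)
  then have "l \<noteq> 0" by auto
  then obtain i where i: "lookup l i \<noteq> 0" by (metis poly_mapping_eqI lookup_zero)
  let ?l = "l - single i (Suc 0)"
  have e: "single i (Suc 0) + ?l = l"
    by (rule poly_mapping_eqI) (use i in \<open>auto simp: lookup_add lookup_minus lookup_single when_def\<close>)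
  then have "mon_degree l = Suc (mon_degree ?l)" using mon_degree_add[of "single i (Suc 0)" ?l] by simp
  then have "P ?l" using Suc by simp
  then show ?case using assms(2)[of ?l i] e by simp
qed

lemma order_ge_mpow:
  assumes "\<And>i. order_ge (Suc i) (s i)"
  shows "order_ge (weight l) (mpow s l :: ('i, 'k::comm_ring_1) series)"
proof (induction l rule: multi_index_induct)
  case zero
  then show ?case by (simp add: weight_def order_ge_1)
next
  case (add i l)
  then show ?case using order_ge_times[OF assms[of i] add] by (simp add: weight_add weight_single mpow_add)
qed

lemma homogeneous_mpow:
  assumes "\<And>i. homogeneous (Suc i) (s i)"
  shows "homogeneous (weight l) (mpow s l :: ('i, 'k::comm_ring_1) series)"
proof (induction l rule: multi_index_induct)
  case zero
  then show ?case by (simp add: weight_def homogeneous_1)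
next
  case (add i l)
  then show ?case using homogeneous_times[OF assms[of i] add] by (simp add: weight_add weight_single mpow_add)
qed

text \<open>Restricting the sum to \<open>weight l \<le> mon_degree \<delta>\<close> makes it finite; nothing is lost when \<open>s i\<close> starts in degree
  \<open>i + 1\<close>.\<close>

definition substitute :: "(nat \<Rightarrow> ('i, 'k::comm_ring_1) series) \<Rightarrow> (nat, 'k) series \<Rightarrow> ('i, 'k) series" where
  "substitute s P = Series (\<lambda>\<delta>. \<Sum>l | weight l \<le> mon_degree \<delta>. scoeff P l * scoeff (mpow s l) \<delta>)"

locale substitution =
  fixes s :: "nat \<Rightarrow> ('i, 'k::comm_ring_1) series"
  assumes order: "\<And>i. order_ge (Suc i) (s i)"
begin

lemma mpow_vanish: "mon_degree \<delta> < weight l \<Longrightarrow> scoeff (mpow s l) \<delta> = 0"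
  using order_ge_mpow[of s, OF order] unfolding order_ge_def by (meson leD)

lemma substitute_add: "substitute s (P + P') = substitute s P + substitute s P'"
  by (rule series_eqI) (simp add: substitute_def sum.distrib distrib_right)

lemma substitute_scalar: "substitute s (scalar c) = scalar c"
proof (rule series_eqI)
  fix \<delta> :: "'i \<Rightarrow>\<^sub>0 nat"
  have "scoeff (substitute s (scalar c)) \<delta> = (\<Sum>l\<in>{0}. scoeff (scalar c) l * scoeff (mpow s l) \<delta>)"
    unfolding substitute_def scoeff_simps(4)
    by (rule sum.mono_neutral_right[OF finite_weight_le]) (auto simp: weight_def split: if_splits)
  then show "scoeff (substitute s (scalar c)) \<delta> = scoeff (scalar c) \<delta>" by simp
qed

lemma substitute_variable:
  "substitute s (Series (\<lambda>l. if l = single i (Suc 0) then 1 else 0)) = s i"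
proof (rule series_eqI)
  fix \<delta> :: "'i \<Rightarrow>\<^sub>0 nat"
  let ?e = "single i (Suc 0) :: nat \<Rightarrow>\<^sub>0 nat"
  have "scoeff (substitute s (Series (\<lambda>l. if l = ?e then 1 else 0))) \<delta>
      = (\<Sum>l | weight l \<le> mon_degree \<delta>. if l = ?e then scoeff (mpow s ?e) \<delta> else 0)"
    unfolding substitute_def scoeff_simps(4) by (rule sum.cong) auto
  also have "\<dots> = scoeff (s i) \<delta>"
    using mpow_vanish[of \<delta> ?e] finite_weight_le[of "mon_degree \<delta>"] by (auto simp: weight_single)
  finally show "scoeff (substitute s (Series (\<lambda>l. if l = ?e then 1 else 0))) \<delta> = scoeff (s i) \<delta>" .
qed

text \<open>Extend all sums to the multi-indices of weight at most the degree of \<open>\<delta>\<close>, exchange them, and regroup the pairs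
  \<open>(l, l')\<close> by their sum.\<close>

lemma substitute_times: "substitute s (P * P') = substitute s P * substitute s P'"
proof (rule series_eqI)
  fix \<delta> :: "'i \<Rightarrow>\<^sub>0 nat"
  let ?W = "{l. weight l \<le> mon_degree \<delta>}" and ?a = "\<lambda>l. scoeff (mpow s l)"
  let ?S = "{(\<alpha>, \<beta>). \<alpha> + \<beta> = \<delta>}"
  have finW: "finite ?W" by (rule finite_weight_le)
  have ext: "scoeff (substitute s R) \<epsilon> = (\<Sum>l\<in>?W. scoeff R l * ?a l \<epsilon>)" if "mon_degree \<epsilon> \<le> mon_degree \<delta>" for R \<epsilon>
    unfolding substitute_def scoeff_simps(4)
    by (rule sum.mono_neutral_left[OF finW]) (use that mpow_vanish in auto)
  have "scoeff (substitute s P * substitute s P') \<delta> =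
      (\<Sum>(\<alpha>, \<beta>)\<in>?S. (\<Sum>l\<in>?W. scoeff P l * ?a l \<alpha>) * (\<Sum>l'\<in>?W. scoeff P' l' * ?a l' \<beta>))"
    unfolding scoeff_times by (rule sum.cong[OF refl]) (use ext in \<open>auto simp: mon_degree_add\<close>)
  also have "\<dots> = (\<Sum>z\<in>?S. \<Sum>l\<in>?W. \<Sum>l'\<in>?W. scoeff P l * scoeff P' l' * (?a l (fst z) * ?a l' (snd z)))"
    by (simp add: case_prod_beta sum_product mult_ac)
  also have "\<dots> = (\<Sum>l\<in>?W. \<Sum>l'\<in>?W. \<Sum>z\<in>?S. scoeff P l * scoeff P' l' * (?a l (fst z) * ?a l' (snd z)))"
    by (subst sum.swap, rule sum.cong[OF refl], rule sum.swap)
  also have "\<dots> = (\<Sum>l\<in>?W. \<Sum>l'\<in>?W. scoeff P l * scoeff P' l' * ?a (l + l') \<delta>)"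
    by (simp add: mpow_add scoeff_times sum_distrib_left case_prod_beta)
  also have "\<dots> = (\<Sum>(l, l')\<in>?W \<times> ?W. scoeff P l * scoeff P' l' * ?a (l + l') \<delta>)"
    by (simp add: sum.cartesian_product)
  also have "\<dots> = (\<Sum>(l, l')\<in>{(l, l'). weight (l + l') \<le> mon_degree \<delta>}. scoeff P l * scoeff P' l' * ?a (l + l') \<delta>)"
  proof (rule sum.mono_neutral_right)
    show "\<forall>z\<in>?W \<times> ?W - {(l, l'). weight (l + l') \<le> mon_degree \<delta>}.
        (case z of (l, l') \<Rightarrow> scoeff P l * scoeff P' l' * ?a (l + l') \<delta>) = 0"
    proof
      fix z assume "z \<in> ?W \<times> ?W - {(l, l'). weight (l + l') \<le> mon_degree \<delta>}"
      then have "mon_degree \<delta> < weight (fst z + snd z)" by (auto simp: not_le)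
      then show "(case z of (l, l') \<Rightarrow> scoeff P l * scoeff P' l' * ?a (l + l') \<delta>) = 0"
        using mpow_vanish[of \<delta> "fst z + snd z"] by (simp add: case_prod_beta)
    qed
  qed (use finW in \<open>auto simp: weight_add\<close>)
  also have "\<dots> = (\<Sum>(n, z)\<in>(SIGMA n:?W. {(l, l'). l + l' = n}). scoeff P (fst z) * scoeff P' (snd z) * ?a n \<delta>)"
    by (rule sum.reindex_bij_witness[where i = "\<lambda>(n, z). z" and j = "\<lambda>(l, l'). (l + l', (l, l'))"]) auto
  also have "\<dots> = (\<Sum>n\<in>?W. \<Sum>z\<in>{(l, l'). l + l' = n}. scoeff P (fst z) * scoeff P' (snd z) * ?a n \<delta>)"
    by (rule sum.Sigma[symmetric]) (use finW finite_splittings in auto)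
  also have "\<dots> = scoeff (substitute s (P * P')) \<delta>"
    by (simp add: substitute_def scoeff_times sum_distrib_right case_prod_beta)
  finally show "scoeff (substitute s (P * P')) \<delta> = scoeff (substitute s P * substitute s P') \<delta>" by simp
qed

end

definition invariant_under :: "('i \<Rightarrow> 'i) \<Rightarrow> ('i, 'k) series \<Rightarrow> bool" where
  "invariant_under \<pi> f \<longleftrightarrow> (\<forall>\<gamma>. scoeff f (map_key \<pi> \<gamma>) = scoeff f \<gamma>)"

lemma lookup_map_key: "inj \<pi> \<Longrightarrow> lookup (map_key \<pi> \<gamma>) i = lookup \<gamma> (\<pi> i)"
  by (simp add: map_key.rep_eq)

lemma map_key_add: "inj \<pi> \<Longrightarrow> map_key \<pi> (a + b :: 'i \<Rightarrow>\<^sub>0 nat) = map_key \<pi> a + map_key \<pi> b"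
  by (rule poly_mapping_eqI) (simp add: lookup_map_key lookup_add)

lemma map_key_inverse:
  assumes "bij \<pi>"
  shows "map_key \<pi> (map_key (pinv \<pi>) \<gamma>) = (\<gamma> :: 'i \<Rightarrow>\<^sub>0 nat)"
    "map_key (pinv \<pi>) (map_key \<pi> \<gamma>) = \<gamma>"
  using assms bij_imp_bij_inv[OF assms]
  by (auto intro!: poly_mapping_eqI simp: lookup_map_key bij_is_inj bij_is_surj inv_f_f surj_f_inv_f)

lemma invariant_times:
  assumes "bij \<pi>" "invariant_under \<pi> f" "invariant_under \<pi> (g :: ('i, 'k::comm_ring_1) series)"
  shows "invariant_under \<pi> (f * g)"
  unfolding invariant_under_def
proof
  fix \<gamma>
  have inj: "inj \<pi>" "inj (pinv \<pi>)" using assms(1) bij_imp_bij_inv bij_is_inj by auto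
  show "scoeff (f * g) (map_key \<pi> \<gamma>) = scoeff (f * g) \<gamma>"
    unfolding scoeff_times
    by (rule sum.reindex_bij_witness[where
          i = "\<lambda>(a, b). (map_key \<pi> a, map_key \<pi> b)" and
          j = "\<lambda>(a, b). (map_key (pinv \<pi>) a, map_key (pinv \<pi>) b)"])
      (use assms(2,3) in \<open>auto simp: map_key_inverse[OF assms(1)] map_key_add[OF inj(1), symmetric] map_key_add[OF inj(2), symmetric]
          invariant_under_def dest: arg_cong[where f = "scoeff _"]\<close>,
        (metis map_key_inverse[OF assms(1)] invariant_under_def assms(2,3))+)
qed

lemma map_key_eq_0_iff:
  assumes "bij \<pi>"
  shows "map_key \<pi> \<gamma> = 0 \<longleftrightarrow> \<gamma> = (0 :: 'i \<Rightarrow>\<^sub>0 nat)"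
proof -
  have "map_key \<pi> \<gamma> = 0 \<longleftrightarrow> (\<forall>i. lookup \<gamma> (\<pi> i) = 0)"
    by (simp add: poly_mapping_eq_iff fun_eq_iff lookup_map_key[OF bij_is_inj[OF assms]])
  also have "\<dots> \<longleftrightarrow> (\<forall>i. lookup \<gamma> i = 0)" using bij_is_surj[OF assms] by (metis surj_f_inv_f)
  also have "\<dots> \<longleftrightarrow> \<gamma> = 0" by (simp add: poly_mapping_eq_iff fun_eq_iff)
  finally show ?thesis .
qed

lemma invariant_scalar: "bij \<pi> \<Longrightarrow> invariant_under \<pi> (scalar c)"
  by (simp add: invariant_under_def map_key_eq_0_iff)

lemma invariant_add: "invariant_under \<pi> f \<Longrightarrow> invariant_under \<pi> g \<Longrightarrow> invariant_under \<pi> (f + g :: ('i, 'k::comm_ring_1) series)"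
  by (simp add: invariant_under_def)

lemma mon_degree_map_key:
  assumes "bij \<pi>"
  shows "mon_degree (map_key \<pi> \<gamma>) = mon_degree \<gamma>"
proof -
  have inj: "inj \<pi>" using assms by (rule bij_is_inj)
  have "keys (map_key \<pi> \<gamma>) = \<pi> -` keys \<gamma>"
    by (auto simp: in_keys_iff lookup_map_key[OF inj])
  then show ?thesis
    unfolding mon_degree_def
    by (intro sum.reindex_bij_witness[where i = "pinv \<pi>" and j = \<pi>])
      (use assms in \<open>auto simp: lookup_map_key[OF inj] bij_is_surj surj_f_inv_f inj\<close>)
qed

lemma invariant_mpow:
  assumes "bij \<pi>" "\<And>i. invariant_under \<pi> (s i)"
  shows "invariant_under \<pi> (mpow s l :: ('i, 'k::comm_ring_1) series)"
proof (induction l rule: multi_index_induct)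
  case zero
  then show ?case using invariant_scalar[OF assms(1), of "1 :: 'k"] unfolding mpow_zero scalar_1 .
next
  case (add i l)
  then show ?case using invariant_times[OF assms(1) assms(2)[of i] add] by (simp add: mpow_add)
qed

lemma invariant_substitute:
  assumes "bij \<pi>" "\<And>i. invariant_under \<pi> (s i)"
  shows "invariant_under \<pi> (substitute s P)"
  using invariant_mpow[OF assms]
  by (simp add: invariant_under_def substitute_def mon_degree_map_key[OF assms(1)])

lemma symmetric_iff: "f \<in> symmetric_functions \<longleftrightarrow> (\<forall>\<pi>. bij \<pi> \<longrightarrow> invariant_under \<pi> f)"
  by (auto simp: symmetric_functions_def invariant_under_def)

lemma bisymmetric_iff: "f \<in> bisymmetric_functions \<longleftrightarrow> (\<forall>\<pi> \<rho>. bij \<pi> \<and> bij \<rho> \<longrightarrow> invariant_under (rename_vars \<pi> \<rho>) f)"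
  by (auto simp: bisymmetric_functions_def invariant_under_def)

lemma rename_vars_bij: "bij \<pi> \<Longrightarrow> bij \<rho> \<Longrightarrow> bij (rename_vars \<pi> \<rho>)"
proof (rule o_bij)
  assume b: "bij \<pi>" "bij \<rho>"
  show "rename_vars (pinv \<pi>) (pinv \<rho>) \<circ> rename_vars \<pi> \<rho> = id"
  proof
    fix v show "(rename_vars (pinv \<pi>) (pinv \<rho>) \<circ> rename_vars \<pi> \<rho>) v = id v"
      using b by (cases v) (auto simp: bij_is_inj)
  qed
  show "rename_vars \<pi> \<rho> \<circ> rename_vars (pinv \<pi>) (pinv \<rho>) = id"
  proof
    fix v show "(rename_vars \<pi> \<rho> \<circ> rename_vars (pinv \<pi>) (pinv \<rho>)) v = id v"
      using b by (cases v) (auto simp: bij_is_surj surj_f_inv_f)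
  qed
qed

lemma scoeff_power_subst:
  "scoeff (power_subst n g) \<gamma> = (if \<forall>v. n dvd lookup \<gamma> v
     then scoeff g (Poly_Mapping.map (\<lambda>e. e div n) \<gamma>) else 0)"
  by (simp add: power_subst_def)

lemma lookup_map_div: "lookup (Poly_Mapping.map (\<lambda>e. e div (n::nat)) \<gamma>) v = lookup \<gamma> v div n"
  by (simp add: Poly_Mapping.map.rep_eq when_def)

lemma invariant_power_subst:
  assumes "bij \<pi>" "invariant_under \<pi> g"
  shows "invariant_under \<pi> (power_subst n g)"
proof -
  have inj: "inj \<pi>" and surj: "surj \<pi>" using assms(1) by (auto simp: bij_def)
  have "(\<forall>v. n dvd lookup \<gamma> (\<pi> v)) \<longleftrightarrow> (\<forall>v. n dvd lookup \<gamma> v)" for \<gamma> :: "'a \<Rightarrow>\<^sub>0 nat"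
    using surj by (metis surj_f_inv_f)
  moreover have "Poly_Mapping.map (\<lambda>e. e div n) (map_key \<pi> \<gamma>) = map_key \<pi> (Poly_Mapping.map (\<lambda>e. e div n) \<gamma>)" for \<gamma> :: "'a \<Rightarrow>\<^sub>0 nat"
    by (rule poly_mapping_eqI) (simp add: lookup_map_div lookup_map_key[OF inj])
  ultimately show ?thesis using assms(2) by (simp add: invariant_under_def scoeff_power_subst lookup_map_key[OF inj])
qed

lemma order_power_subst:
  assumes "scoeff g 0 = 0" "n \<ge> 1"
  shows "order_ge n (power_subst n g)"
  unfolding order_ge_def
proof (intro allI impI)
  fix \<gamma> assume nz: "scoeff (power_subst n g) \<gamma> \<noteq> 0"
  then have d: "\<forall>v. n dvd lookup \<gamma> v" and g: "scoeff g (Poly_Mapping.map (\<lambda>e. e div n) \<gamma>) \<noteq> 0"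
    by (auto simp: scoeff_power_subst split: if_splits)
  have "Poly_Mapping.map (\<lambda>e. e div n) \<gamma> \<noteq> 0" using g assms(1) by auto
  then obtain v where v: "lookup \<gamma> v div n \<noteq> 0" by (metis lookup_map_div lookup_zero poly_mapping_eqI)
  then have "n \<le> lookup \<gamma> v" by (metis div_less not_le)
  also have "\<dots> \<le> mon_degree \<gamma>"
    unfolding mon_degree_def by (rule member_le_sum) (use v in \<open>auto simp: in_keys_iff intro: ccontr\<close>)
  finally show "n \<le> mon_degree \<gamma>" .
qed

section \<open>Plethysm through power sums\<close>

lemma scoeff_uminus [simp]: "scoeff (- f) \<gamma> = - scoeff f \<gamma>"
  by (simp add: uminus_series.rep_eq)

lemma scoeff_minus [simp]: "scoeff (f - g) \<gamma> = scoeff f \<gamma> - scoeff g \<gamma>"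
  by (simp add: minus_series.rep_eq)

text \<open>The partition formed by the exponents of \<open>\<alpha>\<close>, in the encoding of \<open>weight\<close>.\<close>

definition ptype :: "('i \<Rightarrow>\<^sub>0 nat) \<Rightarrow> (nat \<Rightarrow>\<^sub>0 nat)" where
  "ptype \<alpha> = (\<Sum>j\<in>keys \<alpha>. single (lookup \<alpha> j - 1) (Suc 0))"

lemma mon_degree_sum: "finite A \<Longrightarrow> mon_degree (sum f A) = (\<Sum>a\<in>A. mon_degree (f a))"
  by (induction A rule: finite_induct) (auto simp: mon_degree_add)

lemma weight_zero [simp]: "weight 0 = 0"
  by (simp add: weight_def)

lemma weight_sum: "finite A \<Longrightarrow> weight (sum f A) = (\<Sum>a\<in>A. weight (f a))"
  by (induction A rule: finite_induct) (auto simp: weight_add)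

lemma mon_degree_ptype: "mon_degree (ptype \<alpha>) = card (keys \<alpha>)"
  unfolding ptype_def by (simp add: mon_degree_sum)

lemma weight_ptype: "weight (ptype \<alpha>) = mon_degree \<alpha>"
  unfolding ptype_def by (auto simp: weight_sum weight_single mon_degree_def in_keys_iff intro!: sum.cong)

lemma lookup_ptype:
  "lookup (ptype \<alpha>) i = card {j \<in> keys \<alpha>. lookup \<alpha> j = Suc i}"
proof -
  have "lookup (ptype \<alpha>) i
      = (\<Sum>j\<in>keys \<alpha>. if lookup \<alpha> j = Suc i then 1 else 0)"
    unfolding ptype_def lookup_sum
    by (rule sum.cong) (auto simp: lookup_single when_def in_keys_iff)
  also have "\<dots> = card {j \<in> keys \<alpha>. lookup \<alpha> j = Suc i}"
    by (simp add: sum.If_cases Int_def)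
  finally show ?thesis .
qed

lemma ptype_add_part:
  assumes "j \<notin> keys \<beta>"
  shows "ptype (single j (Suc i) + \<beta>) = single i (Suc 0) + ptype \<beta>"
    and "keys (single j (Suc i) + \<beta>) = insert j (keys \<beta>)"
proof -
  let ?\<alpha> = "single j (Suc i) + \<beta>"
  have l: "lookup ?\<alpha> j = Suc i" "k \<noteq> j \<Longrightarrow> lookup ?\<alpha> k = lookup \<beta> k" for k
    using assms by (auto simp: lookup_add lookup_single when_def in_keys_iff)
  show k: "keys ?\<alpha> = insert j (keys \<beta>)"
    using l by (auto simp: in_keys_iff simp del: plus_poly_mapping.rep_eq) (metis gr_implies_not0 l zero_less_Suc)+
  have "(\<Sum>k\<in>keys \<beta>. single (lookup ?\<alpha> k - 1) (Suc 0)) = ptype \<beta>"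
    unfolding ptype_def by (rule sum.cong[OF refl]) (use assms in \<open>metis l(2)\<close>)
  then show "ptype ?\<alpha> = single i (Suc 0) + ptype \<beta>"
    unfolding ptype_def[of ?\<alpha>] k using assms l(1) by (subst sum.insert) auto
qed

lemma ptype_surj: "\<exists>\<alpha> :: nat \<Rightarrow>\<^sub>0 nat. ptype \<alpha> = l"
proof (induction l rule: multi_index_induct)
  case zero
  show ?case by (rule exI[of _ 0]) (simp add: ptype_def)
next
  case (add i l)
  then obtain \<beta> :: "nat \<Rightarrow>\<^sub>0 nat" where "ptype \<beta> = l" by blast
  moreover obtain j where "j \<notin> keys \<beta>" using ex_new_if_finite[OF infinite_UNIV_nat, of "keys \<beta>"] by auto
  ultimately show ?case using ptype_add_part(1)[of j \<beta> i] by blast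
qed

lemma scoeff_power_sum_times:
  assumes "n \<ge> 1"
  shows "scoeff (power_sum n * f) \<alpha> =
    (\<Sum>j | n \<le> lookup \<alpha> j. scoeff f (\<alpha> - single j n) :: 'k::comm_ring_1)"
proof -
  let ?A = "{(a, b). a + b = \<alpha> \<and> (\<exists>j. a = single j n)}"
  have "scoeff (power_sum n * f) \<alpha> = (\<Sum>(a, b)\<in>?A. scoeff f b)"
    unfolding scoeff_times
    by (rule sum.mono_neutral_cong_right) (use finite_splittings in \<open>auto simp: power_sum_def split: if_splits\<close>)
  also have "\<dots> = (\<Sum>j | n \<le> lookup \<alpha> j. scoeff f (\<alpha> - single j n))"
  proof (rule sum.reindex_bij_witness[symmetric, where
      i = "\<lambda>(a, b). THE j. j \<in> keys a" and
      j = "\<lambda>j. (single j n, \<alpha> - single j n)"])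
    fix j assume "j \<in> {j. n \<le> lookup \<alpha> j}"
    then have "single j n + (\<alpha> - single j n) = \<alpha>"
      by (intro poly_mapping_eqI) (auto simp: lookup_add lookup_minus lookup_single when_def)
    then show "(single j n, \<alpha> - single j n) \<in> ?A" by auto
  qed (use assms in \<open>auto simp: lookup_add lookup_single\<close>)
  finally show ?thesis .
qed

abbreviation psum_var :: "nat \<Rightarrow> (nat, 'k::field_char_0) series" where
  "psum_var \<equiv> (\<lambda>i. power_sum (Suc i))"

lemma homogeneous_psum_var: "homogeneous (Suc i) (psum_var i)"
  by (auto simp: homogeneous_def power_sum_def split: if_splits)

lemma psum_product_degree: "scoeff (mpow psum_var l) \<alpha> \<noteq> (0 :: 'k::field_char_0) \<Longrightarrow> mon_degree \<alpha> = weight l"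
  using homogeneous_mpow[of psum_var l, OF homogeneous_psum_var] by (auto simp: homogeneous_def)

interpretation psums: substitution "psum_var :: nat \<Rightarrow> (nat, 'k::field_char_0) series"
  by unfold_locales (use homogeneous_psum_var in \<open>fastforce simp: order_ge_def homogeneous_def\<close>)

text \<open>The coefficient counts the ways to merge the parts of \<open>l\<close> into the exponents of \<open>\<alpha>\<close>. Being natural numbers, such
  coefficients cannot cancel.\<close>

lemma psum_product_nat: "\<exists>k. scoeff (mpow psum_var l) \<alpha> = (of_nat k :: 'k::field_char_0)"
proof (induction l arbitrary: \<alpha> rule: multi_index_induct)
  case zero
  show ?case by (auto intro: exI[of _ 1] exI[of _ 0])
next
  case (add i l)
  then obtain k where "\<And>\<alpha>. scoeff (mpow psum_var l) \<alpha> = (of_nat (k \<alpha>) :: 'k)" by metis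
  then have "scoeff (mpow psum_var (single i (Suc 0) + l)) \<alpha>
      = (of_nat (\<Sum>j | Suc i \<le> lookup \<alpha> j. k (\<alpha> - single j (Suc i))) :: 'k)"
    by (simp add: mpow_add scoeff_power_sum_times)
  then show ?case by blast
qed

text \<open>Multiplying by one power sum touches one variable. Hence a product of power sums contains only
  monomials with at most as many variables as factors, and with equality only when every factor has its own variable.
  This is the triangularity of power sums with respect to monomial symmetric functions.\<close>

lemma psum_product_support:
  assumes "scoeff (mpow psum_var l) \<alpha> \<noteq> (0 :: 'k::field_char_0)"
  shows "card (keys \<alpha>) \<le> mon_degree l \<and> (card (keys \<alpha>) = mon_degree l \<longrightarrow> ptype \<alpha> = l)"
  using assms
proof (induction l arbitrary: \<alpha> rule: multi_index_induct)
  case zero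
  then show ?case by (auto simp: ptype_def split: if_splits)
next
  case (add i l)
  have "\<exists>j. Suc i \<le> lookup \<alpha> j \<and>
      scoeff (mpow psum_var l) (\<alpha> - single j (Suc i)) \<noteq> (0 :: 'k)"
  proof (rule ccontr)
    assume "\<not> ?thesis"
    then have "scoeff (mpow psum_var (single i (Suc 0) + l)) \<alpha> = (0 :: 'k)"
      by (simp add: mpow_add scoeff_power_sum_times)
    then show False using add.prems by simp
  qed
  then obtain j where j: "Suc i \<le> lookup \<alpha> j"
    and nz: "scoeff (mpow psum_var l) (\<alpha> - single j (Suc i)) \<noteq> (0 :: 'k)" by blast
  define \<beta> where "\<beta> = \<alpha> - single j (Suc i)"
  have \<alpha>: "\<alpha> = single j (Suc i) + \<beta>"
    unfolding \<beta>_def by (rule poly_mapping_eqI) (use j in \<open>auto simp: lookup_add lookup_minus lookup_single when_def\<close>)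
  have IH: "card (keys \<beta>) \<le> mon_degree l"
    "card (keys \<beta>) = mon_degree l \<Longrightarrow> ptype \<beta> = l" using add.IH[OF nz] by (auto simp: \<beta>_def)
  have d: "mon_degree (single i (Suc 0) + l) = Suc (mon_degree l)" by (simp add: mon_degree_add)
  have "keys \<alpha> \<subseteq> insert j (keys \<beta>)"
    unfolding \<alpha> using keys_add[of "single j (Suc i)" \<beta>] by auto
  then have c: "card (keys \<alpha>) \<le> card (insert j (keys \<beta>))"
    by (intro card_mono) auto
  show ?case
  proof (cases "j \<in> keys \<beta>")
    case True
    then show ?thesis using c IH d by (simp add: insert_absorb)
  next
    case False
    then show ?thesis using ptype_add_part[OF False, of i] IH d unfolding \<alpha> by auto
  qed
qed

text \<open>Assign every exponent of \<open>\<alpha>\<close> to a power sum of its own.\<close>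

lemma psum_product_diagonal: "scoeff (mpow psum_var (ptype \<alpha>)) \<alpha> \<noteq> (0 :: 'k::field_char_0)"
proof (induction "card (keys \<alpha>)" arbitrary: \<alpha>)
  case 0
  then have "\<alpha> = 0" by simp
  then show ?case by (simp add: ptype_def)
next
  case (Suc n)
  then obtain j where j: "j \<in> keys \<alpha>" by (metis card.empty ex_in_conv nat.distinct(1))
  obtain i where i: "lookup \<alpha> j = Suc i" using j by (metis in_keys_iff not0_implies_Suc)
  define \<beta> where "\<beta> = \<alpha> - single j (Suc i)"
  have \<alpha>: "\<alpha> = single j (Suc i) + \<beta>"
    unfolding \<beta>_def by (rule poly_mapping_eqI) (use i in \<open>auto simp: lookup_add lookup_minus lookup_single when_def\<close>)
  have nj: "j \<notin> keys \<beta>" by (simp add: \<beta>_def in_keys_iff lookup_minus i)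
  have "n = card (keys \<beta>)"
    using Suc.hyps(2) nj unfolding \<alpha> ptype_add_part(2)[OF nj, of i] by simp
  then have b: "scoeff (mpow psum_var (ptype \<beta>)) \<beta> \<noteq> (0 :: 'k)" by (rule Suc.hyps(1))
  obtain k where k: "\<And>\<alpha>. scoeff (mpow psum_var (ptype \<beta>)) \<alpha> = (of_nat (k \<alpha>) :: 'k)" using psum_product_nat[where 'k = 'k, of "ptype \<beta>"] by metis
  let ?J = "{j'. Suc i \<le> lookup \<alpha> j'}"
  have fin: "finite ?J" by (rule finite_subset[of _ "keys \<alpha>"]) (auto simp: in_keys_iff)
  have "k \<beta> \<noteq> 0" using b k by auto
  then have "(\<Sum>j'\<in>?J. k (\<alpha> - single j' (Suc i))) \<noteq> 0"
    using i fin unfolding \<beta>_def sum_eq_0_iff[OF fin] by (intro notI) (drule bspec[of _ _ j]; simp)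
  moreover have "scoeff (mpow psum_var (ptype \<alpha>)) \<alpha> = (of_nat (\<Sum>j'\<in>?J. k (\<alpha> - single j' (Suc i))) :: 'k)"
  proof -
    have "ptype \<alpha> = single i (Suc 0) + ptype \<beta>" using ptype_add_part(1)[OF nj, of i] \<alpha> by simp
    then show ?thesis by (simp add: mpow_add scoeff_power_sum_times k)
  qed
  ultimately show ?case by (metis of_nat_eq_0_iff)
qed

lemma power_sum_symmetric: "power_sum n \<in> symmetric_functions"
proof -
  have "(\<exists>i. map_key \<pi> \<alpha> = single i n) \<longleftrightarrow> (\<exists>i. \<alpha> = single i n)"
    if b: "bij \<pi>" for \<pi> :: "nat \<Rightarrow> nat" and \<alpha> :: "nat \<Rightarrow>\<^sub>0 nat"
  proof -
    have s: "map_key \<rho> (single i n) = single (pinv \<rho> i) n" if "bij \<rho>" for \<rho> i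
      by (rule poly_mapping_eqI) (use that in \<open>auto simp: lookup_map_key bij_is_inj lookup_single when_def
          bij_is_surj surj_f_inv_f\<close>)
    show ?thesis using s[OF b] s[OF bij_imp_bij_inv[OF b]] map_key_inverse[OF b, of \<alpha>] by metis
  qed
  then show ?thesis by (auto simp: symmetric_functions_def power_sum_def)
qed

lemma complete_sym_symmetric: "complete_sym n \<in> symmetric_functions"
  by (simp add: symmetric_functions_def complete_sym_def mon_degree_map_key)

text \<open>Monomials with the same exponents differ by a permutation of the finitely many variables involved.\<close>

lemma symmetric_by_type:
  assumes "f \<in> symmetric_functions" "ptype \<alpha> = ptype \<beta>"
  shows "scoeff f \<alpha> = scoeff f \<beta>"
proof -
  let ?A = "keys \<alpha> \<union> keys \<beta>"
  have parts: "image_mset (lookup \<delta>) (mset_set ?A) =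
      image_mset (lookup \<delta>) (mset_set (keys \<delta>)) + replicate_mset (card ?A - card (keys \<delta>)) 0"
    if "keys \<delta> \<subseteq> ?A" for \<delta>
  proof -
    have "mset_set ?A = mset_set (keys \<delta>) + mset_set (?A - keys \<delta>)"
      using that by (subst mset_set_Union[symmetric]) (auto simp: Un_absorb1 intro!: arg_cong[where f = mset_set])
    moreover have "image_mset (lookup \<delta>) (mset_set (?A - keys \<delta>))
        = image_mset (\<lambda>_. 0) (mset_set (?A - keys \<delta>))"
      by (rule image_mset_cong) (auto simp: in_keys_iff)
    moreover have "card (?A - keys \<delta>) = card ?A - card (keys \<delta>)"
      using that by (intro card_Diff_subset) auto
    ultimately show ?thesis by (simp add: image_mset_const_eq)
  qed
  have "count (image_mset (lookup \<delta>) (mset_set (keys \<delta>))) e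
      = (case e of 0 \<Rightarrow> 0 | Suc i \<Rightarrow> lookup (ptype \<delta>) i)" for \<delta> :: "nat \<Rightarrow>\<^sub>0 nat" and e
  proof -
    have "count (image_mset (lookup \<delta>) (mset_set (keys \<delta>))) e
        = (\<Sum>j\<in>lookup \<delta> -` {e} \<inter> keys \<delta>. 1)"
      unfolding count_image_mset by (rule sum.cong) auto
    also have "\<dots> = card {j \<in> keys \<delta>. lookup \<delta> j = e}"
      unfolding card_eq_sum by (rule sum.cong) auto
    also have "\<dots> = (case e of 0 \<Rightarrow> 0 | Suc i \<Rightarrow> lookup (ptype \<delta>) i)"
      by (cases e) (auto simp: lookup_ptype in_keys_iff)
    finally show ?thesis .
  qed
  then have "image_mset (lookup \<alpha>) (mset_set (keys \<alpha>)) =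
      image_mset (lookup \<beta>) (mset_set (keys \<beta>))"
    by (intro multiset_eqI) (simp add: assms(2) split: nat.split)
  moreover have "card (keys \<alpha>) = card (keys \<beta>)" 
    using assms(2) mon_degree_ptype[of \<alpha>] mon_degree_ptype[of \<beta>] by simp
  ultimately have "image_mset (lookup \<beta>) (mset_set ?A) = image_mset (lookup \<alpha>) (mset_set ?A)"
    using parts[of \<alpha>] parts[of \<beta>] by simp
  then obtain p where p: "p permutes ?A" "\<forall>x\<in>?A. lookup \<beta> x = lookup \<alpha> (p x)"
    by (rule image_mset_eq_implies_permutes[rotated]) auto
  have b: "bij p" using p(1) by (rule permutes_bij)
  have "map_key p \<alpha> = \<beta>"
  proof (rule poly_mapping_eqI)
    fix x
    show "lookup (map_key p \<alpha>) x = lookup \<beta> x"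
    proof (cases "x \<in> ?A")
      case True
      then show ?thesis using p(2) by (simp add: lookup_map_key[OF bij_is_inj[OF b]])
    next
      case False
      then show ?thesis using permutes_not_in[OF p(1) False] by (simp add: lookup_map_key[OF bij_is_inj[OF b]] in_keys_iff)
    qed
  qed
  then show ?thesis using assms(1) b by (auto simp: symmetric_functions_def)
qed

lemma substitute_diff: "substitute psum_var (P - P') = substitute psum_var P - substitute psum_var P'"
  using psums.substitute_add[of "P - P'" P'] by (simp add: algebra_simps)

lemma substitute_psum_symmetric: "substitute psum_var P \<in> symmetric_functions"
  using invariant_substitute[of _ psum_var P] power_sum_symmetric by (auto simp: symmetric_iff)

lemma psum_product_symmetric: "mpow psum_var l \<in> symmetric_functions"
  using invariant_mpow[of _ psum_var l] power_sum_symmetric by (auto simp: symmetric_iff)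

lemma scoeff_substitute_psum:
  "scoeff (substitute psum_var P) \<alpha> =
    (\<Sum>l | weight l = mon_degree \<alpha>. scoeff P l * scoeff (mpow psum_var l) \<alpha> :: 'k::field_char_0)"
  unfolding substitute_def scoeff_simps(4)
  by (rule sum.mono_neutral_right[OF finite_weight_le]) (auto dest: psum_product_degree)

text \<open>Induction on a bound for the number of variables in a monomial: the coefficients with the most variables
  are removed by products of power sums, which is possible because the diagonal coefficients are invertible.\<close>

lemma psum_generate_homogeneous:
  fixes f :: "(nat, 'k::field_char_0) series"
  assumes "f \<in> symmetric_functions"
    and "\<And>\<alpha>. scoeff f \<alpha> \<noteq> 0 \<Longrightarrow> mon_degree \<alpha> = N \<and> card (keys \<alpha>) < k"
  shows "\<exists>P. substitute psum_var P = f"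
  using assms
proof (induction k arbitrary: f)
  case 0
  then have "substitute psum_var 0 = f" by (intro series_eqI) (auto simp: substitute_def)
  then show ?case by blast
next
  case (Suc k)
  define rep where "rep l = (SOME \<alpha> :: nat \<Rightarrow>\<^sub>0 nat. ptype \<alpha> = l)" for l
  have rep: "ptype (rep l) = l" for l unfolding rep_def using ptype_surj by (rule someI_ex)
  define Q where "Q = Series (\<lambda>l. if weight l = N \<and> mon_degree l = k
    then scoeff f (rep l) / scoeff (mpow psum_var l) (rep l) else 0)"
  define f' where "f' = f - substitute psum_var Q"
  have sym: "f' \<in> symmetric_functions"
    using Suc.prems(1) substitute_psum_symmetric[of Q] by (simp add: f'_def symmetric_functions_def)
  \<comment> \<open>By triangularity \<open>Q\<close> reproduces the coefficients of \<open>f\<close> at the monomials with exactly \<open>k\<close>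
    variables, and it creates none with more variables.\<close>
  have top: "scoeff (substitute psum_var Q) \<alpha> = scoeff f \<alpha>"
    if "mon_degree \<alpha> = N" "card (keys \<alpha>) = k" for \<alpha>
  proof -
    let ?l = "ptype \<alpha>"
    have "scoeff (substitute psum_var Q) \<alpha> = (\<Sum>l\<in>{?l}. scoeff Q l * scoeff (mpow psum_var l) \<alpha>)"
      unfolding scoeff_substitute_psum
      by (rule sum.mono_neutral_right)
        (use that finite_weight_le[of N] psum_product_support[where 'k = 'k, of _ \<alpha>]
          in \<open>auto simp: weight_ptype Q_def intro: finite_subset[rotated]\<close>)
    also have "\<dots> = scoeff f (rep ?l) / scoeff (mpow psum_var ?l) (rep ?l) * scoeff (mpow psum_var ?l) \<alpha>"
      using that by (simp add: Q_def weight_ptype mon_degree_ptype)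
    also have "scoeff (mpow psum_var ?l) (rep ?l) = (scoeff (mpow psum_var ?l) \<alpha> :: 'k)"
      by (rule symmetric_by_type[OF psum_product_symmetric rep])
    also have "scoeff f (rep ?l) = scoeff f \<alpha>" by (rule symmetric_by_type[OF Suc.prems(1) rep])
    finally show ?thesis using psum_product_diagonal[where 'k = 'k, of \<alpha>] by simp
  qed
  have low: "mon_degree \<alpha> = N \<and> card (keys \<alpha>) \<le> k" if "scoeff (substitute psum_var Q) \<alpha> \<noteq> 0" for \<alpha>
  proof -
    have "\<exists>l. weight l = mon_degree \<alpha> \<and> scoeff Q l * scoeff (mpow psum_var l) \<alpha> \<noteq> 0"
    proof (rule ccontr)
      assume "\<not> ?thesis"
      then have "scoeff (substitute psum_var Q) \<alpha> = 0" unfolding scoeff_substitute_psum by (intro sum.neutral) auto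
      then show False using that by simp
    qed
    then obtain l where l: "weight l = mon_degree \<alpha>" "scoeff Q l \<noteq> 0" "scoeff (mpow psum_var l) \<alpha> \<noteq> (0 :: 'k)"
      by auto
    then show ?thesis using psum_product_support[OF l(3)] by (auto simp: Q_def split: if_splits)
  qed
  have "mon_degree \<alpha> = N \<and> card (keys \<alpha>) < k" if nz: "scoeff f' \<alpha> \<noteq> 0" for \<alpha>
  proof -
    have "mon_degree \<alpha> = N \<and> card (keys \<alpha>) \<le> k"
      using nz low[of \<alpha>] Suc.prems(2)[of \<alpha>]
      by (cases "scoeff f \<alpha> = 0") (auto simp: f'_def less_Suc_eq_le)
    moreover have "card (keys \<alpha>) \<noteq> k" using nz top[of \<alpha>] calculation by (auto simp: f'_def)
    ultimately show ?thesis by simp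
  qed
  then obtain P where "substitute psum_var P = f'" using Suc.IH[OF sym] by blast
  then have "substitute psum_var (P + Q) = f" by (simp add: psums.substitute_add f'_def)
  then show ?case by blast
qed

lemma card_keys_le_mon_degree: "card (keys \<alpha>) \<le> mon_degree \<alpha>"
  using mon_degree_le_weight[of "ptype \<alpha>"] by (simp add: mon_degree_ptype weight_ptype)

lemma psum_generate:
  fixes f :: "(nat, 'k::field_char_0) series"
  assumes "f \<in> symmetric_functions"
  shows "\<exists>P. substitute psum_var P = f"
proof -
  define part where "part N = Series (\<lambda>\<alpha>. if mon_degree \<alpha> = N then scoeff f \<alpha> else 0)" for N
  have "\<exists>P. substitute psum_var P = part N" for N
  proof (rule psum_generate_homogeneous[where N = N and k = "Suc N"])
    show "part N \<in> symmetric_functions"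
      using assms by (simp add: part_def symmetric_functions_def mon_degree_map_key)
    show "mon_degree \<alpha> = N \<and> card (keys \<alpha>) < Suc N" if "scoeff (part N) \<alpha> \<noteq> 0" for \<alpha>
      using that card_keys_le_mon_degree[of \<alpha>] by (auto simp: part_def split: if_splits)
  qed
  then obtain P where P: "\<And>N. substitute psum_var (P N) = part N" by metis
  have "substitute psum_var (Series (\<lambda>l. scoeff (P (weight l)) l)) = f"
  proof (rule series_eqI)
    fix \<alpha>
    have "scoeff (substitute psum_var (Series (\<lambda>l. scoeff (P (weight l)) l))) \<alpha>
        = scoeff (substitute psum_var (P (mon_degree \<alpha>))) \<alpha>"
      unfolding scoeff_substitute_psum by (rule sum.cong) auto
    then show "scoeff (substitute psum_var (Series (\<lambda>l. scoeff (P (weight l)) l))) \<alpha> = scoeff f \<alpha>"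
      by (simp add: P part_def)
  qed
  then show ?thesis by blast
qed

text \<open>Stated for a single degree so that it also yields continuity of the plethysm.\<close>

lemma psum_independent:
  fixes P :: "(nat, 'k::field_char_0) series"
  assumes zero: "\<And>\<alpha>. mon_degree \<alpha> = N \<Longrightarrow> scoeff (substitute psum_var P) \<alpha> = 0"
    and l: "weight l = N"
  shows "scoeff P l = 0"
proof (rule ccontr)
  assume nz: "scoeff P l \<noteq> 0"
  let ?L = "{l. weight l = N \<and> scoeff P l \<noteq> 0}"
  have fin: "finite ?L" by (rule finite_subset[OF _ finite_weight_le[of N]]) auto
  \<comment> \<open>A partition with the largest number of parts cannot be cancelled by the others.\<close>
  obtain m where m: "m \<in> ?L" "\<And>l. l \<in> ?L \<Longrightarrow> mon_degree l \<le> mon_degree m"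
    using Max_in[of "mon_degree ` ?L"] Max_ge[of "mon_degree ` ?L"] fin nz l by fastforce
  obtain \<alpha> :: "nat \<Rightarrow>\<^sub>0 nat" where \<alpha>: "ptype \<alpha> = m" using ptype_surj by blast
  have deg: "mon_degree \<alpha> = N" "card (keys \<alpha>) = mon_degree m"
    using m(1) weight_ptype[of \<alpha>] mon_degree_ptype[of \<alpha>] by (auto simp: \<alpha>)
  have "scoeff (substitute psum_var P) \<alpha> = (\<Sum>l\<in>{m}. scoeff P l * scoeff (mpow psum_var l) \<alpha>)"
    unfolding scoeff_substitute_psum
  proof (rule sum.mono_neutral_right)
    show "finite {l. weight l = mon_degree \<alpha>}" by (rule finite_subset[OF _ finite_weight_le[of N]]) (auto simp: deg)
    show "{m} \<subseteq> {l. weight l = mon_degree \<alpha>}" using m(1) by (simp add: deg)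
    show "\<forall>l\<in>{l. weight l = mon_degree \<alpha>} - {m}. scoeff P l * scoeff (mpow psum_var l) \<alpha> = 0"
    proof
      fix l assume l: "l \<in> {l. weight l = mon_degree \<alpha>} - {m}"
      show "scoeff P l * scoeff (mpow psum_var l) \<alpha> = 0"
      proof (rule ccontr)
        assume "scoeff P l * scoeff (mpow psum_var l) \<alpha> \<noteq> 0"
        then have "scoeff P l \<noteq> 0" "scoeff (mpow psum_var l) \<alpha> \<noteq> (0 :: 'k)" by auto
        then show False using l m(2)[of l] psum_product_support[of l \<alpha>] by (auto simp: deg \<alpha>)
      qed
    qed
  qed
  then show False using zero[OF deg(1)] m(1) psum_product_diagonal[where 'k = 'k, of \<alpha>] by (simp add: \<alpha>)
qed

lemma psum_injective:
  fixes P :: "(nat, 'k::field_char_0) series"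
  assumes "substitute psum_var P = substitute psum_var P'"
  shows "P = P'"
proof (rule series_eqI)
  fix l
  have "scoeff (P - P') l = 0"
    by (rule psum_independent[where N = "weight l"]) (simp_all add: substitute_diff assms)
  then show "scoeff P l = scoeff P' l" by simp
qed

definition psum_poly :: "(nat, 'k::field_char_0) series \<Rightarrow> (nat, 'k) series" where
  "psum_poly f = (THE P. substitute psum_var P = f)"

lemma psum_poly_eqI: "substitute psum_var P = f \<Longrightarrow> psum_poly f = P"
  unfolding psum_poly_def by (rule the_equality) (auto intro: psum_injective)

lemma substitute_psum_poly: "f \<in> symmetric_functions \<Longrightarrow> substitute psum_var (psum_poly f) = f"
  using psum_generate[of f] psum_poly_eqI[where f = f] by fastforce

text \<open>Write a symmetric function as a series in the power sums, in a unique way, and replace \<open>p\<^sub>i\<close> by the series in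
  which all variables are raised to the power \<open>i\<close>. As \<open>g\<close> has no constant term, that series starts in
  degree \<open>i\<close> and the substitution converges.\<close>

lemma plethysm_exists:
  fixes g :: "(var, 'k::field_char_0) series"
  assumes g: "g \<in> bisymmetric_functions" and g0: "scoeff g 0 = 0"
  shows "\<exists>\<phi>. is_plethysm g \<phi>"
proof -
  let ?s = "\<lambda>i. power_subst (Suc i) g"
  interpret subst: substitution ?s by unfold_locales (rule order_power_subst, use g0 in auto)
  define \<phi> where "\<phi> f = substitute ?s (psum_poly f)" for f
  have "\<phi> f \<in> bisymmetric_functions" for f
    unfolding \<phi>_def bisymmetric_iff
    using g by (auto intro!: invariant_substitute invariant_power_subst rename_vars_bij simp: bisymmetric_iff)
  moreover have "\<phi> (scalar c) = scalar c" for c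
    unfolding \<phi>_def using psum_poly_eqI[OF psums.substitute_scalar[of c]] subst.substitute_scalar by simp
  moreover have "\<phi> (f + f') = \<phi> f + \<phi> f'" "\<phi> (f * f') = \<phi> f * \<phi> f'"
    if f: "f \<in> symmetric_functions" "f' \<in> symmetric_functions" for f f'
  proof -
    have "psum_poly (f + f') = psum_poly f + psum_poly f'" "psum_poly (f * f') = psum_poly f * psum_poly f'"
      by (auto intro!: psum_poly_eqI simp: psums.substitute_add psums.substitute_times substitute_psum_poly f)
    then show "\<phi> (f + f') = \<phi> f + \<phi> f'" "\<phi> (f * f') = \<phi> f * \<phi> f'"
      by (simp_all add: \<phi>_def subst.substitute_add subst.substitute_times)
  qed
  moreover have "\<exists>N. \<forall>f\<in>symmetric_functions. (\<forall>\<alpha>. mon_degree \<alpha> < N \<longrightarrow> scoeff f \<alpha> = 0) \<longrightarrow> scoeff (\<phi> f) \<gamma> = 0" for \<gamma>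
  proof (rule exI[of _ "Suc (mon_degree \<gamma>)"], intro ballI impI)
    fix f :: "(nat, 'k) series"
    assume f: "f \<in> symmetric_functions" "\<forall>\<alpha>. mon_degree \<alpha> < Suc (mon_degree \<gamma>) \<longrightarrow> scoeff f \<alpha> = 0"
    have "scoeff (psum_poly f) l = 0" if "weight l \<le> mon_degree \<gamma>" for l
      by (rule psum_independent[where N = "weight l"]) (use f that in \<open>auto simp: substitute_psum_poly\<close>)
    then show "scoeff (\<phi> f) \<gamma> = 0" by (simp add: \<phi>_def substitute_def)
  qed
  moreover have "\<phi> (power_sum n) = power_subst n g" if n: "n \<ge> 1" for n
  proof -
    from n obtain i where i: "n = Suc i" by (cases n) auto
    show ?thesis unfolding \<phi>_def i psum_poly_eqI[OF psums.substitute_variable[of i]] by (rule subst.substitute_variable)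
  qed
  ultimately have "is_plethysm g \<phi>" unfolding is_plethysm_def by blast
  then show ?thesis by blast
qed

text \<open>A monomial \<open>\<alpha>\<close> of degree \<open>n\<close> is obtained from \<open>p\<^sub>i h\<^bsub>n-i\<^esub>\<close> once for each variable whose exponent is at least \<open>i\<close>; summing
  over \<open>i\<close> gives the sum of the exponents.\<close>

lemma newton_complete:
  "scalar (of_nat n) * complete_sym n = (\<Sum>i = 1..n. power_sum i * complete_sym (n - i) :: (nat, 'k::field_char_0) series)"
proof (rule series_eqI)
  fix \<alpha> :: "nat \<Rightarrow>\<^sub>0 nat"
  let ?K = "keys \<alpha>"
  have deg: "mon_degree (\<alpha> - single j i) = n - i \<longleftrightarrow> mon_degree \<alpha> = n"
    if "i \<le> n" "i \<le> lookup \<alpha> j" for i j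
  proof -
    have "single j i + (\<alpha> - single j i) = \<alpha>"
      by (rule poly_mapping_eqI) (use that in \<open>auto simp: lookup_add lookup_minus lookup_single when_def\<close>)
    then have "i + mon_degree (\<alpha> - single j i) = mon_degree \<alpha>"
      using mon_degree_add[of "single j i" "\<alpha> - single j i"] by simp
    then show ?thesis using that(1) by auto
  qed
  have fin: "finite {j. i \<le> lookup \<alpha> j}" if "i \<ge> 1" for i
    by (rule finite_subset[of _ ?K]) (use that in \<open>auto simp: in_keys_iff\<close>)
  have "scoeff (\<Sum>i = 1..n. power_sum i * complete_sym (n - i)) \<alpha>
      = (\<Sum>i = 1..n. \<Sum>j | i \<le> lookup \<alpha> j. if mon_degree \<alpha> = n then 1 else 0 :: 'k)"
    using deg by (auto simp: scoeff_power_sum_times complete_sym_def intro!: sum.cong)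
  also have "\<dots> = (if mon_degree \<alpha> = n then of_nat (\<Sum>i = 1..n. card {j. i \<le> lookup \<alpha> j}) else 0)"
    by simp
  also have "\<dots> = (if mon_degree \<alpha> = n then of_nat n else 0)"
  proof (cases "mon_degree \<alpha> = n")
    case True
    have le: "lookup \<alpha> j \<le> n" if "j \<in> ?K" for j
      unfolding True[symmetric] mon_degree_def by (rule member_le_sum) (use that in auto)
    have "(\<Sum>i = 1..n. card {j. i \<le> lookup \<alpha> j}) = (\<Sum>i = 1..n. \<Sum>j\<in>?K. if i \<le> lookup \<alpha> j then 1 else 0)"
    proof (rule sum.cong[OF refl])
      fix i assume "i \<in> {1..n}"
      then have "{j. i \<le> lookup \<alpha> j} = {j \<in> ?K. i \<le> lookup \<alpha> j}"
        by (auto simp: in_keys_iff)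
      then show "card {j. i \<le> lookup \<alpha> j} = (\<Sum>j\<in>?K. if i \<le> lookup \<alpha> j then 1 else 0)"
        by (simp add: sum.If_cases Int_def)
    qed
    also have "\<dots> = (\<Sum>j\<in>?K. \<Sum>i = 1..n. if i \<le> lookup \<alpha> j then 1 else 0)" by (rule sum.swap)
    also have "\<dots> = (\<Sum>j\<in>?K. lookup \<alpha> j)"
    proof (rule sum.cong[OF refl])
      fix j assume "j \<in> ?K"
      then have "{1..n} \<inter> {i. i \<le> lookup \<alpha> j} = {1..lookup \<alpha> j}" using le by fastforce
      then show "(\<Sum>i = 1..n. if i \<le> lookup \<alpha> j then 1 else 0) = lookup \<alpha> j"
        by (simp add: sum.If_cases)
    qed
    also have "\<dots> = n" using True by (simp add: mon_degree_def)
    finally show ?thesis using True by simp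
  qed simp
  also have "\<dots> = scoeff (scalar (of_nat n) * complete_sym n) \<alpha>"
    by (simp add: scoeff_scalar_times complete_sym_def)
  finally show "scoeff (scalar (of_nat n) * complete_sym n) \<alpha> = scoeff (\<Sum>i = 1..n. power_sum i * complete_sym (n - i) :: (nat, 'k) series) \<alpha>"
    by simp
qed

text \<open>The recursion determines \<open>H n\<close> because \<open>n\<close> is invertible.\<close>

lemma newton_unique:
  fixes H R :: "nat \<Rightarrow> ('i, 'k::field_char_0) series"
  assumes "H 0 = R 0"
    and H: "\<And>n. scalar (of_nat n) * H n = (\<Sum>i = 1..n. q i * H (n - i))"
    and R: "\<And>n. scalar (of_nat n) * R n = (\<Sum>i = 1..n. q i * R (n - i))"
  shows "H n = R n"
proof (induction n rule: less_induct)
  case (less n)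
  show ?case
  proof (cases "n = 0")
    case False
    have "(\<Sum>i = 1..n. q i * H (n - i)) = (\<Sum>i = 1..n. q i * R (n - i))"
      by (rule sum.cong) (use less in auto)
    then have e: "scalar (of_nat n) * H n = scalar (of_nat n) * R n" using H R by metis
    show ?thesis
    proof (rule series_eqI)
      fix \<gamma>
      have "of_nat n * scoeff (H n) \<gamma> = of_nat n * scoeff (R n) \<gamma>"
        using arg_cong[OF e, of "\<lambda>f. scoeff f \<gamma>"] by (simp only: scoeff_scalar_times)
      then show "scoeff (H n) \<gamma> = scoeff (R n) \<gamma>" using False by simp
    qed
  qed (use assms(1) in simp)
qed

lemma symmetric_times: "f \<in> symmetric_functions \<Longrightarrow> g \<in> symmetric_functions \<Longrightarrow>
    f * (g :: (nat, 'k::comm_ring_1) series) \<in> symmetric_functions"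
  by (auto simp: symmetric_iff intro: invariant_times)

lemma plethysm_newton:
  fixes g :: "(var, 'k::field_char_0) series"
  assumes "is_plethysm g \<phi>"
  shows "\<phi> (complete_sym 0) = 1"
    and "scalar (of_nat n) * \<phi> (complete_sym n) = (\<Sum>i = 1..n. power_subst i g * \<phi> (complete_sym (n - i)))"
proof -
  have sc: "\<phi> (scalar c) = scalar c" for c using assms by (auto simp: is_plethysm_def)
  have hom: "\<phi> (f + f') = \<phi> f + \<phi> f'" "\<phi> (f * f') = \<phi> f * \<phi> f'"
    if "f \<in> symmetric_functions" "f' \<in> symmetric_functions" for f f'
    using assms that by (auto simp: is_plethysm_def)
  have ps: "\<phi> (power_sum n) = power_subst n g" if "n \<ge> 1" for n using assms that by (auto simp: is_plethysm_def)
  have "complete_sym 0 = (scalar 1 :: (nat, 'k) series)"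
    by (rule series_eqI) (auto simp: complete_sym_def mon_degree_eq_0_iff)
  then show "\<phi> (complete_sym 0) = 1" using sc[of 1] by (simp add: scalar_1)
  have ss: "scalar c \<in> symmetric_functions" for c :: 'k by (auto simp: symmetric_iff invariant_scalar)
  have zero: "scalar 0 = (0 :: ('j, 'k) series)" by (rule series_eqI) simp
  have sum: "\<phi> (sum f A) = (\<Sum>a\<in>A. \<phi> (f a)) \<and> sum f A \<in> symmetric_functions"
    if "finite A" "\<And>a. a \<in> A \<Longrightarrow> f a \<in> symmetric_functions" for f and A :: "nat set"
    using that
  proof (induction A rule: finite_induct)
    case empty
    then show ?case using sc[of 0] ss[of 0] by (simp add: zero)
  next
    case (insert a A)
    then have "f a \<in> symmetric_functions" "sum f A \<in> symmetric_functions" "\<phi> (sum f A) = (\<Sum>a\<in>A. \<phi> (f a))" by auto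
    moreover have "f a + sum f A \<in> symmetric_functions" using calculation by (auto simp: symmetric_iff intro: invariant_add)
    ultimately show ?case using insert.hyps by (simp add: hom)
  qed
  have "scalar (of_nat n) * \<phi> (complete_sym n) = \<phi> (scalar (of_nat n) * complete_sym n)"
    by (simp add: hom ss complete_sym_symmetric sc)
  also have "\<dots> = \<phi> (\<Sum>i = 1..n. power_sum i * complete_sym (n - i))" by (simp only: newton_complete)
  also have "\<dots> = (\<Sum>i = 1..n. \<phi> (power_sum i * complete_sym (n - i)))"
    by (rule conjunct1[OF sum]) (auto intro: symmetric_times power_sum_symmetric complete_sym_symmetric)
  also have "\<dots> = (\<Sum>i = 1..n. power_subst i g * \<phi> (complete_sym (n - i)))"
    by (rule sum.cong) (auto simp: hom power_sum_symmetric complete_sym_symmetric ps)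
  finally show "scalar (of_nat n) * \<phi> (complete_sym n) = (\<Sum>i = 1..n. power_subst i g * \<phi> (complete_sym (n - i)))" .
qed

text \<open>Every plethysm maps Newton's identity to the recursion satisfied by \<open>R\<close>, so its values on complete symmetric
  functions are forced.\<close>

lemma rel_plethysm_complete:
  fixes g :: "(var, 'k::field_char_0) series"
  assumes g: "g \<in> bisymmetric_functions" "scoeff g 0 = 0"
    and R: "R 0 = 1" "\<And>n. scalar (of_nat n) * R n = (\<Sum>i = 1..n. power_subst i g * R (n - i))"
  shows "rel_plethysm (complete_sym n) g = R n" and "R n \<in> bisymmetric_functions"
proof -
  have u: "\<phi> (complete_sym n) = R n" if "is_plethysm g \<phi>" for \<phi>
    by (rule newton_unique[where q = "\<lambda>i. power_subst i g"]) (use plethysm_newton[OF that] R in auto)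
  obtain \<phi> where \<phi>: "is_plethysm g \<phi>" using plethysm_exists[OF g] by blast
  show "rel_plethysm (complete_sym n) g = R n"
    unfolding rel_plethysm_def using u \<phi> by (intro the_equality) blast+
  show "R n \<in> bisymmetric_functions"
    using \<phi> u[OF \<phi>] complete_sym_symmetric unfolding is_plethysm_def by metis
qed

section \<open>Plethysm of letter series\<close>

definition scale :: "nat \<Rightarrow> ('i \<Rightarrow>\<^sub>0 nat) \<Rightarrow> ('i \<Rightarrow>\<^sub>0 nat)" where
  "scale n \<gamma> = smul n \<gamma>"

lemma lookup_scale [simp]: "lookup (scale n \<gamma>) v = n * lookup \<gamma> v"
  by (simp add: scale_def Poly_Mapping.map.rep_eq when_def)

context letter_system
begin

definition letter_series :: "(var, 'k) series" where
  "letter_series = Series (\<lambda>\<gamma>. (-1) ^ hb \<gamma> * of_nat (c \<gamma>))"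

definition mset_series :: "nat \<Rightarrow> (var, 'k) series" where
  "mset_series n = Series (\<lambda>\<gamma>. (-1) ^ hb \<gamma> * of_nat (card (letter_msets n \<gamma>)))"

text \<open>The admissibility condition of \<open>letter_msets\<close>, quantified over all letters because this form passes to submultisets directly.\<close>

definition super :: "letter multiset \<Rightarrow> bool" where
  "super A \<longleftrightarrow> (\<forall>l\<in>#A. valid l) \<and> (\<forall>l. odd (hb (fst l)) \<longrightarrow> count A l \<le> 1)"

lemma letter_msets_super: "letter_msets n \<gamma> = {A. super A \<and> size A = n \<and> (\<Sum>l\<in>#A. fst l) = \<gamma>}"
proof -
  have "(\<forall>l\<in>#A. odd (hb (fst l)) \<longrightarrow> count A l \<le> 1) \<longleftrightarrow> (\<forall>l. odd (hb (fst l)) \<longrightarrow> count A l \<le> 1)"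
    for A :: "letter multiset"
  proof (intro iffI allI impI ballI)
    fix l :: letter assume a: "\<forall>l\<in>#A. odd (hb (fst l)) \<longrightarrow> count A l \<le> 1" and o: "odd (hb (fst l))"
    show "count A l \<le> 1" using a o by (cases "l \<in># A") (auto simp: not_in_iff)
  qed fast
  then show ?thesis unfolding letter_msets_def super_def by blast
qed

lemma finite_letter_msets_size: "c 0 = 0 \<Longrightarrow> finite (letter_msets n \<gamma>)"
  by (rule finite_subset[OF _ finite_letter_msets[of \<gamma>]]) auto

text \<open>Multisets that reach size \<open>n\<close> and weight \<open>\<gamma>\<close> when \<open>i\<close> copies of \<open>l\<close> are added, whether or not the result is admissible.\<close>

definition extensions :: "nat \<Rightarrow> (var \<Rightarrow>\<^sub>0 nat) \<Rightarrow> letter \<Rightarrow> nat \<Rightarrow> letter multiset set" where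
  "extensions n \<gamma> l i = {B. super B \<and> size B + i = n \<and> (\<Sum>l\<in>#B. fst l) + scale i (fst l) = \<gamma>}"

lemma extensions_eq:
  assumes "scale i (fst l) + \<beta> = \<gamma>" "i \<le> n"
  shows "extensions n \<gamma> l i = letter_msets (n - i) \<beta>"
  using assms by (auto simp: extensions_def letter_msets_super add.commute[of _ "scale i (fst l)"])

lemma extensions_empty: "\<nexists>\<beta>. scale i (fst l) + \<beta> = \<gamma> \<Longrightarrow> extensions n \<gamma> l i = {}"
  unfolding extensions_def by (auto simp: add.commute[of _ "scale i (fst l)"])

lemma finite_extensions:
  assumes "c 0 = 0"
  shows "finite (extensions n \<gamma> l i)"
proof (cases "i \<le> n \<and> (\<exists>\<beta>. scale i (fst l) + \<beta> = \<gamma>)")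
  case True
  then show ?thesis using extensions_eq finite_letter_msets_size[OF assms] by metis
next
  case False
  then have "extensions n \<gamma> l i = {}"
    unfolding extensions_def by (auto simp: add.commute[of _ "scale i (fst l)"])
  then show ?thesis by simp
qed

lemma weight_replicate: "(\<Sum>l\<in>#replicate_mset i l. fst l) = scale i (fst l)"
  by (induction i) (auto intro!: poly_mapping_eqI simp: lookup_add)

lemma extensions_add:
  "super (B + replicate_mset i l) \<Longrightarrow> super B \<Longrightarrow>
    B \<in> extensions n \<gamma> l i \<longleftrightarrow> B + replicate_mset i l \<in> letter_msets n \<gamma>"
  unfolding letter_msets_super extensions_def
  by (simp only: image_mset_union sum_mset.union weight_replicate size_union size_replicate_mset mem_Collect_eq simp_thms)

lemma super_mono: "super A \<Longrightarrow> B \<subseteq># A \<Longrightarrow> super B"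
  unfolding super_def by (meson le_trans mset_subset_eqD mset_subset_eq_count)

text \<open>For an even letter, adding copies keeps a multiset admissible.\<close>

lemma extensions_even:
  assumes l: "valid l" "even (hb (fst l))"
  shows "card (extensions n \<gamma> l i) = card {A \<in> letter_msets n \<gamma>. i \<le> count A l}"
proof (rule bij_betw_same_card[of "\<lambda>B. B + replicate_mset i l"])
  have s: "super (B + replicate_mset i l)" if "super B" for B
    using that l by (auto simp: super_def)
  show "bij_betw (\<lambda>B. B + replicate_mset i l) (extensions n \<gamma> l i) {A \<in> letter_msets n \<gamma>. i \<le> count A l}"
  proof (rule bij_betw_byWitness[where f' = "\<lambda>A. A - replicate_mset i l"])
    show "\<forall>B\<in>extensions n \<gamma> l i. B + replicate_mset i l - replicate_mset i l = B" by simp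
    show "\<forall>A\<in>{A \<in> letter_msets n \<gamma>. i \<le> count A l}. A - replicate_mset i l + replicate_mset i l = A"
      by (simp add: count_le_replicate_mset_subset_eq)
    show "(\<lambda>B. B + replicate_mset i l) ` extensions n \<gamma> l i \<subseteq> {A \<in> letter_msets n \<gamma>. i \<le> count A l}"
    proof
      fix A assume "A \<in> (\<lambda>B. B + replicate_mset i l) ` extensions n \<gamma> l i"
      then obtain B where B: "B \<in> extensions n \<gamma> l i" "A = B + replicate_mset i l" by blast
      then have "super B" by (simp add: extensions_def)
      then have "A \<in> letter_msets n \<gamma>" using extensions_add[OF s] B by blast
      then show "A \<in> {A \<in> letter_msets n \<gamma>. i \<le> count A l}" by (simp add: B(2))
    qed
    show "(\<lambda>A. A - replicate_mset i l) ` {A \<in> letter_msets n \<gamma>. i \<le> count A l} \<subseteq> extensions n \<gamma> l i"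
    proof
      fix B assume "B \<in> (\<lambda>A. A - replicate_mset i l) ` {A \<in> letter_msets n \<gamma>. i \<le> count A l}"
      then obtain A where A: "A \<in> letter_msets n \<gamma>" "i \<le> count A l" "B = A - replicate_mset i l" by blast
      have e: "B + replicate_mset i l = A" using A by (simp add: count_le_replicate_mset_subset_eq)
      have "super A" using A(1) by (simp add: letter_msets_super)
      then have "super B" by (rule super_mono) (simp add: A(3))
      then show "B \<in> extensions n \<gamma> l i" using extensions_add[OF s] A(1) e by metis
    qed
  qed
qed

text \<open>Moving the single copy of \<open>l\<close> from the multiset to the extension raises \<open>i\<close> by one.\<close>

lemma extensions_odd:
  assumes l: "valid l" "odd (hb (fst l))"
  shows "card {B \<in> extensions n \<gamma> l i. l \<in># B} = card {B \<in> extensions n \<gamma> l (Suc i). l \<notin># B}"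
    and "card {B \<in> extensions n \<gamma> l 1. l \<notin># B} = card {A \<in> letter_msets n \<gamma>. l \<in># A}"
proof -
  have add: "super (add_mset l B)" if "super B" "l \<notin># B" for B
    using that l by (auto simp: super_def not_in_iff)
  have remove: "super (A - {#l#})" "l \<notin># A - {#l#}" if "super A" for A
  proof -
    show "super (A - {#l#})" by (rule super_mono[OF that]) simp
    have "count A l \<le> 1" using that l(2) unfolding super_def by blast
    then show "l \<notin># A - {#l#}" by (simp add: in_diff_count)
  qed
  have weight: "scale (Suc i) (fst l) = fst l + scale i (fst l)" for i
    by (rule poly_mapping_eqI) (simp add: lookup_add)
  have bij: "card {B. super B \<and> l \<in># B \<and> P (size B) (\<Sum>l\<in>#B. fst l)}
      = card {B. super B \<and> l \<notin># B \<and> P (Suc (size B)) (fst l + (\<Sum>l\<in>#B. fst l))}" for P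
  proof (rule bij_betw_same_card[of "\<lambda>A. A - {#l#}"], rule bij_betw_byWitness[where f' = "add_mset l"])
    show "(\<lambda>A. A - {#l#}) ` {B. super B \<and> l \<in># B \<and> P (size B) (\<Sum>l\<in>#B. fst l)}
        \<subseteq> {B. super B \<and> l \<notin># B \<and> P (Suc (size B)) (fst l + (\<Sum>l\<in>#B. fst l))}"
    proof
      fix B assume "B \<in> (\<lambda>A. A - {#l#}) ` {B. super B \<and> l \<in># B \<and> P (size B) (\<Sum>l\<in>#B. fst l)}"
      then obtain A where A: "super A" "l \<in># A" "P (size A) (\<Sum>l\<in>#A. fst l)" "B = A - {#l#}" by blast
      then have "A = add_mset l B" by simp
      then show "B \<in> {B. super B \<and> l \<notin># B \<and> P (Suc (size B)) (fst l + (\<Sum>l\<in>#B. fst l))}"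
        using A(3) remove[OF A(1)] unfolding A(4)[symmetric] by simp
    qed
  qed (use add in auto)
  show "card {B \<in> extensions n \<gamma> l i. l \<in># B} = card {B \<in> extensions n \<gamma> l (Suc i). l \<notin># B}"
  proof -
    have "{B \<in> extensions n \<gamma> l i. l \<in># B} = {B. super B \<and> l \<in># B \<and> size B + i = n \<and> (\<Sum>l\<in>#B. fst l) + scale i (fst l) = \<gamma>}"
      unfolding extensions_def by blast
    moreover have "{B \<in> extensions n \<gamma> l (Suc i). l \<notin># B}
        = {B. super B \<and> l \<notin># B \<and> Suc (size B) + i = n \<and> (fst l + (\<Sum>l\<in>#B. fst l)) + scale i (fst l) = \<gamma>}"
      unfolding extensions_def weight by (auto simp: ac_simps)
    ultimately show ?thesis using bij[of "\<lambda>s w. s + i = n \<and> w + scale i (fst l) = \<gamma>"] by simp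
  qed
  show "card {B \<in> extensions n \<gamma> l 1. l \<notin># B} = card {A \<in> letter_msets n \<gamma>. l \<in># A}"
  proof -
    have z: "scale 1 (fst l) = fst l" by (rule poly_mapping_eqI) simp
    have "{B \<in> extensions n \<gamma> l 1. l \<notin># B}
        = {B. super B \<and> l \<notin># B \<and> Suc (size B) = n \<and> fst l + (\<Sum>l\<in>#B. fst l) = \<gamma>}"
      unfolding extensions_def z by (auto simp: ac_simps)
    moreover have "{A \<in> letter_msets n \<gamma>. l \<in># A} = {B. super B \<and> l \<in># B \<and> size B = n \<and> (\<Sum>l\<in>#B. fst l) = \<gamma>}"
      unfolding letter_msets_super by blast
    ultimately show ?thesis using bij[of "\<lambda>s w. s = n \<and> w = \<gamma>"] by simp
  qed
qed

text \<open>Even letters: counting, for all \<open>i\<close>, the multisets with at least \<open>i\<close> copies of \<open>l\<close> counts all copies. Odd letters: an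
  alternating sum that telescopes to the number of multisets containing \<open>l\<close>.\<close>

lemma letter_newton:
  assumes c0: "c 0 = 0" and l: "valid l"
  shows "(\<Sum>i = 1..n. (-1) ^ (Suc i * hb (fst l)) * of_nat (card (extensions n \<gamma> l i)))
    = (of_nat (\<Sum>A\<in>letter_msets n \<gamma>. count A l) :: 'k)"
proof (cases "even (hb (fst l))")
  case True
  have fin: "finite (letter_msets n \<gamma>)" by (rule finite_letter_msets_size[OF c0])
  have "(\<Sum>i = 1..n. (-1) ^ (Suc i * hb (fst l)) * of_nat (card (extensions n \<gamma> l i)))
      = (of_nat (\<Sum>i = 1..n. card {A \<in> letter_msets n \<gamma>. i \<le> count A l}) :: 'k)"
    using True by (simp add: extensions_even[OF l True])
  also have "(\<Sum>i = 1..n. card {A \<in> letter_msets n \<gamma>. i \<le> count A l})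
      = (\<Sum>i = 1..n. \<Sum>A\<in>letter_msets n \<gamma>. if i \<le> count A l then 1 else 0)"
    using fin by (simp add: sum.If_cases Int_def)
  also have "\<dots> = (\<Sum>A\<in>letter_msets n \<gamma>. \<Sum>i = 1..n. if i \<le> count A l then 1 else 0)" by (rule sum.swap)
  also have "\<dots> = (\<Sum>A\<in>letter_msets n \<gamma>. count A l)"
  proof (rule sum.cong[OF refl])
    fix A assume "A \<in> letter_msets n \<gamma>"
    then have "count A l \<le> n" using count_le_size[of A l] by (simp add: letter_msets_super)
    then have "{1..n} \<inter> {i. i \<le> count A l} = {1..count A l}" by auto
    then show "(\<Sum>i = 1..n. if i \<le> count A l then 1 else 0) = count A l" by (simp add: sum.If_cases)
  qed
  finally show ?thesis .
next
  case odd: False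
  define v where "v i = (of_nat (card {B \<in> extensions n \<gamma> l i. l \<notin># B}) :: 'k)" for i
  have split: "of_nat (card (extensions n \<gamma> l i)) = v i + v (Suc i)" for i
  proof -
    have "extensions n \<gamma> l i = {B \<in> extensions n \<gamma> l i. l \<notin># B} \<union> {B \<in> extensions n \<gamma> l i. l \<in># B}" by blast
    then have "card (extensions n \<gamma> l i) = card {B \<in> extensions n \<gamma> l i. l \<notin># B} + card {B \<in> extensions n \<gamma> l i. l \<in># B}"
      using finite_extensions[OF c0, of n \<gamma> l i]
      by (subst card_Un_disjoint[symmetric]) (auto intro: finite_subset[rotated])
    then show ?thesis using extensions_odd(1)[OF l odd, of n \<gamma> i] by (simp add: v_def)
  qed
  \<comment> \<open>An odd letter occurs at most once, so the extensions that contain it at stage \<open>i\<close> are those that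
    avoid it at stage \<open>i + 1\<close>, and the alternating sum telescopes.\<close>
  have telescope: "(\<Sum>i = 1..k. (-1) ^ Suc i * (v i + v (Suc i))) = v 1 - (-1) ^ k * v (Suc k)" for k
    by (induction k) (simp_all add: algebra_simps)
  have "(\<Sum>i = 1..n. (-1) ^ (Suc i * hb (fst l)) * of_nat (card (extensions n \<gamma> l i)))
      = (\<Sum>i = 1..n. (-1) ^ Suc i * (v i + v (Suc i)))"
  proof (rule sum.cong[OF refl])
    fix i
    have "(-1 :: 'k) ^ (Suc i * hb (fst l)) = ((-1) ^ hb (fst l)) ^ Suc i" by (metis power_mult mult.commute)
    then show "(-1) ^ (Suc i * hb (fst l)) * of_nat (card (extensions n \<gamma> l i)) = (-1) ^ Suc i * (v i + v (Suc i))"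
      using odd by (simp add: split)
  qed
  also have "\<dots> = v 1"
  proof -
    have "extensions n \<gamma> l (Suc n) = {}" by (auto simp: extensions_def)
    then have "v (Suc n) = 0" by (simp add: v_def)
    then show ?thesis using telescope[of n] by simp
  qed
  also have "v 1 = of_nat (card {A \<in> letter_msets n \<gamma>. l \<in># A})" unfolding v_def extensions_odd(2)[OF l odd] ..
  also have "card {A \<in> letter_msets n \<gamma>. l \<in># A} = (\<Sum>A\<in>letter_msets n \<gamma>. if l \<in># A then 1 else 0)"
    using finite_letter_msets_size[OF c0, of n \<gamma>] by (simp add: sum.If_cases Int_def)
  also have "\<dots> = (\<Sum>A\<in>letter_msets n \<gamma>. count A l)"
  proof (rule sum.cong[OF refl])
    fix A assume "A \<in> letter_msets n \<gamma>"
    then have "super A" by (simp add: letter_msets_super)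
    then have "count A l \<le> 1" using odd unfolding super_def by blast
    moreover have "l \<in># A \<longleftrightarrow> count A l \<noteq> 0" by simp
    ultimately show "(if l \<in># A then 1 else 0) = count A l" by presburger
  qed
  finally show ?thesis .
qed

lemma mset_series_0: "c 0 = 0 \<Longrightarrow> mset_series 0 = 1"
proof (rule series_eqI)
  fix \<gamma>
  have "letter_msets 0 \<gamma> = (if \<gamma> = 0 then {{#}} else {})" by (auto simp: letter_msets_def)
  then show "scoeff (mset_series 0) \<gamma> = scoeff 1 \<gamma>" by (simp add: mset_series_def)
qed

text \<open>A factor \<open>power_subst i\<close> of the letter series picks a letter, to be used \<open>i\<close> times. Only letters whose weight divides
  \<open>\<gamma>\<close> can contribute, which keeps the sum over letters finite.\<close>

lemma scoeff_power_subst_mset_series: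
  assumes i: "1 \<le> i" "i \<le> n"
  shows "scoeff (power_subst i letter_series * mset_series (n - i)) \<gamma>
    = (-1) ^ hb \<gamma> * (\<Sum>l\<in>(SIGMA \<delta>:{\<delta>. \<exists>\<beta>. \<delta> + \<beta> = \<gamma>}. {..<c \<delta>}).
        (-1) ^ (Suc i * hb (fst l)) * of_nat (card (extensions n \<gamma> l i)))"
proof -
  let ?D = "{\<delta>. \<exists>\<beta>. \<delta> + \<beta> = \<gamma>}" and ?S = "{(\<alpha>, \<beta>). \<alpha> + \<beta> = \<gamma>}"
  have "?D = fst ` ?S" by force
  then have finD: "finite ?D" using finite_splittings[of \<gamma>] by simp
  let ?D' = "{\<delta>. \<exists>\<beta>. scale i \<delta> + \<beta> = \<gamma>}"
  have sub: "?D' \<subseteq> ?D"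
  proof
    fix \<delta> assume "\<delta> \<in> ?D'"
    then obtain \<beta> where "scale i \<delta> + \<beta> = \<gamma>" by blast
    moreover have "\<delta> + (scale (i - 1) \<delta> + \<beta>) = scale i \<delta> + \<beta>"
      using i(1) by (intro poly_mapping_eqI) (simp add: lookup_add algebra_simps diff_mult_distrib)
    ultimately show "\<delta> \<in> ?D" by auto
  qed
  let ?f = "\<lambda>\<delta> \<beta>. (-1) ^ hb \<delta> * of_nat (c \<delta>) * ((-1) ^ hb \<beta> * of_nat (card (letter_msets (n - i) \<beta>))) :: 'k"
  let ?div = "\<lambda>\<alpha> :: var \<Rightarrow>\<^sub>0 nat. Poly_Mapping.map (\<lambda>e. e div i) \<alpha>"
  have "(-1) ^ hb \<gamma> * (\<Sum>l\<in>Sigma ?D (\<lambda>\<delta>. {..<c \<delta>}). (-1) ^ (Suc i * hb (fst l)) * of_nat (card (extensions n \<gamma> l i)))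
      = (\<Sum>\<delta>\<in>?D. \<Sum>t<c \<delta>. (-1) ^ hb \<gamma> * ((-1) ^ (Suc i * hb \<delta>) * of_nat (card (extensions n \<gamma> (\<delta>, t) i))) :: 'k)"
    using finD by (subst sum.Sigma) (auto simp: sum_distrib_left case_prod_beta)
  also have "\<dots> = (\<Sum>\<delta>\<in>?D'. \<Sum>t<c \<delta>. (-1) ^ hb \<gamma> * ((-1) ^ (Suc i * hb \<delta>) * of_nat (card (extensions n \<gamma> (\<delta>, t) i))))"
    by (rule sum.mono_neutral_right[OF finD sub]) (auto simp: extensions_empty)
  also have "\<dots> = (\<Sum>\<delta>\<in>?D'. ?f \<delta> (\<gamma> - scale i \<delta>))"
  proof (rule sum.cong[OF refl])
    fix \<delta> assume "\<delta> \<in> ?D'"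
    then obtain \<beta> where \<beta>: "scale i \<delta> + \<beta> = \<gamma>" by blast
    then have b: "\<gamma> - scale i \<delta> = \<beta>" by (metis add_diff_cancel_left')
    \<comment> \<open>Taking \<open>i\<close> copies of an odd letter changes the total sign by \<open>i - 1\<close> signs, because \<open>power_subst\<close>
      keeps only one of them.\<close>
    have "even (hb \<gamma> + Suc i * hb \<delta> + (hb \<delta> + hb \<beta>))"
      unfolding \<beta>[symmetric] lookup_add by (simp add: ac_simps)
    then have sg: "(-1 :: 'k) ^ (hb \<gamma> + Suc i * hb \<delta>) = (-1) ^ (hb \<delta> + hb \<beta>)"
      by (simp add: minus_one_power_iff)
    have "extensions n \<gamma> (\<delta>, t) i = letter_msets (n - i) \<beta>" for t
      by (rule extensions_eq) (use \<beta> i in auto)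
    then show "(\<Sum>t<c \<delta>. (-1) ^ hb \<gamma> * ((-1) ^ (Suc i * hb \<delta>) * of_nat (card (extensions n \<gamma> (\<delta>, t) i)))) = ?f \<delta> (\<gamma> - scale i \<delta>)"
      using sg by (simp add: b power_add mult_ac)
  qed
  also have "\<dots> = (\<Sum>(\<alpha>, \<beta>)\<in>{(\<alpha>, \<beta>) \<in> ?S. \<forall>v. i dvd lookup \<alpha> v}. ?f (?div \<alpha>) \<beta>)"
  proof (rule sum.reindex_bij_witness[where i = "\<lambda>(\<alpha>, \<beta>). ?div \<alpha>" and j = "\<lambda>\<delta>. (scale i \<delta>, \<gamma> - scale i \<delta>)"])
    have d: "?div (scale i \<delta>) = \<delta>" for \<delta>
      by (rule poly_mapping_eqI) (use i in \<open>simp add: lookup_map_div\<close>)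
    have m: "scale i (?div \<alpha>) = \<alpha>" if "\<forall>v. i dvd lookup \<alpha> v" for \<alpha>
      by (rule poly_mapping_eqI) (use that in \<open>simp add: lookup_map_div\<close>)
    fix \<delta> assume "\<delta> \<in> ?D'"
    then obtain \<beta> where \<beta>: "scale i \<delta> + \<beta> = \<gamma>" by blast
    then have b: "\<gamma> - scale i \<delta> = \<beta>" by (metis add_diff_cancel_left')
    show "(case (scale i \<delta>, \<gamma> - scale i \<delta>) of (\<alpha>, \<beta>) \<Rightarrow> ?div \<alpha>) = \<delta>" by (simp add: d)
    show "(scale i \<delta>, \<gamma> - scale i \<delta>) \<in> {(\<alpha>, \<beta>) \<in> ?S. \<forall>v. i dvd lookup \<alpha> v}" by (simp add: b \<beta>)
    show "(case (scale i \<delta>, \<gamma> - scale i \<delta>) of (\<alpha>, \<beta>) \<Rightarrow> ?f (?div \<alpha>) \<beta>) = ?f \<delta> (\<gamma> - scale i \<delta>)" by (simp add: d)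
  next
    have m: "scale i (?div \<alpha>) = \<alpha>" if "\<forall>v. i dvd lookup \<alpha> v" for \<alpha>
      by (rule poly_mapping_eqI) (use that in \<open>simp add: lookup_map_div\<close>)
    fix z assume "z \<in> {(\<alpha>, \<beta>) \<in> ?S. \<forall>v. i dvd lookup \<alpha> v}"
    then obtain \<alpha> \<beta> where z: "z = (\<alpha>, \<beta>)" "\<alpha> + \<beta> = \<gamma>" "\<forall>v. i dvd lookup \<alpha> v" by blast
    have b: "\<gamma> - \<alpha> = \<beta>" using z(2) by (metis add_diff_cancel_left')
    show "(scale i (case z of (\<alpha>, \<beta>) \<Rightarrow> ?div \<alpha>), \<gamma> - scale i (case z of (\<alpha>, \<beta>) \<Rightarrow> ?div \<alpha>)) = z"
      by (simp add: z(1) m[OF z(3)] b)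
    show "(case z of (\<alpha>, \<beta>) \<Rightarrow> ?div \<alpha>) \<in> ?D'" using m[OF z(3)] z(2) by (auto simp: z(1))
  qed
  also have "\<dots> = scoeff (power_subst i letter_series * mset_series (n - i)) \<gamma>"
    unfolding scoeff_times
    by (rule sum.mono_neutral_cong_left)
      (use finite_splittings in \<open>auto simp: scoeff_power_subst letter_series_def mset_series_def split: if_splits\<close>)
  finally show ?thesis by simp
qed

text \<open>Sum \<open>letter_newton\<close> over all letters: every multiset is counted once for each of its \<open>n\<close> elements.\<close>

lemma mset_series_newton:
  assumes c0: "c 0 = 0"
  shows "scalar (of_nat n) * mset_series n = (\<Sum>i = 1..n. power_subst i letter_series * mset_series (n - i))"
proof (rule series_eqI)
  fix \<gamma> :: "var \<Rightarrow>\<^sub>0 nat"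
  let ?D = "{\<delta>. \<exists>\<beta>. \<delta> + \<beta> = \<gamma>}"
  let ?L = "Sigma ?D (\<lambda>\<delta>. {..<c \<delta>})"
  have "?D = fst ` {(\<alpha>, \<beta>). \<alpha> + \<beta> = \<gamma>}" by force
  then have finL: "finite ?L" using finite_splittings[of \<gamma>] by (intro finite_SigmaI) auto
  have "scoeff (\<Sum>i = 1..n. power_subst i letter_series * mset_series (n - i)) \<gamma>
      = (\<Sum>i = 1..n. (-1) ^ hb \<gamma> * (\<Sum>l\<in>?L. (-1) ^ (Suc i * hb (fst l)) * of_nat (card (extensions n \<gamma> l i))))"
    unfolding scoeff_sum by (rule sum.cong[OF refl]) (auto simp: scoeff_power_subst_mset_series)
  also have "\<dots> = (-1) ^ hb \<gamma> * (\<Sum>l\<in>?L. \<Sum>i = 1..n. (-1) ^ (Suc i * hb (fst l)) * of_nat (card (extensions n \<gamma> l i)))"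
    unfolding sum_distrib_left[symmetric] by (subst sum.swap) (rule refl)
  also have "(\<Sum>l\<in>?L. \<Sum>i = 1..n. (-1) ^ (Suc i * hb (fst l)) * of_nat (card (extensions n \<gamma> l i)))
      = (\<Sum>l\<in>?L. of_nat (\<Sum>A\<in>letter_msets n \<gamma>. count A l) :: 'k)"
    by (rule sum.cong[OF refl], rule letter_newton[OF c0]) (auto simp: valid_def)
  also have "\<dots> = of_nat (\<Sum>A\<in>letter_msets n \<gamma>. \<Sum>l\<in>?L. count A l)"
    unfolding of_nat_sum by (rule sum.swap)
  also have "(\<Sum>A\<in>letter_msets n \<gamma>. \<Sum>l\<in>?L. count A l) = (\<Sum>A\<in>letter_msets n \<gamma>. n)"
  proof (rule sum.cong[OF refl])
    fix A assume A: "A \<in> letter_msets n \<gamma>"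
    have "set_mset A \<subseteq> ?L"
      using A mset_weight_split[of _ A] by (force simp: letter_msets_def valid_def)
    then have "(\<Sum>l\<in>?L. count A l) = (\<Sum>l\<in>set_mset A. count A l)"
      by (intro sum.mono_neutral_right[OF finL]) (auto simp: not_in_iff)
    also have "\<dots> = n" using A by (simp add: letter_msets_def size_multiset_overloaded_eq)
    finally show "(\<Sum>l\<in>?L. count A l) = n" .
  qed
  also have "(-1) ^ hb \<gamma> * of_nat (\<Sum>A\<in>letter_msets n \<gamma>. n) = scoeff (scalar (of_nat n) * mset_series n) \<gamma>"
    by (simp add: scoeff_scalar_times mset_series_def mult_ac)
  finally show "scoeff (scalar (of_nat n) * mset_series n) \<gamma> =
      scoeff (\<Sum>i = 1..n. power_subst i letter_series * mset_series (n - i)) \<gamma>" by simp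
qed

theorem series_saturation_letters:
  assumes c0: "c 0 = 0" and bi: "letter_series \<in> bisymmetric_functions"
  shows "scoeff (series_saturation letter_series) \<gamma> = (-1) ^ hb \<gamma> * of_nat (card (\<Union>n\<in>{1..}. letter_msets n \<gamma>))"
    and "series_saturation letter_series \<in> bisymmetric_functions"
proof -
  have g0: "scoeff letter_series 0 = 0" by (simp add: letter_series_def c0)
  note rp = rel_plethysm_complete[OF bi g0 mset_series_0[OF c0] mset_series_newton[OF c0]]
  have S: "scoeff (series_saturation letter_series) \<gamma>
      = (\<Sum>n | n \<ge> 1 \<and> scoeff (mset_series n) \<gamma> \<noteq> 0. scoeff (mset_series n) \<gamma>)" for \<gamma>
    by (simp add: series_saturation_def rp(1))
  show "series_saturation letter_series \<in> bisymmetric_functions"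
    using rp(2) by (simp add: bisymmetric_functions_def S)
  let ?N = "{n. n \<ge> 1 \<and> letter_msets n \<gamma> \<noteq> {}}"
  have fin: "finite (letter_msets n \<gamma>)" for n by (rule finite_letter_msets_size[OF c0])
  have nz: "scoeff (mset_series n) \<gamma> \<noteq> 0 \<longleftrightarrow> letter_msets n \<gamma> \<noteq> {}" for n
    using fin by (simp add: mset_series_def)
  have "?N \<subseteq> size ` (\<Union>n. letter_msets n \<gamma>)" by (force simp: letter_msets_def)
  then have finN: "finite ?N" by (rule finite_subset) (use finite_letter_msets[OF c0] in blast)
  have "(\<Union>n\<in>{1..}. letter_msets n \<gamma>) = (\<Union>n\<in>?N. letter_msets n \<gamma>)" by auto
  also have "card \<dots> = (\<Sum>n\<in>?N. card (letter_msets n \<gamma>))"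
    by (rule card_UN_disjoint[OF finN]) (use fin in \<open>auto simp: letter_msets_def\<close>)
  finally have "card (\<Union>n\<in>{1..}. letter_msets n \<gamma>) = (\<Sum>n\<in>?N. card (letter_msets n \<gamma>))" .
  then show "scoeff (series_saturation letter_series) \<gamma> = (-1) ^ hb \<gamma> * of_nat (card (\<Union>n\<in>{1..}. letter_msets n \<gamma>))"
    unfolding S nz by (simp add: mset_series_def sum_distrib_left)
qed

end

section \<open>Characters\<close>

lemma dual_system_transport:
  assumes V: "vspace V" and D: "dual_system V W T e \<psi>"
    and f: "lin_on V V f" and f': "lin_on V V f'"
    and inverse: "\<And>v. v \<in> carrier V \<Longrightarrow> f (f' v) = v" "\<And>v. v \<in> carrier V \<Longrightarrow> f' (f v) = v"
    and W: "W' \<subseteq> carrier V" "f ` W \<subseteq> W'" "f' ` W' \<subseteq> W"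
  shows "dual_system V W' T (\<lambda>t. f (e t)) (\<lambda>t v. \<psi> t (f' v))"
proof -
  note D = D[unfolded dual_system_def]
  have e: "e t \<in> carrier V" if "t \<in> T" for t using D that by blast
  have gen: "e ` T \<union> W \<subseteq> carrier V" using D by blast
  have gen': "(\<lambda>t. f (e t)) ` T \<union> W' \<subseteq> carrier V" using e lin_on_simps(1)[OF f] W(1) by auto
  have base: "f u \<in> vspan V ((\<lambda>t. f (e t)) ` T \<union> W')" if "u \<in> e ` T \<union> W" for u
  proof -
    have "f u \<in> (\<lambda>t. f (e t)) ` T \<union> W'" using that W(2) by blast
    then show ?thesis using vspan_sub(2)[OF V gen'] by blast
  qed
  note span = lin_on_span_image[OF V V f gen gen' _ base]
  show ?thesis
    unfolding dual_system_def
  proof (intro conjI ballI)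
    show "finite T" using D by blast
    show "W' \<subseteq> carrier V" by (rule W(1))
    show "(\<lambda>t. f (e t)) ` T \<subseteq> carrier V" using gen' by blast
    fix t assume t: "t \<in> T"
    have lf: "linear_form V (\<psi> t)" using D t by blast
    show "linear_form V (\<lambda>v. \<psi> t (f' v))"
      unfolding linear_form_def
      using linear_form_simps(1,2)[OF lf] lin_on_simps(1-3)[OF f'] by simp
    show "\<psi> t (f' w) = 0" if "w \<in> W'" for w using D t W(3) that by blast
    show "\<psi> t (f' (f (e s))) = (if s = t then 1 else 0)" if "s \<in> T" for s
      using D t that inverse(2)[OF e[OF that]] by simp
  next
    show "carrier V \<subseteq> vspan V ((\<lambda>t. f (e t)) ` T \<union> W')"
    proof
      fix v assume v: "v \<in> carrier V"
      then have "f' v \<in> vspan V (e ` T \<union> W)" using lin_on_simps(1)[OF f'] D by blast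
      then show "v \<in> vspan V ((\<lambda>t. f (e t)) ` T \<union> W')" using span inverse(1)[OF v] by metis
    qed
  qed
qed

lemma stab_rels_sub:
  assumes "bi_action V (length I) (length J) B"
  shows "stab_rels V B I J \<subseteq> carrier V"
proof
  fix w assume "w \<in> stab_rels V B I J"
  then obtain \<sigma> \<tau> v where w: "w = B \<sigma> \<tau> v \<ominus>\<^bsub>V\<^esub> v" "v \<in> carrier V"
    and p: "\<sigma> permutes {..<length I}" "\<tau> permutes {..<length J}"
    unfolding stab_rels_def word_stab_def by blast
  have V: "vspace V" and l: "lin_on V V (B \<sigma> \<tau>)" using assms p unfolding bi_action_def by blast+
  show "w \<in> carrier V" unfolding w(1) by (rule vspace_simps(3)[OF V lin_on_simps(1)[OF l w(2)] w(2)])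
qed

lemma word_stab_conjugate:
  assumes s: "\<sigma> permutes {..<length I}" and a: "\<alpha> \<in> word_stab I"
  shows "pinv \<sigma> \<circ> \<alpha> \<circ> \<sigma> \<in> word_stab (permute_list \<sigma> I)"
proof -
  have ap: "\<alpha> permutes {..<length I}" "permute_list \<alpha> I = I" using a by (auto simp: word_stab_def)
  have i: "pinv \<sigma> permutes {..<length I}" by (rule permutes_inv[OF s])
  have "permute_list (pinv \<sigma> \<circ> \<alpha> \<circ> \<sigma>) (permute_list \<sigma> I) = permute_list (\<sigma> \<circ> (pinv \<sigma> \<circ> \<alpha> \<circ> \<sigma>)) I"
    using permutes_compose[OF s permutes_compose[OF ap(1) i]] by (intro permute_list_compose[symmetric]) (simp add: comp_assoc)
  also have "\<sigma> \<circ> (pinv \<sigma> \<circ> \<alpha> \<circ> \<sigma>) = \<alpha> \<circ> \<sigma>"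
    using permutes_inverses(1)[OF s] by (simp add: fun_eq_iff)
  also have "permute_list (\<alpha> \<circ> \<sigma>) I = permute_list \<sigma> I" by (simp add: permute_list_compose[OF s] ap(2))
  finally have "permute_list (pinv \<sigma> \<circ> \<alpha> \<circ> \<sigma>) (permute_list \<sigma> I) = permute_list \<sigma> I" .
  moreover have "pinv \<sigma> \<circ> \<alpha> \<circ> \<sigma> permutes {..<length I}"
    by (rule permutes_compose[OF s permutes_compose[OF ap(1) i]])
  ultimately show ?thesis unfolding word_stab_def by simp
qed

lemma word_stab_map: "inj \<pi> \<Longrightarrow> word_stab (map \<pi> I) = word_stab I"
  by (auto simp: word_stab_def permute_list_map inj_map_eq_map)

lemma stab_rels_transport:
  assumes act: "bi_action V (length I) (length J) B"
    and s: "\<sigma> permutes {..<length I}" and t: "\<tau> permutes {..<length J}"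
  shows "B \<sigma> \<tau> ` stab_rels V B I J \<subseteq> stab_rels V B (permute_list \<sigma> I) (permute_list \<tau> J)"
proof
  note A = act[unfolded bi_action_def]
  have V: "vspace V" using A by blast
  have l: "lin_on V V (B \<sigma> \<tau>)" using A s t by blast
  fix w assume "w \<in> B \<sigma> \<tau> ` stab_rels V B I J"
  then obtain \<alpha> \<beta> v where w: "w = B \<sigma> \<tau> (B \<alpha> \<beta> v \<ominus>\<^bsub>V\<^esub> v)" and v: "v \<in> carrier V"
    and st: "\<alpha> \<in> word_stab I" "\<beta> \<in> word_stab J" unfolding stab_rels_def by blast
  have p: "\<alpha> permutes {..<length I}" "\<beta> permutes {..<length J}" using st by (auto simp: word_stab_def)
  let ?\<alpha> = "pinv \<sigma> \<circ> \<alpha> \<circ> \<sigma>" and ?\<beta> = "pinv \<tau> \<circ> \<beta> \<circ> \<tau>"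
  have q: "?\<alpha> permutes {..<length I}" "?\<beta> permutes {..<length J}"
    using word_stab_conjugate[OF s st(1)] word_stab_conjugate[OF t st(2)] by (auto simp: word_stab_def)
  have la: "lin_on V V (B \<alpha> \<beta>)" using A p by blast
  have "w = B \<sigma> \<tau> (B \<alpha> \<beta> v) \<ominus>\<^bsub>V\<^esub> B \<sigma> \<tau> v"
    unfolding w by (rule lin_on_simps(5)[OF l V V lin_on_simps(1)[OF la v] v])
  also have "B \<sigma> \<tau> (B \<alpha> \<beta> v) = B (\<alpha> \<circ> \<sigma>) (\<beta> \<circ> \<tau>) v" using A s t p v by simp
  also have "\<alpha> \<circ> \<sigma> = \<sigma> \<circ> ?\<alpha>" using permutes_inverses(1)[OF s] by (simp add: fun_eq_iff)
  also have "\<beta> \<circ> \<tau> = \<tau> \<circ> ?\<beta>" using permutes_inverses(1)[OF t] by (simp add: fun_eq_iff)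
  also have "B (\<sigma> \<circ> ?\<alpha>) (\<tau> \<circ> ?\<beta>) v = B ?\<alpha> ?\<beta> (B \<sigma> \<tau> v)" using A s t q v by blast
  finally show "w \<in> stab_rels V B (permute_list \<sigma> I) (permute_list \<tau> J)"
    unfolding stab_rels_def
    using word_stab_conjugate[OF s st(1)] word_stab_conjugate[OF t st(2)] lin_on_simps(1)[OF l v] by blast
qed

text \<open>Renaming the variables does not change stabilizers, and rearranging the words only conjugates them; so the weight
  spaces of a monomial and of its renamings have the same dimension. This is the bisymmetry of a character.\<close>

lemma dual_system_card_renamed:
  fixes V :: "('k::field_char_0, 'v) module"
  assumes act: "bi_action V (length I) (length J) B"
    and D: "dual_system V (stab_rels V B I J) T e \<psi>"
    and D': "dual_system V (stab_rels V B I' J') T' e' \<psi>'"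
    and inj: "inj \<pi>" "inj \<rho>"
    and words: "mset (map \<pi> I') = mset I" "mset (map \<rho> J') = mset J"
  shows "card T' = card T"
proof -
  note A = act[unfolded bi_action_def]
  have V: "vspace V" using A by blast
  obtain \<sigma> where s: "\<sigma> permutes {..<length I}" "permute_list \<sigma> I = map \<pi> I'"
    using word_permutation[OF words(1)[symmetric]] by blast
  obtain \<tau> where t: "\<tau> permutes {..<length J}" "permute_list \<tau> J = map \<rho> J'"
    using word_permutation[OF words(2)[symmetric]] by blast
  let ?\<sigma> = "pinv \<sigma>" and ?\<tau> = "pinv \<tau>"
  have i: "?\<sigma> permutes {..<length I}" "?\<tau> permutes {..<length J}" by (rule permutes_inv[OF s(1)], rule permutes_inv[OF t(1)])
  have back_words: "permute_list ?\<sigma> (permute_list \<sigma> I) = I" "permute_list ?\<tau> (permute_list \<tau> J) = J"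
    using permute_list_compose[OF i(1), of \<sigma>] permute_list_compose[OF i(2), of \<tau>]
    by (simp_all add: permutes_inv_o[OF s(1)] permutes_inv_o[OF t(1)])
  have stab: "stab_rels V B (permute_list \<sigma> I) (permute_list \<tau> J) = stab_rels V B I' J'"
    unfolding s(2) t(2) stab_rels_def by (simp add: word_stab_map inj)
  have "dual_system V (stab_rels V B I' J') T (\<lambda>t. B \<sigma> \<tau> (e t)) (\<lambda>t v. \<psi> t (B ?\<sigma> ?\<tau> v))"
  proof (rule dual_system_transport[OF V D])
    show "lin_on V V (B \<sigma> \<tau>)" using A s(1) t(1) by blast
    show "lin_on V V (B ?\<sigma> ?\<tau>)" using A i by blast
    show "B \<sigma> \<tau> (B ?\<sigma> ?\<tau> v) = v" "B ?\<sigma> ?\<tau> (B \<sigma> \<tau> v) = v" if v: "v \<in> carrier V" for v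
    proof -
      have "B \<sigma> \<tau> (B ?\<sigma> ?\<tau> v) = B (?\<sigma> \<circ> \<sigma>) (?\<tau> \<circ> \<tau>) v" "B ?\<sigma> ?\<tau> (B \<sigma> \<tau> v) = B (\<sigma> \<circ> ?\<sigma>) (\<tau> \<circ> ?\<tau>) v"
        using A s(1) t(1) i v by simp_all
      then show "B \<sigma> \<tau> (B ?\<sigma> ?\<tau> v) = v" "B ?\<sigma> ?\<tau> (B \<sigma> \<tau> v) = v"
        using A v by (simp_all add: permutes_inv_o[OF s(1)] permutes_inv_o[OF t(1)])
    qed
    show "stab_rels V B I' J' \<subseteq> carrier V" using D' unfolding dual_system_def by blast
    show "B \<sigma> \<tau> ` stab_rels V B I J \<subseteq> stab_rels V B I' J'"
      unfolding stab[symmetric] by (rule stab_rels_transport[OF act s(1) t(1)])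
    show "B ?\<sigma> ?\<tau> ` stab_rels V B I' J' \<subseteq> stab_rels V B I J"
      using stab_rels_transport[of V "permute_list \<sigma> I" "permute_list \<tau> J" B ?\<sigma> ?\<tau>] act i
      unfolding stab[symmetric] back_words by simp
  qed
  then show ?thesis using dual_system_card[OF V _ D'] by metis
qed

lemma digits_unique:
  fixes a b :: "nat \<Rightarrow> nat"
  assumes "\<And>i. i < N \<Longrightarrow> a i < B" "\<And>i. i < N \<Longrightarrow> b i < B"
    and "(\<Sum>i<N. B ^ i * a i) = (\<Sum>i<N. B ^ i * b i)"
  shows "i < N \<Longrightarrow> a i = b i"
  using assms
proof (induction N arbitrary: a b i)
  case (Suc N)
  have shift: "(\<Sum>i<Suc N. B ^ i * f i) = f 0 + B * (\<Sum>i<N. B ^ i * f (Suc i))" for f :: "nat \<Rightarrow> nat"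
    by (subst sum.lessThan_Suc_shift) (simp add: sum_distrib_left mult.assoc)
  have B: "a 0 < B" "b 0 < B" using Suc.prems(2,3) by auto
  have e: "a 0 + B * (\<Sum>i<N. B ^ i * a (Suc i)) = b 0 + B * (\<Sum>i<N. B ^ i * b (Suc i))"
    using Suc.prems(4) unfolding shift .
  have e0: "a 0 = b 0" using arg_cong[OF e, of "\<lambda>z. z mod B"] B by simp
  moreover have "(\<Sum>i<N. B ^ i * a (Suc i)) = (\<Sum>i<N. B ^ i * b (Suc i))" using e e0 B by simp
  then have "j < N \<Longrightarrow> a (Suc j) = b (Suc j)" for j
    using Suc.IH[of j "\<lambda>i. a (Suc i)" "\<lambda>i. b (Suc i)"] Suc.prems(2,3) by simp
  ultimately show ?case using Suc.prems(1) by (cases i) auto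
qed simp

lemma sum_two_blocks:
  fixes r s :: nat
  shows "(\<Sum>i<r + s. f i) = (\<Sum>i<r. f i) + (\<Sum>j<s. f (r + j) :: 'a::comm_monoid_add)"
  by (induction s) (simp_all add: add.assoc)

text \<open>Substituting suitable powers of one variable \<open>t\<close> turns both parts into values of polynomials in \<open>t\<close> in which distinct
  monomials have distinct exponents; polynomials with equal values on an infinite field coincide.\<close>

lemma eval_part_determines:
  fixes g h :: "(var, 'k::field_char_0) series"
  assumes eq: "\<And>x y. eval_part g r s m n d x y = eval_part h r s m n d x y"
    and \<gamma>: "\<gamma> \<in> monomials r s m n d"
  shows "scoeff g \<gamma> = scoeff h \<gamma>"
proof -
  let ?Mo = "monomials r s m n d"
  \<comment> \<open>Kronecker substitution: every exponent is at most \<open>m + n\<close>, so that in this base the exponents are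
    the digits of one natural number.\<close>
  define B where "B = Suc (m + n)"
  define digit where "digit \<gamma> i = (if i < r then lookup \<gamma> (X i) else lookup \<gamma> (Y (i - r)))"
    for \<gamma> :: "var \<Rightarrow>\<^sub>0 nat" and i
  define code where "code \<gamma> = (\<Sum>i<r + s. B ^ i * digit \<gamma> i)" for \<gamma>
  have small: "digit \<delta> i < B" if d: "\<delta> \<in> ?Mo" and i: "i < r + s" for \<delta> i
  proof (cases "i < r")
    case True
    then have "lookup \<delta> (X i) \<le> (\<Sum>i<r. lookup \<delta> (X i))" by (intro member_le_sum) auto
    then show ?thesis using d True by (simp add: monomials_def digit_def B_def)
  next
    case False
    then have "lookup \<delta> (Y (i - r)) \<le> (\<Sum>j<s. lookup \<delta> (Y j))" using i by (intro member_le_sum) auto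
    then show ?thesis using d False by (simp add: monomials_def digit_def B_def)
  qed
  have inj: "\<delta> = \<gamma>" if d: "\<delta> \<in> ?Mo" and e: "code \<delta> = code \<gamma>" for \<delta>
  proof -
    have dig: "digit \<delta> i = digit \<gamma> i" if "i < r + s" for i
      by (rule digits_unique[OF small[OF d] small[OF \<gamma>]]) (use e that in \<open>auto simp: code_def\<close>)
    have z: "lookup \<epsilon> v = 0" if "\<epsilon> \<in> ?Mo" "v \<notin> X ` {..<r} \<union> Y ` {..<s} \<union> {Hbar}" for \<epsilon> v
      using that by (auto simp: monomials_def in_keys_iff)
    show ?thesis
    proof (rule monomial_eqI)
      show "lookup \<delta> (X i) = lookup \<gamma> (X i)" for i
      proof (cases "i < r")
        case False
        then have "X i \<notin> X ` {..<r} \<union> Y ` {..<s} \<union> {Hbar}" by auto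
        then show ?thesis using z d \<gamma> by simp
      qed (use dig[of i] in \<open>simp add: digit_def\<close>)
      show "lookup \<delta> (Y j) = lookup \<gamma> (Y j)" for j
      proof (cases "j < s")
        case False
        then have "Y j \<notin> X ` {..<r} \<union> Y ` {..<s} \<union> {Hbar}" by auto
        then show ?thesis using z d \<gamma> by simp
      qed (use dig[of "r + j"] in \<open>simp add: digit_def\<close>)
      show "lookup \<delta> Hbar = lookup \<gamma> Hbar" using d \<gamma> by (simp add: monomials_def)
    qed
  qed
  define p where "p f = (\<Sum>\<delta>\<in>?Mo. Polynomial.monom (scoeff f \<delta>) (code \<delta>))" for f :: "(var, 'k) series"
  have ev: "poly (p f) t = eval_part f r s m n d (\<lambda>i. t ^ B ^ i) (\<lambda>j. t ^ B ^ (r + j))" for f t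
  proof -
    have "t ^ code \<delta> = (\<Prod>i<r. (t ^ B ^ i) ^ lookup \<delta> (X i)) * (\<Prod>j<s. (t ^ B ^ (r + j)) ^ lookup \<delta> (Y j))" for \<delta>
      unfolding code_def sum_two_blocks power_add power_sum by (simp add: digit_def power_mult)
    then show ?thesis
      unfolding p_def eval_part_def monomials_def[symmetric] poly_sum poly_monom by (simp add: mult.assoc)
  qed
  have "poly (p g - p h) t = 0" for t by (simp add: ev eq)
  then have "p g = p h" using poly_all_0_iff_0[of "p g - p h"] by simp
  moreover have "coeff (p f) (code \<gamma>) = scoeff f \<gamma>" for f
  proof -
    have "coeff (p f) (code \<gamma>) = (\<Sum>\<delta>\<in>?Mo. if \<delta> = \<gamma> then scoeff f \<gamma> else 0)"
      unfolding p_def coeff_sum coeff_monom by (rule sum.cong) (use inj in auto)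
    then show ?thesis using \<gamma> by (simp add: finite_monomials)
  qed
  ultimately show ?thesis by metis
qed

text \<open>Every monomial occurs in the part of some biarity for enough variables.\<close>

lemma character_unique:
  assumes "is_character M g" "is_character M h"
  shows "g = h"
proof (rule series_eqI)
  fix \<gamma> :: "var \<Rightarrow>\<^sub>0 nat"
  define r where "r = Suc (Max (insert 0 (X -` keys \<gamma>)))"
  define s where "s = Suc (Max (insert 0 (Y -` keys \<gamma>)))"
  have fin: "finite (X -` keys \<gamma>)" "finite (Y -` keys \<gamma>)"
    by (auto intro!: finite_vimageI simp: inj_def)
  have "v \<in> X ` {..<r} \<union> Y ` {..<s} \<union> {Hbar}" if "v \<in> keys \<gamma>" for v
    using that fin by (cases v) (auto simp: r_def s_def less_Suc_eq_le)
  then have "\<gamma> \<in> monomials r s (\<Sum>i<r. lookup \<gamma> (X i)) (\<Sum>j<s. lookup \<gamma> (Y j)) (lookup \<gamma> Hbar)"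
    by (auto simp: monomials_def)
  moreover have "r \<ge> 1" "s \<ge> 1" by (auto simp: r_def s_def)
  ultimately show "scoeff g \<gamma> = scoeff h \<gamma>"
    using assms by (intro eval_part_determines) (auto simp: is_character_def)
qed

lemma character_eqI: "is_character M g \<Longrightarrow> character M = g"
  unfolding character_def by (rule the_equality) (auto intro: character_unique)

text \<open>The sign \<open>(-1)\<^sup>d\<close> in the series is the one in the graded trace; the rest is \<open>schur_trace\<close> in each biarity.\<close>

lemma is_character_from_dual_systems:
  fixes M :: "('k::field_char_0, 'v) bimodule" and T :: "(var \<Rightarrow>\<^sub>0 nat) \<Rightarrow> 't set"
  assumes act: "\<And>m n d. bi_action (bcomp M m n d) m n (biact M m n d)"
    and sys: "\<And>m n d \<gamma>. m = length (wordX \<gamma>) \<Longrightarrow> n = length (wordY \<gamma>) \<Longrightarrow> d = lookup \<gamma> Hbar \<Longrightarrow>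
      \<exists>e \<psi>. dual_system (bcomp M m n d) (stab_rels (bcomp M m n d) (biact M m n d) (wordX \<gamma>) (wordY \<gamma>)) (T \<gamma>) e \<psi>"
    and g: "g \<in> bisymmetric_functions" "\<And>\<gamma>. scoeff g \<gamma> = (-1) ^ lookup \<gamma> Hbar * of_nat (card (T \<gamma>))"
  shows "is_character M g"
  unfolding is_character_def
proof (intro conjI allI impI)
  show "g \<in> bisymmetric_functions" by (rule g(1))
  fix r s m n d x y
  have "\<forall>\<gamma>. \<exists>e \<psi>. \<gamma> \<in> monomials r s m n d \<longrightarrow>
      dual_system (bcomp M m n d) (stab_rels (bcomp M m n d) (biact M m n d) (wordX \<gamma>) (wordY \<gamma>)) (T \<gamma>) e \<psi>"
  proof
    fix \<gamma>
    show "\<exists>e \<psi>. \<gamma> \<in> monomials r s m n d \<longrightarrow>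
        dual_system (bcomp M m n d) (stab_rels (bcomp M m n d) (biact M m n d) (wordX \<gamma>) (wordY \<gamma>)) (T \<gamma>) e \<psi>"
    proof (cases "\<gamma> \<in> monomials r s m n d")
      case True
      note w = monomials_words[OF True]
      show ?thesis using sys[of m \<gamma> n d] w(1,3,5) by auto
    qed simp
  qed
  then obtain e \<psi> where e: "\<And>\<gamma>. \<gamma> \<in> monomials r s m n d \<Longrightarrow>
      dual_system (bcomp M m n d) (stab_rels (bcomp M m n d) (biact M m n d) (wordX \<gamma>) (wordY \<gamma>)) (T \<gamma>) (e \<gamma>) (\<psi> \<gamma>)"
    by metis
  have "eval_part g r s m n d x y = (\<Sum>\<gamma>\<in>monomials r s m n d. (-1) ^ d *
      (of_nat (card (T \<gamma>)) * (\<Prod>i<r. x i ^ lookup \<gamma> (X i)) * (\<Prod>j<s. y j ^ lookup \<gamma> (Y j))))"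
    unfolding eval_part_def monomials_def[symmetric]
    by (rule sum.cong[OF refl]) (simp add: g(2) monomials_words(5) mult.assoc)
  moreover have "lin_trace (schur_space M r s m n d) (schur_diag M r s m n d x y) =
      (\<Sum>\<gamma>\<in>monomials r s m n d. of_nat (card (T \<gamma>)) * (\<Prod>i<r. x i ^ lookup \<gamma> (X i))
        * (\<Prod>j<s. y j ^ lookup \<gamma> (Y j)))"
    by (rule schur_trace[OF act e])
  ultimately show "eval_part g r s m n d x y =
      (-1) ^ d * lin_trace (schur_space M r s m n d) (schur_diag M r s m n d x y)"
    by (simp only: sum_distrib_left)
qed

theorem corollary4p12:
  fixes M :: "('k::field_char_0, 'v) bimodule"
  assumes "symmetric_bimodule M"
    and "finite_type M"
    and "carrier (bcomp M 0 0 0) = {\<zero>\<^bsub>bcomp M 0 0 0\<^esub>}"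
  shows "character (saturation M) = series_saturation (character M)"
proof -
  let ?hb = "\<lambda>\<gamma>. lookup \<gamma> Hbar"
  let ?V = "\<lambda>\<gamma>. bcomp M (length (wordX \<gamma>)) (length (wordY \<gamma>)) (?hb \<gamma>)"
  let ?B = "\<lambda>\<gamma>. biact M (length (wordX \<gamma>)) (length (wordY \<gamma>)) (?hb \<gamma>)"
  note act = symmetric_bimodule_action[OF assms(1)]
  have V: "vspace (bcomp M m n d)" for m n d using act[of m n d] by (simp add: bi_action_def)
  have "\<exists>(c :: nat) e \<psi>. dual_system (?V \<gamma>) (stab_rels (?V \<gamma>) (?B \<gamma>) (wordX \<gamma>) (wordY \<gamma>)) {..<c} e \<psi>" for \<gamma>
  proof -
    have "vectorspace.fin_dim class_ring (?V \<gamma>)" using assms(2) by (simp add: finite_type_def)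
    then obtain c e \<psi> where "dual_system (?V \<gamma>) (stab_rels (?V \<gamma>) (?B \<gamma>) (wordX \<gamma>) (wordY \<gamma>)) {..<c :: nat} e \<psi>"
      using dual_system_exists[OF V _ stab_rels_sub[OF act]] by metis
    then show ?thesis by (intro exI)
  qed
  then obtain c :: "(var \<Rightarrow>\<^sub>0 nat) \<Rightarrow> nat" and e \<psi>
    where sys: "\<And>\<gamma>. dual_system (?V \<gamma>) (stab_rels (?V \<gamma>) (?B \<gamma>) (wordX \<gamma>) (wordY \<gamma>)) {..<c \<gamma>} (e \<gamma>) (\<psi> \<gamma>)"
    by metis
  interpret letter_system M c e \<psi> by unfold_locales (rule assms(1), rule sys)
  \<comment> \<open>No letter has weight zero, since the degree zero part of \<open>M(0,0)\<close> vanishes; hence only finitely many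
    letter multisets have a given weight.\<close>
  have empty: "wordX 0 = []" "wordY 0 = []"
    using count_wordX[of 0] count_wordY[of 0] by (auto simp flip: mset_zero_iff intro: multiset_eqI)
  have c0: "c 0 = 0"
  proof (rule ccontr)
    assume "c 0 \<noteq> 0"
    then have z: "\<psi> 0 0 (e 0 0) = 1" "linear_form (bcomp M 0 0 0) (\<psi> 0 0)" "e 0 0 \<in> carrier (bcomp M 0 0 0)"
      using sys[of 0] by (auto simp: dual_system_def empty)
    show False using linear_form_simps(3)[OF z(2) V] z(1,3) assms(3) by simp
  qed
  have c_sym: "c (map_key (rename_vars \<pi> \<rho>) \<gamma>) = c \<gamma>" if b: "bij \<pi>" "bij \<rho>" for \<pi> \<rho> \<gamma>
  proof -
    let ?\<gamma> = "map_key (rename_vars \<pi> \<rho>) \<gamma>"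
    have inj: "inj \<pi>" "inj \<rho>" using b by (auto intro: bij_is_inj)
    have lk: "lookup ?\<gamma> v = lookup \<gamma> (rename_vars \<pi> \<rho> v)" for v
      by (rule lookup_map_key[OF bij_is_inj[OF rename_vars_bij[OF b]]])
    have count_map: "count (mset (map f I)) i = count (mset I) (pinv f i)" if f: "bij f" for f :: "nat \<Rightarrow> nat" and I i
    proof (induction I)
      case (Cons a I)
      have "f a = i \<longleftrightarrow> a = pinv f i" by (rule bij_inv_eq_iff[OF f, symmetric])
      then show ?case using Cons.IH by simp
    qed simp
    have words: "mset (map \<pi> (wordX ?\<gamma>)) = mset (wordX \<gamma>)" "mset (map \<rho> (wordY ?\<gamma>)) = mset (wordY \<gamma>)"
      by (rule multiset_eqI, simp only: count_map[OF b(1)] count_map[OF b(2)] count_wordX count_wordY lk rename_vars.simps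
          surj_f_inv_f[OF bij_is_surj[OF b(1)]] surj_f_inv_f[OF bij_is_surj[OF b(2)]])+
    have len: "length (wordX ?\<gamma>) = length (wordX \<gamma>)" "length (wordY ?\<gamma>) = length (wordY \<gamma>)"
      using words by (metis length_map mset_eq_length)+
    have "card {..<c ?\<gamma>} = card {..<c \<gamma>}"
      by (rule dual_system_card_renamed[OF act sys[of \<gamma>] _ inj words])
        (use sys[of ?\<gamma>] in \<open>simp only: len lk rename_vars.simps\<close>)
    then show ?thesis by simp
  qed
  have bi: "letter_series \<in> bisymmetric_functions"
    unfolding bisymmetric_functions_def
    using c_sym by (auto simp: letter_series_def lookup_map_key[OF bij_is_inj[OF rename_vars_bij]])
  have "is_character M letter_series"
  proof (rule is_character_from_dual_systems[where T = "\<lambda>\<gamma>. {..<c \<gamma>}"])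
    fix m n d \<gamma>
    assume m: "m = length (wordX \<gamma>)" "n = length (wordY \<gamma>)" "d = ?hb \<gamma>"
    show "\<exists>e \<psi>. dual_system (bcomp M m n d) (stab_rels (bcomp M m n d) (biact M m n d) (wordX \<gamma>) (wordY \<gamma>)) {..<c \<gamma>} e \<psi>"
      unfolding m by (intro exI) (rule sys)
  qed (use act bi in \<open>auto simp: letter_series_def\<close>)
  then have M: "character M = letter_series" by (rule character_eqI)
  have "is_character (saturation M) (series_saturation letter_series)"
  proof (rule is_character_from_dual_systems[where T = "\<lambda>\<gamma>. \<Union>n\<in>{1..}. letter_msets n \<gamma>"])
    fix m n d
    let ?\<gamma> = "word_monomial (replicate m 0) (replicate n 0) d"
    have "m = length (wordX ?\<gamma>)" "n = length (wordY ?\<gamma>)" "d = ?hb ?\<gamma>"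
      using mset_word_monomial[of "replicate m 0" "replicate n 0" d, THEN mset_eq_length] by (auto simp: lookup_word_monomial)
    then show "bi_action (bcomp (saturation M) m n d) m n (biact (saturation M) m n d)"
      by (rule saturation_dual_system(1)[OF c0])
  qed (use saturation_dual_system(2)[OF c0] series_saturation_letters[OF c0 bi] in auto)
  then show ?thesis unfolding M by (rule character_eqI)
qed

end
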